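(* Consider all hyp-hor packings $\mathcal{P}_p^{(q,r)}$ derived from the Coxeter tilings of $\mathbb{H}^3$ generated by the simple frustum orthoschemes $\mathcal{F}_p^{(q,r)}$, where $(q,r)\in\{(3,6),(4,4),(6,3)\}$ and $p$ is an integer with $p\ge7$ if $(q,r)=(3,6)$, $p\ge5$ if $(q,r)=(4,4)$, and $p\ge4$ if $(q,r)=(6,3)$. The maximal density among all of them is attained for $(p,q,r)=(7,3,6)$, by the configuration in $\mathcal{F}_7^{(3,6)}$ whose horosphere (centred at $A_0$) passes through $A_1$ and whose hypersphere (with base plane $P_0P_1P_2$) passes through $A_2$. This maximal density is $\approx0.83267$ (i.e. equal to $0.83267$ after rounding to five decimals).
   Context: $\mathbb{H}^3$ has curvature $-1$ and is considered in the projective (Beltrami-Cayley-Klein) model, the interior of a quadric $Q$ in real projective space. Simple frustum orthoscheme. Let $A_0A_1A_2A_3$ be a projective tetrahedron, with $H^i$ the face plane opposite $A_i$, such that the dihedral angles between $H^0,H^1$; $H^1,H^2$; $H^2,H^3$ are $\frac{\pi}{p},\frac{\pi}{q},\frac{\pi}{r}$ respectively, and $H^i\perp H^j$ for $|i-j|\ge2$. For the parameters considered, $A_0$ lies on $Q$ (is ideal), $A_1,A_2$ are proper points of $\mathbb{H}^3$, and $A_3$ is an outer point (outside $Q$). Let $\pi_3$ be the polar plane of $A_3$ with respect to $Q$ and let $P_i=\pi_3\cap A_iA_3$ ($i=0,1,2$). The simple frustum orthoscheme $\mathcal{F}_p^{(q,r)}=A_0A_1A_2P_0P_1P_2$ is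 the orthoscheme truncated by $\pi_3$ (the part on the side of $A_0,A_1,A_2$). For the integer parameters listed in the claim, its images under reflections in its faces tile $\mathbb{H}^3$; this is the Coxeter tiling with symbol $[p,q,r]$. Hyp-hor packing. It is given by a closed horoball $\mathfrak{H}$ centred at $A_0$ and a hyperball $\mathcal{H}$ with base plane $\pi_3=P_0P_1P_2$ (the set of points on the side of $\pi_3$ containing $A_0$, or on $\pi_3$, at hyperbolic distance at most some $h\ge0$ from $\pi_3$), such that: (1) $\mathfrak{H}$ has no common points with the relative interiors of the faces $P_0P_1P_2$ and $A_1A_2P_2P_1$; (2) $\mathcal{H}$ has no common points with the relative interior of the face $A_0A_1A_2$; (3) the interiors of $\mathfrak{H}$ and $\mathcal{H}$ are disjoint. Its density is $$\frac{\mathrm{Vol}(\mathcal{F}_p^{(q,r)}\cap(\mathfrak{H}\cup\mathcal{H}))}{\mathrm{Vol}(\mathcal{F}_p^{(q,r)})},$$ where $\mathrm{Vol}$ is hyperbolic volume. *)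

theory Defs
  imports "HOL-Analysis.Analysis"
begin

section \<open>The projective model\<close>

text \<open>
  Points of real projective 3-space are given by nonzero homogeneous coordinates \<open>(t, x)\<close>;
  the quadric is the zero set of the Lorentzian form below. In the affine chart \<open>t = 1\<close> it is the
  unit sphere and hyperbolic space is the open unit ball.
\<close>

type_synonym hvec = "real \<times> (real ^ 3)"

definition lorentz :: "hvec \<Rightarrow> hvec \<Rightarrow> real" where
  "lorentz v w = snd v \<bullet> snd w - fst v * fst w"

definition hom :: "real ^ 3 \<Rightarrow> hvec" where
  "hom x = (1, x)"

definition chart :: "hvec \<Rightarrow> real ^ 3" where
  "chart v = snd v /\<^sub>R fst v"

definition proper_point :: "hvec \<Rightarrow> bool" where
  "proper_point v \<longleftrightarrow> lorentz v v < 0"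

definition ideal_point :: "hvec \<Rightarrow> bool" where
  "ideal_point v \<longleftrightarrow> v \<noteq> 0 \<and> lorentz v v = 0"

definition outer_point :: "hvec \<Rightarrow> bool" where
  "outer_point v \<longleftrightarrow> lorentz v v > 0"

definition H3 :: "(real ^ 3) set" where
  "H3 = ball 0 1"

definition hdist :: "real ^ 3 \<Rightarrow> real ^ 3 \<Rightarrow> real" where
  "hdist x y = arcosh ((1 - x \<bullet> y) / (sqrt (1 - (norm x)\<^sup>2) * sqrt (1 - (norm y)\<^sup>2)))"

text \<open>The Riemannian volume element of the projective model in dimension \<open>n\<close> is
  \<open>(1 - |x|\<^sup>2) powr (- (n + 1) / 2) dx\<close>; here \<open>n = 3\<close>.\<close>

definition hyp_measure :: "(real ^ 3) measure" where
  "hyp_measure = density lborel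
     (\<lambda>x. ennreal (if x \<in> H3 then 1 / (1 - (norm x)\<^sup>2)\<^sup>2 else 0))"

definition hyp_vol :: "(real ^ 3) set \<Rightarrow> real" where
  "hyp_vol S = measure hyp_measure S"

definition polar_plane :: "hvec \<Rightarrow> (real ^ 3) set" where
  "polar_plane v = {x \<in> H3. lorentz (hom x) v = 0}"

text \<open>The closed half-space of \<open>H3\<close> bounded by the polar plane of \<open>v\<close>, on the side of the proper
  or ideal point \<open>a\<close> (which is rescaled to first coordinate 1, as is \<open>hom x\<close>).\<close>

definition polar_halfspace :: "hvec \<Rightarrow> hvec \<Rightarrow> (real ^ 3) set" where
  "polar_halfspace v a = {x \<in> H3. lorentz (hom x) v * lorentz (hom (chart a)) v \<ge> 0}"


section \<open>Simple frustum orthoschemes\<close>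

text \<open>
  A projective tetrahedron is given by linearly independent vectors \<open>A 0, ..., A 3\<close>: it is the
  image of the cone they span. Replacing some \<open>A i\<close> by their negatives keeps the vertices but
  in general selects another one of the eight tetrahedra bounded by the four face planes;
  prescribing the dihedral angles below fixes this choice (up to a common sign).
\<close>

definition proj_tetrahedron :: "(nat \<Rightarrow> hvec) \<Rightarrow> (real ^ 3) set" where
  "proj_tetrahedron A =
     {chart v | v c. v = (\<Sum>i<4. c i *\<^sub>R A i) \<and> (\<forall>i<4. 0 \<le> c i) \<and> fst v \<noteq> (0::real)}"

text \<open>\<open>u\<close> is the pole of the face plane opposite \<open>A i\<close>, oriented towards \<open>A i\<close>.\<close>

definition inward_normal :: "(nat \<Rightarrow> hvec) \<Rightarrow> nat \<Rightarrow> hvec \<Rightarrow> bool" where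
  "inward_normal A i u \<longleftrightarrow> (\<forall>j<4. j \<noteq> i \<longrightarrow> lorentz u (A j) = 0) \<and> lorentz u (A i) > 0"

text \<open>The dihedral angle between the face planes opposite \<open>A i\<close> and \<open>A j\<close>, measured inside the
  tetrahedron, is \<open>\<theta>\<close>: the inward normals enclose the angle \<open>\<pi> - \<theta>\<close>.\<close>

definition has_dihedral_angle :: "(nat \<Rightarrow> hvec) \<Rightarrow> nat \<Rightarrow> nat \<Rightarrow> real \<Rightarrow> bool" where
  "has_dihedral_angle A i j \<theta> \<longleftrightarrow> 0 \<le> \<theta> \<and> \<theta> \<le> pi \<and>
     (\<exists>u v. inward_normal A i u \<and> inward_normal A j v \<and> lorentz u u > 0 \<and> lorentz v v > 0 \<and>
        lorentz u v / (sqrt (lorentz u u) * sqrt (lorentz v v)) = cos (pi - \<theta>))"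

definition simple_frustum_orthoscheme :: "nat \<Rightarrow> nat \<Rightarrow> nat \<Rightarrow> (nat \<Rightarrow> hvec) \<Rightarrow> bool" where
  "simple_frustum_orthoscheme p q r A \<longleftrightarrow>
     inj_on A {..<4} \<and> independent (A ` {..<4}) \<and>
     has_dihedral_angle A 0 1 (pi / real p) \<and>
     has_dihedral_angle A 1 2 (pi / real q) \<and>
     has_dihedral_angle A 2 3 (pi / real r) \<and>
     has_dihedral_angle A 0 2 (pi / 2) \<and>
     has_dihedral_angle A 0 3 (pi / 2) \<and>
     has_dihedral_angle A 1 3 (pi / 2) \<and>
     ideal_point (A 0) \<and> proper_point (A 1) \<and> proper_point (A 2) \<and> outer_point (A 3)"

text \<open>\<open>vertexP A i\<close> is the intersection of the line \<open>A i A 3\<close> with the polar plane of \<open>A 3\<close>.\<close>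

definition vertexP :: "(nat \<Rightarrow> hvec) \<Rightarrow> nat \<Rightarrow> hvec" where
  "vertexP A i = A i - (lorentz (A i) (A 3) / lorentz (A 3) (A 3)) *\<^sub>R A 3"

definition frustum :: "(nat \<Rightarrow> hvec) \<Rightarrow> (real ^ 3) set" where
  "frustum A = proj_tetrahedron A \<inter> polar_halfspace (A 3) (A 0)"

text \<open>Faces of the frustum; the chart maps hyperbolic convex hulls to Euclidean ones.\<close>

definition face_PPP :: "(nat \<Rightarrow> hvec) \<Rightarrow> (real ^ 3) set" where
  "face_PPP A = convex hull {chart (vertexP A 0), chart (vertexP A 1), chart (vertexP A 2)}"

definition face_AAPP :: "(nat \<Rightarrow> hvec) \<Rightarrow> (real ^ 3) set" where
  "face_AAPP A =
     convex hull {chart (A 1), chart (A 2), chart (vertexP A 2), chart (vertexP A 1)}"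

definition face_AAA :: "(nat \<Rightarrow> hvec) \<Rightarrow> (real ^ 3) set" where
  "face_AAA A = convex hull {chart (A 0), chart (A 1), chart (A 2)}"


section \<open>Horoballs and hyperballs\<close>

text \<open>Busemann function of the ideal point \<open>a\<close> on the unit sphere, normalized to vanish at the
  origin; \<open>s \<mapsto> s *\<^sub>R a\<close> runs along the geodesic ray from the origin to \<open>a\<close>.\<close>

definition busemann :: "real ^ 3 \<Rightarrow> real ^ 3 \<Rightarrow> real" where
  "busemann a x = Lim (at_left 1) (\<lambda>s. hdist x (s *\<^sub>R a) - hdist 0 (s *\<^sub>R a))"

definition horoball :: "hvec \<Rightarrow> real \<Rightarrow> (real ^ 3) set" where
  "horoball a \<beta> = {x \<in> H3. busemann (chart a) x \<le> \<beta>}"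

definition horosphere :: "hvec \<Rightarrow> real \<Rightarrow> (real ^ 3) set" where
  "horosphere a \<beta> = {x \<in> H3. busemann (chart a) x = \<beta>}"

definition hdist_set :: "real ^ 3 \<Rightarrow> (real ^ 3) set \<Rightarrow> real" where
  "hdist_set x S = (INF y\<in>S. hdist x y)"

text \<open>One-sided hyperball and hypersphere: base plane polar to \<open>v\<close>, on the side of \<open>a\<close>.\<close>

definition hyperball :: "hvec \<Rightarrow> hvec \<Rightarrow> real \<Rightarrow> (real ^ 3) set" where
  "hyperball v a h = {x \<in> polar_halfspace v a. hdist_set x (polar_plane v) \<le> h}"

definition hypersphere :: "hvec \<Rightarrow> hvec \<Rightarrow> real \<Rightarrow> (real ^ 3) set" where
  "hypersphere v a h = {x \<in> polar_halfspace v a. hdist_set x (polar_plane v) = h}"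


section \<open>Hyp-hor packings\<close>

definition hyp_hor_packing ::
    "nat \<Rightarrow> nat \<Rightarrow> nat \<Rightarrow> (nat \<Rightarrow> hvec) \<Rightarrow> real \<Rightarrow> real \<Rightarrow> bool" where
  "hyp_hor_packing p q r A \<beta> h \<longleftrightarrow>
     simple_frustum_orthoscheme p q r A \<and> 0 \<le> h \<and>
     horoball (A 0) \<beta> \<inter> rel_interior (face_PPP A) = {} \<and>
     horoball (A 0) \<beta> \<inter> rel_interior (face_AAPP A) = {} \<and>
     hyperball (A 3) (A 0) h \<inter> rel_interior (face_AAA A) = {} \<and>
     interior (horoball (A 0) \<beta>) \<inter> interior (hyperball (A 3) (A 0) h) = {}"

definition packing_density :: "(nat \<Rightarrow> hvec) \<Rightarrow> real \<Rightarrow> real \<Rightarrow> real" where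
  "packing_density A \<beta> h =
     hyp_vol (frustum A \<inter> (horoball (A 0) \<beta> \<union> hyperball (A 3) (A 0) h)) / hyp_vol (frustum A)"

definition admissible :: "nat \<Rightarrow> nat \<Rightarrow> nat \<Rightarrow> bool" where
  "admissible p q r \<longleftrightarrow>
     (q = 3 \<and> r = 6 \<and> p \<ge> 7) \<or> (q = 4 \<and> r = 4 \<and> p \<ge> 5) \<or> (q = 6 \<and> r = 3 \<and> p \<ge> 4)"

text \<open>The horosphere passes through \<open>A 1\<close> and the hypersphere through \<open>A 2\<close>; that such a
  configuration is a packing is not part of this definition.\<close>

definition touching_configuration ::
    "nat \<Rightarrow> nat \<Rightarrow> nat \<Rightarrow> (nat \<Rightarrow> hvec) \<Rightarrow> real \<Rightarrow> real \<Rightarrow> bool" where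
  "touching_configuration p q r A \<beta> h \<longleftrightarrow>
     simple_frustum_orthoscheme p q r A \<and> 0 \<le> h \<and>
     chart (A 1) \<in> horosphere (A 0) \<beta> \<and>
     chart (A 2) \<in> hypersphere (A 3) (A 0) h"

end

theory Submission
  imports Defs "HOL-Real_Asymp.Real_Asymp"
begin

text \<open>
  Write \<open>\<alpha> = \<pi>/p\<close> and \<open>\<gamma> = \<pi>/r\<close>, and use the upper half-space with the ideal vertex at infinity and
  \<open>A 1\<close> at height 1, so that \<open>\<pi>\<^sub>3\<close> is a hemisphere of some radius \<open>\<rho>\<close>. For a horosphere at height \<open>z\<close>
  and a hyperball of width \<open>h\<close>, the packing conditions force \<open>1 \<le> z\<close>, \<open>\<rho> e\<^sup>h \<le> z\<close> and
  \<open>tanh h \<le> tan \<alpha> / tan \<gamma>\<close>, and the covered volume is at most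
  \<open>(cos \<alpha>)\<^sup>2 tan \<gamma> / (4 z\<^sup>2) + (\<gamma> - \<alpha>) (h / 2 + sinh (2 h) / 4)\<close>. If \<open>z\<close> is as small as possible, this is
  increasing in \<open>h\<close> while \<open>z = 1\<close> and convex in \<open>h\<close> afterwards, so only extreme values of \<open>h\<close> matter.
  The volume \<open>V\<close> of the frustum satisfies \<open>dV/d\<alpha> = - artanh (tan \<alpha> / tan \<gamma>) / 2\<close>. With \<open>D\<close> the density of
  the touching configuration for \<open>(7,3,6)\<close>, the difference of \<open>D V\<close> and the covered volume is
  decreasing in \<open>\<alpha>\<close> for each such configuration. This leaves the least \<open>p\<close> of the three families,
  where the inequalities (equality for \<open>(7,3,6)\<close>) are numerical: \<open>V\<close> is evaluated by the inverse
  tangent integral and a power series of the edge integral.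
\<close>

section \<open>Lebesgue measure in projective charts\<close>

text \<open>Which constraint binds depends on \<gamma>. For \<gamma> = \<pi>/6 the largest horoball
  and the largest hyperball fit together, so both terms of the bound are maximal at once. For
  \<gamma> = \<pi>/3 the radius \<rho> is at least 1, so the least height is always
  \<open>\<rho> e\<^sup>h\<close> and only the convex regime occurs. For \<gamma> = \<pi>/4 both
  regimes occur, and the width at which they meet is one more candidate. At the least p these rival
  candidates stay below \<open>D V\<close> by more than 0.004, which fixes how precisely their
  volumes must be known; the monotonicity uses of \<open>D\<close> only that it is at least 0.8326.
  The frustum and the pieces are simple in charts other than \<open>t = 1\<close>, but a change of
  projective chart is not linear. Hence hyperbolic volume is rewritten as the Lebesgue measure of a
  truncated cone in four-space: there a change of chart acts linearly, and only a Gram determinant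
  enters.\<close>

lemma nn_integral_FTC_interior:
  fixes F f :: "real \<Rightarrow> real"
  assumes ab: "a \<le> b" and contF: "continuous_on {a..b} F"
    and derF: "\<And>x. a < x \<Longrightarrow> x < b \<Longrightarrow> (F has_real_derivative f x) (at x)"
    and nonneg: "\<And>x. a < x \<Longrightarrow> x < b \<Longrightarrow> 0 \<le> f x"
    and A: "{a<..<b} \<subseteq> A" "A \<subseteq> {a..b}"
  shows "(\<integral>\<^sup>+x. ennreal (f x) * indicator A x \<partial>lborel) = ennreal (F b - F a)"
proof -
  define g where "g x = (if a < x \<and> x < b then f x else 0)" for x
  have "(g has_integral (F b - F a)) {a..b}"
    by (rule fundamental_theorem_of_calculus_interior[OF ab contF])
      (use derF in \<open>auto simp: g_def has_real_derivative_iff_has_vector_derivative\<close>)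
  then have "(\<integral>\<^sup>+x. ennreal (g x) * indicator {a..b} x \<partial>lborel) = ennreal (F b - F a)"
    by (rule nn_integral_has_integral_lebesgue'[rotated]) (auto simp: g_def nonneg)
  moreover have "(\<integral>\<^sup>+x. ennreal (f x) * indicator A x \<partial>lborel) = (\<integral>\<^sup>+x. ennreal (g x) * indicator {a..b} x \<partial>lborel)"
  proof (rule nn_integral_cong_AE)
    show "AE x in lborel. ennreal (f x) * indicator A x = ennreal (g x) * indicator {a..b} x"
      using AE_lborel_singleton[of a] AE_lborel_singleton[of b]
    proof eventually_elim
      case (elim x)
      then show ?case using A by (auto simp: g_def indicator_def)
    qed
  qed
  ultimately show ?thesis by simp
qed

lemma emeasure_lborel_scaleR_vimage:
  fixes B :: "'a::euclidean_space set"
  assumes c: "c > 0" and [measurable]: "B \<in> sets borel"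
  shows "emeasure lborel B = ennreal (c ^ DIM('a)) * emeasure lborel ((\<lambda>x. c *\<^sub>R x) -` B)"
proof -
  have "emeasure lborel B = emeasure (density (distr lborel borel (\<lambda>x. 0 + c *\<^sub>R x)) (\<lambda>_. \<bar>c\<bar>^DIM('a))) B"
    using lborel_affine[of c "0::'a"] c by simp
  also have "\<dots> = ennreal (c ^ DIM('a)) * emeasure lborel ((\<lambda>x. c *\<^sub>R x) -` B)"
    using c by (simp add: emeasure_density_const emeasure_distr ennreal_power)
  finally show ?thesis .
qed

text \<open>The last condition bounds by 1 the homogeneous extension of \<open>q\<close> of degree
  2. If \<open>q\<close> is a quadratic form restricted to a chart, the set depends only on the form
  and on the cone over \<open>S\<close>, so linear maps carry such sets to such sets.\<close>

definition trunc_cone :: "'a::euclidean_space set \<Rightarrow> ('a \<Rightarrow> real) \<Rightarrow> (real \<times> 'a) set" where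
  "trunc_cone S q = {v. 0 < fst v \<and> snd v /\<^sub>R fst v \<in> S \<and> (fst v)\<^sup>2 * q (snd v /\<^sub>R fst v) < 1}"

lemma sets_trunc_cone [measurable]:
  assumes [measurable]: "S \<in> sets borel" "q \<in> borel_measurable borel"
  shows "trunc_cone S q \<in> sets borel"
proof -
  have "{v \<in> space (borel \<Otimes>\<^sub>M borel). 0 < fst v \<and> snd v /\<^sub>R fst v \<in> S \<and> (fst v)\<^sup>2 * q (snd v /\<^sub>R fst v) < 1}
    \<in> sets (borel \<Otimes>\<^sub>M borel)"
    by measurable
  then show ?thesis unfolding trunc_cone_def borel_prod by simp
qed

text \<open>The slice at \<open>t\<close> is \<open>t\<close> times the part of \<open>S\<close>
  where \<open>t\<^sup>2 * q y < 1\<close>, whence a factor \<open>t ^ 3\<close>; integrating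
  \<open>t ^ 3\<close> up to \<open>1 / sqrt (q y)\<close> leaves
  \<open>1 / (4 * (q y)\<^sup>2)\<close>. Dimension 3 makes this exponent that of the hyperbolic
  volume element.\<close>

lemma emeasure_trunc_cone:
  fixes q :: "'a::euclidean_space \<Rightarrow> real"
  assumes dim: "DIM('a) = 3" and [measurable]: "S \<in> sets borel" "q \<in> borel_measurable borel"
    and pos: "\<And>y. y \<in> S \<Longrightarrow> 0 < q y"
  shows "emeasure lborel (trunc_cone S q) = (\<integral>\<^sup>+y. ennreal (1 / (4 * (q y)\<^sup>2)) * indicator S y \<partial>lborel)"
proof -
  have "emeasure lborel (trunc_cone S q) = emeasure (lborel \<Otimes>\<^sub>M lborel) (trunc_cone S q)"
    by (simp add: lborel_prod)
  also have "\<dots> = (\<integral>\<^sup>+t. emeasure lborel (Pair t -` trunc_cone S q) \<partial>lborel)"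
    by (rule lborel.emeasure_pair_measure_alt) (simp only: lborel_prod sets_lborel, measurable)
  also have "\<dots> = (\<integral>\<^sup>+t. \<integral>\<^sup>+y. ennreal (t^3) * indicator {0<..} t * indicator {y\<in>S. t\<^sup>2 * q y < 1} y \<partial>lborel \<partial>lborel)"
  proof (rule nn_integral_cong)
    fix t :: real
    show "emeasure lborel (Pair t -` trunc_cone S q) =
      (\<integral>\<^sup>+y. ennreal (t^3) * indicator {0<..} t * indicator {y\<in>S. t\<^sup>2 * q y < 1} y \<partial>lborel)"
    proof (cases "t > 0")
      case True
      have "emeasure lborel (Pair t -` trunc_cone S q)
          = ennreal (t^3) * emeasure lborel ((\<lambda>x. t *\<^sub>R x) -` (Pair t -` trunc_cone S q))"
        using emeasure_lborel_scaleR_vimage[OF True, of "Pair t -` trunc_cone S q"] dim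
        by (simp add: measurable_sets_borel[where M=borel and f="Pair t"])
      also have "(\<lambda>x. t *\<^sub>R x) -` (Pair t -` trunc_cone S q) = {y\<in>S. t\<^sup>2 * q y < 1}"
        using True by (auto simp: trunc_cone_def)
      finally show ?thesis using True by (simp add: nn_integral_cmult)
    next
      case False
      then have "Pair t -` trunc_cone S q = {}" by (auto simp: trunc_cone_def)
      with False show ?thesis by simp
    qed
  qed
  also have "\<dots> = (\<integral>\<^sup>+y. \<integral>\<^sup>+t. ennreal (t^3) * indicator {0<..} t * indicator {y\<in>S. t\<^sup>2 * q y < 1} y \<partial>lborel \<partial>lborel)"
    by (rule lborel_pair.Fubini'[symmetric]) measurable
  also have "\<dots> = (\<integral>\<^sup>+y. ennreal (1 / (4 * (q y)\<^sup>2)) * indicator S y \<partial>lborel)"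
  proof (rule nn_integral_cong)
    fix y
    show "(\<integral>\<^sup>+t. ennreal (t^3) * indicator {0<..} t * indicator {y\<in>S. t\<^sup>2 * q y < 1} y \<partial>lborel)
      = ennreal (1 / (4 * (q y)\<^sup>2)) * indicator S y"
    proof (cases "y \<in> S")
      case True
      define r where "r = 1 / sqrt (q y)"
      have r: "r > 0" "r\<^sup>2 = 1 / q y" using pos[OF True] by (auto simp: r_def power_divide)
      have less_iff: "t\<^sup>2 * q y < 1 \<longleftrightarrow> t < r" if "t > 0" for t
      proof -
        have "t\<^sup>2 * q y < 1 \<longleftrightarrow> t\<^sup>2 < r\<^sup>2" using pos[OF True] r by (simp add: pos_less_divide_eq)
        also have "\<dots> \<longleftrightarrow> t < r" using that r(1) power_strict_mono[of t r 2] power2_less_imp_less[of t r] by auto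
        finally show ?thesis .
      qed
      have "(\<integral>\<^sup>+t. ennreal (t^3) * indicator {0<..} t * indicator {y\<in>S. t\<^sup>2 * q y < 1} y \<partial>lborel)
        = (\<integral>\<^sup>+t. ennreal (t^3) * indicator {0<..<r} t \<partial>lborel)"
        by (rule nn_integral_cong) (use True less_iff in \<open>auto simp: indicator_def\<close>)
      also have "\<dots> = ennreal (r^4/4 - 0^4/4)"
        by (rule nn_integral_FTC_interior[where F="\<lambda>t. t^4/4"])
          (use r in \<open>auto intro!: continuous_intros derivative_eq_intros\<close>)
      also have "r^4 = (r\<^sup>2)\<^sup>2" by simp
      finally show ?thesis using True unfolding r by (simp add: power_divide)
    qed simp
  qed
  finally show ?thesis .
qed

section \<open>Linear changes of variables in four-space through Gram determinants\<close>

lemma prod_Basis_cart: "(\<Prod>b\<in>Basis. x \<bullet> b) = (\<Prod>i\<in>UNIV. (x :: real ^ 'n) $ i)"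
proof -
  have "(Basis :: (real ^ 'n) set) = range (\<lambda>i. axis i 1)" by (auto simp: Basis_vec_def)
  moreover have "inj (\<lambda>i::'n. axis i (1::real))" by (auto simp: inj_on_def axis_eq_axis)
  ultimately show ?thesis
    unfolding \<open>Basis = _\<close> by (subst prod.reindex) (auto simp: inner_axis)
qed

lemma prod_UNIV_3: "prod f (UNIV :: 3 set) = f 1 * (f 2 * f 3)"
  unfolding UNIV_3 by simp

lemma prod_UNIV_4: "prod f (UNIV :: 4 set) = f 1 * (f 2 * (f 3 * f 4))"
  unfolding UNIV_4 by simp

text \<open>Determinants live on \<open>real ^ 4\<close>, whereas the model and the charts use
  product types; \<open>vec4\<close> and \<open>quad4\<close> are the coordinate isomorphisms, shown
  below to preserve Lebesgue measure.\<close>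

definition vec4 :: "real \<times> (real ^ 3) \<Rightarrow> real ^ 4" where
  "vec4 v = vector [fst v, snd v $ 1, snd v $ 2, snd v $ 3]"

definition quad4 :: "real \<times> real \<times> real \<times> real \<Rightarrow> real ^ 4" where
  "quad4 v = vector [fst v, fst (snd v), fst (snd (snd v)), snd (snd (snd v))]"

lemma vector4_nth [simp]:
  "(vector [a, b, c, d] :: 'a::zero ^ 4) $ 1 = a" "(vector [a, b, c, d] :: 'a ^ 4) $ 2 = b"
  "(vector [a, b, c, d] :: 'a ^ 4) $ 3 = c" "(vector [a, b, c, d] :: 'a ^ 4) $ 4 = d"
  by (simp_all add: vector_def)

lemma linear_vec4: "linear vec4"
  by (rule linearI) (auto simp: vec4_def vec_eq_iff forall_4)

lemma linear_quad4: "linear quad4"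
  by (rule linearI) (auto simp: quad4_def vec_eq_iff forall_4)

lemma lborel_distr_vec4: "distr lborel borel vec4 = lborel"
proof (rule lborel_eqI[symmetric])
  fix l u :: "real ^ 4" assume le: "\<And>b. b \<in> Basis \<Longrightarrow> l \<bullet> b \<le> u \<bullet> b"
  have le': "l $ i \<le> u $ i" for i using le[of "axis i 1"] by (simp add: axis_in_Basis_iff inner_axis)
  have [measurable]: "vec4 \<in> borel_measurable borel"
    by (intro borel_measurable_continuous_onI linear_continuous_on linear_conv_bounded_linear[THEN iffD1] linear_vec4)
  define l' u' :: "real ^ 3" where "l' = vector [l $ 2, l $ 3, l $ 4]" and "u' = vector [u $ 2, u $ 3, u $ 4]"
  have "vec4 -` box l u = {l $ 1 <..< u $ 1} \<times> box l' u'"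
    by (auto simp: mem_box_cart vec4_def forall_4 forall_3 l'_def u'_def)
  then have "emeasure (distr lborel borel vec4) (box l u)
      = emeasure (lborel \<Otimes>\<^sub>M lborel) ({l $ 1 <..< u $ 1} \<times> box l' u')"
    by (simp add: emeasure_distr lborel_prod)
  also have "\<dots> = emeasure lborel {l $ 1 <..< u $ 1} * emeasure lborel (box l' u')"
    by (rule lborel.emeasure_pair_measure_Times) auto
  also have "emeasure lborel (box l' u') = ennreal (\<Prod>b\<in>Basis. (u' - l') \<bullet> b)"
  proof (rule emeasure_lborel_box)
    fix b :: "real ^ 3" assume "b \<in> Basis"
    then obtain i where "b = axis i 1" by (auto simp: Basis_vec_def)
    then show "l' \<bullet> b \<le> u' \<bullet> b"
      using le' exhaust_3[of i] by (auto simp: inner_axis l'_def u'_def)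
  qed
  also have "emeasure lborel {l $ 1 <..< u $ 1} = ennreal (u $ 1 - l $ 1)" using le' by simp
  also have "ennreal (u $ 1 - l $ 1) * ennreal (\<Prod>b\<in>Basis. (u' - l') \<bullet> b) = (\<Prod>b\<in>Basis. (u - l) \<bullet> b)"
  proof -
    have "(u $ 1 - l $ 1) * (\<Prod>b\<in>Basis. (u' - l') \<bullet> b) = (\<Prod>b\<in>Basis. (u - l) \<bullet> b)"
      by (simp add: prod_Basis_cart prod_UNIV_3 prod_UNIV_4 l'_def u'_def)
    moreover have "0 \<le> (\<Prod>b\<in>Basis. (u' - l') \<bullet> b)"
      using le' by (simp add: prod_Basis_cart prod_UNIV_3 l'_def u'_def)
    ultimately show ?thesis using le'[of 1] by (simp flip: ennreal_mult)
  qed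
  finally show "emeasure (distr lborel borel vec4) (box l u) = (\<Prod>b\<in>Basis. (u - l) \<bullet> b)" .
qed simp

lemma lborel_distr_quad4: "distr lborel borel quad4 = lborel"
proof (rule lborel_eqI[symmetric])
  fix l u :: "real ^ 4" assume le: "\<And>b. b \<in> Basis \<Longrightarrow> l \<bullet> b \<le> u \<bullet> b"
  have le': "l $ i \<le> u $ i" for i using le[of "axis i 1"] by (simp add: axis_in_Basis_iff inner_axis)
  have [measurable]: "quad4 \<in> borel_measurable borel"
    by (intro borel_measurable_continuous_onI linear_continuous_on linear_conv_bounded_linear[THEN iffD1] linear_quad4)
  have "quad4 -` box l u = {l $ 1 <..< u $ 1} \<times> {l $ 2 <..< u $ 2} \<times> {l $ 3 <..< u $ 3} \<times> {l $ 4 <..< u $ 4}"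
    by (auto simp: mem_box_cart quad4_def forall_4)
  then have "emeasure (distr lborel borel quad4) (box l u)
      = emeasure (lborel \<Otimes>\<^sub>M (lborel \<Otimes>\<^sub>M (lborel \<Otimes>\<^sub>M lborel)))
         ({l $ 1 <..< u $ 1} \<times> {l $ 2 <..< u $ 2} \<times> {l $ 3 <..< u $ 3} \<times> {l $ 4 <..< u $ 4})"
    by (simp add: emeasure_distr lborel_prod)
  also have "\<dots> = ennreal (u $ 1 - l $ 1) * (ennreal (u $ 2 - l $ 2) * (ennreal (u $ 3 - l $ 3) * ennreal (u $ 4 - l $ 4)))"
  proof -
    have t: "emeasure (lborel \<Otimes>\<^sub>M lborel) (A \<times> B) = emeasure lborel A * emeasure lborel B"
      if "A \<in> sets borel" "B \<in> sets borel" for A :: "real set" and B :: "'b::euclidean_space set"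
      using that by (intro lborel.emeasure_pair_measure_Times) auto
    have t': "emeasure lborel (A \<times> B) = emeasure lborel A * emeasure lborel B"
      if "A \<in> sets borel" "B \<in> sets borel" for A :: "real set" and B :: "'b::euclidean_space set"
      using t[OF that] by (simp add: lborel_prod)
    have b: "A \<times> B \<in> sets borel"
      if "A \<in> sets borel" "B \<in> sets borel" for A :: "real set" and B :: "'b::euclidean_space set"
      using that by (rule borel_Times)
    show ?thesis using le' by (simp add: lborel_prod t' b)
  qed
  also have "\<dots> = (\<Prod>b\<in>Basis. (u - l) \<bullet> b)"
    using le'[of 1] le'[of 2] le'[of 3] le'[of 4] by (simp add: prod_Basis_cart prod_UNIV_4 ennreal_mult')
  finally show "emeasure (distr lborel borel quad4) (box l u) = (\<Prod>b\<in>Basis. (u - l) \<bullet> b)" .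
qed simp

text \<open>Boxes determine the measure, and the preimage of a box under \<open>M\<close> is its
  image under the inverse matrix, to which the determinant formula for linear images
  applies.\<close>

lemma lborel_distr_matrix:
  fixes M :: "real ^ 4 ^ 4"
  assumes "det M \<noteq> 0"
  shows "lborel = density (distr lborel borel ((*v) M)) (\<lambda>_. ennreal \<bar>det M\<bar>)"
proof (rule lborel_eqI)
  have [measurable]: "(*v) M \<in> borel_measurable borel"
    by (intro borel_measurable_continuous_onI linear_continuous_on linear_conv_bounded_linear[THEN iffD1] matrix_vector_mul_linear)
  fix l u :: "real ^ 4" assume le: "\<And>b. b \<in> Basis \<Longrightarrow> l \<bullet> b \<le> u \<bullet> b"
  have inv: "invertible M" using assms by (simp add: invertible_det_nz)
  obtain N where N: "M ** N = mat 1" "N ** M = mat 1" using inv by (auto simp: invertible_def)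
  have dN: "det N * det M = 1" using N(2) by (metis det_mul det_I)
  have vim: "(*v) M -` B = (*v) N ` B" for B
  proof (intro set_eqI iffI)
    fix x assume "x \<in> (*v) M -` B"
    moreover have "x = N *v (M *v x)" by (simp only: matrix_vector_mul_assoc N matrix_vector_mul_lid)
    ultimately show "x \<in> (*v) N ` B" by blast
  next
    fix x assume "x \<in> (*v) N ` B"
    then obtain y where "y \<in> B" "x = N *v y" by blast
    moreover have "M *v (N *v y) = y" by (simp only: matrix_vector_mul_assoc N matrix_vector_mul_lid)
    ultimately show "x \<in> (*v) M -` B" by simp
  qed
  have lm: "box l u \<in> lmeasurable" by simp
  have "(*v) N ` box l u \<in> lmeasurable"
    by (rule measurable_linear_image[OF matrix_vector_mul_linear lm])
  then have "emeasure lebesgue ((*v) N ` box l u) = ennreal (measure lebesgue ((*v) N ` box l u))"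
    by (simp add: emeasure_eq_measure2 fmeasurableD2)
  also have "\<dots> = ennreal (\<bar>det N\<bar> * measure lebesgue (box l u))"
    by (subst measure_linear_image[OF matrix_vector_mul_linear lm]) simp
  finally have e: "emeasure lebesgue ((*v) M -` box l u) = ennreal (\<bar>det N\<bar> * measure lborel (box l u))"
    by (simp add: vim)
  have "emeasure (density (distr lborel borel ((*v) M)) (\<lambda>_. ennreal \<bar>det M\<bar>)) (box l u)
     = ennreal \<bar>det M\<bar> * emeasure lborel ((*v) M -` box l u)"
    by (simp add: emeasure_density_const emeasure_distr)
  also have "emeasure lborel ((*v) M -` box l u) = emeasure lebesgue ((*v) M -` box l u)"
  proof -
    have "(*v) M -` box l u \<in> sets borel"
      using measurable_sets[of "(*v) M" borel borel "box l u"] by simp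
    then show ?thesis by simp
  qed
  also have "ennreal \<bar>det M\<bar> * \<dots> = ennreal (\<bar>det N * det M\<bar> * measure lborel (box l u))"
    unfolding e by (simp add: ennreal_mult[symmetric] abs_mult mult_ac)
  finally show "emeasure (density (distr lborel borel ((*v) M)) (\<lambda>_. ennreal \<bar>det M\<bar>)) (box l u)
     = (\<Prod>b\<in>Basis. (u - l) \<bullet> b)"
    using dN measure_lborel_box_eq[of l u] le by simp
qed simp

lemma det_4:
  fixes A :: "'a::comm_ring_1 ^ 4 ^ 4"
  shows "det A =
    A$1$1 * (A$2$2 * (A$3$3 * A$4$4 - A$3$4 * A$4$3) - A$2$3 * (A$3$2 * A$4$4 - A$3$4 * A$4$2) + A$2$4 * (A$3$2 * A$4$3 - A$3$3 * A$4$2))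
  - A$1$2 * (A$2$1 * (A$3$3 * A$4$4 - A$3$4 * A$4$3) - A$2$3 * (A$3$1 * A$4$4 - A$3$4 * A$4$1) + A$2$4 * (A$3$1 * A$4$3 - A$3$3 * A$4$1))
  + A$1$3 * (A$2$1 * (A$3$2 * A$4$4 - A$3$4 * A$4$2) - A$2$2 * (A$3$1 * A$4$4 - A$3$4 * A$4$1) + A$2$4 * (A$3$1 * A$4$2 - A$3$2 * A$4$1))
  - A$1$4 * (A$2$1 * (A$3$2 * A$4$3 - A$3$3 * A$4$2) - A$2$2 * (A$3$1 * A$4$3 - A$3$3 * A$4$1) + A$2$3 * (A$3$1 * A$4$2 - A$3$2 * A$4$1))"
proof -
  have f1234: "finite {2::4, 3, 4}" "(1::4) \<notin> {2, 3, 4}" and f234: "finite {3::4, 4}" "(2::4) \<notin> {3, 4}" and f34: "finite {4::4}" "(3::4) \<notin> {4}"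
    by auto
  show ?thesis
    unfolding det_def UNIV_4
    unfolding sum_over_permutations_insert[OF f1234] sum_over_permutations_insert[OF f234]
      sum_over_permutations_insert[OF f34]
    unfolding permutes_sing
    by (simp add: sign_swap_id permutation_swap_id permutation_compose sign_compose sign_id swap_id_eq
        transpose_def prod_UNIV_4 algebra_simps)
qed

definition frame_map :: "hvec \<Rightarrow> hvec \<Rightarrow> hvec \<Rightarrow> hvec \<Rightarrow> real \<times> real \<times> real \<times> real \<Rightarrow> hvec" where
  "frame_map b0 b1 b2 b3 v =
     fst v *\<^sub>R b0 + fst (snd v) *\<^sub>R b1 + fst (snd (snd v)) *\<^sub>R b2 + snd (snd (snd v)) *\<^sub>R b3"

definition gram4 :: "hvec \<Rightarrow> hvec \<Rightarrow> hvec \<Rightarrow> hvec \<Rightarrow> real ^ 4 ^ 4" where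
  "gram4 b0 b1 b2 b3 =
     (let b = vector [b0, b1, b2, b3] :: hvec ^ 4 in \<chi> i j. lorentz (b $ i) (b $ j))"

lemma lorentz_vec4:
  "lorentz v w = - (vec4 v $ 1 * vec4 w $ 1) + vec4 v $ 2 * vec4 w $ 2 + vec4 v $ 3 * vec4 w $ 3 + vec4 v $ 4 * vec4 w $ 4"
  by (simp add: lorentz_def vec4_def inner_vec_def sum_3)

text \<open>If the columns of \<open>M\<close> are the frame vectors and \<open>J\<close> is the
  matrix of the form, the Gram matrix is \<open>transpose M ** J ** M\<close> with
  \<open>det J = - 1\<close>. So the Jacobian depends only on the inner products of the
  frame.\<close>

lemma emeasure_frame_map:
  assumes d: "det (gram4 b0 b1 b2 b3) \<noteq> 0" and K: "K \<in> sets borel"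
  shows "emeasure lborel K =
    ennreal (sqrt \<bar>det (gram4 b0 b1 b2 b3)\<bar>) * emeasure lborel (frame_map b0 b1 b2 b3 -` K)"
proof -
  define b where "b = (vector [b0, b1, b2, b3] :: hvec ^ 4)"
  define M :: "real ^ 4 ^ 4" where "M = (\<chi> i j. vec4 (b $ j) $ i)"
  define J :: "real ^ 4 ^ 4" where "J = (\<chi> i j. if i = j then (if i = 1 then -1 else 1) else 0)"
  have "det J = -1" unfolding J_def by (subst det_diagonal) (auto simp: prod_UNIV_4)
  moreover have "transpose M ** J ** M = gram4 b0 b1 b2 b3"
    by (simp add: gram4_def Let_def b_def[symmetric] vec_eq_iff matrix_matrix_mult_def transpose_def
        M_def J_def lorentz_vec4 sum_4)
  then have "det M * det J * det M = det (gram4 b0 b1 b2 b3)"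
    by (metis det_mul det_transpose)
  ultimately have "\<bar>det M\<bar> * \<bar>det M\<bar> = \<bar>det (gram4 b0 b1 b2 b3)\<bar>"
    by (metis abs_minus_cancel abs_mult mult.commute mult_minus1)
  then have dM: "\<bar>det M\<bar> = sqrt \<bar>det (gram4 b0 b1 b2 b3)\<bar>"
    by (metis real_sqrt_abs2 abs_idempotent)
  with d have d': "det M \<noteq> 0" by auto
  have inj: "inj vec4"
    by (auto simp: inj_def vec4_def vec_eq_iff forall_4 forall_3 prod_eq_iff)
  have eq: "vec4 (frame_map b0 b1 b2 b3 v) = M *v quad4 v" for v
    by (simp add: vec_eq_iff forall_4 matrix_vector_mult_def sum_4 M_def b_def quad4_def vec4_def
        frame_map_def)
  have cont: "continuous_on UNIV vec4" "continuous_on UNIV quad4"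
    by (intro linear_continuous_on linear_conv_bounded_linear[THEN iffD1] linear_vec4 linear_quad4)+
  then have [measurable]: "vec4 \<in> borel_measurable borel" "quad4 \<in> borel_measurable borel"
    by (auto intro: borel_measurable_continuous_onI)
  have [measurable]: "(*v) M \<in> borel_measurable borel"
    by (intro borel_measurable_continuous_onI linear_continuous_on linear_conv_bounded_linear[THEN iffD1] matrix_vector_mul_linear)
  define w :: "real ^ 4 \<Rightarrow> hvec" where "w z = (z $ 1, vector [z $ 2, z $ 3, z $ 4])" for z
  have wv: "w (vec4 v) = v" for v
    by (auto simp: w_def vec4_def vec_eq_iff forall_3 prod_eq_iff)
  have "linear w" by (rule linearI) (auto simp: w_def vec_eq_iff forall_3)
  then have [measurable]: "w \<in> borel_measurable borel"
    by (intro borel_measurable_continuous_onI linear_continuous_on linear_conv_bounded_linear[THEN iffD1])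
  have wK[measurable]: "w -` K \<in> sets borel"
    using measurable_sets[of w borel borel K] K by simp
  have "emeasure lborel K = emeasure lborel (vec4 -` (w -` K))"
    by (simp add: vimage_def wv)
  also have "\<dots> = emeasure (distr lborel borel vec4) (w -` K)"
    using wK by (simp add: emeasure_distr)
  also have "\<dots> = emeasure (lborel :: (real ^ 4) measure) (w -` K)"
    by (simp only: lborel_distr_vec4)
  also have "\<dots> = emeasure (density (distr lborel borel ((*v) M)) (\<lambda>_. ennreal \<bar>det M\<bar>)) (w -` K)"
    by (subst lborel_distr_matrix[OF d']) simp
  also have "\<dots> = ennreal \<bar>det M\<bar> * emeasure lborel ((*v) M -` w -` K)"
    using wK by (simp add: emeasure_density_const emeasure_distr)
  also have "emeasure lborel ((*v) M -` w -` K) = emeasure (distr lborel borel quad4) ((*v) M -` w -` K)"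
    by (simp only: lborel_distr_quad4)
  also have "\<dots> = emeasure lborel (quad4 -` (*v) M -` w -` K)"
    using measurable_sets[of "(*v) M" borel borel "w -` K"] wK by (subst emeasure_distr) auto
  also have "quad4 -` (*v) M -` w -` K = frame_map b0 b1 b2 b3 -` K"
    by (auto simp: eq[symmetric] wv)
  finally show ?thesis by (simp add: dM)
qed

section \<open>Hyperbolic volume as the Lebesgue measure of a cone\<close>

lemma measurable_hyp_density [measurable]:
  "(\<lambda>x :: real ^ 3. ennreal (if x \<in> H3 then 1 / (1 - (norm x)\<^sup>2)\<^sup>2 else 0)) \<in> borel_measurable borel"
proof -
  have [measurable]: "H3 \<in> sets borel" by (simp add: H3_def)
  show ?thesis by measurable
qed

lemma sets_hyp_measure [simp, measurable_cong]: "sets hyp_measure = sets borel"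
  by (simp add: hyp_measure_def)

text \<open>For \<open>q x = 1 - (norm x)\<^sup>2\<close> the cone formula yields a quarter of the
  volume element; hence the factor 4.\<close>

lemma emeasure_hyp_measure:
  assumes S [measurable]: "S \<in> sets borel" and S3: "S \<subseteq> H3"
  shows "emeasure hyp_measure S = 4 * emeasure lborel (trunc_cone S (\<lambda>x. 1 - (norm x)\<^sup>2))"
proof -
  have pos: "0 < 1 - (norm x)\<^sup>2" if "x \<in> S" for x
    using that S3 by (auto simp: H3_def abs_square_less_1 subset_iff)
  have "emeasure hyp_measure S = (\<integral>\<^sup>+x. ennreal (1 / (1 - (norm x)\<^sup>2)\<^sup>2) * indicator S x \<partial>lborel)"
    unfolding hyp_measure_def using S S3
    by (subst emeasure_density)
      (auto intro!: nn_integral_cong simp: indicator_def measurable_hyp_density)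
  also have "\<dots> = (\<integral>\<^sup>+x. 4 * (ennreal (1 / (4 * (1 - (norm x)\<^sup>2)\<^sup>2)) * indicator S x) \<partial>lborel)"
  proof (rule nn_integral_cong)
    fix x :: "real ^ 3"
    have "4 * ennreal (1 / (4 * (1 - (norm x)\<^sup>2)\<^sup>2)) = ennreal (4 * (1 / (4 * (1 - (norm x)\<^sup>2)\<^sup>2)))"
      by (subst ennreal_mult) auto
    then show "ennreal (1 / (1 - (norm x)\<^sup>2)\<^sup>2) * indicator S x = 4 * (ennreal (1 / (4 * (1 - (norm x)\<^sup>2)\<^sup>2)) * indicator S x)"
      by (simp add: mult.assoc[symmetric])
  qed
  also have "\<dots> = 4 * (\<integral>\<^sup>+x. ennreal (1 / (4 * (1 - (norm x)\<^sup>2)\<^sup>2)) * indicator S x \<partial>lborel)"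
    by (intro nn_integral_cmult) measurable
  also have "(\<integral>\<^sup>+x. ennreal (1 / (4 * (1 - (norm x)\<^sup>2)\<^sup>2)) * indicator S x \<partial>lborel) = emeasure lborel (trunc_cone S (\<lambda>x. 1 - (norm x)\<^sup>2))"
    using S pos by (subst emeasure_trunc_cone) auto
  finally show ?thesis .
qed

text \<open>Affine charts other than \<open>t = 1\<close>: \<open>S'\<close> is the region \<open>S\<close> in the projective coordinates of the
  frame \<open>b\<close>, and \<open>q'\<close> is the negated quadratic form in that chart.\<close>

lemma emeasure_hyp_measure_chart:
  fixes S' :: "(real \<times> real \<times> real) set"
  assumes S: "S \<in> sets borel" "S \<subseteq> H3" and S': "S' \<in> sets borel" and q': "q' \<in> borel_measurable borel"
    and pos: "\<And>y. y \<in> S' \<Longrightarrow> 0 < q' y"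
    and d: "\<bar>det (gram4 b0 b1 b2 b3)\<bar> = D\<^sup>2" "D > 0"
    and mem: "\<And>a y. 0 < fst (frame_map b0 b1 b2 b3 (a, y)) \<and> chart (frame_map b0 b1 b2 b3 (a, y)) \<in> S
        \<longleftrightarrow> 0 < a \<and> y /\<^sub>R a \<in> S'"
    and form: "\<And>y. - lorentz (frame_map b0 b1 b2 b3 (1, y)) (frame_map b0 b1 b2 b3 (1, y)) = q' y"
  shows "emeasure hyp_measure S = ennreal D * (\<integral>\<^sup>+y. ennreal (1 / (q' y)\<^sup>2) * indicator S' y \<partial>lborel)"
proof -
  let ?f = "frame_map b0 b1 b2 b3"
  have cone: "(fst v)\<^sup>2 * (1 - (norm (snd v /\<^sub>R fst v))\<^sup>2) = - lorentz v v" if "0 < fst v" for v :: hvec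
    using that by (simp add: lorentz_def power_mult_distrib divide_simps dot_square_norm power2_eq_square algebra_simps)
  have scale: "?f (a, y) = a *\<^sub>R ?f (1, y /\<^sub>R a)" if "a > 0" for a y
    using that by (simp add: frame_map_def scaleR_add_right mult.assoc[symmetric])
  have form': "- lorentz (?f (a, y)) (?f (a, y)) = a\<^sup>2 * q' (y /\<^sub>R a)" if "a > 0" for a y
    unfolding scale[OF that] form[symmetric] by (simp add: lorentz_def power2_eq_square algebra_simps)
  have "?f -` trunc_cone S (\<lambda>x. 1 - (norm x)\<^sup>2) = trunc_cone S' q'"
  proof (intro set_eqI)
    fix v :: "real \<times> real \<times> real \<times> real"
    obtain a y where v: "v = (a, y)" by (cases v)
    have "v \<in> ?f -` trunc_cone S (\<lambda>x. 1 - (norm x)\<^sup>2) \<longleftrightarrow>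
       (0 < fst (?f v) \<and> chart (?f v) \<in> S) \<and> - lorentz (?f v) (?f v) < 1"
      using cone[of "?f v"] by (auto simp: trunc_cone_def chart_def)
    also have "\<dots> \<longleftrightarrow> (0 < a \<and> y /\<^sub>R a \<in> S') \<and> a\<^sup>2 * q' (y /\<^sub>R a) < 1"
      unfolding v mem using form'[of a y] by (cases "a > 0") auto
    also have "\<dots> \<longleftrightarrow> v \<in> trunc_cone S' q'" by (auto simp: trunc_cone_def v)
    finally show "v \<in> ?f -` trunc_cone S (\<lambda>x. 1 - (norm x)\<^sup>2) \<longleftrightarrow> v \<in> trunc_cone S' q'" .
  qed
  moreover have "det (gram4 b0 b1 b2 b3) \<noteq> 0"
  proof
    assume "det (gram4 b0 b1 b2 b3) = 0"
    with d show False by simp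
  qed
  then have "emeasure lborel (trunc_cone S (\<lambda>x. 1 - (norm x)\<^sup>2))
      = ennreal D * emeasure lborel (?f -` trunc_cone S (\<lambda>x. 1 - (norm x)\<^sup>2))"
    using emeasure_frame_map[of b0 b1 b2 b3 "trunc_cone S (\<lambda>x. 1 - (norm x)\<^sup>2)"] d S by auto
  ultimately have "emeasure hyp_measure S = 4 * (ennreal D * emeasure lborel (trunc_cone S' q'))"
    using S by (simp add: emeasure_hyp_measure)
  also have "emeasure lborel (trunc_cone S' q') = (\<integral>\<^sup>+y. ennreal (1 / (4 * (q' y)\<^sup>2)) * indicator S' y \<partial>lborel)"
    using S' q' pos by (intro emeasure_trunc_cone) auto
  also have "4 * (ennreal D * \<dots>) = ennreal D * (4 * \<dots>)" by (simp add: mult_ac)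
  also have "4 * (\<integral>\<^sup>+y. ennreal (1 / (4 * (q' y)\<^sup>2)) * indicator S' y \<partial>lborel)
     = (\<integral>\<^sup>+y. 4 * (ennreal (1 / (4 * (q' y)\<^sup>2)) * indicator S' y) \<partial>lborel)"
    using S' q' by (intro nn_integral_cmult[symmetric]) auto
  also have "\<dots> = (\<integral>\<^sup>+y. ennreal (1 / (q' y)\<^sup>2) * indicator S' y \<partial>lborel)"
  proof (rule nn_integral_cong)
    fix y
    have "4 * ennreal (1 / (4 * (q' y)\<^sup>2)) = ennreal (4 * (1 / (4 * (q' y)\<^sup>2)))"
      by (subst ennreal_mult) auto
    then show "4 * (ennreal (1 / (4 * (q' y)\<^sup>2)) * indicator S' y) = ennreal (1 / (q' y)\<^sup>2) * indicator S' y"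
      by (simp add: mult.assoc[symmetric])
  qed
  finally show ?thesis .
qed

section \<open>Volumes of hyperbolic prisms\<close>

lemma nn_integral_lborel_triple:
  fixes f :: "real \<times> real \<times> real \<Rightarrow> ennreal"
  assumes f: "f \<in> borel_measurable borel"
  shows "(\<integral>\<^sup>+v. f v \<partial>lborel) = (\<integral>\<^sup>+x. \<integral>\<^sup>+y. \<integral>\<^sup>+z. f (x, y, z) \<partial>lborel \<partial>lborel \<partial>lborel)"
proof -
  have f': "f \<in> borel_measurable (lborel \<Otimes>\<^sub>M lborel)"
    using f by (simp add: lborel_prod)
  have g: "(\<lambda>w. f (x, w)) \<in> borel_measurable (lborel \<Otimes>\<^sub>M lborel)" for x
  proof -
    have "(\<lambda>w. f (x, w)) \<in> borel_measurable lborel" using f' by measurable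
    then show ?thesis by (simp add: lborel_prod)
  qed
  have "(\<integral>\<^sup>+v. f v \<partial>lborel) = (\<integral>\<^sup>+v. f v \<partial>(lborel \<Otimes>\<^sub>M lborel))"
    by (simp add: lborel_prod)
  also have "\<dots> = (\<integral>\<^sup>+x. \<integral>\<^sup>+w. f (x, w) \<partial>lborel \<partial>lborel)"
    by (rule lborel.nn_integral_fst[symmetric, OF f'])
  also have "\<dots> = (\<integral>\<^sup>+x. \<integral>\<^sup>+w. f (x, w) \<partial>(lborel \<Otimes>\<^sub>M lborel) \<partial>lborel)"
    by (simp add: lborel_prod)
  also have "\<dots> = (\<integral>\<^sup>+x. \<integral>\<^sup>+y. \<integral>\<^sup>+z. f (x, y, z) \<partial>lborel \<partial>lborel \<partial>lborel)"
    by (intro nn_integral_cong lborel.nn_integral_fst[symmetric] g)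
  finally show ?thesis .
qed

lemma nn_integral_FTC_closed:
  fixes F f :: "real \<Rightarrow> real"
  assumes "a \<le> b" and der: "\<And>x. a \<le> x \<Longrightarrow> x \<le> b \<Longrightarrow> (F has_real_derivative f x) (at x)"
    and "\<And>x. a \<le> x \<Longrightarrow> x \<le> b \<Longrightarrow> 0 \<le> f x"
  shows "(\<integral>\<^sup>+x. ennreal (f x) * indicator {a..b} x \<partial>lborel) = ennreal (F b - F a)"
proof (rule nn_integral_FTC_interior[where F=F])
  show "continuous_on {a..b} F"
    by (rule DERIV_continuous_on[where D=f]) (auto intro: has_field_derivative_at_within der)
qed (use assms in auto)

lemma sinh_cosh_tanh: "tanh h / (1 - (tanh h)\<^sup>2) = sinh (2 * h) / (2 :: real)"
proof -
  have c: "cosh h > 0" by (simp add: cosh_real_pos)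
  have "1 - (tanh h)\<^sup>2 = 1 / (cosh h)\<^sup>2"
    using c hyperbolic_pythagoras[of h] by (simp add: tanh_def power_divide divide_simps)
  then have "tanh h / (1 - (tanh h)\<^sup>2) = tanh h * (cosh h)\<^sup>2" by simp
  also have "\<dots> = sinh h * cosh h" using c by (simp add: tanh_def power2_eq_square)
  finally show ?thesis by (simp add: sinh_double)
qed

lemma DERIV_fun_artanh:
  assumes "(g has_real_derivative m) (at x)" "\<bar>g x\<bar> < 1"
  shows "((\<lambda>x. artanh (g x)) has_real_derivative 1 / (1 - (g x)\<^sup>2) * m) (at x)"
  using DERIV_chain2[OF artanh_real_has_field_derivative[OF assms(2)] assms(1)] by simp

text \<open>The substitution s = sqrt q * tanh r turns the integrand into cosh^2 r / (q * sqrt q),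
  with r from 0 to \<open>h\<close> measuring the distance along the column. The factor 1 / (q *
  sqrt q) that remains is the area density of the base plane.\<close>

lemma nn_integral_hyper_column:
  fixes q h :: real
  assumes q: "q > 0" and h: "h \<ge> 0"
  shows "(\<integral>\<^sup>+s. ennreal (1 / (q - s\<^sup>2)\<^sup>2) * indicator {0..tanh h * sqrt q} s \<partial>lborel)
    = ennreal ((h / 2 + sinh (2 * h) / 4) / (q * sqrt q))"
proof -
  define T where "T = tanh h"
  have T: "0 \<le> T" "T < 1" "1 - T\<^sup>2 > 0"
    using h tanh_real_lt_1[of h] by (auto simp: T_def abs_square_less_1)
  have lt: "s\<^sup>2 < q" "\<bar>s / sqrt q\<bar> < 1" if "0 \<le> s" "s \<le> T * sqrt q" for s
  proof -
    have "T * sqrt q < 1 * sqrt q" using T q by (intro mult_strict_right_mono) auto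
    with that have "s < sqrt q" by simp
    then show "\<bar>s / sqrt q\<bar> < 1" using q that by simp
    from \<open>s < sqrt q\<close> show "s\<^sup>2 < q"
      using that q by (metis abs_of_nonneg real_sqrt_abs real_sqrt_less_iff)
  qed
  define F where "F s = s / (2 * q * (q - s\<^sup>2)) + artanh (s / sqrt q) / (2 * q * sqrt q)" for s
  have der: "(F has_real_derivative 1 / (q - s\<^sup>2)\<^sup>2) (at s)" if s: "0 \<le> s" "s \<le> T * sqrt q" for s
  proof -
    note l = lt[OF s]
    have e: "1 - (s / sqrt q)\<^sup>2 = (q - s\<^sup>2) / q" using q by (simp add: power_divide field_simps)
    have ne: "q - s\<^sup>2 \<noteq> 0" using l by simp
    have "(F has_real_derivative (1 * (2 * q * (q - s\<^sup>2)) - s * (2 * q * (0 - 2 * s))) / ((2 * q * (q - s\<^sup>2)) * (2 * q * (q - s\<^sup>2)))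
       + (1 / (1 - (s / sqrt q)\<^sup>2) * (1 / sqrt q)) / (2 * q * sqrt q)) (at s)"
      unfolding F_def
    proof (rule DERIV_add)
      show "((\<lambda>s. s / (2 * q * (q - s\<^sup>2))) has_real_derivative
          (1 * (2 * q * (q - s\<^sup>2)) - s * (2 * q * (0 - 2 * s))) / ((2 * q * (q - s\<^sup>2)) * (2 * q * (q - s\<^sup>2)))) (at s)"
        using q ne by (auto intro!: derivative_eq_intros)
      show "((\<lambda>s. artanh (s / sqrt q) / (2 * q * sqrt q)) has_real_derivative
          (1 / (1 - (s / sqrt q)\<^sup>2) * (1 / sqrt q)) / (2 * q * sqrt q)) (at s)"
        using l(2) by (intro DERIV_cdivide DERIV_fun_artanh DERIV_ident)
    qed
    also have "(1 * (2 * q * (q - s\<^sup>2)) - s * (2 * q * (0 - 2 * s))) / ((2 * q * (q - s\<^sup>2)) * (2 * q * (q - s\<^sup>2)))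
       + (1 / (1 - (s / sqrt q)\<^sup>2) * (1 / sqrt q)) / (2 * q * sqrt q) = 
       (q + s\<^sup>2) / (2 * q * (q - s\<^sup>2)\<^sup>2) + 1 / (2 * q * (q - s\<^sup>2))"
    proof (rule arg_cong2[where f="(+)"])
      show "(1 * (2 * q * (q - s\<^sup>2)) - s * (2 * q * (0 - 2 * s))) / ((2 * q * (q - s\<^sup>2)) * (2 * q * (q - s\<^sup>2)))
         = (q + s\<^sup>2) / (2 * q * (q - s\<^sup>2)\<^sup>2)"
        using q ne by (simp add: divide_simps) (simp add: algebra_simps power2_eq_square)
      have "1 / ((q - s\<^sup>2) / q) * (1 / r) / (2 * q * r) = 1 / (2 * q * (q - s\<^sup>2))" if "r * r = q" "r \<noteq> 0" for r
      proof -
        have "1 / ((q - s\<^sup>2) / q) * (1 / r) / (2 * q * r) = q / ((q - s\<^sup>2) * (2 * q * (r * r)))"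
          using that(2) by simp
        then show ?thesis unfolding that(1) using q by simp
      qed
      from this[of "sqrt q"] show "1 / (1 - (s / sqrt q)\<^sup>2) * (1 / sqrt q) / (2 * q * sqrt q) = 1 / (2 * q * (q - s\<^sup>2))"
        unfolding e using q by simp
    qed
    also have "\<dots> = 1 / (q - s\<^sup>2)\<^sup>2"
      using q ne by (simp add: divide_simps) (simp add: algebra_simps power2_eq_square)
    finally show ?thesis .
  qed
  have "(\<integral>\<^sup>+s. ennreal (1 / (q - s\<^sup>2)\<^sup>2) * indicator {0..T * sqrt q} s \<partial>lborel) = ennreal (F (T * sqrt q) - F 0)"
    using T q by (intro nn_integral_FTC_closed[where F=F] der) auto
  also have "F (T * sqrt q) - F 0 = (T / (1 - T\<^sup>2)) / (2 * q * sqrt q) + h / (2 * q * sqrt q)"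
  proof -
    have "artanh T = h" unfolding T_def by (simp add: artanh_tanh_real)
    moreover have "T * sqrt q / (2 * q * (q - (T * sqrt q)\<^sup>2)) = (T / (1 - T\<^sup>2)) / (2 * q * sqrt q)"
    proof -
      have "q - (T * sqrt q)\<^sup>2 = q * (1 - T\<^sup>2)" using q by (simp add: power_mult_distrib algebra_simps)
      moreover have "sqrt q * sqrt q = q" using q by simp
      ultimately show ?thesis using q T by (simp add: divide_simps)
    qed
    ultimately show ?thesis using q by (simp add: F_def)
  qed
  also have "\<dots> = (h / 2 + sinh (2 * h) / 4) / (q * sqrt q)"
    unfolding sinh_cosh_tanh T_def using q by (simp add: field_simps)
  finally show ?thesis by (simp add: T_def)
qed

lemma nn_integral_hyp_triangle_row:
  fixes p :: real
  assumes "0 \<le> y1" "y1\<^sup>2 < p"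
  shows "(\<integral>\<^sup>+y. ennreal (1 / ((p - y\<^sup>2) * sqrt (p - y\<^sup>2))) * indicator {0..y1} y \<partial>lborel)
     = ennreal (y1 / (p * sqrt (p - y1\<^sup>2)))"
proof -
  have lt: "y\<^sup>2 < p" if "0 \<le> y" "y \<le> y1" for y
    using that assms(2) power_mono[of y y1 2] by linarith
  have p: "p > 0" using assms zero_le_power2[of y1] by linarith
  define F where "F y = y / (p * sqrt (p - y\<^sup>2))" for y
  have der: "(F has_real_derivative 1 / ((p - y\<^sup>2) * sqrt (p - y\<^sup>2))) (at y)" if y: "0 \<le> y" "y \<le> y1" for y
  proof -
    define E where "E = sqrt (p - y\<^sup>2)"
    have E: "E > 0" "E * E = p - y\<^sup>2" using lt[OF y] by (auto simp: E_def)
    have "(F has_real_derivative (1 * (p * E) - y * (p * ((0 - 2 * y) * (inverse E / 2)))) / ((p * E) * (p * E))) (at y)"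
      unfolding F_def E_def using lt[OF y] p
      by (auto intro!: derivative_eq_intros simp: field_simps power2_eq_square)
    also have "(1 * (p * E) - y * (p * ((0 - 2 * y) * (inverse E / 2)))) / ((p * E) * (p * E)) = (E * E + y\<^sup>2) / (p * (E * E) * E)"
      using E(1) p by (simp add: divide_simps) (simp add: algebra_simps power2_eq_square)
    also have "\<dots> = 1 / ((p - y\<^sup>2) * E)" using E p by simp
    finally show ?thesis by (simp add: E_def)
  qed
  have "(\<integral>\<^sup>+y. ennreal (1 / ((p - y\<^sup>2) * sqrt (p - y\<^sup>2))) * indicator {0..y1} y \<partial>lborel) = ennreal (F y1 - F 0)"
    using assms lt
    by (intro nn_integral_FTC_closed[where F=F] der) (auto simp: less_imp_le)
  then show ?thesis by (simp add: F_def)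
qed

lemma DERIV_fun_arctan:
  assumes "(g has_real_derivative m) (at x)"
  shows "((\<lambda>x. arctan (g x)) has_real_derivative m / (1 + (g x)\<^sup>2)) (at x)"
  using assms by (auto intro!: derivative_eq_intros simp: field_simps)

text \<open>The right side is the angle defect of a hyperbolic right triangle:
  \<open>arctan (1 / k)\<close> is the complement of the angle at the origin, and the subtracted
  term is the third angle.\<close>

lemma nn_integral_hyp_triangle_col:
  fixes a k :: real
  assumes k: "k > 0" and a: "a \<ge> 0" "(1 + k\<^sup>2) * a\<^sup>2 < 1"
  shows "(\<integral>\<^sup>+x. ennreal (k * x / ((1 - x\<^sup>2) * sqrt (1 - (1 + k\<^sup>2) * x\<^sup>2))) * indicator {0..a} x \<partial>lborel)
     = ennreal (arctan (1 / k) - arctan (sqrt (1 - (1 + k\<^sup>2) * a\<^sup>2) / k))"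
proof -
  have lt: "(1 + k\<^sup>2) * x\<^sup>2 < 1" "x\<^sup>2 < 1" if "0 \<le> x" "x \<le> a" for x
  proof -
    have "(1 + k\<^sup>2) * x\<^sup>2 \<le> (1 + k\<^sup>2) * a\<^sup>2" using that by (intro mult_left_mono power_mono) auto
    with a(2) show "(1 + k\<^sup>2) * x\<^sup>2 < 1" by linarith
    moreover have "x\<^sup>2 \<le> (1 + k\<^sup>2) * x\<^sup>2" by (simp add: mult_le_cancel_right1)
    ultimately show "x\<^sup>2 < 1" by linarith
  qed
  define F where "F x = - arctan (sqrt (1 - (1 + k\<^sup>2) * x\<^sup>2) / k)" for x
  have der: "(F has_real_derivative k * x / ((1 - x\<^sup>2) * sqrt (1 - (1 + k\<^sup>2) * x\<^sup>2))) (at x)" if x: "0 \<le> x" "x \<le> a" for x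
  proof -
    define E where "E = sqrt (1 - (1 + k\<^sup>2) * x\<^sup>2)"
    have E: "E > 0" "E * E = 1 - (1 + k\<^sup>2) * x\<^sup>2" using lt[OF x] by (auto simp: E_def)
    have dE: "((\<lambda>x. sqrt (1 - (1 + k\<^sup>2) * x\<^sup>2)) has_real_derivative (0 - (1 + k\<^sup>2) * (2 * x)) * (inverse E / 2)) (at x)"
      unfolding E_def using lt[OF x] by (auto intro!: derivative_eq_intros)
    have "(F has_real_derivative - (((0 - (1 + k\<^sup>2) * (2 * x)) * (inverse E / 2) / k) / (1 + (E / k)\<^sup>2))) (at x)"
      unfolding F_def using DERIV_minus[OF DERIV_fun_arctan[OF DERIV_cdivide[OF dE, of k]]]
      by (simp add: E_def)
    also have "1 + (E / k)\<^sup>2 = (1 + k\<^sup>2) * (1 - x\<^sup>2) / k\<^sup>2"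
      using k E(2) by (simp add: power_divide field_simps power2_eq_square)
    also have "- (((0 - (1 + k\<^sup>2) * (2 * x)) * (inverse E / 2) / k) / ((1 + k\<^sup>2) * (1 - x\<^sup>2) / k\<^sup>2)) = k * x / ((1 - x\<^sup>2) * E)"
    proof -
      have "1 + k\<^sup>2 > 0" "1 - x\<^sup>2 \<noteq> 0" using lt[OF x] by (auto simp: add_pos_nonneg)
      moreover have "- (((0 - m * (2 * x)) * (inverse E / 2) / k) / (m * n / k\<^sup>2)) = k * x / (n * E)" if "m > 0" "n \<noteq> 0" for m n :: real
        using that k E(1) by (simp add: divide_simps power2_eq_square)
      ultimately show ?thesis by blast
    qed
    finally show ?thesis by (simp add: E_def)
  qed
  have "(\<integral>\<^sup>+x. ennreal (k * x / ((1 - x\<^sup>2) * sqrt (1 - (1 + k\<^sup>2) * x\<^sup>2))) * indicator {0..a} x \<partial>lborel) = ennreal (F a - F 0)"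
    using assms lt
    by (intro nn_integral_FTC_closed[where F=F] der) (auto simp: less_imp_le)
  then show ?thesis by (simp add: F_def)
qed

text \<open>The region is a hyperball over a right triangle of the base plane. Every column
  contributes the same function of \<open>h\<close> times the area density, so the volume is that
  function times the area of the triangle.\<close>

lemma nn_integral_hyper_prism:
  fixes a k h :: real
  assumes k: "k > 0" and a: "a > 0" "(1 + k\<^sup>2) * a\<^sup>2 < 1" and h: "h \<ge> 0"
  shows "(\<integral>\<^sup>+v. ennreal (1 / (1 - (fst v)\<^sup>2 - (fst (snd v))\<^sup>2 - (snd (snd v))\<^sup>2)\<^sup>2) *
      indicator {(x, y, s). 0 \<le> x \<and> x \<le> a \<and> 0 \<le> y \<and> y \<le> k * x \<and> 0 \<le> s \<and> s \<le> tanh h * sqrt (1 - x\<^sup>2 - y\<^sup>2)} v \<partial>lborel)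
    = ennreal ((h / 2 + sinh (2 * h) / 4) * (arctan (1 / k) - arctan (sqrt (1 - (1 + k\<^sup>2) * a\<^sup>2) / k)))"
    (is "(\<integral>\<^sup>+v. ?f v * indicator ?S v \<partial>lborel) = _")
proof -
  define H where "H = h / 2 + sinh (2 * h) / 4"
  have H: "H \<ge> 0" using h by (simp add: H_def)
  have lt: "(1 + k\<^sup>2) * x\<^sup>2 < 1" if "0 \<le> x" "x \<le> a" for x
  proof -
    have "(1 + k\<^sup>2) * x\<^sup>2 \<le> (1 + k\<^sup>2) * a\<^sup>2" using that by (intro mult_left_mono power_mono) auto
    with a(2) show ?thesis by linarith
  qed
  have pos: "0 < 1 - x\<^sup>2 - y\<^sup>2" if "0 \<le> x" "x \<le> a" "0 \<le> y" "y \<le> k * x" for x y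
  proof -
    have "y\<^sup>2 \<le> (k * x)\<^sup>2" using that by (intro power_mono) auto
    with lt[of x] that show ?thesis by (simp add: power_mult_distrib algebra_simps)
  qed
  have [measurable]: "?S \<in> sets (borel \<Otimes>\<^sub>M (borel \<Otimes>\<^sub>M borel))"
  proof -
    have "?S = {v \<in> space (borel \<Otimes>\<^sub>M (borel \<Otimes>\<^sub>M borel)). 0 \<le> fst v \<and> fst v \<le> a \<and> 0 \<le> fst (snd v) \<and>
       fst (snd v) \<le> k * fst v \<and> 0 \<le> snd (snd v) \<and> snd (snd v) \<le> tanh h * sqrt (1 - (fst v)\<^sup>2 - (fst (snd v))\<^sup>2)}"
      by (auto simp: space_pair_measure)
    also have "\<dots> \<in> sets (borel \<Otimes>\<^sub>M (borel \<Otimes>\<^sub>M borel))" by measurable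
    finally show ?thesis .
  qed
  have "(\<lambda>v. ?f v * indicator ?S v) \<in> borel_measurable (borel \<Otimes>\<^sub>M (borel \<Otimes>\<^sub>M borel))" by measurable
  then have "(\<lambda>v. ?f v * indicator ?S v) \<in> borel_measurable borel" by (simp add: borel_prod)
  then have "(\<integral>\<^sup>+v. ?f v * indicator ?S v \<partial>lborel) = (\<integral>\<^sup>+x. \<integral>\<^sup>+y. \<integral>\<^sup>+s. ?f (x, y, s) * indicator ?S (x, y, s) \<partial>lborel \<partial>lborel \<partial>lborel)"
    by (rule nn_integral_lborel_triple)
  also have "\<dots> = (\<integral>\<^sup>+x. ennreal H * (ennreal (k * x / ((1 - x\<^sup>2) * sqrt (1 - (1 + k\<^sup>2) * x\<^sup>2))) * indicator {0..a} x) \<partial>lborel)"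
  proof (rule nn_integral_cong)
    fix x
    show "(\<integral>\<^sup>+y. \<integral>\<^sup>+s. ?f (x, y, s) * indicator ?S (x, y, s) \<partial>lborel \<partial>lborel)
       = ennreal H * (ennreal (k * x / ((1 - x\<^sup>2) * sqrt (1 - (1 + k\<^sup>2) * x\<^sup>2))) * indicator {0..a} x)"
    proof (cases "x \<in> {0..a}")
      case True
      then have x: "0 \<le> x" "x \<le> a" by auto
      have "(\<integral>\<^sup>+y. \<integral>\<^sup>+s. ?f (x, y, s) * indicator ?S (x, y, s) \<partial>lborel \<partial>lborel)
         = (\<integral>\<^sup>+y. ennreal H * (ennreal (1 / ((1 - x\<^sup>2 - y\<^sup>2) * sqrt (1 - x\<^sup>2 - y\<^sup>2))) * indicator {0..k * x} y) \<partial>lborel)"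
      proof (rule nn_integral_cong)
        fix y
        show "(\<integral>\<^sup>+s. ?f (x, y, s) * indicator ?S (x, y, s) \<partial>lborel)
          = ennreal H * (ennreal (1 / ((1 - x\<^sup>2 - y\<^sup>2) * sqrt (1 - x\<^sup>2 - y\<^sup>2))) * indicator {0..k * x} y)"
        proof (cases "y \<in> {0..k * x}")
          case True
          then have y: "0 \<le> y" "y \<le> k * x" by auto
          have "(\<integral>\<^sup>+s. ?f (x, y, s) * indicator ?S (x, y, s) \<partial>lborel)
            = (\<integral>\<^sup>+s. ennreal (1 / (1 - x\<^sup>2 - y\<^sup>2 - s\<^sup>2)\<^sup>2) * indicator {0..tanh h * sqrt (1 - x\<^sup>2 - y\<^sup>2)} s \<partial>lborel)"
            using x y by (intro nn_integral_cong) (auto simp: indicator_def)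
          also have "\<dots> = ennreal (H / ((1 - x\<^sup>2 - y\<^sup>2) * sqrt (1 - x\<^sup>2 - y\<^sup>2)))"
            unfolding H_def by (rule nn_integral_hyper_column[OF pos[OF x y] h])
          finally show ?thesis using True H pos[OF x y] by (simp add: ennreal_mult[symmetric])
        next
          case False
          then have "indicator ?S (x, y, s) = (0 :: ennreal)" for s by (auto simp: indicator_def)
          then show ?thesis using False by simp
        qed
      qed
      also have "\<dots> = ennreal H * (\<integral>\<^sup>+y. ennreal (1 / ((1 - x\<^sup>2 - y\<^sup>2) * sqrt (1 - x\<^sup>2 - y\<^sup>2))) * indicator {0..k * x} y \<partial>lborel)"
        by (rule nn_integral_cmult) measurable
      also have "(\<integral>\<^sup>+y. ennreal (1 / ((1 - x\<^sup>2 - y\<^sup>2) * sqrt (1 - x\<^sup>2 - y\<^sup>2))) * indicator {0..k * x} y \<partial>lborel)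
          = ennreal (k * x / ((1 - x\<^sup>2) * sqrt (1 - x\<^sup>2 - (k * x)\<^sup>2)))"
        using pos[OF x, of "k * x"] k x by (intro nn_integral_hyp_triangle_row) auto
      also have "1 - x\<^sup>2 - (k * x)\<^sup>2 = 1 - (1 + k\<^sup>2) * x\<^sup>2" by (simp add: algebra_simps)
      finally show ?thesis using True by simp
    next
      case False
      then have "indicator ?S (x, y, s) = (0 :: ennreal)" for y s by (auto simp: indicator_def)
      then show ?thesis using False by simp
    qed
  qed
  also have "\<dots> = ennreal H * (\<integral>\<^sup>+x. ennreal (k * x / ((1 - x\<^sup>2) * sqrt (1 - (1 + k\<^sup>2) * x\<^sup>2))) * indicator {0..a} x \<partial>lborel)"
    by (rule nn_integral_cmult) measurable
  also have "\<dots> = ennreal H * ennreal (arctan (1 / k) - arctan (sqrt (1 - (1 + k\<^sup>2) * a\<^sup>2) / k))"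
    by (subst nn_integral_hyp_triangle_col) (use k a in auto)
  also have "\<dots> = ennreal (H * (arctan (1 / k) - arctan (sqrt (1 - (1 + k\<^sup>2) * a\<^sup>2) / k)))"
    using H by (simp add: ennreal_mult')
  finally show ?thesis by (simp add: H_def)
qed

text \<open>With the slope \<open>m = y / x\<close> as variable and the integrals exchanged, the
  inner integrand is \<open>x\<close> times a rational function of \<open>x\<^sup>2\<close>; the
  outer integral then produces \<open>artanh\<close>.\<close>

lemma nn_integral_triangle_slopes:
  fixes a k c :: real
  assumes a: "a > 0" and k: "k > 0" and c: "(1 + k\<^sup>2) * a\<^sup>2 < c"
  shows "(\<integral>\<^sup>+x. \<integral>\<^sup>+y. ennreal (1 / (c - x\<^sup>2 - y\<^sup>2)\<^sup>2) *
      (indicator {0..a} x * indicator {0..k * x} y) \<partial>lborel \<partial>lborel)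
    = ennreal (a / (2 * c * sqrt (c - a\<^sup>2)) * artanh (a * k / sqrt (c - a\<^sup>2)))"
proof -
  have ca: "a\<^sup>2 < c"
  proof -
    have "1 * a\<^sup>2 \<le> (1 + k\<^sup>2) * a\<^sup>2" by (intro mult_right_mono) auto
    with c show ?thesis by linarith
  qed
  have c0: "c > 0" using ca zero_le_power2[of a] by linarith
  have lt: "x\<^sup>2 * (1 + m\<^sup>2) < c" if "0 \<le> x" "x \<le> a" "0 \<le> m" "m \<le> k" for x m
  proof -
    have "x\<^sup>2 * (1 + m\<^sup>2) \<le> a\<^sup>2 * (1 + k\<^sup>2)"
      using that by (intro mult_mono add_left_mono power_mono) auto
    with c show ?thesis by (simp add: mult.commute)
  qed
  have "(\<integral>\<^sup>+x. \<integral>\<^sup>+y. ennreal (1 / (c - x\<^sup>2 - y\<^sup>2)\<^sup>2) * (indicator {0..a} x * indicator {0..k * x} y) \<partial>lborel \<partial>lborel)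
    = (\<integral>\<^sup>+x. \<integral>\<^sup>+m. ennreal (x / (c - x\<^sup>2 * (1 + m\<^sup>2))\<^sup>2) * indicator {0..a} x * indicator {0..k} m \<partial>lborel \<partial>lborel)"
  proof (rule nn_integral_cong)
    fix x
    show "(\<integral>\<^sup>+y. ennreal (1 / (c - x\<^sup>2 - y\<^sup>2)\<^sup>2) * (indicator {0..a} x * indicator {0..k * x} y) \<partial>lborel)
      = (\<integral>\<^sup>+m. ennreal (x / (c - x\<^sup>2 * (1 + m\<^sup>2))\<^sup>2) * indicator {0..a} x * indicator {0..k} m \<partial>lborel)"
    proof (cases "0 < x \<and> x \<le> a")
      case True
      then have x: "0 < x" "x \<le> a" by auto
      have "(\<integral>\<^sup>+y. ennreal (1 / (c - x\<^sup>2 - y\<^sup>2)\<^sup>2) * (indicator {0..a} x * indicator {0..k * x} y) \<partial>lborel)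
        = ennreal \<bar>x\<bar> * (\<integral>\<^sup>+m. ennreal (1 / (c - x\<^sup>2 - (0 + x * m)\<^sup>2)\<^sup>2) * (indicator {0..a} x * indicator {0..k * x} (0 + x * m)) \<partial>lborel)"
        using x by (intro nn_integral_real_affine) auto
      also have "\<dots> = (\<integral>\<^sup>+m. ennreal \<bar>x\<bar> * (ennreal (1 / (c - x\<^sup>2 - (0 + x * m)\<^sup>2)\<^sup>2) * (indicator {0..a} x * indicator {0..k * x} (0 + x * m))) \<partial>lborel)"
        by (rule nn_integral_cmult[symmetric]) measurable
      also have "\<dots> = (\<integral>\<^sup>+m. ennreal (x / (c - x\<^sup>2 * (1 + m\<^sup>2))\<^sup>2) * indicator {0..a} x * indicator {0..k} m \<partial>lborel)"
      proof (rule nn_integral_cong)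
        fix m
        have "indicator {0..k * x} (x * m) = (indicator {0..k} m :: ennreal)"
          using x by (auto simp: indicator_def zero_le_mult_iff mult.commute)
        moreover have "c - x\<^sup>2 - (x * m)\<^sup>2 = c - x\<^sup>2 * (1 + m\<^sup>2)" by (simp add: algebra_simps)
        moreover have "ennreal \<bar>x\<bar> * ennreal (1 / (c - x\<^sup>2 * (1 + m\<^sup>2))\<^sup>2) = ennreal (x / (c - x\<^sup>2 * (1 + m\<^sup>2))\<^sup>2)"
          using x by (simp flip: ennreal_mult)
        ultimately show "ennreal \<bar>x\<bar> * (ennreal (1 / (c - x\<^sup>2 - (0 + x * m)\<^sup>2)\<^sup>2) * (indicator {0..a} x * indicator {0..k * x} (0 + x * m)))
          = ennreal (x / (c - x\<^sup>2 * (1 + m\<^sup>2))\<^sup>2) * indicator {0..a} x * indicator {0..k} m"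
          by (simp only: add_0 mult.assoc[symmetric])
      qed
      finally show ?thesis .
    next
      case False
      show ?thesis
      proof (cases "x = 0")
        \<comment> \<open>The substitution degenerates at \<open>x = 0\<close>, where
          \<open>y\<close> runs over a null set.\<close>
        case True
        have "(\<integral>\<^sup>+y. ennreal (1 / (c - x\<^sup>2 - y\<^sup>2)\<^sup>2) * (indicator {0..a} x * indicator {0..k * x} y) \<partial>lborel)
          = (\<integral>\<^sup>+y. 0 \<partial>(lborel :: real measure))"
        proof (rule nn_integral_cong_AE)
          show "AE y in lborel. ennreal (1 / (c - x\<^sup>2 - y\<^sup>2)\<^sup>2) * (indicator {0..a} x * indicator {0..k * x} y) = 0"
            using AE_lborel_singleton[of "0::real"] by eventually_elim (use True in \<open>auto simp: indicator_def\<close>)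
        qed
        then show ?thesis using True by simp
      next
        case neq: False
        with False have "x \<notin> {0..a}" by auto
        then show ?thesis by simp
      qed
    qed
  qed
  also have "\<dots> = (\<integral>\<^sup>+m. \<integral>\<^sup>+x. ennreal (x / (c - x\<^sup>2 * (1 + m\<^sup>2))\<^sup>2) * indicator {0..a} x * indicator {0..k} m \<partial>lborel \<partial>lborel)"
    by (rule lborel_pair.Fubini'[symmetric]) measurable
  also have "\<dots> = (\<integral>\<^sup>+m. ennreal (a\<^sup>2 / (2 * c * (c - a\<^sup>2 * (1 + m\<^sup>2)))) * indicator {0..k} m \<partial>lborel)"
  proof (rule nn_integral_cong)
    fix m
    show "(\<integral>\<^sup>+x. ennreal (x / (c - x\<^sup>2 * (1 + m\<^sup>2))\<^sup>2) * indicator {0..a} x * indicator {0..k} m \<partial>lborel)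
      = ennreal (a\<^sup>2 / (2 * c * (c - a\<^sup>2 * (1 + m\<^sup>2)))) * indicator {0..k} m"
    proof (cases "m \<in> {0..k}")
      case True
      then have m: "0 \<le> m" "m \<le> k" by auto
      define n where "n = 1 + m\<^sup>2"
      have n: "n > 0" by (simp add: n_def add_pos_nonneg)
      define F where "F x = 1 / (2 * n * (c - x\<^sup>2 * n))" for x
      have "(\<integral>\<^sup>+x. ennreal (x / (c - x\<^sup>2 * n)\<^sup>2) * indicator {0..a} x \<partial>lborel) = ennreal (F a - F 0)"
      proof (rule nn_integral_FTC_closed)
        fix x assume x: "0 \<le> x" "x \<le> a"
        have ne: "c - x\<^sup>2 * n > 0" using lt[OF x m] by (simp add: n_def)
        have "(F has_real_derivative (0 * (2 * n * (c - x\<^sup>2 * n)) - 1 * (2 * n * (0 - 2 * x * n))) / ((2 * n * (c - x\<^sup>2 * n)) * (2 * n * (c - x\<^sup>2 * n)))) (at x)"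
          unfolding F_def using ne n by (auto intro!: derivative_eq_intros)
        also have "(0 * (2 * n * (c - x\<^sup>2 * n)) - 1 * (2 * n * (0 - 2 * x * n))) / ((2 * n * (c - x\<^sup>2 * n)) * (2 * n * (c - x\<^sup>2 * n))) = x / (c - x\<^sup>2 * n)\<^sup>2"
          using ne n by (simp add: divide_simps) (simp add: algebra_simps power2_eq_square)
        finally show "(F has_real_derivative x / (c - x\<^sup>2 * n)\<^sup>2) (at x)" .
      qed (use a in auto)
      also have "F a - F 0 = a\<^sup>2 / (2 * c * (c - a\<^sup>2 * n))"
        using lt[of a m] a m n c0 by (simp add: F_def n_def[symmetric] field_simps)
      finally show ?thesis using True by (simp add: n_def)
    qed simp
  qed
  also have "\<dots> = ennreal (a / (2 * c * sqrt (c - a\<^sup>2)) * artanh (a * k / sqrt (c - a\<^sup>2)))"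
  proof -
    define r where "r = sqrt (c - a\<^sup>2)"
    have r: "r > 0" "r\<^sup>2 = c - a\<^sup>2" using ca by (auto simp: r_def)
    define F where "F m = a / (2 * c * r) * artanh (a * m / r)" for m
    have "(\<integral>\<^sup>+m. ennreal (a\<^sup>2 / (2 * c * (c - a\<^sup>2 * (1 + m\<^sup>2)))) * indicator {0..k} m \<partial>lborel) = ennreal (F k - F 0)"
    proof (rule nn_integral_FTC_closed)
      fix m assume m: "0 \<le> m" "m \<le> k"
      have l: "(a * m)\<^sup>2 < r\<^sup>2" using lt[of a m] a m by (simp add: r algebra_simps)
      then have l': "\<bar>a * m / r\<bar> < 1"
        using r(1) a m by (simp add: abs_mult power2_less_imp_less)
      have "(F has_real_derivative a / (2 * c * r) * (1 / (1 - (a * m / r)\<^sup>2) * (a / r))) (at m)"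
        unfolding F_def using l' r(1) by (intro DERIV_cmult DERIV_fun_artanh) (auto intro!: derivative_eq_intros)
      also have "a / (2 * c * r) * (1 / (1 - (a * m / r)\<^sup>2) * (a / r)) = a\<^sup>2 / (2 * c * (c - a\<^sup>2 * (1 + m\<^sup>2)))"
      proof -
        have "1 - (a * m / r)\<^sup>2 = (c - a\<^sup>2 * (1 + m\<^sup>2)) / r\<^sup>2"
        proof -
          have "c - a\<^sup>2 * (1 + m\<^sup>2) = r\<^sup>2 - (a * m)\<^sup>2" by (simp add: r(2) algebra_simps)
          then show ?thesis using r(1) by (simp add: power_divide diff_divide_distrib)
        qed
        then show ?thesis using r(1) c0 by (simp add: power2_eq_square)
      qed
      finally show "(F has_real_derivative a\<^sup>2 / (2 * c * (c - a\<^sup>2 * (1 + m\<^sup>2)))) (at m)" .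
      show "0 \<le> a\<^sup>2 / (2 * c * (c - a\<^sup>2 * (1 + m\<^sup>2)))"
        using lt[of a m] a m c0 by simp
    qed (use k in auto)
    then show ?thesis by (simp add: F_def r_def)
  qed
  finally show ?thesis .
qed

text \<open>By \<open>eq\<close> the vertex \<open>(t, a, k * a)\<close> lies on the unit sphere: it
  is the ideal vertex. A slice of constant \<open>s\<close> contributes an \<open>artanh\<close>
  with an algebraic factor, and the new variable \<open>u\<close> absorbs this factor.\<close>

lemma nn_integral_frustum_prism:
  fixes a k t :: real
  assumes a: "a > 0" and k: "k > 0" and t: "t > 0" and eq: "(1 + k\<^sup>2) * a\<^sup>2 + t\<^sup>2 = 1"
  shows "(\<integral>\<^sup>+v. ennreal (1 / (1 - (fst v)\<^sup>2 - (fst (snd v))\<^sup>2 - (snd (snd v))\<^sup>2)\<^sup>2) *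
      indicator {(s, x, y). 0 \<le> s \<and> s \<le> t \<and> 0 \<le> x \<and> x \<le> a \<and> 0 \<le> y \<and> y \<le> k * x} v \<partial>lborel)
    = (\<integral>\<^sup>+u. ennreal (artanh (k * sqrt ((a\<^sup>2 + (tan u)\<^sup>2) / (1 - a\<^sup>2))) / 2) * indicator {0..arctan (t / k)} u \<partial>lborel)"
    (is "(\<integral>\<^sup>+v. ?f v * indicator ?S v \<partial>lborel) = _")
proof -
  have a1: "a\<^sup>2 < 1" 
  proof -
    have "1 * a\<^sup>2 \<le> (1 + k\<^sup>2) * a\<^sup>2" by (intro mult_right_mono) auto
    with eq t show ?thesis using zero_less_power[of t 2] by linarith
  qed
  have pos: "1 - a\<^sup>2 - s\<^sup>2 > 0" "1 - s\<^sup>2 > 0" if "0 \<le> s" "s \<le> t" for s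
  proof -
    have "s\<^sup>2 \<le> t\<^sup>2" using that by (intro power_mono) auto
    moreover have "(k * a)\<^sup>2 > 0" using k a by simp
    moreover have "a\<^sup>2 + (k * a)\<^sup>2 + t\<^sup>2 = 1" using eq by (simp add: power_mult_distrib algebra_simps)
    ultimately show "1 - a\<^sup>2 - s\<^sup>2 > 0" by linarith
    then show "1 - s\<^sup>2 > 0" using zero_le_power2[of a] by linarith
  qed
  have [measurable]: "?S \<in> sets (borel \<Otimes>\<^sub>M (borel \<Otimes>\<^sub>M borel))"
  proof -
    have "?S = {v \<in> space (borel \<Otimes>\<^sub>M (borel \<Otimes>\<^sub>M borel)). 0 \<le> fst v \<and> fst v \<le> t \<and> 0 \<le> fst (snd v) \<and>
       fst (snd v) \<le> a \<and> 0 \<le> snd (snd v) \<and> snd (snd v) \<le> k * fst (snd v)}"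
      by (auto simp: space_pair_measure)
    also have "\<dots> \<in> sets (borel \<Otimes>\<^sub>M (borel \<Otimes>\<^sub>M borel))" by measurable
    finally show ?thesis .
  qed
  define G where "G s = a / (2 * (1 - s\<^sup>2) * sqrt (1 - s\<^sup>2 - a\<^sup>2)) * artanh (a * k / sqrt (1 - s\<^sup>2 - a\<^sup>2))" for s
  have "(\<lambda>v. ?f v * indicator ?S v) \<in> borel_measurable (borel \<Otimes>\<^sub>M (borel \<Otimes>\<^sub>M borel))" by measurable
  then have "(\<lambda>v. ?f v * indicator ?S v) \<in> borel_measurable borel" by (simp add: borel_prod)
  then have "(\<integral>\<^sup>+v. ?f v * indicator ?S v \<partial>lborel) = (\<integral>\<^sup>+s. \<integral>\<^sup>+x. \<integral>\<^sup>+y. ?f (s, x, y) * indicator ?S (s, x, y) \<partial>lborel \<partial>lborel \<partial>lborel)"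
    by (rule nn_integral_lborel_triple)
  also have "\<dots> = (\<integral>\<^sup>+s. ennreal (G s) * indicator {0..t} s \<partial>lborel)"
  proof (rule nn_integral_cong_AE)
    \<comment> \<open>The slice \<open>s = t\<close> reaches the ideal vertex, where the strict
      inequality required of a slice fails; it is a null set.\<close>
    show "AE s in lborel. (\<integral>\<^sup>+x. \<integral>\<^sup>+y. ?f (s, x, y) * indicator ?S (s, x, y) \<partial>lborel \<partial>lborel)
       = ennreal (G s) * indicator {0..t} s"
      using AE_lborel_singleton[of t]
    proof eventually_elim
      case (elim s)
      show ?case
      proof (cases "s \<in> {0..t}")
        case True
        with elim have s: "0 \<le> s" "s < t" by auto
        have "s\<^sup>2 < t\<^sup>2" using s by (intro power_strict_mono) auto
        then have l: "(1 + k\<^sup>2) * a\<^sup>2 < 1 - s\<^sup>2" using eq by linarith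
        have "(\<integral>\<^sup>+x. \<integral>\<^sup>+y. ?f (s, x, y) * indicator ?S (s, x, y) \<partial>lborel \<partial>lborel)
          = (\<integral>\<^sup>+x. \<integral>\<^sup>+y. ennreal (1 / ((1 - s\<^sup>2) - x\<^sup>2 - y\<^sup>2)\<^sup>2) * (indicator {0..a} x * indicator {0..k * x} y) \<partial>lborel \<partial>lborel)"
          using s by (intro nn_integral_cong) (auto simp: indicator_def)
        also have "\<dots> = ennreal (G s)"
          unfolding G_def by (rule nn_integral_triangle_slopes[OF a k l])
        finally show ?thesis using True by simp
      next
        case False
        then have "indicator ?S (s, x, y) = (0 :: ennreal)" for x y by (auto simp: indicator_def)
        then show ?thesis using False by simp
      qed
    qed
  qed
  also have "\<dots> = (\<integral>\<^sup>+u. ennreal (artanh (k * sqrt ((a\<^sup>2 + (tan u)\<^sup>2) / (1 - a\<^sup>2))) / 2) * indicator {0..arctan (t / k)} u \<partial>lborel)"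
  proof -
    define E where "E s = sqrt (1 - a\<^sup>2 - s\<^sup>2)" for s
    \<comment> \<open>Chosen so that its derivative \<open>g'\<close> is twice the algebraic factor
      of \<open>G\<close>.\<close>
    define g where "g s = arctan (a * s / E s)" for s
    define g' where "g' s = a / ((1 - s\<^sup>2) * E s)" for s
    define f where "f u = artanh (k * sqrt ((a\<^sup>2 + (tan u)\<^sup>2) / (1 - a\<^sup>2))) / 2" for u
    have E: "E s > 0" "(E s)\<^sup>2 = 1 - a\<^sup>2 - s\<^sup>2" if "0 \<le> s" "s \<le> t" for s
      using pos[OF that] by (auto simp: E_def)
    have [measurable]: "tan \<in> borel_measurable (borel :: real measure)"
      unfolding tan_def[abs_def] by measurable
    have [measurable]: "artanh \<in> borel_measurable (borel :: real measure)"
      unfolding artanh_def[abs_def] by measurable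
    have fm: "f \<in> borel_measurable borel" unfolding f_def by measurable
    have der: "(g has_real_derivative g' s) (at s)" if s: "s \<in> {0..t}" for s
    proof -
      have s': "0 \<le> s" "s \<le> t" using s by auto
      note Es = E[OF s'] and p = pos[OF s']
      have dE: "(E has_real_derivative (0 - 2 * s) * (inverse (E s) / 2)) (at s)"
        unfolding E_def using p by (auto intro!: derivative_eq_intros)
      have "(g has_real_derivative ((a * 1 * E s - a * s * ((0 - 2 * s) * (inverse (E s) / 2))) / (E s * E s)) / (1 + (a * s / E s)\<^sup>2)) (at s)"
        unfolding g_def using Es(1)
        by (intro DERIV_fun_arctan DERIV_divide DERIV_cmult DERIV_ident dE) auto
      also have "1 + (a * s / E s)\<^sup>2 = (1 - a\<^sup>2) * (1 - s\<^sup>2) / (E s)\<^sup>2"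
      proof -
        have "(E s)\<^sup>2 + (a * s)\<^sup>2 = (1 - a\<^sup>2) * (1 - s\<^sup>2)" unfolding Es(2) by (simp add: power_mult_distrib algebra_simps)
        then show ?thesis using Es(1) by (simp add: power_divide field_simps)
      qed
      also have "(a * 1 * E s - a * s * ((0 - 2 * s) * (inverse (E s) / 2))) / (E s * E s) = a * (1 - a\<^sup>2) / ((E s)\<^sup>2 * E s)"
      proof -
        have "a * 1 * E s - a * s * ((0 - 2 * s) * (inverse (E s) / 2)) = a * ((E s)\<^sup>2 + s\<^sup>2) / E s"
          using Es(1) by (simp add: field_simps power2_eq_square)
        also have "(E s)\<^sup>2 + s\<^sup>2 = 1 - a\<^sup>2" unfolding Es(2) by simp
        finally show ?thesis using Es(1) by (simp add: power2_eq_square)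
      qed
      also have "a * (1 - a\<^sup>2) / ((E s)\<^sup>2 * E s) / ((1 - a\<^sup>2) * (1 - s\<^sup>2) / (E s)\<^sup>2) = g' s"
      proof -
        have "a * w / (e2 * e) / (w * z / e2) = a / (z * e)" if "w \<noteq> 0" "e2 \<noteq> 0" "e \<noteq> 0" "z \<noteq> 0" for w e2 e z :: real
          using that by (simp add: field_simps)
        moreover have "1 - a\<^sup>2 \<noteq> 0" using a1 by simp
        moreover have "(E s)\<^sup>2 \<noteq> 0" "E s \<noteq> 0" "1 - s\<^sup>2 \<noteq> 0" using Es(1) p by auto
        ultimately show ?thesis unfolding g'_def by blast
      qed
      finally show ?thesis .
    qed
    have cont: "continuous_on {0..t} g'"
      unfolding g'_def E_def using pos by (intro continuous_intros) (auto simp: less_imp_neq[THEN not_sym])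
    have sub: "(\<integral>\<^sup>+u. f u * indicator {g 0..g t} u \<partial>lborel) = (\<integral>\<^sup>+s. f (g s) * g' s * indicator {0..t} s \<partial>lborel)"
      using t a pos E fm der cont
      by (intro nn_integral_substitution) (auto simp: g'_def set_borel_measurable_def less_imp_le)
    have g0: "g 0 = 0" by (simp add: g_def)
    moreover have gt: "g t = arctan (t / k)"
    proof -
      have "(E t)\<^sup>2 = (a * k)\<^sup>2" using E(2)[of t] t eq by (simp add: power_mult_distrib algebra_simps)
      then have "E t = a * k" using E(1)[of t] t a k by (simp add: power2_eq_iff_nonneg)
      then show ?thesis using a by (simp add: g_def)
    qed
    moreover have "f (g s) * g' s = G s" if s: "0 \<le> s" "s \<le> t" for s
    proof -
      note Es = E[OF s] and p = pos[OF s]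
      have "tan (g s) = a * s / E s" by (simp add: g_def tan_arctan)
      then have "(a\<^sup>2 + (tan (g s))\<^sup>2) / (1 - a\<^sup>2) = (a / E s)\<^sup>2"
      proof -
        have "a\<^sup>2 + (a * s / E s)\<^sup>2 = a\<^sup>2 * ((E s)\<^sup>2 + s\<^sup>2) / (E s)\<^sup>2"
          using Es(1) by (simp add: power_divide power_mult_distrib field_simps)
        also have "(E s)\<^sup>2 + s\<^sup>2 = 1 - a\<^sup>2" unfolding Es(2) by simp
        finally show ?thesis using a1 \<open>tan (g s) = _\<close> by (simp add: power_divide)
      qed
      then have "k * sqrt ((a\<^sup>2 + (tan (g s))\<^sup>2) / (1 - a\<^sup>2)) = a * k / E s"
        using a Es(1) by (simp add: real_sqrt_abs)
      then show ?thesis by (simp add: f_def g'_def G_def E_def algebra_simps)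
    qed
    ultimately have "(\<integral>\<^sup>+s. ennreal (G s) * indicator {0..t} s \<partial>lborel) = (\<integral>\<^sup>+s. f (g s) * g' s * indicator {0..t} s \<partial>lborel)"
      by (intro nn_integral_cong) (auto simp: indicator_def)
    also have "\<dots> = (\<integral>\<^sup>+u. f u * indicator {0..arctan (t / k)} u \<partial>lborel)"
      using sub g0 gt by simp
    also have "\<dots> = (\<integral>\<^sup>+u. ennreal (f u) * indicator {0..arctan (t / k)} u \<partial>lborel)"
      by (intro nn_integral_cong) (auto simp: indicator_def)
    finally show ?thesis by (simp add: f_def)
  qed
  finally show ?thesis .
qed

section \<open>The inverse tangent integral\<close>

lemma artanh_eq_arsinh:
  fixes x :: real
  assumes "0 \<le> x" "x < 1"
  shows "artanh x = arsinh (x / sqrt (1 - x\<^sup>2))"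
proof -
  define r where "r = sqrt (1 - x\<^sup>2)"
  have x2: "x\<^sup>2 < 1" using assms by (simp add: abs_square_less_1)
  then have r: "r > 0" "r\<^sup>2 = 1 - x\<^sup>2" by (auto simp: r_def)
  have "(x / r)\<^sup>2 + 1 = (1 / r)\<^sup>2" using r by (simp add: power_divide field_simps)
  then have "sqrt ((x / r)\<^sup>2 + 1) = 1 / r" using r by (simp add: real_sqrt_divide)
  then have "arsinh (x / r) = ln ((1 + x) / r)"
    by (simp add: arsinh_real_def add_divide_distrib add.commute)
  moreover have "(1 + x) / (1 - x) = ((1 + x) / r)\<^sup>2"
  proof -
    have "r\<^sup>2 = (1 - x) * (1 + x)" unfolding r(2) by (simp add: power2_eq_square algebra_simps)
    then show ?thesis using assms by (simp add: power_divide) (simp add: power2_eq_square)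
  qed
  then have "ln ((1 + x) / (1 - x)) = 2 * ln ((1 + x) / r)"
    using assms r by (simp add: ln_realpow)
  ultimately show ?thesis by (simp add: artanh_def r_def)
qed

text \<open>The inverse tangent integral \<open>Ti\<^sub>2\<close>, and an antiderivative of \<open>- ln (tan t)\<close> built from it.\<close>

definition ti2 :: "real \<Rightarrow> real" where
  "ti2 x = integral {0..x} (\<lambda>u. if u = 0 then 1 else arctan u / u)"

definition neg_ln_tan_integral :: "real \<Rightarrow> real" where
  "neg_ln_tan_integral t = ti2 (tan t) - t * ln (tan t)"

lemma isCont_arctan_div: "isCont (\<lambda>u::real. if u = 0 then 1 else arctan u / u) x"
proof (cases "x = 0")
  case True
  have "((\<lambda>u::real. arctan u / u) \<longlongrightarrow> 1) (at 0)"
    using DERIV_arctan[of 0] by (simp add: has_field_derivative_def has_derivative_at)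
      (use DERIV_arctan[of 0] in \<open>simp add: DERIV_def\<close>)
  then have "((\<lambda>u::real. if u = 0 then 1 else arctan u / u) \<longlongrightarrow> 1) (at 0)"
    by (rule Lim_transform_eventually) (auto simp: eventually_at_filter)
  then show ?thesis using True by (simp add: isCont_def)
next
  case False
  have "\<forall>\<^sub>F u in nhds x. (if u = 0 then 1 else arctan u / u) = arctan u / u"
    using t1_space_nhds[OF False] by eventually_elim auto
  then have "isCont (\<lambda>u::real. if u = 0 then 1 else arctan u / u) x \<longleftrightarrow> isCont (\<lambda>u. arctan u / u) x"
    by (rule isCont_cong)
  then show ?thesis using False isCont_divide[OF isCont_arctan continuous_ident, of x] by simp
qed

lemma DERIV_ti2:
  assumes "x > 0"
  shows "(ti2 has_real_derivative arctan x / x) (at x)"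
proof -
  have "((\<lambda>x. integral {0..x} (\<lambda>u. if u = 0 then 1 else arctan u / u)) has_real_derivative (if x = 0 then 1 else arctan x / x)) (at x within {0..x + 1})"
    using assms by (intro integral_has_real_derivative continuous_at_imp_continuous_on) (auto intro: isCont_arctan_div)
  moreover have "at x within {0..x + 1} = at x"
    using assms by (intro at_within_interior) auto
  ultimately show ?thesis using assms unfolding ti2_def[abs_def] by simp
qed

lemma continuous_on_ti2: "continuous_on {0..b} ti2"
  unfolding ti2_def[abs_def]
  by (intro indefinite_integral_continuous_1 integrable_continuous_real continuous_at_imp_continuous_on)
    (auto intro: isCont_arctan_div)

lemma ti2_0 [simp]: "ti2 0 = 0" by (simp add: ti2_def)

lemma DERIV_neg_ln_tan_integral:
  assumes t: "0 < t" "t < pi / 2"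
  shows "(neg_ln_tan_integral has_real_derivative - ln (tan t)) (at t)"
proof -
  have s: "sin t > 0" using t by (intro sin_gt_zero) auto
  have c: "cos t > 0" using t by (intro cos_gt_zero) auto
  have tt: "tan t > 0" using t by (rule tan_gt_zero)
  have d: "(tan has_real_derivative inverse ((cos t)\<^sup>2)) (at t)" using c by (intro DERIV_tan) auto
  have "(neg_ln_tan_integral has_real_derivative
     arctan (tan t) / tan t * inverse ((cos t)\<^sup>2) - (1 * ln (tan t) + 1 / tan t * inverse ((cos t)\<^sup>2) * t)) (at t)"
    unfolding neg_ln_tan_integral_def
    by (intro DERIV_diff DERIV_mult DERIV_ident DERIV_chain2[OF DERIV_ti2[OF tt] d] DERIV_chain2[OF DERIV_ln_divide[OF tt] d])
  moreover have "arctan (tan t) = t" using t by (intro arctan_tan) auto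
  ultimately show ?thesis by simp
qed

text \<open>At 0 the product \<open>t * ln (tan t)\<close> tends to 0, which is also its value there
  because of the factor \<open>t\<close>.\<close>

lemma continuous_on_neg_ln_tan_integral:
  assumes "b < pi / 2"
  shows "continuous_on {0..b} neg_ln_tan_integral"
  unfolding continuous_on_eq_continuous_within
proof
  fix t assume t: "t \<in> {0..b}"
  show "continuous (at t within {0..b}) neg_ln_tan_integral"
  proof (cases "t = 0")
    case False
    with t assms have "0 < t" "t < pi / 2" by auto
    from DERIV_isCont[OF DERIV_neg_ln_tan_integral[OF this]] show ?thesis
      by (rule continuous_at_imp_continuous_at_within)
  next
    case True
    show ?thesis
    proof (cases "b > 0")
      case b: True
      have tan0: "((\<lambda>t::real. tan t) \<longlongrightarrow> 0) (at_right 0)"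
        by real_asymp
      have "continuous (at 0 within {0..1}) ti2"
        using continuous_on_ti2[of 1] by (simp add: continuous_on_eq_continuous_within)
      then have "(ti2 \<longlongrightarrow> ti2 0) (at_right 0)"
        by (simp add: continuous_within at_within_Icc_at_right)
      moreover have "filterlim tan (at_right (0::real)) (at_right 0)"
        by real_asymp
      ultimately have "((\<lambda>t. ti2 (tan t)) \<longlongrightarrow> ti2 0) (at_right 0)"
        by (rule filterlim_compose)
      moreover have "((\<lambda>t::real. t * ln (tan t)) \<longlongrightarrow> 0) (at_right 0)"
        by real_asymp
      ultimately have "((\<lambda>t. ti2 (tan t) - t * ln (tan t)) \<longlongrightarrow> ti2 0 - 0) (at_right 0)"
        by (rule tendsto_diff)
      then show ?thesis using True b
        by (simp add: continuous_within at_within_Icc_at_right neg_ln_tan_integral_def[abs_def])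
    next
      case False
      with t True have "{0..b} = {t}" by auto
      then show ?thesis by (simp add: continuous_within at_within_def)
    qed
  qed
qed

text \<open>\<open>ln (tan t)\<close> changes sign under the reflection, so the difference of the
  two sides is constant, and it vanishes at \<pi>/4. At \<pi>/3 this moves the series of
  \<open>ti2\<close> from the argument sqrt 3, where it diverges, to 1 / sqrt 3.\<close>

lemma neg_ln_tan_integral_reflect:
  assumes t: "0 < t" "t < pi / 2"
  shows "neg_ln_tan_integral (pi / 2 - t) = neg_ln_tan_integral t"
proof -
  define D where "D x = neg_ln_tan_integral x - neg_ln_tan_integral (pi / 2 - x)" for x
  have der: "(D has_real_derivative 0) (at x)" if x: "0 < x" "x < pi / 2" for x
  proof -
    have "(D has_real_derivative (- ln (tan x) - (- ln (tan (pi / 2 - x)) * (0 - 1)))) (at x)"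
      unfolding D_def
      by (intro DERIV_diff DERIV_chain2[OF DERIV_neg_ln_tan_integral] DERIV_const DERIV_ident DERIV_neg_ln_tan_integral)
        (use x in auto)
    moreover have "tan (pi / 2 - x) = inverse (tan x)" by (simp add: tan_def sin_diff cos_diff)
    moreover have "tan x > 0" using x by (rule tan_gt_zero)
    ultimately show ?thesis by (simp add: ln_inverse)
  qed
  have "D t = D (pi / 4)"
  proof (cases t "pi / 4" rule: linorder_cases)
    case less
    have "D (pi / 4) = D t"
      by (rule DERIV_isconst_end[OF less])
        (use t less in \<open>auto intro!: DERIV_isCont[OF der] continuous_at_imp_continuous_on der\<close>)
    then show ?thesis by simp
  next
    case greater
    show ?thesis
      by (rule DERIV_isconst_end[OF greater])
        (use t greater in \<open>auto intro!: DERIV_isCont[OF der] continuous_at_imp_continuous_on der\<close>)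
  next
    case equal
    show ?thesis unfolding equal ..
  qed
  moreover have "D (pi / 4) = 0" by (simp add: D_def field_simps)
  ultimately show ?thesis by (simp add: D_def)
qed

text \<open>The sum-to-product identities turn
  \<open>(1 + cos b / cos u) / (1 - cos b / cos u)\<close> into a product of two cotangents, so
  \<open>artanh\<close> becomes half the sum of two values of \<open>- ln (tan t)\<close>. For
  \<open>b = \<pi>/2 - \<gamma>\<close> the integral is twice the volume in the limit \<alpha> =
  0.\<close>

lemma nn_integral_artanh_cos_ratio:
  fixes b :: real
  assumes b: "0 < b" "b < pi / 2"
  shows "(\<integral>\<^sup>+u. ennreal (artanh (cos b / cos u)) * indicator {0..b} u \<partial>lborel) = ennreal (neg_ln_tan_integral b)"
    and "0 \<le> neg_ln_tan_integral b"
proof -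
  define F where "F u = neg_ln_tan_integral ((b + u) / 2) - neg_ln_tan_integral ((b - u) / 2)" for u
  have cont: "continuous_on {0..b} F"
    unfolding F_def
  proof (intro continuous_intros continuous_on_compose2[OF continuous_on_neg_ln_tan_integral[OF b(2)]])
    show "(\<lambda>x. (b + x) / 2) ` {0..b} \<subseteq> {0..b}" "(\<lambda>x. (b - x) / 2) ` {0..b} \<subseteq> {0..b}" using b by auto
  qed auto
  have key: "artanh (cos b / cos u) = - (ln (tan ((b + u) / 2)) + ln (tan ((b - u) / 2))) / 2" "0 \<le> artanh (cos b / cos u)"
    if u: "0 < u" "u < b" for u
  proof -
    let ?p = "(b + u) / 2" and ?m = "(b - u) / 2"
    have cu: "cos u > 0" using u b by (intro cos_gt_zero) auto
    have cb: "cos b > 0" using b by (intro cos_gt_zero) auto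
    have lt: "cos b < cos u" using u b by (intro cos_monotone_0_pi) auto
    have pp: "sin ?p > 0" "cos ?p > 0" "sin ?m > 0" "cos ?m > 0"
      using u b by (auto intro!: sin_gt_zero cos_gt_zero)
    have e: "cos u + cos b = 2 * cos ?p * cos ?m" "cos u - cos b = 2 * sin ?p * sin ?m"
      using cos_add[of ?p ?m] cos_diff[of ?p ?m] by (simp_all add: field_simps add_divide_distrib[symmetric] diff_divide_distrib[symmetric])
    have "(1 + cos b / cos u) / (1 - cos b / cos u) = (cos u + cos b) / (cos u - cos b)"
      using cu lt by (simp add: field_simps)
    also have "\<dots> = inverse (tan ?p * tan ?m)"
      unfolding e using pp by (simp add: tan_def)
    finally have "(1 + cos b / cos u) / (1 - cos b / cos u) = inverse (tan ?p * tan ?m)" .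
    moreover have tp: "tan ?p > 0" "tan ?m > 0" using pp by (auto simp: tan_def)
    ultimately show "artanh (cos b / cos u) = - (ln (tan ?p) + ln (tan ?m)) / 2"
      by (simp add: artanh_def ln_inverse ln_mult)
    show "0 \<le> artanh (cos b / cos u)"
      unfolding artanh_def using cu cb lt by (intro divide_nonneg_nonneg ln_ge_zero) (simp_all add: field_simps)
  qed
  have der: "(F has_real_derivative artanh (cos b / cos u)) (at u)" if u: "0 < u" "u < b" for u
  proof -
    have "(F has_real_derivative (- ln (tan ((b + u) / 2)) * ((0 + 1) / 2) - (- ln (tan ((b - u) / 2)) * ((0 - 1) / 2)))) (at u)"
      unfolding F_def
      by (intro DERIV_diff DERIV_chain2[OF DERIV_neg_ln_tan_integral] DERIV_cdivide DERIV_add DERIV_const DERIV_ident)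
        (use u b in auto)
    then show ?thesis
      unfolding key(1)[OF u] by (rule DERIV_cong) (simp add: field_simps)
  qed
  have F: "F b = neg_ln_tan_integral b" "F 0 = 0"
    by (simp_all add: F_def neg_ln_tan_integral_def[of 0])
  have int: "(\<integral>\<^sup>+u. ennreal (artanh (cos b / cos u)) * indicator {0..b} u \<partial>lborel) = ennreal (F b - F 0)"
    by (rule nn_integral_FTC_interior[OF _ cont der key(2)]) (use b in auto)
  show "(\<integral>\<^sup>+u. ennreal (artanh (cos b / cos u)) * indicator {0..b} u \<partial>lborel) = ennreal (neg_ln_tan_integral b)"
    unfolding int F by simp
  have "F 0 \<le> F b"
  proof (rule DERIV_nonneg_imp_increasing_open[OF _ _ cont])
    show "0 \<le> b" using b by simp
    show "\<exists>y. (F has_real_derivative y) (at x) \<and> 0 \<le> y" if "0 < x" "x < b" for x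
      using der[OF that] key(2)[OF that] by blast
  qed
  then show "0 \<le> neg_ln_tan_integral b"
    unfolding F .
qed

section \<open>The volume of the frustum as an edge integral\<close>

text \<open>By Schlaefli's formula, with \<open>\<alpha> = \<pi>/p\<close> and \<open>\<gamma> = \<pi>/r\<close>, the edge carrying the dihedral
  angle \<open>\<alpha>\<close> has length \<open>artanh (tan \<alpha> / tan \<gamma>)\<close>; the volume is its integral over the angle.\<close>

definition edge_length :: "real \<Rightarrow> real \<Rightarrow> real" where
  "edge_length ga t = artanh (tan t / tan ga)"

definition edge_integral :: "real \<Rightarrow> real \<Rightarrow> real" where
  "edge_integral ga al = integral {0..al} (edge_length ga)"

text \<open>The first term is twice the volume at \<open>al = 0\<close>, from which the differential
  - length / 2 of Schlaefli's formula is integrated.\<close>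

definition frustum_volume :: "real \<Rightarrow> real \<Rightarrow> real" where
  "frustum_volume ga al = (neg_ln_tan_integral (pi / 2 - ga) - edge_integral ga al) / 2"

lemma tan_ratio:
  assumes "0 \<le> t" "t < ga" "ga < pi / 2"
  shows "0 \<le> tan t / tan ga" "tan t / tan ga < 1"
proof -
  have "tan t < tan ga" using assms by (intro tan_monotone) auto
  moreover have "tan t \<ge> 0" using assms by (cases "t = 0") (auto intro!: less_imp_le tan_gt_zero)
  ultimately show "0 \<le> tan t / tan ga" "tan t / tan ga < 1" by auto
qed

lemma artanh_nonneg: "0 \<le> x \<Longrightarrow> x < 1 \<Longrightarrow> 0 \<le> artanh (x :: real)"
  unfolding artanh_def by (intro divide_nonneg_nonneg ln_ge_zero) (simp_all add: field_simps)

lemma edge_length_nonneg: "0 \<le> t \<Longrightarrow> t < ga \<Longrightarrow> ga < pi / 2 \<Longrightarrow> 0 \<le> edge_length ga t"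
  unfolding edge_length_def by (intro artanh_nonneg tan_ratio)

lemma isCont_edge_length:
  assumes "0 \<le> t" "t < ga" "ga < pi / 2"
  shows "isCont (edge_length ga) t"
proof -
  have "cos t > 0" using assms by (intro cos_gt_zero_pi) auto
  moreover have "\<bar>tan t / tan ga\<bar> < 1" using tan_ratio[OF assms] by linarith
  moreover have "tan ga \<noteq> 0" using assms tan_gt_zero[of ga] by auto
  ultimately have "(edge_length ga has_real_derivative 1 / (1 - (tan t / tan ga)\<^sup>2) * (inverse ((cos t)\<^sup>2) / tan ga)) (at t)"
    unfolding edge_length_def by (intro DERIV_fun_artanh DERIV_cdivide DERIV_tan) auto
  then show ?thesis by (rule DERIV_isCont)
qed

text \<open>The integral over \<open>u\<close> further below produces the edge length in this
  form.\<close>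

lemma edge_length_eq_arsinh:
  assumes "0 \<le> t" "t < ga" "ga < pi / 2"
  shows "edge_length ga t = arsinh (sin t * cos ga / sqrt ((sin ga)\<^sup>2 - (sin t)\<^sup>2))"
proof -
  have ct: "cos t > 0" using assms by (intro cos_gt_zero_pi) auto
  have sg: "sin ga > 0" using assms by (intro sin_gt_zero) auto
  have cg: "cos ga > 0" using assms by (intro cos_gt_zero) auto
  have "1 - (tan t / tan ga)\<^sup>2 = ((sin ga)\<^sup>2 - (sin t)\<^sup>2) / (cos t * sin ga)\<^sup>2"
  proof -
    have "1 - (tan t / tan ga)\<^sup>2 = ((cos t * sin ga)\<^sup>2 - (sin t * cos ga)\<^sup>2) / (cos t * sin ga)\<^sup>2"
      using ct sg cg by (simp add: tan_def power_divide power_mult_distrib field_simps)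
    also have "(cos t * sin ga)\<^sup>2 - (sin t * cos ga)\<^sup>2 = (sin ga)\<^sup>2 - (sin t)\<^sup>2"
      by (simp add: power_mult_distrib cos_squared_eq algebra_simps)
    finally show ?thesis .
  qed
  then have "sqrt (1 - (tan t / tan ga)\<^sup>2) = sqrt ((sin ga)\<^sup>2 - (sin t)\<^sup>2) / (cos t * sin ga)"
    using ct sg by (simp add: real_sqrt_divide)
  then show ?thesis
    unfolding edge_length_def artanh_eq_arsinh[OF tan_ratio[OF assms]]
    using ct sg cg by (simp add: tan_def field_simps)
qed

text \<open>For fixed \<open>u\<close> the first term is the volume integrand as a function of the
  angle \<open>al\<close>, and the kernel under the integral is minus its derivative at the angle
  \<open>t\<close>. The equation is written as a sum so that no extended nonnegative reals are
  subtracted.\<close>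

lemma nn_integral_frustum_height:
  fixes al ga u :: real
  assumes al: "0 \<le> al" "al < ga" and ga: "ga < pi / 2" and u: "0 \<le> u" "u < pi / 2 - ga"
  shows "ennreal (artanh (sqrt ((sin ga / cos u)\<^sup>2 - (sin al)\<^sup>2) / cos al))
      + (\<integral>\<^sup>+t. ennreal (sin t / sqrt ((sin ga / cos u)\<^sup>2 - (sin t)\<^sup>2)) * indicator {0..al} t \<partial>lborel)
      = ennreal (artanh (sin ga / cos u))"
    and "sqrt ((sin ga / cos u)\<^sup>2 - (sin al)\<^sup>2) / cos al < 1"
proof -
  define S where "S = (sin ga / cos u)\<^sup>2"
  have cu: "cos u > 0" using assms by (intro cos_gt_zero_pi) auto
  have sg: "sin ga > 0" using assms by (intro sin_gt_zero) auto
  have "sin ga < cos u"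
    using cos_monotone_0_pi[of u "pi / 2 - ga"] assms by (simp add: cos_diff)
  then have q: "0 < sin ga / cos u" "sin ga / cos u < 1" using cu sg by auto
  then have S1: "S < 1" unfolding S_def by (simp add: abs_square_less_1)
  have Sg: "(sin t)\<^sup>2 < S" if "0 \<le> t" "t \<le> al" for t
  proof -
    have "0 \<le> sin t" using that assms by (intro sin_ge_zero) auto
    moreover have "sin t < sin ga" using that assms by (intro sin_monotone_2pi) auto
    moreover have "sin ga \<le> sin ga / cos u" using cu sg by (simp add: pos_le_divide_eq mult_left_le)
    ultimately show ?thesis unfolding S_def by (intro power_strict_mono) auto
  qed
  have sqrtS: "sqrt S = sin ga / cos u" unfolding S_def using q(1) by (metis less_imp_le real_sqrt_abs abs_of_pos)
  define F where "F t = - artanh (sqrt (S - (sin t)\<^sup>2) / cos t)" for t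
  have lt1: "sqrt (S - (sin t)\<^sup>2) / cos t < 1" "cos t > 0" if "0 \<le> t" "t \<le> al" for t
  proof -
    show c: "cos t > 0" using that assms by (intro cos_gt_zero_pi) auto
    have "S - (sin t)\<^sup>2 < (cos t)\<^sup>2" using S1 by (simp add: cos_squared_eq)
    then have "sqrt (S - (sin t)\<^sup>2) < cos t" using c by (intro real_less_lsqrt) auto
    then show "sqrt (S - (sin t)\<^sup>2) / cos t < 1" using c by simp
  qed
  then show "sqrt ((sin ga / cos u)\<^sup>2 - (sin al)\<^sup>2) / cos al < 1" using al by (simp add: S_def)
  have "(\<integral>\<^sup>+t. ennreal (sin t / sqrt (S - (sin t)\<^sup>2)) * indicator {0..al} t \<partial>lborel) = ennreal (F al - F 0)"
  proof (rule nn_integral_FTC_closed)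
    fix t assume t: "0 \<le> t" "t \<le> al"
    define r where "r = sqrt (S - (sin t)\<^sup>2)"
    have r: "r > 0" "r * r = S - (sin t)\<^sup>2" using Sg[OF t] by (auto simp: r_def)
    note l = lt1[OF t]
    have dr: "((\<lambda>t. sqrt (S - (sin t)\<^sup>2)) has_real_derivative (0 - 2 * sin t * cos t) * (inverse r / 2)) (at t)"
      unfolding r_def using Sg[OF t] by (auto intro!: derivative_eq_intros)
    have l': "\<bar>sqrt (S - (sin t)\<^sup>2) / cos t\<bar> < 1"
      using l r by (simp add: r_def)
    have "(F has_real_derivative - (1 / (1 - (sqrt (S - (sin t)\<^sup>2) / cos t)\<^sup>2) *
        (((0 - 2 * sin t * cos t) * (inverse r / 2) * cos t - sqrt (S - (sin t)\<^sup>2) * (- sin t)) / (cos t * cos t)))) (at t)"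
      unfolding F_def using l(2)
      by (intro DERIV_minus DERIV_fun_artanh DERIV_divide dr DERIV_cos l') auto
    also have "- (1 / (1 - (sqrt (S - (sin t)\<^sup>2) / cos t)\<^sup>2) *
        (((0 - 2 * sin t * cos t) * (inverse r / 2) * cos t - sqrt (S - (sin t)\<^sup>2) * (- sin t)) / (cos t * cos t))) = sin t / r"
    proof -
      have e: "1 - (r / cos t)\<^sup>2 = (1 - S) / (cos t * cos t)"
      proof -
        have "cos t * cos t - r * r = 1 - S" unfolding r using sin_cos_squared_add[of t] by (simp add: power2_eq_square)
        then show ?thesis using l(2) by (simp add: power_divide power2_eq_square diff_divide_distrib[symmetric] flip: diff_divide_distrib) (simp add: field_simps)
      qed
      have "(0 - 2 * sin t * cos t) * (inverse r / 2) * cos t - r * (- sin t) = - sin t * (cos t * cos t - r * r) / r"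
        using r(1) by (simp add: field_simps)
      also have "cos t * cos t - r * r = 1 - S" unfolding r using sin_cos_squared_add[of t] by (simp add: power2_eq_square)
      finally have n: "(0 - 2 * sin t * cos t) * (inverse r / 2) * cos t - r * (- sin t) = - sin t * (1 - S) / r" .
      show ?thesis unfolding r_def[symmetric] e n using S1 l(2) r(1) by simp
    qed
    finally show "(F has_real_derivative sin t / sqrt (S - (sin t)\<^sup>2)) (at t)" by (simp add: r_def)
    have "0 \<le> sin t" using t assms by (intro sin_ge_zero) auto
    then show "0 \<le> sin t / sqrt (S - (sin t)\<^sup>2)" using Sg[OF t] by simp
  qed (use al in auto)
  moreover have "F al - F 0 = artanh (sin ga / cos u) - artanh (sqrt (S - (sin al)\<^sup>2) / cos al)"
    using sqrtS by (simp add: F_def)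
  moreover have "0 \<le> artanh (sqrt (S - (sin al)\<^sup>2) / cos al)"
    using lt1[of al] Sg[of al] al by (intro artanh_nonneg) auto
  moreover have "0 \<le> F al - F 0"
  proof -
    have "sqrt (S - (sin al)\<^sup>2) / cos al \<le> sin ga / cos u"
    proof -
      have "S - (sin al)\<^sup>2 \<le> S * (cos al)\<^sup>2"
        using S1 mult_right_mono[of S 1 "(sin al)\<^sup>2"] by (simp add: cos_squared_eq algebra_simps)
      then have "sqrt (S - (sin al)\<^sup>2) \<le> sqrt (S * (cos al)\<^sup>2)" by simp
      also have "\<dots> = sin ga / cos u * cos al"
        using lt1(2)[of al] al sqrtS by (simp add: real_sqrt_mult)
      finally show ?thesis using lt1(2)[of al] al by (simp add: pos_divide_le_eq)
    qed
    moreover have "artanh x \<le> artanh y" if "0 \<le> x" "x \<le> y" "y < 1" for x y :: real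
      unfolding artanh_def using that by (intro divide_right_mono ln_mono) (auto intro!: divide_pos_pos frac_le)
    ultimately show ?thesis
      using q lt1[of al] Sg[of al] al sqrtS by (simp add: F_def)
  qed
  ultimately show "ennreal (artanh (sqrt ((sin ga / cos u)\<^sup>2 - (sin al)\<^sup>2) / cos al))
      + (\<integral>\<^sup>+t. ennreal (sin t / sqrt ((sin ga / cos u)\<^sup>2 - (sin t)\<^sup>2)) * indicator {0..al} t \<partial>lborel)
      = ennreal (artanh (sin ga / cos u))"
    unfolding S_def[symmetric] by (simp flip: ennreal_plus)
qed

text \<open>Integrating the same kernel over \<open>u\<close> instead of over the angle yields the
  edge length, which is the core of Schlaefli's formula for this family.\<close>

lemma nn_integral_edge_length:
  assumes t: "0 \<le> t" "t < ga" and ga: "ga < pi / 2"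
  shows "(\<integral>\<^sup>+u. ennreal (sin t / sqrt ((sin ga / cos u)\<^sup>2 - (sin t)\<^sup>2)) * indicator {0..pi / 2 - ga} u \<partial>lborel)
    = ennreal (edge_length ga t)"
proof -
  have sg: "sin ga > 0" using assms by (intro sin_gt_zero) auto
  have st: "0 \<le> sin t" using t ga by (intro sin_ge_zero) auto
  have "sin t < sin ga" using t ga by (intro sin_monotone_2pi) auto
  then have R0: "(sin ga)\<^sup>2 - (sin t)\<^sup>2 > 0" using st by (simp add: power_strict_mono)
  define R where "R = sqrt ((sin ga)\<^sup>2 - (sin t)\<^sup>2)"
  have R: "R > 0" "R\<^sup>2 = (sin ga)\<^sup>2 - (sin t)\<^sup>2" using R0 by (auto simp: R_def)
  define F where "F u = arsinh (sin t * sin u / R)" for u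
  have "(\<integral>\<^sup>+u. ennreal (sin t / sqrt ((sin ga / cos u)\<^sup>2 - (sin t)\<^sup>2)) * indicator {0..pi / 2 - ga} u \<partial>lborel) = ennreal (F (pi / 2 - ga) - F 0)"
  proof (rule nn_integral_FTC_closed)
    fix u assume u: "0 \<le> u" "u \<le> pi / 2 - ga"
    have cu: "cos u > 0" using u assms by (intro cos_gt_zero_pi) auto
    define w where "w = (sin ga)\<^sup>2 - (sin t)\<^sup>2 * (cos u)\<^sup>2"
    have wR: "w = R\<^sup>2 + (sin t * sin u)\<^sup>2" unfolding w_def R by (simp add: cos_squared_eq power_mult_distrib algebra_simps)
    have w: "w > 0" unfolding wR using R(1) by (simp add: add_pos_nonneg)
    have "(F has_real_derivative 1 / sqrt ((sin t * sin u / R)\<^sup>2 + 1) * (sin t * cos u / R)) (at u)"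
      unfolding F_def
      by (rule DERIV_chain2[OF arsinh_real_has_field_derivative]) (use R(1) in \<open>auto intro!: derivative_eq_intros\<close>)
    also have "sqrt ((sin t * sin u / R)\<^sup>2 + 1) = sqrt w / R"
    proof -
      have "(sin t * sin u / R)\<^sup>2 + 1 = w / R\<^sup>2" unfolding wR using R(1) by (simp add: power_divide add_divide_distrib)
      then show ?thesis using R(1) by (simp add: real_sqrt_divide)
    qed
    also have "1 / (sqrt w / R) * (sin t * cos u / R) = sin t / sqrt ((sin ga / cos u)\<^sup>2 - (sin t)\<^sup>2)"
    proof -
      have "(sin ga / cos u)\<^sup>2 - (sin t)\<^sup>2 = w / (cos u)\<^sup>2" using cu by (simp add: w_def power_divide field_simps)
      then have "sqrt ((sin ga / cos u)\<^sup>2 - (sin t)\<^sup>2) = sqrt w / cos u" using cu by (simp add: real_sqrt_divide)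
      then show ?thesis using cu R(1) by simp
    qed
    finally show "(F has_real_derivative sin t / sqrt ((sin ga / cos u)\<^sup>2 - (sin t)\<^sup>2)) (at u)" .
    have "(sin ga / cos u)\<^sup>2 - (sin t)\<^sup>2 = w / (cos u)\<^sup>2" using cu by (simp add: w_def power_divide field_simps)
    then show "0 \<le> sin t / sqrt ((sin ga / cos u)\<^sup>2 - (sin t)\<^sup>2)" using st w by simp
  qed (use assms in auto)
  then show ?thesis
    by (simp add: F_def R_def edge_length_eq_arsinh[OF t ga] sin_diff)
qed

lemma has_integral_edge_length:
  assumes "0 \<le> al" "al < ga" "ga < pi / 2"
  shows "(edge_length ga has_integral edge_integral ga al) {0..al}"
  unfolding edge_integral_def
  by (intro integrable_integral integrable_continuous_real continuous_at_imp_continuous_on ballI isCont_edge_length)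
    (use assms in auto)

lemma edge_integral_nonneg:
  assumes "0 \<le> al" "al < ga" "ga < pi / 2"
  shows "0 \<le> edge_integral ga al"
  by (rule has_integral_nonneg[OF has_integral_edge_length[OF assms]]) (use assms in \<open>auto intro!: edge_length_nonneg\<close>)

text \<open>The kernel is integrated over the rectangle of all \<open>t\<close> and \<open>u\<close>
  in both orders: one gives the change of the volume integrand between the angles 0 and
  \<open>al\<close>, the other the integral of the edge length.\<close>

lemma nn_integral_frustum_volume:
  assumes al: "0 \<le> al" "al < ga" and ga: "ga < pi / 2"
  shows "(\<integral>\<^sup>+u. ennreal (artanh (sqrt ((sin ga / cos u)\<^sup>2 - (sin al)\<^sup>2) / cos al)) * indicator {0..pi / 2 - ga} u \<partial>lborel)
      = ennreal (2 * frustum_volume ga al)"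
    and "0 \<le> frustum_volume ga al"
proof -
  let ?K = "\<lambda>u. artanh (sqrt ((sin ga / cos u)\<^sup>2 - (sin al)\<^sup>2) / cos al)"
  let ?D = "\<lambda>t u. sin t / sqrt ((sin ga / cos u)\<^sup>2 - (sin t)\<^sup>2)"
  let ?I = "indicator {0..pi / 2 - ga} :: real \<Rightarrow> ennreal"
  have [measurable]: "artanh \<in> borel_measurable (borel :: real measure)"
    unfolding artanh_def[abs_def] by measurable
  have "ennreal (neg_ln_tan_integral (pi / 2 - ga)) = (\<integral>\<^sup>+u. ennreal (artanh (cos (pi / 2 - ga) / cos u)) * ?I u \<partial>lborel)"
    using al ga by (intro nn_integral_artanh_cos_ratio(1)[symmetric]) auto
  also have "\<dots> = (\<integral>\<^sup>+u. ennreal (?K u) * ?I u + (\<integral>\<^sup>+t. ennreal (?D t u) * indicator {0..al} t * ?I u \<partial>lborel) \<partial>lborel)"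
  proof (rule nn_integral_cong_AE)
    show "AE u in lborel. ennreal (artanh (cos (pi / 2 - ga) / cos u)) * ?I u
      = ennreal (?K u) * ?I u + (\<integral>\<^sup>+t. ennreal (?D t u) * indicator {0..al} t * ?I u \<partial>lborel)"
      using AE_lborel_singleton[of "pi / 2 - ga"]
    proof eventually_elim
      case (elim u)
      show ?case
      proof (cases "u \<in> {0..pi / 2 - ga}")
        case True
        with elim have "0 \<le> u" "u < pi / 2 - ga" by auto
        from nn_integral_frustum_height(1)[OF al ga this] True show ?thesis by (simp add: cos_diff)
      qed simp
    qed
  qed
  also have "\<dots> = (\<integral>\<^sup>+u. ennreal (?K u) * ?I u \<partial>lborel) + (\<integral>\<^sup>+u. (\<integral>\<^sup>+t. ennreal (?D t u) * indicator {0..al} t * ?I u \<partial>lborel) \<partial>lborel)"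
    by (rule nn_integral_add) measurable
  also have "(\<integral>\<^sup>+u. (\<integral>\<^sup>+t. ennreal (?D t u) * indicator {0..al} t * ?I u \<partial>lborel) \<partial>lborel)
     = (\<integral>\<^sup>+t. (\<integral>\<^sup>+u. ennreal (?D t u) * indicator {0..al} t * ?I u \<partial>lborel) \<partial>lborel)"
    by (rule lborel_pair.Fubini') measurable
  also have "\<dots> = (\<integral>\<^sup>+t. ennreal (edge_length ga t) * indicator {0..al} t \<partial>lborel)"
  proof (rule nn_integral_cong)
    fix t
    show "(\<integral>\<^sup>+u. ennreal (?D t u) * indicator {0..al} t * ?I u \<partial>lborel) = ennreal (edge_length ga t) * indicator {0..al} t"
      using nn_integral_edge_length[of t ga] al ga by (cases "t \<in> {0..al}") auto
  qed
  also have "\<dots> = ennreal (edge_integral ga al)"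
    by (rule nn_integral_has_integral_lebesgue'[OF _ has_integral_edge_length[OF al ga]])
      (use al ga in \<open>auto intro!: edge_length_nonneg\<close>)
  finally have eq: "ennreal (neg_ln_tan_integral (pi / 2 - ga)) = (\<integral>\<^sup>+u. ennreal (?K u) * ?I u \<partial>lborel) + ennreal (edge_integral ga al)" .
  then have le: "ennreal (edge_integral ga al) \<le> ennreal (neg_ln_tan_integral (pi / 2 - ga))" by simp
  have e0: "0 \<le> edge_integral ga al" by (rule edge_integral_nonneg[OF al ga])
  have "(\<integral>\<^sup>+u. ennreal (?K u) * ?I u \<partial>lborel) = ennreal (neg_ln_tan_integral (pi / 2 - ga)) - ennreal (edge_integral ga al)"
    unfolding eq by (simp add: ennreal_add_diff_cancel_right)
  also have "\<dots> = ennreal (2 * frustum_volume ga al)"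
    proof -
    have "2 * frustum_volume ga al = neg_ln_tan_integral (pi / 2 - ga) - edge_integral ga al"
      by (simp add: frustum_volume_def)
    then show ?thesis using e0 by (simp add: ennreal_minus)
  qed
  finally show "(\<integral>\<^sup>+u. ennreal (?K u) * ?I u \<partial>lborel) = ennreal (2 * frustum_volume ga al)" .
  \<comment> \<open>\<open>ennreal\<close> truncates negative numbers to 0, so the inequality would
    also hold if the right side were negative and the edge integral 0.\<close>
  have "edge_integral ga al \<le> neg_ln_tan_integral (pi / 2 - ga) \<or> edge_integral ga al = 0"
    using le e0 by (metis ennreal_le_iff2 order_antisym)
  moreover have "0 \<le> neg_ln_tan_integral (pi / 2 - ga)"
    using al ga by (intro nn_integral_artanh_cos_ratio(2)) auto
  ultimately show "0 \<le> frustum_volume ga al" by (auto simp: frustum_volume_def)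
qed

section \<open>Upper half-space coordinates at the ideal vertex\<close>

lemma lorentz_commute: "lorentz v w = lorentz w v"
  by (simp add: lorentz_def inner_commute)

lemma lorentz_bilinear [simp]:
  "lorentz (u + v) w = lorentz u w + lorentz v w" "lorentz w (u + v) = lorentz w u + lorentz w v"
  "lorentz (u - v) w = lorentz u w - lorentz v w" "lorentz w (u - v) = lorentz w u - lorentz w v"
  "lorentz (r *\<^sub>R v) w = r * lorentz v w" "lorentz w (r *\<^sub>R v) = r * lorentz w v"
  "lorentz (- v) w = - lorentz v w" "lorentz w (- v) = - lorentz w v"
  "lorentz 0 w = 0" "lorentz w 0 = 0"
  by (simp_all add: lorentz_def algebra_simps)

lemma continuous_on_lorentz [continuous_intros]:
  "continuous_on S f \<Longrightarrow> continuous_on S g \<Longrightarrow> continuous_on S (\<lambda>x. lorentz (f x) (g x))"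
  unfolding lorentz_def by (intro continuous_intros)

lemma continuous_on_hom [continuous_intros]: "continuous_on S hom"
  unfolding hom_def[abs_def] by (intro continuous_intros)

definition future :: "hvec \<Rightarrow> bool" where
  "future v \<longleftrightarrow> 0 < fst v \<and> lorentz v v < 0"

definition hnorm :: "real ^ 3 \<Rightarrow> real" where
  "hnorm x = sqrt (1 - (norm x)\<^sup>2)"

lemma lorentz_self: "lorentz v v = (norm (snd v))\<^sup>2 - (fst v)\<^sup>2"
  by (simp add: lorentz_def dot_square_norm power2_eq_square)

lemma future_hom: "x \<in> H3 \<Longrightarrow> future (hom x)"
  by (simp add: future_def hom_def H3_def lorentz_self abs_square_less_1)

lemma hnorm_pos: "x \<in> H3 \<Longrightarrow> 0 < hnorm x"
  by (simp add: hnorm_def H3_def abs_square_less_1)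

lemma lorentz_hom_self: "x \<in> H3 \<Longrightarrow> lorentz (hom x) (hom x) = - (hnorm x)\<^sup>2"
  by (simp add: hnorm_def H3_def lorentz_self hom_def abs_square_le_1 less_imp_le)

lemma lorentz_nonpos_iff: "0 \<le> fst v \<Longrightarrow> lorentz v v \<le> 0 \<longleftrightarrow> norm (snd v) \<le> fst v"
  by (simp add: lorentz_self abs_le_square_iff[symmetric])

lemma lorentz_neg_iff: "0 \<le> fst v \<Longrightarrow> lorentz v v < 0 \<longleftrightarrow> norm (snd v) < fst v"
  by (metis abs_norm_cancel abs_of_nonneg diff_less_0_iff_less lorentz_self power2_less_imp_less power_strict_mono norm_ge_zero zero_less_numeral)

lemma future_lorentz_neg:
  assumes "future v" "0 < fst w" "lorentz w w \<le> 0"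
  shows "lorentz v w < 0"
proof -
  have v: "norm (snd v) < fst v" "0 < fst v" using assms(1) by (auto simp: future_def lorentz_neg_iff)
  have w: "norm (snd w) \<le> fst w" using assms by (simp add: lorentz_nonpos_iff)
  have "snd v \<bullet> snd w \<le> norm (snd v) * norm (snd w)" by (rule norm_cauchy_schwarz)
  also have "\<dots> \<le> norm (snd v) * fst w" using w by (intro mult_left_mono) auto
  also have "\<dots> < fst v * fst w" using v assms(2) by (intro mult_strict_right_mono) auto
  finally show ?thesis by (simp add: lorentz_def)
qed

lemma causal_future:
  assumes "lorentz v v \<le> 0" "lorentz v w < 0" "0 < fst w" "lorentz w w \<le> 0"
  shows "0 < fst v"
proof (rule ccontr)
  assume "\<not> 0 < fst v"
  then have "norm (snd (- v)) \<le> fst (- v)" using assms(1) lorentz_nonpos_iff[of "- v"] by simp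
  moreover have "norm (snd w) \<le> fst w" using assms by (simp add: lorentz_nonpos_iff)
  ultimately have "norm (snd v) * norm (snd w) \<le> - fst v * fst w"
    using assms(3) \<open>\<not> 0 < fst v\<close> by (intro mult_mono) auto
  moreover have "- (snd v \<bullet> snd w) \<le> norm (snd v) * norm (snd w)"
    using norm_cauchy_schwarz[of "- snd v" "snd w"] by simp
  ultimately show False using assms(2) by (simp add: lorentz_def)
qed

lemma chart_scale [simp]: "r \<noteq> 0 \<Longrightarrow> chart (r *\<^sub>R v) = chart v"
  by (simp add: chart_def)

lemma hom_chart: "fst v \<noteq> 0 \<Longrightarrow> hom (chart v) = (1 / fst v) *\<^sub>R v"
  by (simp add: hom_def chart_def prod_eq_iff divide_inverse)

lemma chart_hom [simp]: "chart (hom x) = x"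
  by (simp add: hom_def chart_def)

lemma chart_in_H3: "fst v \<noteq> 0 \<Longrightarrow> chart v \<in> H3 \<longleftrightarrow> lorentz v v < 0"
proof -
  assume v: "fst v \<noteq> 0"
  have "chart v \<in> H3 \<longleftrightarrow> (norm (snd v /\<^sub>R fst v))\<^sup>2 < 1" 
    by (simp add: H3_def chart_def abs_square_less_1)
  also have "\<dots> \<longleftrightarrow> (norm (snd v))\<^sup>2 < (fst v)\<^sup>2"
    using v by (simp add: power_mult_distrib power_inverse field_simps)
  finally show ?thesis by (simp add: lorentz_self)
qed

lemma hnorm_chart: "future v \<Longrightarrow> hnorm (chart v) = sqrt (- lorentz v v) / fst v"
proof -
  assume v: "future v"
  then have "chart v \<in> H3" by (simp add: chart_in_H3 future_def)
  then have "(hnorm (chart v))\<^sup>2 = - lorentz v v / (fst v)\<^sup>2"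
    using lorentz_hom_self[of "chart v"] v by (simp add: hom_chart future_def power2_eq_square)
  then show ?thesis using v hnorm_pos[OF \<open>chart v \<in> H3\<close>]
    by (metis abs_of_pos future_def real_sqrt_abs real_sqrt_divide)
qed

text \<open>The component \<open>p\<close> of \<open>v\<close> orthogonal to the time-like vector
  \<open>w\<close> cannot be time-like; \<open>0 \<le> lorentz p p\<close> is the
  inequality.\<close>

lemma reverse_cauchy_schwarz:
  assumes "future v" "future w"
  shows "lorentz v v * lorentz w w \<le> (lorentz v w)\<^sup>2"
proof -
  define r where "r = - lorentz v w / lorentz w w"
  have w: "lorentz w w < 0" using assms by (simp add: future_def)
  define p where "p = v + r *\<^sub>R w"
  have pw: "lorentz p w = 0" using w by (simp add: p_def r_def)
  have "0 \<le> lorentz p p"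
  proof (rule ccontr)
    assume n: "\<not> 0 \<le> lorentz p p"
    then have "fst p \<noteq> 0" by (auto simp: lorentz_self not_le)
    then consider "future p" | "future (- p)" using n by (fastforce simp: future_def)
    then show False
      using future_lorentz_neg[of p w] future_lorentz_neg[of "- p" w] assms(2) pw
      by cases (auto simp: future_def)
  qed
  also have "lorentz p p = lorentz v v - (lorentz v w)\<^sup>2 / lorentz w w"
    using w by (simp add: p_def r_def lorentz_commute[of w v] power2_eq_square field_simps)
  finally show ?thesis using w by (simp add: field_simps)
qed

section \<open>Distances to planes and Busemann functions in the linear model\<close>

lemma hdist_eq:
  assumes "x \<in> H3" "y \<in> H3"
  shows "hdist x y = arcosh (- lorentz (hom x) (hom y) / (hnorm x * hnorm y))"
  by (simp add: hdist_def hnorm_def lorentz_def hom_def)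

text \<open>\<open>p = v - s *\<^sub>R n\<close> represents the foot of the perpendicular. Vectors
  \<open>w\<close> of the plane are orthogonal to \<open>n\<close>, so
  \<open>lorentz v w = lorentz p w\<close>, and the reverse Cauchy-Schwarz inequality shows that no
  point of the plane is nearer than the foot.\<close>

lemma hdist_set_polar_plane:
  assumes n: "lorentz n n = 1" and x: "x \<in> H3"
  shows "hdist_set x (polar_plane n) = arsinh (\<bar>lorentz (hom x) n\<bar> / hnorm x)"
proof -
  define s where "s = lorentz (hom x) n / hnorm x"
  define v where "v = (1 / hnorm x) *\<^sub>R hom x"
  have N: "hnorm x > 0" by (rule hnorm_pos[OF x])
  have vv: "lorentz v v = - 1" using N by (simp add: v_def lorentz_hom_self[OF x] power2_eq_square)
  have "0 < fst v" using future_hom[OF x] N by (simp add: future_def v_def)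
  then have fv: "future v" using vv by (simp add: future_def)
  define p where "p = v - s *\<^sub>R n"
  have vn: "lorentz v n = s" by (simp add: v_def s_def)
  have pp: "lorentz p p = - (1 + s\<^sup>2)"
    by (simp add: p_def vv vn lorentz_commute[of n v] n power2_eq_square)
  have pn: "lorentz p n = 0" by (simp add: p_def vn n)
  have pv: "lorentz p v = - (1 + s\<^sup>2)"
    by (simp add: p_def vv vn lorentz_commute[of n v] power2_eq_square)
  have s0: "1 + s\<^sup>2 > 0" by (simp add: add_pos_nonneg)
  have fp: "future p"
    using causal_future[of p v] fv s0 pp pv by (simp add: future_def)
  have arc: "arcosh (sqrt (1 + s\<^sup>2)) = arsinh \<bar>s\<bar>"
    by (simp add: arcosh_real_def arsinh_real_def add.commute)
  have hx: "hom x = hnorm x *\<^sub>R v" using N by (simp add: v_def)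
  show ?thesis
    unfolding hdist_set_def
  proof (rule cInf_eq_minimum)
    define y where "y = chart p"
    have y: "y \<in> H3" using fp by (simp add: y_def chart_in_H3 future_def)
    have hy: "hom y = (1 / fst p) *\<^sub>R p" using fp by (simp add: y_def hom_chart future_def)
    have "y \<in> polar_plane n" using y by (simp add: polar_plane_def hy pn)
    moreover have "hdist x y = arsinh (\<bar>lorentz (hom x) n\<bar> / hnorm x)"
    proof -
      have Ny: "hnorm y = sqrt (1 + s\<^sup>2) / fst p" using hnorm_chart[OF fp] by (simp add: y_def pp)
      have vp: "lorentz v p = - (1 + s\<^sup>2)" using pv by (simp add: lorentz_commute)
      have "- lorentz (hom x) (hom y) / (hnorm x * hnorm y) = - lorentz v p / sqrt (1 + s\<^sup>2)"
        unfolding hx hy Ny using N fp by (simp add: future_def)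
      also have "\<dots> = (1 + s\<^sup>2) / sqrt (1 + s\<^sup>2)" unfolding vp by simp
      also have "\<dots> = sqrt (1 + s\<^sup>2)" using s0 by (simp add: real_div_sqrt)
      finally show ?thesis using arc N by (simp add: hdist_eq[OF x y] s_def)
    qed
    ultimately show "arsinh (\<bar>lorentz (hom x) n\<bar> / hnorm x) \<in> hdist x ` polar_plane n" by (metis image_eqI)
  next
    fix d assume "d \<in> hdist x ` polar_plane n"
    then obtain y where y: "y \<in> H3" "lorentz (hom y) n = 0" and d: "d = hdist x y"
      by (auto simp: polar_plane_def)
    have Ny: "hnorm y > 0" by (rule hnorm_pos[OF y(1)])
    define w where "w = (1 / hnorm y) *\<^sub>R hom y"
    have ww: "lorentz w w = - 1" using Ny by (simp add: w_def lorentz_hom_self[OF y(1)] power2_eq_square)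
    have "0 < fst w" using future_hom[OF y(1)] Ny by (simp add: future_def w_def)
    then have fw: "future w" using ww by (simp add: future_def)
    have "lorentz p w = lorentz v w" by (simp add: p_def w_def y lorentz_commute[of n])
    then have "1 + s\<^sup>2 \<le> (lorentz v w)\<^sup>2" using reverse_cauchy_schwarz[OF fp fw] by (simp add: pp ww)
    moreover have "lorentz v w < 0" using future_lorentz_neg[OF fv, of w] fw by (simp add: future_def)
    ultimately have "sqrt (1 + s\<^sup>2) \<le> - lorentz v w"
      by (metis abs_of_neg real_sqrt_abs real_sqrt_le_mono)
    moreover have "1 \<le> sqrt (1 + s\<^sup>2)" by simp
    ultimately have "arcosh (sqrt (1 + s\<^sup>2)) \<le> arcosh (- lorentz v w)"
      by (metis arcosh_real_strict_mono less_eq_real_def)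
    moreover have "- lorentz (hom x) (hom y) / (hnorm x * hnorm y) = - lorentz v w"
      using N Ny by (simp add: v_def w_def)
    ultimately show "arsinh (\<bar>lorentz (hom x) n\<bar> / hnorm x) \<le> d"
      using arc N by (simp add: d hdist_eq[OF x y(1)] s_def)
  qed
qed

text \<open>Each distance is a logarithm from which \<open>ln (r s)\<close> splits off. This term
  diverges as \<open>s\<close> tends to 1 but is the same in both distances, so it cancels before
  the limit is taken.\<close>

lemma busemann_eq:
  assumes a: "norm a = 1" and x: "x \<in> H3"
  shows "busemann a x = ln ((1 - x \<bullet> a) / hnorm x)"
proof -
  have N: "hnorm x > 0" by (rule hnorm_pos[OF x])
  have nx: "norm x < 1" using x by (simp add: H3_def)
  have xa: "x \<bullet> a < 1" using norm_cauchy_schwarz[of x a] a nx by simp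
  have xa': "\<bar>x \<bullet> a\<bar> < 1" using Cauchy_Schwarz_ineq2[of x a] a nx by simp
  define r where "r s = sqrt (1 - s\<^sup>2)" for s :: real
  define P where "P s = (1 - s * (x \<bullet> a)) / hnorm x" for s
  have dist: "hdist x (s *\<^sub>R a) - hdist 0 (s *\<^sub>R a)
     = ln ((P s + sqrt ((P s)\<^sup>2 - (r s)\<^sup>2)) / (1 + s))" if s: "0 < s" "s < 1" for s
  proof -
    have s2: "s\<^sup>2 < 1" using s by (simp add: abs_square_less_1)
    have rs: "r s > 0" "(r s)\<^sup>2 = 1 - s\<^sup>2" using s2 by (auto simp: r_def)
    have inH: "s *\<^sub>R a \<in> H3" "0 \<in> H3" using s a by (auto simp: H3_def)
    have hs: "hnorm (s *\<^sub>R a) = r s" using a s by (simp add: hnorm_def r_def)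
    have "s * (x \<bullet> a) \<le> s * \<bar>x \<bullet> a\<bar>" using s by (intro mult_left_mono) auto
    also have "\<dots> < 1" using s xa' mult_strict_mono[of s 1 "\<bar>x \<bullet> a\<bar>" 1] by simp
    finally have P0: "P s > 0" using N by (simp add: P_def)
    have l: "lorentz (hom x) (hom (s *\<^sub>R a)) = - (hnorm x * P s)"
      using N by (simp add: lorentz_def hom_def P_def)
    have "(r s)\<^sup>2 * (hnorm x)\<^sup>2 \<le> (hnorm x * P s)\<^sup>2"
      using reverse_cauchy_schwarz[OF future_hom[OF x] future_hom[OF inH(1)]]
      by (simp add: lorentz_hom_self[OF x] lorentz_hom_self[OF inH(1)] hs l mult.commute)
    then have rP: "(r s)\<^sup>2 \<le> (P s)\<^sup>2" using N by (simp add: power_mult_distrib mult.commute)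
    then have rP': "r s \<le> P s" using P0 by (intro power2_le_imp_le[OF rP]) simp
    have Q: "P s + sqrt ((P s)\<^sup>2 - (r s)\<^sup>2) > 0" using P0 rP by (intro add_pos_nonneg) auto
    have "hdist x (s *\<^sub>R a) = arcosh (P s / r s)"
      using N by (simp add: hdist_eq[OF x inH(1)] l hs)
    also have "\<dots> = ln (P s / r s + sqrt ((P s / r s)\<^sup>2 - 1))"
      using rP' rs by (intro arcosh_real_def) simp
    also have "(P s / r s)\<^sup>2 - 1 = ((P s)\<^sup>2 - (r s)\<^sup>2) / (r s)\<^sup>2" using rs(1) by (simp add: power_divide diff_divide_distrib)
    also have "sqrt \<dots> = sqrt ((P s)\<^sup>2 - (r s)\<^sup>2) / r s" using rs(1) by (simp add: real_sqrt_divide)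
    also have "P s / r s + \<dots> = (P s + sqrt ((P s)\<^sup>2 - (r s)\<^sup>2)) / r s" by (simp add: add_divide_distrib)
    finally have d1: "hdist x (s *\<^sub>R a) = ln (P s + sqrt ((P s)\<^sup>2 - (r s)\<^sup>2)) - ln (r s)"
      by (simp only: ln_divide_pos[OF Q rs(1)])
    have "hdist 0 (s *\<^sub>R a) = arcosh (1 / r s)" using a s by (simp add: hdist_def r_def)
    also have "\<dots> = ln (1 / r s + sqrt ((1 / r s)\<^sup>2 - 1))"
      using rs by (intro arcosh_real_def) (simp add: r_def)
    also have "(1 / r s)\<^sup>2 - 1 = s\<^sup>2 / (r s)\<^sup>2" using rs by (simp add: power_divide field_simps)
    also have "sqrt \<dots> = s / r s" using rs(1) s by (simp add: real_sqrt_divide)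
    also have "1 / r s + s / r s = (1 + s) / r s" by (simp add: add_divide_distrib)
    finally have d2: "hdist 0 (s *\<^sub>R a) = ln (1 + s) - ln (r s)" using s rs(1) by (simp add: ln_div)
    show ?thesis unfolding d1 d2 using ln_divide_pos[OF Q, of "1 + s"] s by linarith
  qed
  have P1: "P 1 > 0" using xa N by (simp add: P_def)
  have r1: "r 1 = 0" by (simp add: r_def)
  have "((\<lambda>s. (P s + sqrt ((P s)\<^sup>2 - (r s)\<^sup>2)) / (1 + s)) \<longlongrightarrow> (P 1 + sqrt ((P 1)\<^sup>2 - (r 1)\<^sup>2)) / (1 + 1)) (at_left 1)"
    unfolding P_def r_def using N by (intro tendsto_intros) auto
  moreover have "(P 1 + sqrt ((P 1)\<^sup>2 - (r 1)\<^sup>2)) / (1 + 1) = P 1" using P1 r1 by simp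
  ultimately have "((\<lambda>s. ln ((P s + sqrt ((P s)\<^sup>2 - (r s)\<^sup>2)) / (1 + s))) \<longlongrightarrow> ln (P 1)) (at_left 1)"
    using P1 by (intro tendsto_ln) simp_all
  moreover have "\<forall>\<^sub>F s in at_left (1::real). ln ((P s + sqrt ((P s)\<^sup>2 - (r s)\<^sup>2)) / (1 + s)) = hdist x (s *\<^sub>R a) - hdist 0 (s *\<^sub>R a)"
    using eventually_at_left_real[of 0 "1::real"] by (auto elim!: eventually_mono simp: dist)
  ultimately have "((\<lambda>s. hdist x (s *\<^sub>R a) - hdist 0 (s *\<^sub>R a)) \<longlongrightarrow> ln (P 1)) (at_left 1)"
    by (rule Lim_transform_eventually)
  then have "busemann a x = ln (P 1)"
    unfolding busemann_def by (intro tendsto_Lim) auto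
  then show ?thesis by (simp add: P_def)
qed

lemma frame_map_surj:
  assumes d: "det (gram4 b0 b1 b2 b3) \<noteq> 0"
  obtains w where "v = frame_map b0 b1 b2 b3 w"
proof -
  define b where "b = (vector [b0, b1, b2, b3] :: hvec ^ 4)"
  define M :: "real ^ 4 ^ 4" where "M = (\<chi> i j. vec4 (b $ j) $ i)"
  define J :: "real ^ 4 ^ 4" where "J = (\<chi> i j. if i = j then (if i = 1 then -1 else 1) else 0)"
  have "transpose M ** J ** M = gram4 b0 b1 b2 b3"
    by (simp add: gram4_def Let_def b_def[symmetric] vec_eq_iff matrix_matrix_mult_def transpose_def
        M_def J_def lorentz_vec4 sum_4)
  then have "det M \<noteq> 0" using d by (metis det_mul mult_zero_right)
  then obtain N where N: "M ** N = mat 1" by (auto simp: invertible_det_nz[symmetric] invertible_def)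
  define z where "z = N *v vec4 v"
  have "vec4 (frame_map b0 b1 b2 b3 (z $ 1, z $ 2, z $ 3, z $ 4)) = M *v z"
    by (simp add: vec_eq_iff forall_4 matrix_vector_mult_def sum_4 M_def b_def vec4_def frame_map_def)
  also have "\<dots> = vec4 v" by (simp only: z_def matrix_vector_mul_assoc N matrix_vector_mul_lid)
  finally have "frame_map b0 b1 b2 b3 (z $ 1, z $ 2, z $ 3, z $ 4) = v"
    by (auto simp: vec4_def vec_eq_iff forall_4 forall_3 prod_eq_iff)
  then show ?thesis using that by metis
qed

section \<open>Signs of the Lorentz form on convex hulls and their relative interiors\<close>

lemma lorentz_hom_affine: "lorentz (hom x) n = snd n \<bullet> x - fst n"
  by (simp add: lorentz_def hom_def inner_commute)

lemma hull_lorentz_nonneg: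
  assumes V: "\<And>v. v \<in> V \<Longrightarrow> 0 < fst v \<and> 0 \<le> lorentz v n" and x: "x \<in> convex hull (chart ` V)"
  shows "0 \<le> lorentz (hom x) n"
proof -
  have "convex {x. 0 \<le> lorentz (hom x) n}"
    using convex_halfspace_ge[of "fst n" "snd n"] by (simp add: lorentz_hom_affine)
  moreover have "chart ` V \<subseteq> {x. 0 \<le> lorentz (hom x) n}"
  proof (rule image_subsetI)
    fix v assume "v \<in> V"
    from V[OF this] show "chart v \<in> {x. 0 \<le> lorentz (hom x) n}" by (simp add: hom_chart)
  qed
  ultimately show ?thesis using x hull_minimal[of "chart ` V" _ convex] by blast
qed

lemma hull_lorentz_zero:
  assumes V: "\<And>v. v \<in> V \<Longrightarrow> 0 < fst v \<and> lorentz v n = 0" and x: "x \<in> convex hull (chart ` V)"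
  shows "lorentz (hom x) n = 0"
  using hull_lorentz_nonneg[of V n x] hull_lorentz_nonneg[of V "- n" x] assms by force

text \<open>From a relative interior point one can move a little further away from the vertex
  \<open>v\<close> inside the hull; if the affine function vanished at the point, it would become
  negative there.\<close>

lemma rel_interior_lorentz_pos:
  assumes V: "\<And>v. v \<in> V \<Longrightarrow> 0 < fst v \<and> 0 \<le> lorentz v n" and x: "x \<in> rel_interior (convex hull (chart ` V))"
    and v: "v \<in> V" "0 < lorentz v n"
  shows "0 < lorentz (hom x) n"
proof -
  have xh: "x \<in> convex hull (chart ` V)" using x rel_interior_subset by blast
  have vh: "chart v \<in> convex hull (chart ` V)" using v by (simp add: hull_inc)
  have pos: "0 < lorentz (hom (chart v)) n" using V[OF v(1)] v by (simp add: hom_chart)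
  obtain e where e: "e > 1" "(1 - e) *\<^sub>R chart v + e *\<^sub>R x \<in> convex hull (chart ` V)"
    using x vh convex_rel_interior_iff[OF convex_convex_hull] by (metis empty_iff)
  have "0 \<le> lorentz (hom ((1 - e) *\<^sub>R chart v + e *\<^sub>R x)) n"
    by (rule hull_lorentz_nonneg[OF V e(2)])
  also have "\<dots> = e * lorentz (hom x) n - (e - 1) * lorentz (hom (chart v)) n"
    by (simp add: lorentz_hom_affine inner_add_right algebra_simps)
  finally have "(e - 1) * lorentz (hom (chart v)) n \<le> e * lorentz (hom x) n" by simp
  moreover have "0 < (e - 1) * lorentz (hom (chart v)) n" using e pos by simp
  ultimately have "0 < e * lorentz (hom x) n" by linarith
  then show ?thesis using e by (simp add: zero_less_mult_iff)
qed

text \<open>Every vertex lies in the closure of the relative interior. Thus the packing conditions,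
  stated for relative interiors, give information at the vertices.\<close>

lemma open_meets_rel_interior_hull:
  fixes V :: "'a::euclidean_space set"
  assumes "open U" "x \<in> U" "x \<in> V"
  shows "U \<inter> rel_interior (convex hull V) \<noteq> {}"
proof -
  have "x \<in> closure (rel_interior (convex hull V))"
  proof -
    have "closure (rel_interior (convex hull V)) = closure (convex hull V)"
      by (rule convex_closure_rel_interior) simp
    moreover have "x \<in> convex hull V" by (rule hull_inc[OF assms(3)])
    ultimately show ?thesis using closure_subset[of "convex hull V"] by blast
  qed
  then show ?thesis using open_Int_closure_eq_empty[OF assms(1), of "rel_interior (convex hull V)"] assms(2) by blast
qed

text \<open>The vectors \<open>g3\<close> (the ideal vertex \<open>A 0\<close>) and \<open>g0\<close> are null, \<open>g1\<close> and \<open>g2\<close> are space-like. With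
  \<open>A 0\<close> at infinity the point of upper half-space given by \<open>v\<close> has horizontal coordinates
  \<open>cx v / ca v\<close> and \<open>cy v / ca v\<close>, and \<open>cw v / ca v\<close> is the squared distance from the origin. The
  parameters stand for \<open>s = sin (\<pi>/p)\<close>, \<open>c = cos (\<pi>/p)\<close>, \<open>T = tan (\<pi>/r)\<close>, and \<open>b1\<close>, \<open>b2\<close>, \<open>b3\<close>
  below are the remaining vertices.\<close>

locale null_frame =
  fixes s c T :: real and g0 g1 g2 g3 :: hvec
  assumes s: "0 < s" and c: "0 < c" and sc: "s\<^sup>2 + c\<^sup>2 = 1" and T: "0 < T" and scT: "s < c * T"
    and gram: "lorentz g0 g0 = 0" "lorentz g3 g3 = 0" "lorentz g0 g3 = - 1 / 2"
      "lorentz g1 g1 = 1" "lorentz g2 g2 = 1" "lorentz g1 g2 = 0"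
      "lorentz g0 g1 = 0" "lorentz g0 g2 = 0" "lorentz g3 g1 = 0" "lorentz g3 g2 = 0"
    and fut: "0 < fst g3"
begin

lemma gram' [simp]: "lorentz g0 g0 = 0" "lorentz g3 g3 = 0" "lorentz g0 g3 = - 1 / 2" "lorentz g3 g0 = - 1 / 2"
  "lorentz g1 g1 = 1" "lorentz g2 g2 = 1" "lorentz g1 g2 = 0" "lorentz g2 g1 = 0"
  "lorentz g0 g1 = 0" "lorentz g1 g0 = 0" "lorentz g0 g2 = 0" "lorentz g2 g0 = 0"
  "lorentz g3 g1 = 0" "lorentz g1 g3 = 0" "lorentz g3 g2 = 0" "lorentz g2 g3 = 0"
  using gram by (simp_all add: lorentz_commute)

lemma det_gram: "det (gram4 g0 g1 g2 g3) = - 1 / 4"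
  by (simp add: det_4 gram4_def Let_def)

definition "ca v = - 2 * lorentz v g3"
definition "cx v = lorentz v g1"
definition "cy v = lorentz v g2"
definition "cw v = - 2 * lorentz v g0"

definition mk :: "real \<Rightarrow> real \<Rightarrow> real \<Rightarrow> real \<Rightarrow> hvec" where
  "mk a x y w = a *\<^sub>R g0 + x *\<^sub>R g1 + y *\<^sub>R g2 + w *\<^sub>R g3"

lemma coord_mk [simp]: "ca (mk a x y w) = a" "cx (mk a x y w) = x" "cy (mk a x y w) = y" "cw (mk a x y w) = w"
  by (simp_all add: ca_def cx_def cy_def cw_def mk_def)

lemma coord_scale [simp]: "ca (r *\<^sub>R v) = r * ca v" "cx (r *\<^sub>R v) = r * cx v" "cy (r *\<^sub>R v) = r * cy v" "cw (r *\<^sub>R v) = r * cw v"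
  by (simp_all add: ca_def cx_def cy_def cw_def)

lemma mk_coord: "mk (ca v) (cx v) (cy v) (cw v) = v"
proof -
  have "det (gram4 g0 g1 g2 g3) \<noteq> 0" by (simp add: det_gram)
  then obtain w where "v = frame_map g0 g1 g2 g3 w" by (rule frame_map_surj)
  then have "v = mk (fst w) (fst (snd w)) (fst (snd (snd w))) (snd (snd (snd w)))"
    by (simp add: frame_map_def mk_def)
  then show ?thesis by simp
qed

lemma lorentz_mk: "lorentz (mk a x y w) (mk a' x' y' w') = x * x' + y * y' - (a * w' + w * a') / 2"
  by (simp add: mk_def algebra_simps)

lemma lorentz_coord: "lorentz v w = cx v * cx w + cy v * cy w - (ca v * cw w + cw v * ca w) / 2"
  using lorentz_mk[of "ca v" "cx v" "cy v" "cw v" "ca w" "cx w" "cy w" "cw w"] by (simp add: mk_coord)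

lemma future_ca: "future v \<Longrightarrow> 0 < ca v"
  using future_lorentz_neg[of v g3] fut by (simp add: ca_def)

lemma ca_future: "lorentz v v < 0 \<Longrightarrow> 0 < ca v \<Longrightarrow> future v"
  using causal_future[of v g3] fut by (simp add: ca_def future_def)

definition "rho = sqrt ((c * T)\<^sup>2 - s\<^sup>2)"

lemma rho: "0 < rho" "rho\<^sup>2 = (c * T)\<^sup>2 - s\<^sup>2"
proof -
  have "s\<^sup>2 < (c * T)\<^sup>2" using s scT by (intro power_strict_mono) auto
  then show "0 < rho" "rho\<^sup>2 = (c * T)\<^sup>2 - s\<^sup>2" by (auto simp: rho_def)
qed

text \<open>All three have \<open>cw = ca\<close>: they lie on the face plane opposite
  \<open>A 0\<close>, which is the unit hemisphere. Their horizontal coordinates (0, 0), (c, 0), (c,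
  c T) are the corners of the right triangle cut out by the vertical faces; \<open>b3\<close> is
  outer because (c, c T) lies outside the unit disc.\<close>

definition "b1 = mk 1 0 0 1"
definition "b2 = mk 1 c 0 1"
definition "b3 = mk 1 c (c * T) 1"

lemma lorentz_b3: "lorentz v b3 = c * cx v + c * T * cy v - (ca v + cw v) / 2"
  by (simp add: lorentz_coord b3_def algebra_simps)

lemma lorentz_b3_b3: "lorentz b3 b3 = rho\<^sup>2"
  unfolding b3_def lorentz_mk rho(2) using sc by (simp add: power2_eq_square algebra_simps)

text \<open>\<open>sd\<close> is the hyperbolic sine of the signed distance to the polar plane of \<open>b3\<close>.\<close>

definition height :: "real ^ 3 \<Rightarrow> real" where "height x = hnorm x / ca (hom x)"
definition sd :: "real ^ 3 \<Rightarrow> real" where "sd x = - lorentz (hom x) b3 / (rho * hnorm x)"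

lemma height_chart: "future v \<Longrightarrow> height (chart v) = sqrt (- lorentz v v) / ca v"
  by (simp add: height_def hnorm_chart hom_chart future_def)

lemma sd_chart: "future v \<Longrightarrow> sd (chart v) = - lorentz v b3 / (rho * sqrt (- lorentz v v))"
  by (simp add: sd_def hnorm_chart hom_chart future_def)

lemma H3_chartE:
  assumes "x \<in> H3"
  obtains y z w where "x = chart (mk 1 y z w)" "future (mk 1 y z w)" "hom x = ca (hom x) *\<^sub>R mk 1 y z w" "0 < ca (hom x)"
proof -
  let ?v = "hom x"
  have a: "0 < ca ?v" using future_ca future_hom assms by blast
  define u where "u = (1 / ca ?v) *\<^sub>R ?v"
  have eq: "u = mk 1 (cx u) (cy u) (cw u)" using a mk_coord[of u] by (simp add: u_def)
  have vu: "?v = ca ?v *\<^sub>R u" using a by (simp add: u_def)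
  have "chart u = x" using a by (simp add: u_def)
  moreover have "future u"
    using future_hom[OF assms] a by (simp add: u_def future_def)
      (simp add: mult_pos_neg divide_neg_pos)
  ultimately show ?thesis using that[of "cx u" "cy u" "cw u"] eq a vu by metis
qed

lemma continuous_height: "continuous_on H3 height"
  unfolding height_def[abs_def] hnorm_def ca_def
  by (intro continuous_intros) (use future_ca future_hom in \<open>fastforce simp: ca_def\<close>)

lemma continuous_sd: "continuous_on H3 sd"
  unfolding sd_def[abs_def] hnorm_def
  by (intro continuous_intros) (use rho hnorm_pos in \<open>fastforce simp: hnorm_def\<close>)

lemma open_H3 [simp]: "open H3" by (simp add: H3_def)

lemma open_height: "open {x \<in> H3. z < height x}"
  using continuous_open_preimage[OF continuous_height open_H3 open_greaterThan[of z]]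
  by (simp add: vimage_def Int_def)

lemma open_sd: "open {x \<in> H3. 0 < sd x \<and> sd x < r}"
  using continuous_open_preimage[OF continuous_sd open_H3 open_greaterThanLessThan[of 0 r]]
  by (simp add: vimage_def Int_def)

lemma future_mk: "0 < w - x\<^sup>2 - y\<^sup>2 \<Longrightarrow> future (mk 1 x y w)"
  by (intro ca_future) (simp_all add: lorentz_mk power2_eq_square)

lemma future_mk_iff: "future (mk 1 x y w) \<longleftrightarrow> 0 < w - x\<^sup>2 - y\<^sup>2"
  using future_mk[of w x y] by (auto simp: future_def lorentz_mk power2_eq_square)

lemma future_b1: "future b1" unfolding b1_def by (intro future_mk) simp
lemma future_b2: "future b2" 
proof -
  have "c\<^sup>2 < 1" using sc zero_less_power[OF s, of 2] by linarith
  then show ?thesis unfolding b2_def by (intro future_mk) simp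
qed

lemma height_mk: "future (mk 1 x y w) \<Longrightarrow> height (chart (mk 1 x y w)) = sqrt (w - x\<^sup>2 - y\<^sup>2)"
  by (simp add: height_chart lorentz_mk power2_eq_square algebra_simps)

lemma sd_mk: "future (mk 1 x y w) \<Longrightarrow>
    sd (chart (mk 1 x y w)) = ((w + 1) / 2 - c * x - c * T * y) / (rho * sqrt (w - x\<^sup>2 - y\<^sup>2))"
  by (simp add: sd_chart lorentz_b3 lorentz_mk power2_eq_square algebra_simps)

text \<open>Upper half-space form of \<open>sd\<close>: the base plane is the hemisphere of radius \<open>rho\<close> centred at
  \<open>(c, c T)\<close>.\<close>

lemma sd_mk': 
  assumes f: "future (mk 1 x y w)" and z: "z = sqrt (w - x\<^sup>2 - y\<^sup>2)"
  shows "sd (chart (mk 1 x y w)) = ((x - c)\<^sup>2 + (y - c * T)\<^sup>2 + z\<^sup>2 - rho\<^sup>2) / (2 * rho * z)"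
proof -
  have w: "w = z\<^sup>2 + x\<^sup>2 + y\<^sup>2" using f by (simp add: z future_mk_iff)
  have s2: "s\<^sup>2 = 1 - c\<^sup>2" using sc by linarith
  have "(w + 1) / 2 - c * x - c * T * y = ((x - c)\<^sup>2 + (y - c * T)\<^sup>2 + z\<^sup>2 - rho\<^sup>2) / 2"
    unfolding w rho(2) s2 by (simp add: power2_eq_square field_simps)
  then show ?thesis unfolding sd_mk[OF f] z[symmetric] by (simp only: divide_divide_eq_left mult.assoc)
qed

end

text \<open>The vertices are given up to scalars. All scalars may be negative at once, but mixed
  signs are excluded: they would select another of the eight tetrahedra with these vertices.\<close>

locale orthoscheme_frame = null_frame +
  fixes A :: "nat \<Rightarrow> hvec" and lam :: "nat \<Rightarrow> real"
  assumes A: "A 0 = lam 0 *\<^sub>R g3" "A 1 = lam 1 *\<^sub>R b1" "A 2 = lam 2 *\<^sub>R b2" "A 3 = lam 3 *\<^sub>R b3"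
    and lam: "\<And>i. i < 4 \<Longrightarrow> 0 < lam i * lam 0"
begin

lemma lam_neq: "lam 0 \<noteq> 0" "lam 1 \<noteq> 0" "lam (Suc 0) \<noteq> 0" "lam 2 \<noteq> 0" "lam 3 \<noteq> 0"
  using lam[of 0] lam[of 1] lam[of 2] lam[of 3] by auto

lemma chart_A: "chart (A 0) = chart g3" "chart (A 1) = chart b1" "chart (A 2) = chart b2"
  unfolding A by (simp_all add: lam_neq)

lemma polar_halfspace_A: "polar_halfspace (A 3) (A 0) = {x \<in> H3. 0 \<le> sd x}"
proof -
  have "lorentz (hom (chart (A 0))) (A 3) = lam 3 * (- 1 / (2 * fst g3))"
    using fut by (simp add: chart_A hom_chart A(4) lorentz_b3 ca_def cx_def cy_def cw_def)
  then have eq: "lorentz (hom x) (A 3) * lorentz (hom (chart (A 0))) (A 3) =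
      (lam 3)\<^sup>2 / (2 * fst g3) * (- lorentz (hom x) b3)" for x
    by (simp add: A(4) power2_eq_square)
  have p: "0 < (lam 3)\<^sup>2 / (2 * fst g3)" using lam_neq fut by simp
  have "0 \<le> lorentz (hom x) (A 3) * lorentz (hom (chart (A 0))) (A 3) \<longleftrightarrow> 0 \<le> sd x" if "x \<in> H3" for x
  proof -
    have pos: "0 \<le> k * m \<longleftrightarrow> 0 \<le> m" "0 \<le> m / k \<longleftrightarrow> 0 \<le> m" if "0 < k" for k m :: real
      using that by (auto simp: zero_le_mult_iff zero_le_divide_iff)
    have "0 < rho * hnorm x" using rho(1) hnorm_pos[OF that] by simp
    then show ?thesis unfolding eq pos(1)[OF p] sd_def by (simp only: pos(2))
  qed
  then show ?thesis by (auto simp: polar_halfspace_def)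
qed

lemma hdist_set_A: "x \<in> H3 \<Longrightarrow> hdist_set x (polar_plane (A 3)) = arsinh \<bar>sd x\<bar>"
proof -
  assume x: "x \<in> H3"
  define n where "n = (1 / rho) *\<^sub>R b3"
  have "lorentz n n = 1" using rho(1) by (simp add: n_def lorentz_b3_b3 power2_eq_square)
  moreover have "polar_plane (A 3) = polar_plane n"
    using lam_neq rho(1) by (simp add: polar_plane_def A n_def)
  ultimately have "hdist_set x (polar_plane (A 3)) = arsinh (\<bar>lorentz (hom x) n\<bar> / hnorm x)"
    using hdist_set_polar_plane[OF _ x] by simp
  also have "\<bar>lorentz (hom x) n\<bar> / hnorm x = \<bar>sd x\<bar>"
    using rho(1) hnorm_pos[OF x] by (simp add: n_def sd_def abs_mult)
  finally show ?thesis .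
qed

lemma hyperball_A: "0 \<le> h \<Longrightarrow> hyperball (A 3) (A 0) h = {x \<in> H3. 0 \<le> sd x \<and> sd x \<le> sinh h}"
proof -
  have "arsinh r \<le> h \<longleftrightarrow> r \<le> sinh h" for r :: real
    by (metis arsinh_sinh_real linorder_not_less arsinh_less_iff_real)
  from this[of "sd _"] have "hdist_set x (polar_plane (A 3)) \<le> h \<longleftrightarrow> sd x \<le> sinh h" if "x \<in> H3" "0 \<le> sd x" for x
    unfolding hdist_set_A[OF that(1)] abs_of_nonneg[OF that(2)] .
  then show ?thesis unfolding hyperball_def polar_halfspace_A by blast
qed

lemma hypersphere_A: "hypersphere (A 3) (A 0) h = {x \<in> H3. 0 \<le> sd x \<and> sd x = sinh h}"
proof -
  have "arsinh r = h \<longleftrightarrow> r = sinh h" for r :: real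
    by (metis arsinh_sinh_real sinh_arsinh_real)
  from this[of "sd _"] have "hdist_set x (polar_plane (A 3)) = h \<longleftrightarrow> sd x = sinh h" if "x \<in> H3" "0 \<le> sd x" for x
    unfolding hdist_set_A[OF that(1)] abs_of_nonneg[OF that(2)] .
  then show ?thesis unfolding hypersphere_def polar_halfspace_A by blast
qed

text \<open>The height of the horosphere at which the Busemann function is \<open>b\<close>.\<close>

definition "z0 b = exp (- b) / (2 * fst g3)"

lemma z0_pos: "0 < z0 b" using fut by (simp add: z0_def)

text \<open>Up to a positive factor, \<open>1 - x \<bullet> chart g3\<close> is the inner product of
  \<open>hom x\<close> with the null vector \<open>g3\<close>, that is, \<open>ca (hom x)\<close>.
  Divided by \<open>hnorm x\<close> it is a reciprocal height, so horospheres about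
  \<open>A 0\<close> are horizontal.\<close>

lemma busemann_A: "x \<in> H3 \<Longrightarrow> busemann (chart (A 0)) x = - ln (2 * fst g3 * height x)"
proof -
  assume x: "x \<in> H3"
  have N: "hnorm x > 0" by (rule hnorm_pos[OF x])
  have a: "ca (hom x) > 0" using future_ca future_hom x by blast
  have "norm (snd g3) = fst g3"
  proof (rule power2_eq_imp_eq)
    show "(norm (snd g3))\<^sup>2 = (fst g3)\<^sup>2" using gram'(2) unfolding lorentz_self by simp
  qed (use fut in auto)
  then have "norm (chart g3) = 1" using fut by (simp add: chart_def)
  then have "busemann (chart (A 0)) x = ln ((1 - x \<bullet> chart g3) / hnorm x)"
    by (simp add: chart_A busemann_eq[OF _ x])
  also have "1 - x \<bullet> chart g3 = ca (hom x) / (2 * fst g3)"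
    using fut by (simp add: ca_def lorentz_def hom_def chart_def field_simps)
  also have "ca (hom x) / (2 * fst g3) / hnorm x = inverse (2 * fst g3 * height x)"
    using N a fut by (simp add: height_def field_simps)
  also have "ln \<dots> = - ln (2 * fst g3 * height x)"
    using N a fut by (intro ln_inverse) 
  finally show ?thesis .
qed

lemma height_pos: "x \<in> H3 \<Longrightarrow> 0 < height x"
  using hnorm_pos future_ca future_hom by (simp add: height_def)

lemma horoball_A: "horoball (A 0) b = {x \<in> H3. z0 b \<le> height x}"
proof -
  have "- ln (2 * fst g3 * height x) \<le> b \<longleftrightarrow> z0 b \<le> height x" if "x \<in> H3" for x
  proof -
    have p: "0 < 2 * fst g3 * height x" using height_pos[OF that] fut by simp
    have "- ln (2 * fst g3 * height x) \<le> b \<longleftrightarrow> exp (- b) \<le> 2 * fst g3 * height x"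
      using ln_ge_iff[OF p, of "- b"] by auto
    then show ?thesis using fut by (simp add: z0_def field_simps)
  qed
  then show ?thesis by (auto simp: horoball_def busemann_A)
qed

lemma horosphere_A: "horosphere (A 0) b = {x \<in> H3. height x = z0 b}"
proof -
  have "- ln (2 * fst g3 * height x) = b \<longleftrightarrow> height x = z0 b" if "x \<in> H3" for x
  proof -
    have p: "0 < 2 * fst g3 * height x" using height_pos[OF that] fut by simp
    have "- ln (2 * fst g3 * height x) = b \<longleftrightarrow> 2 * fst g3 * height x = exp (- b)"
      using p by (metis exp_ln ln_exp minus_minus)
    then show ?thesis using fut by (auto simp: z0_def field_simps)
  qed
  then show ?thesis
    unfolding horosphere_def by (intro Collect_cong conj_cong refl) (simp only: busemann_A)
qed

text \<open>In the half-space this is the region above the triangle 0 \<le> y \<le> T x, x \<le> c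
  that lies outside the unit hemisphere and outside the hemisphere of the base plane.\<close>

lemma frustum_A:
  "frustum A = {x \<in> H3. 0 \<le> cy (hom x) \<and> cy (hom x) \<le> T * cx (hom x) \<and> cx (hom x) \<le> c * ca (hom x)
     \<and> ca (hom x) \<le> cw (hom x) \<and> 0 \<le> sd x}"
proof -
  have sum4: "(\<Sum>i<4. f i) = f 0 + f 1 + f 2 + f 3" for f :: "nat \<Rightarrow> hvec"
    by (simp add: eval_nat_numeral)
  have coordb: "ca g3 = 0" "cx g3 = 0" "cy g3 = 0" "cw g3 = 1"
    by (simp_all add: ca_def cx_def cy_def cw_def)
  have add: "ca (u + v) = ca u + ca v" "cx (u + v) = cx u + cx v" "cy (u + v) = cy u + cy v" "cw (u + v) = cw u + cw v" for u v
    by (simp_all add: ca_def cx_def cy_def cw_def algebra_simps)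
  have iff: "x \<in> proj_tetrahedron A \<longleftrightarrow>
      0 \<le> cy (hom x) \<and> cy (hom x) \<le> T * cx (hom x) \<and> cx (hom x) \<le> c * ca (hom x) \<and> ca (hom x) \<le> cw (hom x)"
    (is "_ \<longleftrightarrow> ?P x") if x: "x \<in> H3" for x
  proof
    assume "x \<in> proj_tetrahedron A"
    then obtain d v where x': "x = chart v" and v: "v = (\<Sum>i<4. d i *\<^sub>R A i)" and d: "\<forall>i<4. 0 \<le> d i" and fv: "fst v \<noteq> (0::real)"
      unfolding proj_tetrahedron_def by blast
    define e where "e i = d i * lam i * lam 0" for i
    have e: "0 \<le> e i" if "i < 4" for i
      using d lam[OF that] that by (simp add: e_def mult.assoc)
    have "lam 0 *\<^sub>R v = e 0 *\<^sub>R g3 + e 1 *\<^sub>R b1 + e 2 *\<^sub>R b2 + e 3 *\<^sub>R b3"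
      unfolding v sum4 A e_def by (simp add: scaleR_add_right mult_ac)
    then have co: "lam 0 * ca v = e 1 + e 2 + e 3" "lam 0 * cx v = e 2 * c + e 3 * c" "lam 0 * cy v = e 3 * (c * T)"
        "lam 0 * cw v = e 0 + e 1 + e 2 + e 3"
      by (metis (no_types, lifting) add coord_mk coord_scale coordb mult_1_right mult_zero_right add_0 add_0_right b1_def b2_def b3_def)+
    define r where "r = lam 0 * fst v"
    have hx: "hom x = (1 / fst v) *\<^sub>R v" using fv by (simp add: x' hom_chart)
    have ho: "ca (hom x) = (lam 0 * ca v) / r" "cx (hom x) = (lam 0 * cx v) / r" "cy (hom x) = (lam 0 * cy v) / r" "cw (hom x) = (lam 0 * cw v) / r"
      using lam_neq by (simp_all add: hx r_def)
    have "0 < (e 1 + e 2 + e 3) / r" using future_ca[OF future_hom[OF x]] ho(1) co(1) by simp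
    \<comment> \<open>\<open>proj_tetrahedron\<close> admits representatives of either sign; since
      the point is proper, the sign is that of \<open>lam 0\<close>.\<close>
    then have r: "0 < r" using e[of 1] e[of 2] e[of 3] by (simp add: zero_less_divide_iff)
    show "?P x"
      unfolding ho co using r e[of 0] e[of 1] e[of 2] e[of 3] c T
      by (auto simp: divide_simps algebra_simps)
  next
    assume P: "?P x"
    define y z w a where "y = cx (hom x)" and "z = cy (hom x)" and "w = cw (hom x)" and "a = ca (hom x)"
    \<comment> \<open>The coefficients of \<open>hom x\<close> in the basis \<open>g3\<close>,
      \<open>b1\<close>, \<open>b2\<close>, \<open>b3\<close>.\<close>
    define e where "e i = (if i = 0 then w - a else if i = 1 then a - y / c else if i = 2 then y / c - z / (c * T) else z / (c * T))" for i :: nat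
    have e: "0 \<le> e i" for i
      using P c T unfolding e_def y_def z_def w_def a_def by (simp add: field_simps)
    have "ca (e 0 *\<^sub>R g3 + e 1 *\<^sub>R b1 + e 2 *\<^sub>R b2 + e 3 *\<^sub>R b3) = a"
      "cx (e 0 *\<^sub>R g3 + e 1 *\<^sub>R b1 + e 2 *\<^sub>R b2 + e 3 *\<^sub>R b3) = y"
      "cy (e 0 *\<^sub>R g3 + e 1 *\<^sub>R b1 + e 2 *\<^sub>R b2 + e 3 *\<^sub>R b3) = z"
      "cw (e 0 *\<^sub>R g3 + e 1 *\<^sub>R b1 + e 2 *\<^sub>R b2 + e 3 *\<^sub>R b3) = w"
      unfolding add coord_scale coordb b1_def b2_def b3_def coord_mk e_def
      using c T by (simp_all add: field_simps)
    then have h: "hom x = e 0 *\<^sub>R g3 + e 1 *\<^sub>R b1 + e 2 *\<^sub>R b2 + e 3 *\<^sub>R b3"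
      by (metis mk_coord y_def z_def w_def a_def)
    define d where "d i = e i * \<bar>lam 0\<bar> / \<bar>lam i\<bar>" for i
    have dl: "d i * lam i = e i * lam 0" if "i < 4" for i
      using lam[OF that] by (cases "lam 0 > 0") (auto simp: d_def zero_less_mult_iff field_simps)
    have v: "(\<Sum>i<4. d i *\<^sub>R A i) = lam 0 *\<^sub>R hom x"
      using dl[of 0] dl[of 1] dl[of 2] dl[of 3]
      unfolding h sum4 A scaleR_scaleR by (simp add: scaleR_add_right mult_ac)
    have "x = chart (\<Sum>i<4. d i *\<^sub>R A i)" unfolding v using lam_neq by simp
    moreover have "\<forall>i<4. 0 \<le> d i" using e by (simp add: d_def)
    moreover have "fst (\<Sum>i<4. d i *\<^sub>R A i) \<noteq> (0::real)" unfolding v using lam_neq by (simp add: hom_def)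
    ultimately show "x \<in> proj_tetrahedron A" unfolding proj_tetrahedron_def by blast
  qed
  show ?thesis unfolding frustum_def polar_halfspace_A using iff by auto
qed

end

section \<open>The packing conditions in coordinates\<close>

context orthoscheme_frame
begin

definition "p0 = g3 + (1 / (2 * rho\<^sup>2)) *\<^sub>R b3"
definition "p1 = b1 + (1 / rho\<^sup>2) *\<^sub>R b3"
definition "p2 = b2 + (s\<^sup>2 / rho\<^sup>2) *\<^sub>R b3"

lemma lorentz_b3_simps: "lorentz g3 b3 = - 1 / 2" "lorentz b1 b3 = - 1" "lorentz b2 b3 = - s\<^sup>2"
  unfolding lorentz_b3 using sc
  by (simp_all add: b1_def b2_def power2_eq_square ca_def[of g3] cx_def[of g3] cy_def[of g3] cw_def[of g3])

lemma chart_vertexP: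
  "chart (vertexP A 0) = chart p0" "chart (vertexP A 1) = chart p1" "chart (vertexP A 2) = chart p2"
proof -
  have "vertexP A 0 = lam 0 *\<^sub>R p0" "vertexP A 1 = lam 1 *\<^sub>R p1" "vertexP A 2 = lam 2 *\<^sub>R p2"
    unfolding vertexP_def A p0_def p1_def p2_def using lam_neq rho(1)
    by (simp_all add: lorentz_b3_b3 lorentz_b3_simps scaleR_add_right power2_eq_square)
  then show "chart (vertexP A 0) = chart p0" "chart (vertexP A 1) = chart p1" "chart (vertexP A 2) = chart p2"
    using lam_neq by simp_all
qed

lemma coord_add: "ca (u + v) = ca u + ca v" "cx (u + v) = cx u + cx v" "cy (u + v) = cy u + cy v" "cw (u + v) = cw u + cw v"
  by (simp_all add: ca_def cx_def cy_def cw_def algebra_simps)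

lemma coord_b:
  "ca g3 = 0" "cx g3 = 0" "cy g3 = 0" "cw g3 = 1"
  "ca b1 = 1" "cx b1 = 0" "cy b1 = 0" "cw b1 = 1"
  "ca b2 = 1" "cx b2 = c" "cy b2 = 0" "cw b2 = 1"
  "ca b3 = 1" "cx b3 = c" "cy b3 = c * T" "cw b3 = 1"
  by (simp_all add: b1_def b2_def b3_def ca_def[of g3] cx_def[of g3] cy_def[of g3] cw_def[of g3])

lemma future_p: "future p0" "future p1" "future p2"
proof -
  note r = rho(1)
  have self: "lorentz (v + k *\<^sub>R b3) (v + k *\<^sub>R b3) = lorentz v v + 2 * k * lorentz v b3 + k\<^sup>2 * rho\<^sup>2" for v k
    by (simp add: lorentz_b3_b3 lorentz_commute[of b3 v] power2_eq_square algebra_simps)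
  have "lorentz p0 p0 < 0"
    unfolding p0_def self lorentz_b3_simps using r by (simp add: power2_eq_square divide_simps)
  moreover have "lorentz p1 p1 < 0"
  proof -
    have "lorentz p1 p1 = lorentz b1 b1 - 1 / rho\<^sup>2"
      unfolding p1_def self lorentz_b3_simps using r by (simp add: power2_eq_square divide_simps)
    moreover have "0 < 1 / rho\<^sup>2" using r by simp
    moreover have "lorentz b1 b1 < 0" using future_b1 by (simp add: future_def)
    ultimately show ?thesis by linarith
  qed
  moreover have "lorentz p2 p2 < 0"
  proof -
    have "lorentz p2 p2 = lorentz b2 b2 - (s\<^sup>2)\<^sup>2 / rho\<^sup>2"
      unfolding p2_def self lorentz_b3_simps using r by (simp add: power2_eq_square divide_simps)
    moreover have "0 \<le> (s\<^sup>2)\<^sup>2 / rho\<^sup>2" by simp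
    moreover have "lorentz b2 b2 < 0" using future_b2 by (simp add: future_def)
    ultimately show ?thesis by linarith
  qed
  moreover have "0 < ca p0" "0 < ca p1" "0 < ca p2"
    using r by (simp_all add: p0_def p1_def p2_def coord_add coord_b add_pos_nonneg)
  ultimately show "future p0" "future p1" "future p2" by (auto intro: ca_future)
qed

lemma face_PPP_eq: "face_PPP A = convex hull (chart ` {p0, p1, p2})"
  unfolding face_PPP_def chart_vertexP by simp

lemma face_AAPP_eq: "face_AAPP A = convex hull (chart ` {b1, b2, p2, p1})"
  unfolding face_AAPP_def chart_vertexP chart_A by simp

lemma face_AAA_eq: "face_AAA A = convex hull (chart ` {g3, b1, b2})"
  unfolding face_AAA_def chart_A by simp

lemma fst_pos: "0 < fst b1" "0 < fst b2" "0 < fst p0" "0 < fst p1" "0 < fst p2"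
  using future_b1 future_b2 future_p by (auto simp: future_def)

lemma chart_future_H3: "future v \<Longrightarrow> chart v \<in> H3"
  by (simp add: future_def chart_in_H3)

lemma height_b1: "height (chart b1) = 1"
  unfolding b1_def by (subst height_mk) (use future_b1 in \<open>simp_all add: b1_def\<close>)

text \<open>With \<open>A 0\<close> at infinity the line to \<open>A 3\<close> is the vertical axis
  of the hemisphere, so P0 is its apex.\<close>

lemma height_p0: "height (chart p0) = rho"
proof -
  note r = rho(1)
  have "lorentz p0 p0 = - (1 / (4 * rho\<^sup>2))"
    unfolding p0_def using r
    by (simp add: lorentz_b3_b3 lorentz_b3_simps lorentz_commute[of b3 g3] power2_eq_square divide_simps)
  moreover have "ca p0 = 1 / (2 * rho\<^sup>2)" by (simp add: p0_def coord_add coord_b)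
  ultimately have "height (chart p0) = sqrt (1 / (4 * rho\<^sup>2)) / (1 / (2 * rho\<^sup>2))"
    by (simp add: height_chart[OF future_p(1)])
  also have "sqrt (1 / (4 * rho\<^sup>2)) = 1 / (2 * rho)" using rho(1) by (simp add: real_sqrt_divide real_sqrt_mult)
  also have "1 / (2 * rho) / (1 / (2 * rho\<^sup>2)) = rho" using rho(1) by (simp add: power2_eq_square)
  finally show ?thesis .
qed

lemma sd_b2: "sd (chart b2) = s / rho"
proof -
  have "lorentz b2 b2 = - s\<^sup>2" using sc by (simp add: b2_def lorentz_mk power2_eq_square algebra_simps)
  then show ?thesis
    unfolding sd_chart[OF future_b2] lorentz_b3_simps using s rho(1) by (simp add: power2_eq_square)
qed

text \<open>\<open>A 1\<close> is the apex of the unit hemisphere, which carries this face. If the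
  horosphere were lower, an open part of the horoball would contain \<open>A 1\<close> and hence
  meet the relative interior of the face.\<close>

lemma packing_z0_ge_1:
  assumes "horoball (A 0) b \<inter> rel_interior (face_AAPP A) = {}"
  shows "1 \<le> z0 b"
proof (rule ccontr)
  assume n: "\<not> 1 \<le> z0 b"
  have "{x \<in> H3. z0 b < height x} \<inter> rel_interior (convex hull (chart ` {b1, b2, p2, p1})) \<noteq> {}"
    using n by (intro open_meets_rel_interior_hull[OF open_height, of "chart b1"])
      (auto simp: height_b1 chart_future_H3 future_b1)
  with assms show False by (force simp: horoball_A face_AAPP_eq)
qed

lemma packing_z0_ge_rho:
  assumes "horoball (A 0) b \<inter> rel_interior (face_PPP A) = {}"
  shows "rho \<le> z0 b"
proof (rule ccontr)
  assume n: "\<not> rho \<le> z0 b"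
  have "{x \<in> H3. z0 b < height x} \<inter> rel_interior (convex hull (chart ` {p0, p1, p2})) \<noteq> {}"
    using n by (intro open_meets_rel_interior_hull[OF open_height, of "chart p0"])
      (auto simp: height_p0 chart_future_H3 future_p)
  with assms show False by (force simp: horoball_A face_PPP_eq)
qed

text \<open>\<open>A 2\<close> is the point of the face nearest to the base plane; at a larger width
  an open part of the hyperball would contain it.\<close>

lemma packing_sinh_le:
  assumes "hyperball (A 3) (A 0) h \<inter> rel_interior (face_AAA A) = {}" "0 \<le> h"
  shows "sinh h \<le> s / rho"
proof (rule ccontr)
  assume n: "\<not> sinh h \<le> s / rho"
  have "{x \<in> H3. 0 < sd x \<and> sd x < sinh h} \<inter> rel_interior (convex hull (chart ` {g3, b1, b2})) \<noteq> {}"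
    using n s rho(1) by (intro open_meets_rel_interior_hull[OF open_sd, of "chart b2"])
      (auto simp: sd_b2 chart_future_H3 future_b2)
  with assms show False by (force simp: hyperball_A face_AAA_eq)
qed

text \<open>The left side is sinh (ln (z / rho)): it is the value of \<open>sd\<close> at height
  \<open>z\<close> on the axis of the hemisphere, at the signed distance ln (z / rho) from the
  apex.\<close>

lemma sinh_height_iff:
  assumes "0 < z"
  shows "(z\<^sup>2 - rho\<^sup>2) / (2 * rho * z) \<le> sinh h \<longleftrightarrow> z \<le> rho * exp h"
    and "(z\<^sup>2 - rho\<^sup>2) / (2 * rho * z) < sinh h \<longleftrightarrow> z < rho * exp h"
proof -
  have e: "sinh h - (z\<^sup>2 - rho\<^sup>2) / (2 * rho * z) = (rho * exp h - z) * (z * exp h + rho) / (2 * rho * z * exp h)"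
    using assms rho(1) by (simp add: sinh_field_def exp_minus divide_simps) (simp add: power2_eq_square algebra_simps)
  have p: "0 < (z * exp h + rho) / (2 * rho * z * exp h)"
    using assms rho(1) by (simp add: add_pos_pos)
  from e have e': "sinh h - (z\<^sup>2 - rho\<^sup>2) / (2 * rho * z) = (rho * exp h - z) * ((z * exp h + rho) / (2 * rho * z * exp h))"
    by (simp only: times_divide_eq_right)
  show "(z\<^sup>2 - rho\<^sup>2) / (2 * rho * z) \<le> sinh h \<longleftrightarrow> z \<le> rho * exp h"
    using mult_le_cancel_right_pos[OF p, of 0 "rho * exp h - z"] unfolding e'[symmetric] by simp
  show "(z\<^sup>2 - rho\<^sup>2) / (2 * rho * z) < sinh h \<longleftrightarrow> z < rho * exp h"
    using mult_less_cancel_right_pos[OF p, of 0 "rho * exp h - z"] unfolding e'[symmetric] by simp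
qed

text \<open>The hyperball is highest on the axis over (c, c T), where it reaches
  \<open>rho * exp h\<close>. A point of the axis strictly between the two heights lies in both
  interiors; \<open>rho \<le> z0 b\<close> keeps it on the side of \<open>A 0\<close>.\<close>

lemma packing_exp_le:
  assumes int: "interior (horoball (A 0) b) \<inter> interior (hyperball (A 3) (A 0) h) = {}"
    and h: "0 \<le> h" and r: "rho \<le> z0 b"
  shows "rho * exp h \<le> z0 b"
proof (rule ccontr)
  assume n: "\<not> rho * exp h \<le> z0 b"
  define z where "z = (z0 b + rho * exp h) / 2"
  have z: "z0 b < z" "z < rho * exp h" "rho < z" "0 < z"
    unfolding z_def using n r rho(1) by argo+
  define v where "v = mk 1 c (c * T) (c\<^sup>2 + (c * T)\<^sup>2 + z\<^sup>2)"
  have f: "future v" unfolding v_def using z by (intro future_mk) simp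
  have zz: "sqrt ((c\<^sup>2 + (c * T)\<^sup>2 + z\<^sup>2) - c\<^sup>2 - (c * T)\<^sup>2) = z" using z by simp
  have "height (chart v) = z" using height_mk[OF f[unfolded v_def]] zz by (simp add: v_def)
  moreover have sdv: "sd (chart v) = (z\<^sup>2 - rho\<^sup>2) / (2 * rho * z)"
    using sd_mk'[OF f[unfolded v_def] zz[symmetric]] by (simp add: v_def)
  moreover have "0 < sd (chart v)"
    unfolding sdv using z rho(1) by (simp add: power_strict_mono)
  moreover have "sd (chart v) < sinh h" unfolding sdv sinh_height_iff(2)[OF z(4)] by (rule z)
  ultimately have "chart v \<in> {x \<in> H3. z0 b < height x}" "chart v \<in> {x \<in> H3. 0 < sd x \<and> sd x < sinh h}"
    using f z by (auto simp: chart_future_H3)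
  moreover have "{x \<in> H3. z0 b < height x} \<subseteq> interior (horoball (A 0) b)"
    by (rule interior_maximal[OF _ open_height]) (auto simp: horoball_A)
  moreover have "{x \<in> H3. 0 < sd x \<and> sd x < sinh h} \<subseteq> interior (hyperball (A 3) (A 0) h)"
    by (rule interior_maximal[OF _ open_sd]) (auto simp: hyperball_A[OF h])
  ultimately show False using int by blast
qed

lemma hyperball_height:
  assumes x: "x \<in> H3" and "sd x \<le> sinh h"
  shows "height x \<le> rho * exp h"
proof -
  obtain y z w where v: "x = chart (mk 1 y z w)" "future (mk 1 y z w)" using H3_chartE[OF x] by metis
  define u where "u = sqrt (w - y\<^sup>2 - z\<^sup>2)"
  have u: "0 < u" using v(2) by (simp add: u_def future_mk_iff)
  have "(u\<^sup>2 - rho\<^sup>2) / (2 * rho * u) \<le> sd x"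
    unfolding v(1) sd_mk'[OF v(2) u_def] using u rho(1) by (intro divide_right_mono) auto
  then have "(u\<^sup>2 - rho\<^sup>2) / (2 * rho * u) \<le> sinh h" using assms(2) by linarith
  then have "u \<le> rho * exp h" using sinh_height_iff(1)[OF u] by blast
  then show ?thesis unfolding v(1) height_mk[OF v(2)] u_def .
qed

text \<open>The critical height 1 and the critical width are attained on the respective faces only
  at \<open>A 1\<close> and \<open>A 2\<close>, outside the relative interiors; so
  \<open>z0 b = 1\<close> and equality in \<open>sh\<close> are allowed. The other inequalities are
  strict and exclude contact altogether.\<close>

lemma hyp_hor_packingI:
  assumes sfo: "simple_frustum_orthoscheme p q r A" and h: "0 \<le> h" and "1 \<le> z0 b" and "rho < z0 b"
    and sh: "sinh h \<le> s / rho" and disj: "rho * exp h < z0 b"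
  shows "hyp_hor_packing p q r A b h"
  unfolding hyp_hor_packing_def
proof (intro conjI)
  show "horoball (A 0) b \<inter> rel_interior (face_PPP A) = {}"
  proof (rule ccontr)
    assume "\<not> ?thesis"
    then obtain x where x: "x \<in> H3" "z0 b \<le> height x" "x \<in> rel_interior (face_PPP A)"
      unfolding horoball_A by blast
    then have "x \<in> convex hull (chart ` {p0, p1, p2})" using rel_interior_subset by (auto simp: face_PPP_eq)
    then have "lorentz (hom x) b3 = 0"
    proof (rule hull_lorentz_zero[rotated])
      fix v assume "v \<in> {p0, p1, p2}"
      then show "0 < fst v \<and> lorentz v b3 = 0"
        using fst_pos rho(1) by (auto simp: p0_def p1_def p2_def lorentz_b3_simps lorentz_b3_b3)
    qed
    then have "sd x \<le> sinh 0" by (simp add: sd_def)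
    from hyperball_height[OF x(1) this] have "height x \<le> rho" by simp
    with x(2) assms show False by linarith
  qed
  show "horoball (A 0) b \<inter> rel_interior (face_AAPP A) = {}"
  proof (rule ccontr)
    assume "\<not> ?thesis"
    then obtain x where x: "x \<in> H3" "z0 b \<le> height x" "x \<in> rel_interior (face_AAPP A)"
      unfolding horoball_A by blast
    have xr: "x \<in> rel_interior (convex hull (chart ` {b1, b2, p2, p1}))" using x by (simp add: face_AAPP_eq)
    then have xh: "x \<in> convex hull (chart ` {b1, b2, p2, p1})" using rel_interior_subset by blast
    have cd: "lorentz v (g3 - g0) = (cw v - ca v) / 2" for v by (simp add: cw_def ca_def)
    have "lorentz (hom x) (g3 - g0) = 0"
      by (rule hull_lorentz_zero[OF _ xh])
        (use fst_pos in \<open>auto simp: cd p1_def p2_def coord_add coord_b simp del: lorentz_bilinear\<close>)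
    then have wa: "cw (hom x) = ca (hom x)" unfolding cd by simp
    \<comment> \<open>\<open>cx\<close> vanishes on this face only at \<open>A 1\<close>. Where it
      is positive, the unit hemisphere is lower than 1.\<close>
    have "0 < lorentz (hom x) g1"
    proof (rule rel_interior_lorentz_pos[OF _ xr, of _ b2])
      show "0 < lorentz b2 g1" using c coord_b by (simp add: cx_def)
      fix v assume "v \<in> {b1, b2, p2, p1}"
      then show "0 < fst v \<and> 0 \<le> lorentz v g1"
        using fst_pos c by (auto simp: cx_def[symmetric] p1_def p2_def coord_add coord_b simp del: lorentz_bilinear)
    qed simp
    then have xp: "0 < cx (hom x)" by (simp add: cx_def)
    obtain y z w where v: "x = chart (mk 1 y z w)" "future (mk 1 y z w)" "hom x = ca (hom x) *\<^sub>R mk 1 y z w" "0 < ca (hom x)"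
      using H3_chartE[OF x(1)] by metis
    have "cw (hom x) = ca (hom x) * w" "cx (hom x) = ca (hom x) * y"
      by (subst v(3), simp)+
    then have wy: "w = 1" "0 < y" using wa v(4) xp by (auto simp: zero_less_mult_iff)
    have "1 \<le> sqrt (w - y\<^sup>2 - z\<^sup>2)" using x(2) assms(3) unfolding v(1) height_mk[OF v(2)] by linarith
    then have "1 \<le> w - y\<^sup>2 - z\<^sup>2" by simp
    moreover have "0 < y\<^sup>2" "0 \<le> z\<^sup>2" using wy by auto
    ultimately show False using wy by linarith
  qed
  show "hyperball (A 3) (A 0) h \<inter> rel_interior (face_AAA A) = {}"
  proof (rule ccontr)
    assume "\<not> ?thesis"
    then obtain x where x: "x \<in> H3" "sd x \<le> sinh h" "x \<in> rel_interior (face_AAA A)"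
      unfolding hyperball_A[OF h] by blast
    have xr: "x \<in> rel_interior (convex hull (chart ` {g3, b1, b2}))" using x by (simp add: face_AAA_eq)
    then have xh: "x \<in> convex hull (chart ` {g3, b1, b2})" using rel_interior_subset by blast
    have "lorentz (hom x) g2 = 0"
    proof (rule hull_lorentz_zero[OF _ xh])
      fix v assume "v \<in> {g3, b1, b2}"
      then show "0 < fst v \<and> lorentz v g2 = 0"
        using fst_pos fut by (auto simp: cy_def[symmetric] coord_b)
    qed
    then have y0: "cy (hom x) = 0" by (simp add: cy_def)
    \<comment> \<open>The linear form of the vertical plane \<open>x = c\<close>, which contains
      \<open>A 0\<close> and \<open>A 2\<close> but not \<open>A 1\<close>; so it is positive on the
      relative interior.\<close>
    define n where "n = (- 2 * c) *\<^sub>R g3 - g1"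
    have ln: "lorentz v n = c * ca v - cx v" for v by (simp add: n_def cx_def ca_def)
    have "0 < lorentz (hom x) n"
    proof (rule rel_interior_lorentz_pos[OF _ xr, of _ b1])
      show "0 < lorentz b1 n" unfolding ln using c coord_b by simp
      fix v assume "v \<in> {g3, b1, b2}"
      then show "0 < fst v \<and> 0 \<le> lorentz v n" unfolding ln
        using fst_pos c fut by (auto simp: coord_b)
    qed simp
    then have xp: "cx (hom x) < c * ca (hom x)" by (simp add: ln)
    obtain y z w where v: "x = chart (mk 1 y z w)" "future (mk 1 y z w)" "hom x = ca (hom x) *\<^sub>R mk 1 y z w" "0 < ca (hom x)"
      using H3_chartE[OF x(1)] by metis
    have "cy (hom x) = ca (hom x) * z" "cx (hom x) = ca (hom x) * y"
      by (subst v(3), simp)+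
    then have z: "z = 0" "y < c" using y0 v(4) xp by auto
    define u where "u = sqrt (w - y\<^sup>2 - z\<^sup>2)"
    have u: "0 < u" using v(2) by (simp add: u_def future_mk_iff)
    have "sd x = ((y - c)\<^sup>2 + (c * T)\<^sup>2 + u\<^sup>2 - rho\<^sup>2) / (2 * rho * u)"
      using sd_mk'[OF v(2) u_def] v(1) z(1) by simp
    \<comment> \<open>Completing the square: on this face \<open>sd\<close> is least over (c, 0) at
      height \<open>s\<close>, which is \<open>A 2\<close>.\<close>
    also have "(y - c)\<^sup>2 + (c * T)\<^sup>2 + u\<^sup>2 - rho\<^sup>2 = (y - c)\<^sup>2 + (u - s)\<^sup>2 + 2 * s * u"
      unfolding rho(2) by (simp add: power2_eq_square algebra_simps)
    finally have "sd x = ((y - c)\<^sup>2 + (u - s)\<^sup>2) / (2 * rho * u) + s / rho"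
      using u rho(1) by (simp add: add_divide_distrib)
    moreover have "0 < (y - c)\<^sup>2 + (u - s)\<^sup>2" using z by (simp add: add_pos_nonneg)
    then have "0 < ((y - c)\<^sup>2 + (u - s)\<^sup>2) / (2 * rho * u)" using u rho(1) by simp
    ultimately show False using x(2) sh by linarith
  qed
  show "interior (horoball (A 0) b) \<inter> interior (hyperball (A 3) (A 0) h) = {}"
  proof -
    have "horoball (A 0) b \<inter> hyperball (A 3) (A 0) h = {}"
      using hyperball_height[of _ h] disj by (force simp: horoball_A hyperball_A[OF h])
    then show ?thesis using interior_subset by blast
  qed
qed (use sfo h in auto)

end

section \<open>Volumes of the frustum and of the pieces\<close>

context orthoscheme_frame
begin

lemma chart_mem_iff:
  assumes "\<And>r w. 0 < r \<Longrightarrow> P (r *\<^sub>R w) = P w"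
  shows "0 < fst v \<and> chart v \<in> {x \<in> H3. P (hom x)} \<longleftrightarrow> future v \<and> P v"
proof (cases "0 < fst v")
  case True
  then have "P (hom (chart v)) = P v" using assms[of "1 / fst v" v] by (simp add: hom_chart)
  then show ?thesis using True chart_in_H3[of v] by (auto simp: future_def)
qed (simp add: future_def)

text \<open>An orthonormal frame at the vertex \<open>P\<^sub>2\<close> whose last vector is normal to \<open>\<pi>\<^sub>3\<close>: in the chart of
  this frame the frustum is a right prism over a triangle in \<open>\<pi>\<^sub>3\<close>.\<close>

definition "f0 = mk (c * T / (rho * s)) (c\<^sup>2 * T / (rho * s)) (s / rho) (c * T / (rho * s))"
definition "f1 = mk (- c / s) (- 1 / s) 0 (- c / s)"
definition "f2 = mk (- 1) 0 0 1"
definition "f3 = mk (- 1 / rho) (- c / rho) (- c * T / rho) (- 1 / rho)"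

lemma f_gram:
  "lorentz f0 f0 = - 1" "lorentz f1 f1 = 1" "lorentz f2 f2 = 1" "lorentz f3 f3 = 1"
  "lorentz f0 f1 = 0" "lorentz f0 f2 = 0" "lorentz f0 f3 = 0" "lorentz f1 f2 = 0" "lorentz f1 f3 = 0" "lorentz f2 f3 = 0"
proof -
  have r: "rho * rho = c * T * (c * T) - s * s" using rho(2) by (simp add: power2_eq_square)
  have c2: "c * c = 1 - s * s" using sc by (simp add: power2_eq_square)
  note ne = s rho(1) c T
  have "lorentz f3 f3 = lorentz b3 b3 / rho\<^sup>2"
    using ne by (simp add: f3_def b3_def lorentz_mk power2_eq_square field_simps)
  then show "lorentz f3 f3 = 1" using ne by (simp add: lorentz_b3_b3)
  have "lorentz f0 f0 = (c * T)\<^sup>2 * (c * c - 1) / (rho * s)\<^sup>2 + (s / rho)\<^sup>2"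
    using ne by (simp add: f0_def lorentz_mk power2_eq_square field_simps)
  also have "\<dots> = (s\<^sup>2 - (c * T)\<^sup>2) / rho\<^sup>2"
    unfolding c2 using ne by (simp add: power2_eq_square field_simps)
  also have "s\<^sup>2 - (c * T)\<^sup>2 = - rho\<^sup>2" using rho(2) by simp
  finally show "lorentz f0 f0 = - 1" using ne(2) by simp
  have "lorentz f1 f1 = (1 - c * c) / s\<^sup>2"
    using ne by (simp add: f1_def lorentz_mk power2_eq_square field_simps)
  then show "lorentz f1 f1 = 1" unfolding c2 using ne by (simp add: power2_eq_square)
  have "lorentz f0 f3 = (c * T) * (1 - c * c - s * s) / (rho * s * rho)"
    using ne by (simp add: f0_def f3_def lorentz_mk power2_eq_square field_simps)
  then show "lorentz f0 f3 = 0" by (simp add: c2)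
  show "lorentz f2 f2 = 1" "lorentz f0 f1 = 0" "lorentz f0 f2 = 0" "lorentz f1 f2 = 0" "lorentz f1 f3 = 0" "lorentz f2 f3 = 0"
    using ne by (simp_all add: f0_def f1_def f2_def f3_def lorentz_mk power2_eq_square field_simps)
qed

lemma f_gram': 
  "lorentz f1 f0 = 0" "lorentz f2 f0 = 0" "lorentz f3 f0 = 0" "lorentz f2 f1 = 0" "lorentz f3 f1 = 0" "lorentz f3 f2 = 0"
  using f_gram by (simp_all add: lorentz_commute)

lemma det_f: "\<bar>det (gram4 f0 f1 f2 f3)\<bar> = 1\<^sup>2" "\<bar>det (gram4 f0 f3 f1 f2)\<bar> = 1\<^sup>2"
  by (simp_all add: det_4 gram4_def Let_def f_gram f_gram')

definition "fv t x y z = t *\<^sub>R f0 + x *\<^sub>R f1 + y *\<^sub>R f2 + z *\<^sub>R f3"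

lemma frame_map_fv: "frame_map f0 f1 f2 f3 (t, x, y, z) = fv t x y z" "frame_map f0 f3 f1 f2 (t, z, x, y) = fv t x y z"
  by (simp_all add: frame_map_def fv_def)

lemma lorentz_fv: "lorentz (fv t x y z) (fv t x y z) = x\<^sup>2 + y\<^sup>2 + z\<^sup>2 - t\<^sup>2"
  by (simp add: fv_def f_gram f_gram' power2_eq_square)

lemma coord_f: 
  "ca f0 = c * T / (rho * s)" "cx f0 = c\<^sup>2 * T / (rho * s)" "cy f0 = s / rho" "cw f0 = c * T / (rho * s)"
  "ca f1 = - c / s" "cx f1 = - 1 / s" "cy f1 = 0" "cw f1 = - c / s"
  "ca f2 = - 1" "cx f2 = 0" "cy f2 = 0" "cw f2 = 1"
  "ca f3 = - 1 / rho" "cx f3 = - c / rho" "cy f3 = - c * T / rho" "cw f3 = - 1 / rho"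
  by (simp_all add: f0_def f1_def f2_def f3_def)

lemma future_f0: "future f0"
  by (rule ca_future) (use c T rho(1) s in \<open>simp_all add: f_gram coord_f\<close>)

lemma future_fv: "future (fv t x y z) \<longleftrightarrow> 0 < t \<and> x\<^sup>2 + y\<^sup>2 + z\<^sup>2 < t\<^sup>2"
proof -
  have l: "lorentz (fv t x y z) f0 = - t" by (simp add: fv_def f_gram f_gram')
  show ?thesis
  proof
    assume "future (fv t x y z)"
    then show "0 < t \<and> x\<^sup>2 + y\<^sup>2 + z\<^sup>2 < t\<^sup>2"
      using future_lorentz_neg[of "fv t x y z" f0] future_f0 l by (simp add: future_def lorentz_fv)
  next
    assume "0 < t \<and> x\<^sup>2 + y\<^sup>2 + z\<^sup>2 < t\<^sup>2"
    then show "future (fv t x y z)"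
      using causal_future[of "fv t x y z" f0] future_f0 l by (simp add: future_def lorentz_fv)
  qed
qed

definition "in_frustum v \<longleftrightarrow> 0 \<le> cy v \<and> cy v \<le> T * cx v \<and> cx v \<le> c * ca v \<and> ca v \<le> cw v \<and> lorentz v b3 \<le> 0"

lemma frustum_in: "frustum A = {x \<in> H3. in_frustum (hom x)}"
proof -
  have "0 \<le> sd x \<longleftrightarrow> lorentz (hom x) b3 \<le> 0" if "x \<in> H3" for x
  proof -
    have "0 < rho * hnorm x" using rho(1) hnorm_pos[OF that] by simp
    then show ?thesis by (simp add: sd_def divide_le_0_iff)
  qed
  then show ?thesis unfolding frustum_A in_frustum_def by auto
qed

lemma in_frustum_scale: "0 < r \<Longrightarrow> in_frustum (r *\<^sub>R w) = in_frustum w"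
  by (simp add: in_frustum_def zero_le_mult_iff mult_le_0_iff mult.left_commute[of _ r])

lemma chart_in_frustum_iff: "0 < fst v \<and> chart v \<in> frustum A \<longleftrightarrow> future v \<and> in_frustum v"
  unfolding frustum_in by (rule chart_mem_iff) (rule in_frustum_scale)

lemma lorentz_fv_b3: "lorentz (fv t x y z) b3 = - rho * z"
proof -
  have "(- rho) *\<^sub>R f3 = mk 1 c (c * T) 1"
    using mk_coord[of "(- rho) *\<^sub>R f3"] rho(1) unfolding coord_scale coord_f by simp
  then have "b3 = (- rho) *\<^sub>R f3" by (simp only: b3_def)
  then show ?thesis by (simp add: fv_def f_gram f_gram')
qed

text \<open>The faces through \<open>A 3\<close> are perpendicular to the base plane and restrict
  only \<open>x\<close> and \<open>y\<close>. The face \<open>A 0\<close>, \<open>A 1\<close>,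
  \<open>A 2\<close> is perpendicular to the edge from \<open>A 2\<close> to \<open>A 3\<close>, so
  it is the plane on which \<open>z / t\<close> is constant; the constant \<open>s / (c * T)\<close>
  is the hyperbolic tangent of the distance from \<open>A 2\<close> to the base plane.\<close>

lemma in_frustum_fv:
  "in_frustum (fv t x y z) \<longleftrightarrow> 0 \<le> y \<and> y \<le> s / c * x \<and> x \<le> rho / T * t \<and> 0 \<le> z \<and> z \<le> s / (c * T) * t"
proof -
  note ne = s rho(1) c T
  have c2: "c\<^sup>2 = 1 - s\<^sup>2" using sc by linarith
  have "cw (fv t x y z) - ca (fv t x y z) = 2 * y"
    by (simp add: fv_def coord_add coord_f)
  then have 1: "ca (fv t x y z) \<le> cw (fv t x y z) \<longleftrightarrow> 0 \<le> y" by linarith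
  have "c * ca (fv t x y z) - cx (fv t x y z) = (1 - c\<^sup>2) / s * x - c * y"
    using ne by (simp add: fv_def coord_add coord_f field_simps power2_eq_square)
  also have "\<dots> = s * x - c * y" unfolding c2 using ne by (simp add: power2_eq_square)
  finally have "cx (fv t x y z) \<le> c * ca (fv t x y z) \<longleftrightarrow> c * y \<le> s * x" by linarith
  also have "\<dots> \<longleftrightarrow> y \<le> s / c * x" using ne by (simp add: field_simps)
  finally have 2: "cx (fv t x y z) \<le> c * ca (fv t x y z) \<longleftrightarrow> y \<le> s / c * x" .
  have "T * cx (fv t x y z) - cy (fv t x y z) = (((c * T)\<^sup>2 - s\<^sup>2) / rho * t - T * x) / s"
    using ne by (simp add: fv_def coord_add coord_f field_simps power2_eq_square)
  also have "\<dots> = (rho * t - T * x) / s" unfolding rho(2)[symmetric] using ne by (simp add: power2_eq_square)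
  finally have e3: "T * cx (fv t x y z) - cy (fv t x y z) = (rho * t - T * x) / s" .
  have "cy (fv t x y z) \<le> T * cx (fv t x y z) \<longleftrightarrow> 0 \<le> (rho * t - T * x) / s" unfolding e3[symmetric] by simp
  then have 3: "cy (fv t x y z) \<le> T * cx (fv t x y z) \<longleftrightarrow> x \<le> rho / T * t"
    using ne by (simp add: zero_le_divide_iff field_simps)
  have e4: "cy (fv t x y z) = (s * t - c * T * z) / rho"
    using ne by (simp add: fv_def coord_add coord_f field_simps)
  have "0 \<le> cy (fv t x y z) \<longleftrightarrow> c * T * z \<le> s * t"
    unfolding e4 using ne(2) by (simp add: zero_le_divide_iff)
  also have "\<dots> \<longleftrightarrow> z \<le> s / (c * T) * t" using ne by (simp add: field_simps)
  finally have 4: "0 \<le> cy (fv t x y z) \<longleftrightarrow> z \<le> s / (c * T) * t" .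
  have 5: "lorentz (fv t x y z) b3 \<le> 0 \<longleftrightarrow> 0 \<le> z"
    unfolding lorentz_fv_b3 using ne by (simp add: zero_le_mult_iff)
  show ?thesis unfolding in_frustum_def 1 2 3 4 5 by auto
qed

lemma sets_H3_Collect:
  assumes "continuous_on H3 f" "continuous_on H3 g"
  shows "{x \<in> H3. f x \<le> (g x :: real)} \<in> sets borel"
proof -
  have H: "H3 \<in> sets borel" by (simp add: H3_def)
  have "continuous_on H3 (\<lambda>x. g x - f x)" using assms by (intro continuous_intros)
  then have "closedin (top_of_set H3) (H3 \<inter> (\<lambda>x. g x - f x) -` {0..})"
    by (rule continuous_closedin_preimage) simp
  then obtain C where C: "closed C" "H3 \<inter> (\<lambda>x. g x - f x) -` {0..} = H3 \<inter> C" by (auto simp: closedin_closed)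
  have "{x \<in> H3. f x \<le> g x} = H3 \<inter> C" unfolding C(2)[symmetric] by auto
  then show ?thesis using H C by (simp add: sets.Int borel_closed)
qed

lemma continuous_coord_hom: "continuous_on S (\<lambda>x. ca (hom x))" "continuous_on S (\<lambda>x. cx (hom x))"
    "continuous_on S (\<lambda>x. cy (hom x))" "continuous_on S (\<lambda>x. cw (hom x))" "continuous_on S (\<lambda>x. lorentz (hom x) b3)"
  unfolding ca_def cx_def cy_def cw_def by (intro continuous_intros)+

lemma sets_frustum: "frustum A \<in> sets borel"
proof -
  have "frustum A = {x \<in> H3. 0 \<le> cy (hom x)} \<inter> {x \<in> H3. cy (hom x) \<le> T * cx (hom x)} \<inter> {x \<in> H3. cx (hom x) \<le> c * ca (hom x)}
     \<inter> {x \<in> H3. ca (hom x) \<le> cw (hom x)} \<inter> {x \<in> H3. lorentz (hom x) b3 \<le> 0}"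
    unfolding frustum_in in_frustum_def by auto
  also have "\<dots> \<in> sets borel"
    by (intro sets.Int sets_H3_Collect continuous_intros continuous_coord_hom)
  finally show ?thesis .
qed

lemma sets_horoball: "horoball (A 0) b \<in> sets borel"
  unfolding horoball_A by (intro sets_H3_Collect continuous_intros continuous_height)

lemma sets_hyperball: "0 \<le> h \<Longrightarrow> hyperball (A 3) (A 0) h \<in> sets borel"
proof -
  assume h: "0 \<le> h"
  have "hyperball (A 3) (A 0) h = {x \<in> H3. 0 \<le> sd x} \<inter> {x \<in> H3. sd x \<le> sinh h}"
    unfolding hyperball_A[OF h] by auto
  then show ?thesis by (simp only:) (intro sets.Int sets_H3_Collect continuous_intros continuous_sd)
qed

lemma frustum_subset: "frustum A \<subseteq> H3" unfolding frustum_in by auto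

text \<open>The top vertex over P0 is \<open>A 0\<close>; the identity says that it lies on the
  quadric.\<close>

lemma prism_param: "(1 + (s / c)\<^sup>2) * (rho / T)\<^sup>2 + (s / (c * T))\<^sup>2 = 1"
proof -
  note ne = s rho(1) c T
  have "1 + (s / c)\<^sup>2 = (s\<^sup>2 + c\<^sup>2) / c\<^sup>2" using ne by (simp add: power_divide field_simps)
  then have "(1 + (s / c)\<^sup>2) * (rho / T)\<^sup>2 + (s / (c * T))\<^sup>2 = (rho\<^sup>2 + s\<^sup>2) / (c * T)\<^sup>2"
    unfolding sc using ne by (simp add: power_divide power_mult_distrib field_simps)
  also have "\<dots> = 1" unfolding rho(2) using ne by simp
  finally show ?thesis .
qed

lemma sq_div: "(inverse a * r)\<^sup>2 = r\<^sup>2 / (a :: real)\<^sup>2"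
  by (simp add: power_mult_distrib power_inverse divide_inverse mult.commute)

text \<open>The frame lists \<open>f3\<close> before \<open>f1\<close> and \<open>f2\<close>, so
  that the inner integrals run over slices of constant \<open>z\<close>. For the hyperball
  \<open>f3\<close> comes last, and the inner integral runs over a column normal to the base
  plane.\<close>

lemma emeasure_frustum:
  "emeasure hyp_measure (frustum A) =
    (\<integral>\<^sup>+u. ennreal (artanh (s / c * sqrt (((rho / T)\<^sup>2 + (tan u)\<^sup>2) / (1 - (rho / T)\<^sup>2))) / 2) *
       indicator {0..arctan (s / (c * T) / (s / c))} u \<partial>lborel)"
proof -
  note ne = s rho(1) c T
  define q :: "real \<times> real \<times> real \<Rightarrow> real" where "q v = 1 - (fst v)\<^sup>2 - (fst (snd v))\<^sup>2 - (snd (snd v))\<^sup>2" for v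
  define S where "S = {(z, x, y). 0 \<le> z \<and> z \<le> s / (c * T) \<and> 0 \<le> x \<and> x \<le> rho / T \<and> 0 \<le> y \<and> y \<le> s / c * x}"
  have S: "S \<in> sets borel"
  proof -
    have "S = {v \<in> space (borel \<Otimes>\<^sub>M (borel \<Otimes>\<^sub>M borel)). 0 \<le> fst v \<and> fst v \<le> s / (c * T) \<and> 0 \<le> fst (snd v) \<and>
       fst (snd v) \<le> rho / T \<and> 0 \<le> snd (snd v) \<and> snd (snd v) \<le> s / c * fst (snd v)}"
      by (auto simp: space_pair_measure S_def)
    also have "\<dots> \<in> sets (borel \<Otimes>\<^sub>M (borel \<Otimes>\<^sub>M borel))" by measurable
    finally show ?thesis unfolding borel_prod .
  qed
  have q: "q \<in> borel_measurable borel"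
    unfolding q_def by (intro borel_measurable_continuous_onI continuous_intros)
  \<comment> \<open>The closed prism contains the ideal vertex, where \<open>q\<close> vanishes; it
    has to be removed because it is not a point of \<open>H3\<close>.\<close>
  have S': "S \<inter> {v. 0 < q v} \<in> sets borel"
    using S q by (intro sets.Int) (auto simp: borel_measurable_iff_greater)
  have qS: "0 \<le> q v" if "v \<in> S" for v
  proof -
    obtain z x y where v: "v = (z, x, y)" by (cases v)
    have b: "0 \<le> z" "z \<le> s / (c * T)" "0 \<le> x" "x \<le> rho / T" "0 \<le> y" "y \<le> s / c * x" using that by (auto simp: v S_def)
    have "y\<^sup>2 \<le> (s / c * x)\<^sup>2" "z\<^sup>2 \<le> (s / (c * T))\<^sup>2" using b by (auto intro!: power_mono)
    moreover have "x\<^sup>2 + (s / c * x)\<^sup>2 = (1 + (s / c)\<^sup>2) * x\<^sup>2" by (simp add: power_mult_distrib power_divide algebra_simps)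
    moreover have "(1 + (s / c)\<^sup>2) * x\<^sup>2 \<le> (1 + (s / c)\<^sup>2) * (rho / T)\<^sup>2" using b by (intro mult_left_mono power_mono) auto
    ultimately show ?thesis using prism_param by (simp add: q_def v)
  qed
  have "emeasure hyp_measure (frustum A) = ennreal 1 * (\<integral>\<^sup>+v. ennreal (1 / (q v)\<^sup>2) * indicator (S \<inter> {v. 0 < q v}) v \<partial>lborel)"
  proof (rule emeasure_hyp_measure_chart[OF sets_frustum frustum_subset S' q])
    show "\<bar>det (gram4 f0 f3 f1 f2)\<bar> = 1\<^sup>2" by (rule det_f)
    fix y :: "real \<times> real \<times> real"
    obtain z' x' y' where y: "y = (z', x', y')" by (cases y)
    show "- lorentz (frame_map f0 f3 f1 f2 (1, y)) (frame_map f0 f3 f1 f2 (1, y)) = q y"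
      unfolding y frame_map_fv lorentz_fv q_def by simp
    fix a :: real
    show "0 < fst (frame_map f0 f3 f1 f2 (a, y)) \<and> chart (frame_map f0 f3 f1 f2 (a, y)) \<in> frustum A \<longleftrightarrow> 0 < a \<and> y /\<^sub>R a \<in> S \<inter> {v. 0 < q v}"
    proof (cases "0 < a")
      case True
      have q: "0 < q (y /\<^sub>R a) \<longleftrightarrow> x'\<^sup>2 + y'\<^sup>2 + z'\<^sup>2 < a\<^sup>2"
      proof -
        have "q (y /\<^sub>R a) = (a\<^sup>2 - (x'\<^sup>2 + y'\<^sup>2 + z'\<^sup>2)) / a\<^sup>2"
          using True by (simp add: y q_def sq_div diff_divide_distrib add_divide_distrib)
        then show ?thesis using True by (simp add: zero_less_divide_iff)
      qed
      have x0: "0 \<le> s / c * x' \<longleftrightarrow> 0 \<le> x'" using ne by (simp add: zero_le_mult_iff zero_le_divide_iff)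
      have Sy: "y /\<^sub>R a \<in> S \<longleftrightarrow> 0 \<le> y' \<and> y' \<le> s / c * x' \<and> x' \<le> rho / T * a \<and> 0 \<le> z' \<and> z' \<le> s / (c * T) * a"
      proof -
        have 1: "inverse a * y' \<le> s / c * (inverse a * x') \<longleftrightarrow> y' \<le> s / c * x'"
          using True by (simp add: field_simps)
        have 2: "inverse a * z' \<le> s / (c * T) \<longleftrightarrow> z' \<le> s / (c * T) * a" "inverse a * x' \<le> rho / T \<longleftrightarrow> x' \<le> rho / T * a"
          using True by (simp_all add: field_simps)
        have 3: "0 \<le> inverse a * r \<longleftrightarrow> 0 \<le> r" for r using True by (simp add: zero_le_mult_iff)
        have "0 \<le> y' \<Longrightarrow> y' \<le> s / c * x' \<Longrightarrow> 0 \<le> x'" using x0 order_trans by blast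
        then show ?thesis
          unfolding y S_def scaleR_Pair real_scaleR_def mem_Collect_eq case_prod_conv 1 2 3 by blast
      qed
      show ?thesis
        unfolding chart_in_frustum_iff unfolding y frame_map_fv future_fv in_frustum_fv
        using True Sy q unfolding y Int_iff mem_Collect_eq by blast
    next
      case False
      then show ?thesis
        unfolding chart_in_frustum_iff unfolding y frame_map_fv future_fv by simp
    qed
  qed auto
  also have "\<dots> = (\<integral>\<^sup>+v. ennreal (1 / (q v)\<^sup>2) * indicator S v \<partial>lborel)"
    unfolding ennreal_1 mult_1
  proof (rule nn_integral_cong)
    fix v
    \<comment> \<open>Where \<open>q v = 0\<close> the quotient is 0 by convention, so the removed
      vertex does not matter.\<close>
    show "ennreal (1 / (q v)\<^sup>2) * indicator (S \<inter> {v. 0 < q v}) v = ennreal (1 / (q v)\<^sup>2) * indicator S v"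
      using qS[of v] by (cases "q v = 0") (auto simp: indicator_def)
  qed
  also have "\<dots> = (\<integral>\<^sup>+u. ennreal (artanh (s / c * sqrt (((rho / T)\<^sup>2 + (tan u)\<^sup>2) / (1 - (rho / T)\<^sup>2))) / 2) *
       indicator {0..arctan (s / (c * T) / (s / c))} u \<partial>lborel)"
    unfolding q_def S_def by (rule nn_integral_frustum_prism) (use ne prism_param in auto)
  finally show ?thesis .
qed

end

lemma power2_le_iff_nonneg: "0 \<le> x \<Longrightarrow> 0 \<le> y \<Longrightarrow> x\<^sup>2 \<le> y\<^sup>2 \<longleftrightarrow> x \<le> (y :: real)"
  by (simp add: abs_le_square_iff[symmetric])

context orthoscheme_frame
begin

lemma tanh_le_iff:
  assumes "0 \<le> h"
  shows "sinh h \<le> s / rho \<longleftrightarrow> tanh h \<le> s / (c * T)"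
proof -
  note ne = s rho(1) c T
  have ch: "0 < cosh h" by (rule cosh_real_pos)
  have sh: "0 \<le> sinh h" using assms by simp
  have st: "0 < s / (c * T)" using ne by simp
  have "sinh h \<le> s / rho \<longleftrightarrow> (sinh h)\<^sup>2 \<le> (s / rho)\<^sup>2"
    using sh ne by (intro power2_le_iff_nonneg[symmetric]) auto
  also have "\<dots> \<longleftrightarrow> rho\<^sup>2 * (sinh h)\<^sup>2 \<le> s\<^sup>2"
    using ne by (simp add: power_divide pos_le_divide_eq mult.commute)
  also have "\<dots> \<longleftrightarrow> (c * T)\<^sup>2 * (sinh h)\<^sup>2 \<le> s\<^sup>2 * (cosh h)\<^sup>2"
    unfolding rho(2) cosh_square_eq by (simp add: algebra_simps)
  also have "\<dots> \<longleftrightarrow> (c * T * sinh h)\<^sup>2 \<le> (s * cosh h)\<^sup>2" by (simp add: power_mult_distrib)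
  also have "\<dots> \<longleftrightarrow> c * T * sinh h \<le> s * cosh h"
    using sh ch ne by (intro power2_le_iff_nonneg) auto
  also have "\<dots> \<longleftrightarrow> tanh h \<le> s / (c * T)"
    using ch ne by (simp add: tanh_def field_simps)
  finally show ?thesis .
qed

text \<open>By \<open>sh\<close> the hyperball stays below the face \<open>A 0\<close>,
  \<open>A 1\<close>, \<open>A 2\<close>, so its part in the frustum is a full hyperball over the
  base triangle. The difference of arctangents is the area \<gamma> - \<alpha> of that triangle,
  whose angles are \<alpha>, \<pi>/2 and \<pi>/2 - \<gamma>.\<close>

lemma emeasure_frustum_hyperball:
  assumes h: "0 \<le> h" and sh: "sinh h \<le> s / rho"
  shows "emeasure hyp_measure (frustum A \<inter> hyperball (A 3) (A 0) h) =
    ennreal ((h / 2 + sinh (2 * h) / 4) * (arctan (c / s) - arctan (1 / T)))"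
proof -
  note ne = s rho(1) c T
  define q :: "real \<times> real \<times> real \<Rightarrow> real" where "q v = 1 - (fst v)\<^sup>2 - (fst (snd v))\<^sup>2 - (snd (snd v))\<^sup>2" for v
  define S where "S = {(x, y, z). 0 \<le> x \<and> x \<le> rho / T \<and> 0 \<le> y \<and> y \<le> s / c * x \<and> 0 \<le> z \<and> z \<le> tanh h * sqrt (1 - x\<^sup>2 - y\<^sup>2)}"
  have S: "S \<in> sets borel"
  proof -
    have "S = {v \<in> space (borel \<Otimes>\<^sub>M (borel \<Otimes>\<^sub>M borel)). 0 \<le> fst v \<and> fst v \<le> rho / T \<and> 0 \<le> fst (snd v) \<and>
       fst (snd v) \<le> s / c * fst v \<and> 0 \<le> snd (snd v) \<and> snd (snd v) \<le> tanh h * sqrt (1 - (fst v)\<^sup>2 - (fst (snd v))\<^sup>2)}"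
      by (auto simp: space_pair_measure S_def)
    also have "\<dots> \<in> sets (borel \<Otimes>\<^sub>M (borel \<Otimes>\<^sub>M borel))" by measurable
    finally show ?thesis unfolding borel_prod .
  qed
  have q: "q \<in> borel_measurable borel"
    unfolding q_def by (intro borel_measurable_continuous_onI continuous_intros)
  have th: "0 \<le> tanh h" "tanh h < 1" using h by (auto simp: tanh_real_lt_1)
  have prism: "(1 + (s / c)\<^sup>2) * (rho / T)\<^sup>2 < 1"
  proof -
    have "0 < (s / (c * T))\<^sup>2" using ne by simp
    then show ?thesis using prism_param by linarith
  qed
  have xy: "0 < 1 - x\<^sup>2 - y\<^sup>2" "s / (c * T) \<le> sqrt (1 - x\<^sup>2 - y\<^sup>2)"
    if "0 \<le> x" "x \<le> rho / T" "0 \<le> y" "y \<le> s / c * x" for x y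
  proof -
    have "y\<^sup>2 \<le> (s / c * x)\<^sup>2" using that by (intro power_mono)
    moreover have "x\<^sup>2 + (s / c * x)\<^sup>2 = (1 + (s / c)\<^sup>2) * x\<^sup>2" by (simp add: power_mult_distrib power_divide algebra_simps)
    moreover have "(1 + (s / c)\<^sup>2) * x\<^sup>2 \<le> (1 + (s / c)\<^sup>2) * (rho / T)\<^sup>2" using that by (intro mult_left_mono power_mono) auto
    ultimately have *: "(s / (c * T))\<^sup>2 \<le> 1 - x\<^sup>2 - y\<^sup>2" using prism_param by linarith
    then show "s / (c * T) \<le> sqrt (1 - x\<^sup>2 - y\<^sup>2)" by (rule real_le_rsqrt)
    have "0 < (s / (c * T))\<^sup>2" using ne by simp
    then show "0 < 1 - x\<^sup>2 - y\<^sup>2" using * by linarith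
  qed
  have pos: "0 < q v" if "v \<in> S" for v
  proof -
    obtain x y z where v: "v = (x, y, z)" by (cases v)
    have b: "0 \<le> x" "x \<le> rho / T" "0 \<le> y" "y \<le> s / c * x" "0 \<le> z" "z \<le> tanh h * sqrt (1 - x\<^sup>2 - y\<^sup>2)" using that by (auto simp: v S_def)
    note p = xy(1)[OF b(1-4)]
    have "tanh h * sqrt (1 - x\<^sup>2 - y\<^sup>2) < 1 * sqrt (1 - x\<^sup>2 - y\<^sup>2)" using th p by (intro mult_strict_right_mono) auto
    then have "z < sqrt (1 - x\<^sup>2 - y\<^sup>2)" using b by linarith
    then have "z\<^sup>2 < (sqrt (1 - x\<^sup>2 - y\<^sup>2))\<^sup>2" using b by (intro power_strict_mono) auto
    then show ?thesis using p by (simp add: q_def v)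
  qed
  have ball: "sd (chart (fv t x y z)) \<le> sinh h \<longleftrightarrow> z \<le> tanh h * sqrt (t\<^sup>2 - x\<^sup>2 - y\<^sup>2)"
    if f: "future (fv t x y z)" and z: "0 \<le> z" for t x y z
  proof -
    define N where "N = sqrt (t\<^sup>2 - x\<^sup>2 - y\<^sup>2 - z\<^sup>2)"
    have N: "0 < N" "N\<^sup>2 = t\<^sup>2 - x\<^sup>2 - y\<^sup>2 - z\<^sup>2" using f by (auto simp: future_fv N_def)
    have ch: "0 < cosh h" by (rule cosh_real_pos)
    have sh: "0 \<le> sinh h" using h by simp
    have "sd (chart (fv t x y z)) = z / N"
      unfolding sd_chart[OF f] lorentz_fv_b3 lorentz_fv using ne by (simp add: N_def algebra_simps)
    then have "sd (chart (fv t x y z)) \<le> sinh h \<longleftrightarrow> z \<le> sinh h * N" using N by (simp add: pos_divide_le_eq)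
    also have "\<dots> \<longleftrightarrow> z\<^sup>2 \<le> (sinh h * N)\<^sup>2"
      using z sh N by (intro power2_le_iff_nonneg[symmetric]) auto
    also have "\<dots> \<longleftrightarrow> (cosh h)\<^sup>2 * z\<^sup>2 \<le> (sinh h)\<^sup>2 * (t\<^sup>2 - x\<^sup>2 - y\<^sup>2)"
      unfolding power_mult_distrib N(2) cosh_square_eq by (simp add: algebra_simps)
    also have "\<dots> \<longleftrightarrow> z\<^sup>2 \<le> (tanh h)\<^sup>2 * (t\<^sup>2 - x\<^sup>2 - y\<^sup>2)"
      using ch by (simp add: tanh_def power_divide field_simps)
    also have "\<dots> \<longleftrightarrow> z\<^sup>2 \<le> (tanh h * sqrt (t\<^sup>2 - x\<^sup>2 - y\<^sup>2))\<^sup>2"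
    proof -
      have "0 \<le> t\<^sup>2 - x\<^sup>2 - y\<^sup>2" using N zero_le_power2[of N] zero_le_power2[of z] by linarith
      then show ?thesis by (simp add: power_mult_distrib)
    qed
    also have "\<dots> \<longleftrightarrow> z \<le> tanh h * sqrt (t\<^sup>2 - x\<^sup>2 - y\<^sup>2)"
    proof -
      have "0 \<le> t\<^sup>2 - x\<^sup>2 - y\<^sup>2" using N zero_le_power2[of N] zero_le_power2[of z] by linarith
      then show ?thesis using z th by (intro power2_le_iff_nonneg) auto
    qed
    finally show ?thesis .
  qed
  have S3: "frustum A \<inter> hyperball (A 3) (A 0) h \<in> sets borel" "frustum A \<inter> hyperball (A 3) (A 0) h \<subseteq> H3"
    using sets_frustum sets_hyperball[OF h] frustum_subset by auto
  have mem: "0 < fst v \<and> chart v \<in> frustum A \<inter> hyperball (A 3) (A 0) h \<longleftrightarrow> future v \<and> in_frustum v \<and> sd (chart v) \<le> sinh h" for v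
  proof -
    have "x \<in> frustum A \<Longrightarrow> x \<in> hyperball (A 3) (A 0) h \<longleftrightarrow> sd x \<le> sinh h" for x
      unfolding frustum_A hyperball_A[OF h] by auto
    then show ?thesis using chart_in_frustum_iff[of v] by blast
  qed
  have "emeasure hyp_measure (frustum A \<inter> hyperball (A 3) (A 0) h) = ennreal 1 * (\<integral>\<^sup>+v. ennreal (1 / (q v)\<^sup>2) * indicator S v \<partial>lborel)"
  proof (rule emeasure_hyp_measure_chart[OF S3 S q pos])
    show "\<bar>det (gram4 f0 f1 f2 f3)\<bar> = 1\<^sup>2" by (rule det_f)
    fix y :: "real \<times> real \<times> real"
    obtain x' y' z' where y: "y = (x', y', z')" by (cases y)
    show "- lorentz (frame_map f0 f1 f2 f3 (1, y)) (frame_map f0 f1 f2 f3 (1, y)) = q y"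
      unfolding y frame_map_fv lorentz_fv q_def by simp
    fix a :: real
    show "0 < fst (frame_map f0 f1 f2 f3 (a, y)) \<and> chart (frame_map f0 f1 f2 f3 (a, y)) \<in> frustum A \<inter> hyperball (A 3) (A 0) h
       \<longleftrightarrow> 0 < a \<and> y /\<^sub>R a \<in> S"
    proof (cases "0 < a")
      case True
      have x0: "0 \<le> s / c * x' \<longleftrightarrow> 0 \<le> x'" using ne by (simp add: zero_le_mult_iff zero_le_divide_iff)
      have sq: "sqrt (1 - (inverse a * x')\<^sup>2 - (inverse a * y')\<^sup>2) = inverse a * sqrt (a\<^sup>2 - x'\<^sup>2 - y'\<^sup>2)"
      proof -
        have "1 - (inverse a * x')\<^sup>2 - (inverse a * y')\<^sup>2 = (inverse a)\<^sup>2 * (a\<^sup>2 - x'\<^sup>2 - y'\<^sup>2)"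
          using True by (simp add: sq_div power_inverse field_simps)
        then show ?thesis using True by (simp add: real_sqrt_mult)
      qed
      have Sy: "y /\<^sub>R a \<in> S \<longleftrightarrow> 0 \<le> y' \<and> y' \<le> s / c * x' \<and> x' \<le> rho / T * a \<and> 0 \<le> z' \<and> z' \<le> tanh h * sqrt (a\<^sup>2 - x'\<^sup>2 - y'\<^sup>2)"
      proof -
        have 1: "inverse a * y' \<le> s / c * (inverse a * x') \<longleftrightarrow> y' \<le> s / c * x'"
          using True by (simp add: field_simps)
        have 2: "inverse a * x' \<le> rho / T \<longleftrightarrow> x' \<le> rho / T * a"
          using True by (simp add: field_simps)
        have 3: "inverse a * z' \<le> tanh h * (inverse a * r) \<longleftrightarrow> z' \<le> tanh h * r" for r
          using True by (simp add: field_simps)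
        have 4: "0 \<le> inverse a * r \<longleftrightarrow> 0 \<le> r" for r using True by (simp add: zero_le_mult_iff)
        have "0 \<le> y' \<Longrightarrow> y' \<le> s / c * x' \<Longrightarrow> 0 \<le> x'" using x0 order_trans by blast
        then show ?thesis
          unfolding y S_def scaleR_Pair real_scaleR_def mem_Collect_eq case_prod_conv sq 1 2 3 4 by blast
      qed
      show ?thesis
      proof
        assume L: "0 < fst (frame_map f0 f1 f2 f3 (a, y)) \<and> chart (frame_map f0 f1 f2 f3 (a, y)) \<in> frustum A \<inter> hyperball (A 3) (A 0) h"
        then show "0 < a \<and> y /\<^sub>R a \<in> S"
          unfolding mem unfolding y frame_map_fv in_frustum_fv using ball Sy True unfolding y by blast
      next
        assume R: "0 < a \<and> y /\<^sub>R a \<in> S"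
        then have "0 < q (y /\<^sub>R a)" using pos by blast
        moreover have "q (y /\<^sub>R a) = (a\<^sup>2 - (x'\<^sup>2 + y'\<^sup>2 + z'\<^sup>2)) / a\<^sup>2"
          using True by (simp add: y q_def sq_div diff_divide_distrib add_divide_distrib)
        ultimately have f: "future (fv a x' y' z')" using True by (simp add: future_fv zero_less_divide_iff)
        have Sy': "0 \<le> y'" "y' \<le> s / c * x'" "x' \<le> rho / T * a" "0 \<le> z'" "z' \<le> tanh h * sqrt (a\<^sup>2 - x'\<^sup>2 - y'\<^sup>2)"
          using R Sy by blast+
        \<comment> \<open>In this chart the hypersphere is highest over the foot of
          \<open>A 2\<close>, and by the width condition it does not exceed the top face
          there.\<close>
        have "z' \<le> s / (c * T) * a"
        proof -
          have "sqrt (a\<^sup>2 - x'\<^sup>2 - y'\<^sup>2) \<le> a" using True by (intro real_le_lsqrt) auto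
          moreover have "0 \<le> a\<^sup>2 - x'\<^sup>2 - y'\<^sup>2"
            using f zero_le_power2[of z'] unfolding future_fv by linarith
          moreover have "tanh h \<le> s / (c * T)" using sh tanh_le_iff[OF h] by blast
          ultimately have "tanh h * sqrt (a\<^sup>2 - x'\<^sup>2 - y'\<^sup>2) \<le> s / (c * T) * a"
            using ne by (intro mult_mono) auto
          with Sy' show ?thesis by linarith
        qed
        then show "0 < fst (frame_map f0 f1 f2 f3 (a, y)) \<and> chart (frame_map f0 f1 f2 f3 (a, y)) \<in> frustum A \<inter> hyperball (A 3) (A 0) h"
          unfolding mem unfolding y frame_map_fv in_frustum_fv using f ball[OF f Sy'(4)] Sy' by blast
      qed
    next
      case False
      then show ?thesis unfolding mem unfolding y frame_map_fv future_fv by simp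
    qed
  qed auto
  also have "(\<integral>\<^sup>+v. ennreal (1 / (q v)\<^sup>2) * indicator S v \<partial>lborel) =
     ennreal ((h / 2 + sinh (2 * h) / 4) * (arctan (1 / (s / c)) - arctan (sqrt (1 - (1 + (s / c)\<^sup>2) * (rho / T)\<^sup>2) / (s / c))))"
    unfolding q_def S_def by (rule nn_integral_hyper_prism) (use ne prism h in auto)
  also have "sqrt (1 - (1 + (s / c)\<^sup>2) * (rho / T)\<^sup>2) = s / (c * T)"
  proof -
    have "1 - (1 + (s / c)\<^sup>2) * (rho / T)\<^sup>2 = (s / (c * T))\<^sup>2" using prism_param by linarith
    then show ?thesis using ne by (simp only: real_sqrt_abs) simp
  qed
  also have "s / (c * T) / (s / c) = 1 / T" using ne by simp
  finally show ?thesis by simp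
qed

end

section \<open>The cusp cut off by a horosphere\<close>

lemma nn_integral_cusp_column:
  fixes r z :: real
  assumes z: "z > 0"
  shows "(\<integral>\<^sup>+w. ennreal (1 / (w - r)\<^sup>2) * indicator {r + z\<^sup>2..} w \<partial>lborel) = ennreal (1 / z\<^sup>2)"
proof -
  have z2: "0 < z\<^sup>2" using z by simp
  have "(\<integral>\<^sup>+w. ennreal (1 / (w - r)\<^sup>2) * indicator {r + z\<^sup>2..} w \<partial>lborel) = ennreal (0 - - (1 / (r + z\<^sup>2 - r)))"
  proof (rule nn_integral_FTC_atLeast)
    show "((\<lambda>w. - (1 / (w - r))) \<longlongrightarrow> 0) at_top" by real_asymp
    fix w assume "r + z\<^sup>2 \<le> w"
    then have "w - r \<noteq> 0" using z2 by auto
    then show "((\<lambda>w. - (1 / (w - r))) has_real_derivative 1 / (w - r)\<^sup>2) (at w)"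
      by (auto intro!: derivative_eq_intros simp: power2_eq_square)
  qed auto
  then show ?thesis by simp
qed

text \<open>The coordinate \<open>w\<close> is the squared distance from the origin, and every
  vertical column has the same integral \<open>1 / z\<^sup>2\<close>; so only the area
  \<open>c\<^sup>2 * T / 2\<close> of the horizontal triangle enters.\<close>

lemma nn_integral_cusp_triangle:
  fixes c T z :: real
  assumes c: "c > 0" and T: "T > 0" and z: "z > 0"
  shows "(\<integral>\<^sup>+v. ennreal (1 / (snd (snd v) - (fst v)\<^sup>2 - (fst (snd v))\<^sup>2)\<^sup>2) *
      indicator {(x, y, w). 0 \<le> y \<and> y \<le> T * x \<and> x \<le> c \<and> x\<^sup>2 + y\<^sup>2 + z\<^sup>2 \<le> w} v \<partial>lborel) = ennreal (c\<^sup>2 * T / (2 * z\<^sup>2))"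
    (is "(\<integral>\<^sup>+v. ?f v * indicator ?S v \<partial>lborel) = _")
proof -
  have [measurable]: "?S \<in> sets (borel \<Otimes>\<^sub>M (borel \<Otimes>\<^sub>M borel))"
  proof -
    have "?S = {v \<in> space (borel \<Otimes>\<^sub>M (borel \<Otimes>\<^sub>M borel)). 0 \<le> fst (snd v) \<and> fst (snd v) \<le> T * fst v \<and> fst v \<le> c \<and>
       (fst v)\<^sup>2 + (fst (snd v))\<^sup>2 + z\<^sup>2 \<le> snd (snd v)}"
      by (auto simp: space_pair_measure)
    also have "\<dots> \<in> sets (borel \<Otimes>\<^sub>M (borel \<Otimes>\<^sub>M borel))" by measurable
    finally show ?thesis .
  qed
  have "(\<lambda>v. ?f v * indicator ?S v) \<in> borel_measurable (borel \<Otimes>\<^sub>M (borel \<Otimes>\<^sub>M borel))" by measurable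
  then have "(\<lambda>v. ?f v * indicator ?S v) \<in> borel_measurable borel" by (simp add: borel_prod)
  then have "(\<integral>\<^sup>+v. ?f v * indicator ?S v \<partial>lborel) = (\<integral>\<^sup>+x. \<integral>\<^sup>+y. \<integral>\<^sup>+w. ?f (x, y, w) * indicator ?S (x, y, w) \<partial>lborel \<partial>lborel \<partial>lborel)"
    by (rule nn_integral_lborel_triple)
  also have "\<dots> = (\<integral>\<^sup>+x. ennreal (T * x / z\<^sup>2) * indicator {0..c} x \<partial>lborel)"
  proof (rule nn_integral_cong)
    fix x
    have "(\<integral>\<^sup>+w. ?f (x, y, w) * indicator ?S (x, y, w) \<partial>lborel) = indicator {0..T * x} y * indicator {0..c} x * ennreal (1 / z\<^sup>2)" for y
    proof -
      have "?f (x, y, w) * indicator ?S (x, y, w) = indicator {0..T * x} y * indicator {0..c} x *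
         (ennreal (1 / (w - (x\<^sup>2 + y\<^sup>2))\<^sup>2) * indicator {(x\<^sup>2 + y\<^sup>2) + z\<^sup>2..} w)" for w
      proof -
        have "0 \<le> y \<Longrightarrow> y \<le> T * x \<Longrightarrow> 0 \<le> x" using T by (meson order_trans zero_le_mult_iff not_less)
        then show ?thesis by (auto simp: indicator_def diff_diff_eq)
      qed
      then show ?thesis by (simp add: nn_integral_cmult nn_integral_cusp_column[OF z])
    qed
    then have "(\<integral>\<^sup>+y. \<integral>\<^sup>+w. ?f (x, y, w) * indicator ?S (x, y, w) \<partial>lborel \<partial>lborel)
      = (\<integral>\<^sup>+y. (indicator {0..c} x * ennreal (1 / z\<^sup>2)) * indicator {0..T * x} y \<partial>lborel)"
      by (simp add: mult_ac)
    also have "\<dots> = (indicator {0..c} x * ennreal (1 / z\<^sup>2)) * emeasure lborel {0..T * x}"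
      by (rule nn_integral_cmult_indicator) simp
    also have "\<dots> = ennreal (T * x / z\<^sup>2) * indicator {0..c} x"
      using T by (cases "x \<in> {0..c}") (simp_all add: ennreal_mult''[symmetric] mult.commute)
    finally show "(\<integral>\<^sup>+y. \<integral>\<^sup>+w. ?f (x, y, w) * indicator ?S (x, y, w) \<partial>lborel \<partial>lborel) = ennreal (T * x / z\<^sup>2) * indicator {0..c} x" .
  qed
  also have "\<dots> = ennreal (T * c\<^sup>2 / (2 * z\<^sup>2) - T * 0\<^sup>2 / (2 * z\<^sup>2))"
    by (rule nn_integral_FTC_closed[where F="\<lambda>x. T * x\<^sup>2 / (2 * z\<^sup>2)"])
      (use c T z in \<open>auto intro!: derivative_eq_intros simp: field_simps\<close>)
  finally show ?thesis by (simp add: mult.commute)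
qed

context orthoscheme_frame
begin

text \<open>A horosphere at height at least 1 and at least \<open>rho\<close> lies above both
  hemispheres, so it cuts off the full column over the triangle. The Gram determinant - 1 / 4 of the
  null frame contributes a factor 1 / 2.\<close>

lemma emeasure_frustum_horoball:
  assumes z1: "1 \<le> z0 b" and zr: "rho \<le> z0 b"
  shows "emeasure hyp_measure (frustum A \<inter> horoball (A 0) b) = ennreal (c\<^sup>2 * T / (4 * (z0 b)\<^sup>2))"
proof -
  define z where "z = z0 b"
  have z: "1 \<le> z" "rho \<le> z" "0 < z" using z1 zr by (auto simp: z_def)
  define q :: "real \<times> real \<times> real \<Rightarrow> real" where "q v = snd (snd v) - (fst v)\<^sup>2 - (fst (snd v))\<^sup>2" for v
  define S where "S = {(x, y, w). 0 \<le> y \<and> y \<le> T * x \<and> x \<le> c \<and> x\<^sup>2 + y\<^sup>2 + z\<^sup>2 \<le> w}"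
  have S: "S \<in> sets borel"
  proof -
    have "S = {v \<in> space (borel \<Otimes>\<^sub>M (borel \<Otimes>\<^sub>M borel)). 0 \<le> fst (snd v) \<and> fst (snd v) \<le> T * fst v \<and> fst v \<le> c \<and>
       (fst v)\<^sup>2 + (fst (snd v))\<^sup>2 + z\<^sup>2 \<le> snd (snd v)}"
      by (auto simp: space_pair_measure S_def)
    also have "\<dots> \<in> sets (borel \<Otimes>\<^sub>M (borel \<Otimes>\<^sub>M borel))" by measurable
    finally show ?thesis unfolding borel_prod .
  qed
  have q: "q \<in> borel_measurable borel"
    unfolding q_def by (intro borel_measurable_continuous_onI continuous_intros)
  have pos: "0 < q v" if "v \<in> S" for v
  proof -
    obtain x y w where v: "v = (x, y, w)" by (cases v)
    have "x\<^sup>2 + y\<^sup>2 + z\<^sup>2 \<le> w" using that by (simp add: v S_def)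
    moreover have "0 < z\<^sup>2" using z by simp
    ultimately show ?thesis unfolding q_def v fst_conv snd_conv by linarith
  qed
  have S3: "frustum A \<inter> horoball (A 0) b \<in> sets borel" "frustum A \<inter> horoball (A 0) b \<subseteq> H3"
    using sets_frustum sets_horoball frustum_subset by auto
  have mem: "0 < fst v \<and> chart v \<in> frustum A \<inter> horoball (A 0) b \<longleftrightarrow> future v \<and> in_frustum v \<and> z \<le> height (chart v)" for v
    using chart_in_frustum_iff[of v] frustum_subset by (auto simp: horoball_A z_def)
  have mem1: "future (mk 1 x y w) \<and> in_frustum (mk 1 x y w) \<and> z \<le> height (chart (mk 1 x y w)) \<longleftrightarrow> (x, y, w) \<in> S" for x y w
  proof
    assume L: "future (mk 1 x y w) \<and> in_frustum (mk 1 x y w) \<and> z \<le> height (chart (mk 1 x y w))"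
    then have f: "future (mk 1 x y w)" by blast
    from L have "z \<le> sqrt (w - x\<^sup>2 - y\<^sup>2)" unfolding height_mk[OF f] by blast
    then have "z\<^sup>2 \<le> (sqrt (w - x\<^sup>2 - y\<^sup>2))\<^sup>2" using z by (intro power_mono) auto
    also have "\<dots> = w - x\<^sup>2 - y\<^sup>2" using L by (simp add: future_mk_iff)
    finally show "(x, y, w) \<in> S" using L by (simp add: S_def in_frustum_def)
  next
    assume "(x, y, w) \<in> S"
    then have R: "0 \<le> y" "y \<le> T * x" "x \<le> c" "x\<^sup>2 + y\<^sup>2 + z\<^sup>2 \<le> w" by (auto simp: S_def)
    have z2: "1 \<le> z\<^sup>2" "rho\<^sup>2 \<le> z\<^sup>2" using z rho(1) by (auto intro: power_mono simp: one_le_power)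
    have f: "future (mk 1 x y w)" using R z2 by (intro future_mk) linarith
    have h: "z \<le> height (chart (mk 1 x y w))"
      unfolding height_mk[OF f] using R by (intro real_le_rsqrt) linarith
    have w1: "1 \<le> w" using R z2 zero_le_power2[of x] zero_le_power2[of y] by linarith
    \<comment> \<open>A point no lower than the apex is not inside the hemisphere around (c, c
      T).\<close>
    have "0 \<le> (x - c)\<^sup>2 + (y - c * T)\<^sup>2" by simp
    also have "\<dots> = x\<^sup>2 + y\<^sup>2 - 2 * c * x - 2 * c * T * y + rho\<^sup>2 + (s\<^sup>2 + c\<^sup>2)"
      unfolding rho(2) by (simp add: power2_eq_square algebra_simps)
    also have "\<dots> \<le> w - 2 * c * x - 2 * c * T * y + 1" using R z2 sc by linarith
    finally have "lorentz (mk 1 x y w) b3 \<le> 0" by (simp add: lorentz_b3 algebra_simps)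
    then show "future (mk 1 x y w) \<and> in_frustum (mk 1 x y w) \<and> z \<le> height (chart (mk 1 x y w))"
      using f h w1 R by (simp add: in_frustum_def)
  qed
  have fm: "frame_map g0 g1 g2 g3 (a, x, y, w) = mk a x y w" for a x y w
    by (simp add: frame_map_def mk_def)
  have "emeasure hyp_measure (frustum A \<inter> horoball (A 0) b) = ennreal (1 / 2) * (\<integral>\<^sup>+v. ennreal (1 / (q v)\<^sup>2) * indicator S v \<partial>lborel)"
  proof (rule emeasure_hyp_measure_chart[OF S3 S q pos])
    show "\<bar>det (gram4 g0 g1 g2 g3)\<bar> = (1 / 2)\<^sup>2" by (simp add: det_gram power_divide)
    fix y :: "real \<times> real \<times> real"
    obtain x' y' w' where y: "y = (x', y', w')" by (cases y)
    show "- lorentz (frame_map g0 g1 g2 g3 (1, y)) (frame_map g0 g1 g2 g3 (1, y)) = q y"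
      unfolding y fm lorentz_mk q_def by (simp add: power2_eq_square)
    fix a :: real
    show "0 < fst (frame_map g0 g1 g2 g3 (a, y)) \<and> chart (frame_map g0 g1 g2 g3 (a, y)) \<in> frustum A \<inter> horoball (A 0) b
       \<longleftrightarrow> 0 < a \<and> y /\<^sub>R a \<in> S"
    proof (cases "0 < a")
      case True
      define u where "u = mk 1 (inverse a * x') (inverse a * y') (inverse a * w')"
      have eq: "frame_map g0 g1 g2 g3 (a, y) = a *\<^sub>R u"
        using True by (simp add: y fm u_def mk_def scaleR_add_right mult.assoc[symmetric])
      have "0 < fst (a *\<^sub>R u) \<and> chart (a *\<^sub>R u) \<in> frustum A \<inter> horoball (A 0) b \<longleftrightarrow>
          0 < fst u \<and> chart u \<in> frustum A \<inter> horoball (A 0) b"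
        using True by (simp add: zero_less_mult_iff)
      also have "\<dots> \<longleftrightarrow> y /\<^sub>R a \<in> S" unfolding mem unfolding u_def mem1 by (simp add: y)
      finally show ?thesis unfolding eq using True by blast
    next
      case False
      then have "\<not> future (mk a x' y' w')" using future_ca[of "mk a x' y' w'"] by auto
      then show ?thesis unfolding mem unfolding y fm using False by blast
    qed
  qed auto
  also have "(\<integral>\<^sup>+v. ennreal (1 / (q v)\<^sup>2) * indicator S v \<partial>lborel) = ennreal (c\<^sup>2 * T / (2 * z\<^sup>2))"
    unfolding q_def S_def by (rule nn_integral_cusp_triangle) (use c T z in auto)
  also have "ennreal (1 / 2) * ennreal (c\<^sup>2 * T / (2 * z\<^sup>2)) = ennreal (c\<^sup>2 * T / (4 * z\<^sup>2))"
    using T by (subst ennreal_mult'[symmetric]) auto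
  finally show ?thesis by (simp add: z_def)
qed

text \<open>Subadditivity gives the upper bound without any discussion of contact; the strict
  separation makes the two pieces disjoint and the sum exact.\<close>

lemma hyp_vol_frustum_union_le:
  assumes z1: "1 \<le> z0 b" and zr: "rho \<le> z0 b" and h: "0 \<le> h" and sh: "sinh h \<le> s / rho"
  shows "hyp_vol (frustum A \<inter> (horoball (A 0) b \<union> hyperball (A 3) (A 0) h)) \<le>
      c\<^sup>2 * T / (4 * (z0 b)\<^sup>2) + (h / 2 + sinh (2 * h) / 4) * (arctan (c / s) - arctan (1 / T))" (is "_ \<le> ?a + ?b")
    and "rho * exp h < z0 b \<Longrightarrow> hyp_vol (frustum A \<inter> (horoball (A 0) b \<union> hyperball (A 3) (A 0) h)) =
      c\<^sup>2 * T / (4 * (z0 b)\<^sup>2) + (h / 2 + sinh (2 * h) / 4) * (arctan (c / s) - arctan (1 / T))"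
proof -
  let ?a = "c\<^sup>2 * T / (4 * (z0 b)\<^sup>2)" and ?b = "(h / 2 + sinh (2 * h) / 4) * (arctan (c / s) - arctan (1 / T))"
  let ?X = "frustum A \<inter> horoball (A 0) b" and ?Y = "frustum A \<inter> hyperball (A 3) (A 0) h"
  note X = emeasure_frustum_horoball[OF z1 zr] and Y = emeasure_frustum_hyperball[OF h sh]
  have m: "?X \<in> sets hyp_measure" "?Y \<in> sets hyp_measure"
    using sets_frustum sets_horoball sets_hyperball[OF h] by auto
  have a: "0 \<le> ?a" using T by simp
  have b: "0 \<le> ?b"
  proof -
    have "arctan (1 / T) \<le> arctan (c / s)" using scT T s by (simp add: arctan_le_iff field_simps)
    then show ?thesis using h by simp
  qed
  have eq: "frustum A \<inter> (horoball (A 0) b \<union> hyperball (A 3) (A 0) h) = ?X \<union> ?Y" by auto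
  have fX: "?X \<in> fmeasurable hyp_measure" and fY: "?Y \<in> fmeasurable hyp_measure"
    using m X Y by (auto intro!: fmeasurableI)
  have mX: "measure hyp_measure ?X = ?a" using X a by (simp add: measure_def)
  have mY: "measure hyp_measure ?Y = ?b" using Y b by (simp add: measure_def)
  show "hyp_vol (frustum A \<inter> (horoball (A 0) b \<union> hyperball (A 3) (A 0) h)) \<le> ?a + ?b"
    unfolding hyp_vol_def eq using measure_Un_le[OF m] mX mY by linarith
  assume "rho * exp h < z0 b"
  then have "?X \<inter> ?Y = {}"
    using hyperball_height[of _ h] by (force simp: horoball_A hyperball_A[OF h])
  then show "hyp_vol (frustum A \<inter> (horoball (A 0) b \<union> hyperball (A 3) (A 0) h)) = ?a + ?b"
    unfolding hyp_vol_def eq using measure_Un3[OF fX fY] mX mY by simp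
qed

end

section \<open>Normal form of the orthoschemes\<close>

definition unit_normal :: "(nat \<Rightarrow> hvec) \<Rightarrow> nat \<Rightarrow> hvec \<Rightarrow> bool" where
  "unit_normal A i u \<longleftrightarrow> inward_normal A i u \<and> lorentz u u = 1"

lemma has_dihedral_angleE:
  assumes "has_dihedral_angle A i j \<theta>"
  obtains u v where "unit_normal A i u" "unit_normal A j v" "lorentz u v = - cos \<theta>"
proof -
  obtain u v where uv: "inward_normal A i u" "inward_normal A j v" "0 < lorentz u u" "0 < lorentz v v"
      "lorentz u v / (sqrt (lorentz u u) * sqrt (lorentz v v)) = cos (pi - \<theta>)"
    using assms by (auto simp: has_dihedral_angle_def)
  let ?u = "(1 / sqrt (lorentz u u)) *\<^sub>R u" and ?v = "(1 / sqrt (lorentz v v)) *\<^sub>R v"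
  have "unit_normal A i ?u" "unit_normal A j ?v"
    using uv by (auto simp: unit_normal_def inward_normal_def)
  moreover have "lorentz ?u ?v = - cos \<theta>"
    using uv(5) by (simp add: cos_diff mult.commute)
  ultimately show ?thesis using that by blast
qed

lemma has_dihedral_angleI:
  assumes "unit_normal A i u" "unit_normal A j v" "lorentz u v = - cos \<theta>" "0 \<le> \<theta>" "\<theta> \<le> pi"
  shows "has_dihedral_angle A i j \<theta>"
  using assms unfolding has_dihedral_angle_def unit_normal_def
  by (intro conjI exI[of _ u] exI[of _ v]) (simp_all add: cos_diff)

lemma lorentz_span_zero:
  assumes "span S = UNIV" and "\<And>x. x \<in> S \<Longrightarrow> lorentz w x = 0"
  shows "w = 0"
proof -
  have z: "lorentz w x = 0" for x
  proof -
    have "x \<in> span S" using assms(1) by simp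
    then show ?thesis
    proof (induction rule: span_induct)
      case base
      show ?case by (auto simp: subspace_def)
    qed (rule assms(2))
  qed
  \<comment> \<open>Reversing the time coordinate turns the form into the Euclidean square norm, so
    the form is nondegenerate.\<close>
  have "lorentz w (- fst w, snd w) = snd w \<bullet> snd w + fst w * fst w" by (simp add: lorentz_def)
  then have "snd w \<bullet> snd w + fst w * fst w = 0" using z by simp
  then have "snd w \<bullet> snd w = 0" "fst w * fst w = 0"
    using inner_ge_zero[of "snd w"] zero_le_square[of "fst w"] by linarith+
  then show ?thesis by (simp add: prod_eq_iff)
qed

text \<open>Every dihedral angle comes with its own existential pair of normals. Uniqueness
  identifies the normals of a face across the six angles and so gives one Gram matrix.\<close>

lemma unit_normal_unique:
  assumes ind: "inj_on A {..<4}" "independent (A ` {..<4})" and "i < 4"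
    and u: "unit_normal A i u" and v: "unit_normal A i v"
  shows "u = v"
proof -
  have "card (A ` {..<4}) = 4" using ind(1) by (simp add: card_image)
  then have sp: "span (A ` {..<4}) = UNIV"
    using ind(2) dim_eq_full[of "A ` {..<4}"] by (simp add: dim_eq_card_independent)
  define k where "k = lorentz v (A i) / lorentz u (A i)"
  have pos: "0 < lorentz u (A i)" "0 < lorentz v (A i)"
    using u v by (auto simp: unit_normal_def inward_normal_def)
  then have k: "0 < k" by (simp add: k_def)
  have "v - k *\<^sub>R u = 0"
  proof (rule lorentz_span_zero[OF sp])
    fix x assume "x \<in> A ` {..<4}"
    then obtain j where j: "j < 4" "x = A j" by auto
    then show "lorentz (v - k *\<^sub>R u) x = 0"
      using u v pos by (cases "j = i") (auto simp: unit_normal_def inward_normal_def k_def)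
  qed
  then have vk: "v = k *\<^sub>R u" by simp
  then have "lorentz v v = k * k * lorentz u u" by simp
  then have "k * k = 1" using u v by (simp add: unit_normal_def)
  then have "k = 1" using k by (metis abs_of_pos abs_mult_self_eq real_sqrt_abs2 real_sqrt_one)
  then show ?thesis using vk by simp
qed

text \<open>The normals are a dual basis up to scaling: pairing a linear relation with
  \<open>u i\<close> isolates its coefficient of \<open>A i\<close>.\<close>

lemma independent_if_normals:
  assumes n: "\<And>i. i < 4 \<Longrightarrow> inward_normal A i (u i)"
  shows "inj_on A {..<4}" "independent (A ` {..<4})"
proof -
  show inj: "inj_on A {..<4}"
  proof (rule inj_onI, rule ccontr)
    fix i j :: nat assume ij: "i \<in> {..<4}" "j \<in> {..<4}" "A i = A j" "i \<noteq> j"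
    then have "lorentz (u i) (A i) > 0" "lorentz (u i) (A j) = 0"
      using n[of i] by (auto simp: inward_normal_def)
    then show False using ij by simp
  qed
  show "independent (A ` {..<4})"
  proof
    assume "dependent (A ` {..<4})"
    then have "\<exists>k. (\<exists>v\<in>A ` {..<4}. k v \<noteq> 0) \<and> (\<Sum>v\<in>A ` {..<4}. k v *\<^sub>R v) = 0"
      by (subst (asm) dependent_finite) auto
    then obtain k v where v: "v \<in> A ` {..<4}" "k v \<noteq> 0" and sum: "(\<Sum>v\<in>A ` {..<4}. k v *\<^sub>R v) = 0"
      by blast
    then obtain i where i: "i < 4" "v = A i" by auto
    have "0 = (\<Sum>j<4. k (A j) *\<^sub>R A j)" using sum inj by (simp add: sum.reindex)
    then have "0 = lorentz (u i) (\<Sum>j<4. k (A j) *\<^sub>R A j)" by simp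
    also have "\<dots> = (\<Sum>j<4. k (A j) * lorentz (u i) (A j))"
    proof -
      have "lorentz (u i) (\<Sum>j\<in>J. k (A j) *\<^sub>R A j) = (\<Sum>j\<in>J. k (A j) * lorentz (u i) (A j))" if "finite J" for J
        using that by induction auto
      then show ?thesis by simp
    qed
    also have "\<dots> = (\<Sum>j<4. if j = i then k (A i) * lorentz (u i) (A i) else 0)"
      using n[OF i(1)] by (intro sum.cong) (auto simp: inward_normal_def)
    also have "\<dots> = k (A i) * lorentz (u i) (A i)" using i by simp
    finally show False using n[OF i(1)] v i by (auto simp: inward_normal_def)
  qed
qed

text \<open>In all three families 1/q + 1/r = 1/2, so the section of the cusp at \<open>A 0\<close>
  is a Euclidean right triangle. This eliminates \<open>q\<close>.\<close>

lemma admissible_angles: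
  assumes "admissible p q r"
  shows "0 < pi / real p" "pi / real p < pi / real r" "pi / real r < pi / 2" "pi / real q = pi / 2 - pi / real r"
    "3 \<le> r" "r < p"
proof -
  have r: "3 \<le> r" "r < p" using assms by (auto simp: admissible_def)
  then show "3 \<le> r" "r < p" by auto
  show "0 < pi / real p" "pi / real p < pi / real r" "pi / real r < pi / 2"
    using r by (auto simp: field_simps)
  show "pi / real q = pi / 2 - pi / real r" using assms by (auto simp: admissible_def field_simps)
qed

text \<open>The angles fix the Gram matrix of the four unit normals, and the null frame is built
  from them. \<open>h1\<close> completes \<open>u3\<close> to an orthonormal basis of the span of
  \<open>u2\<close> and \<open>u3\<close>. Because of 1/q + 1/r = 1/2 it satisfies
  \<open>lorentz h1 u1 = - 1\<close>, so \<open>u1 + h1\<close> is null and orthogonal to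
  \<open>u1\<close>, \<open>u2\<close>, \<open>u3\<close>: it represents \<open>A 0\<close>.\<close>

lemma simple_frustum_orthoscheme_frame:
  assumes sfo: "simple_frustum_orthoscheme p q r A" and adm: "admissible p q r"
  obtains g0 g1 g2 g3 lam where
    "orthoscheme_frame (sin (pi / real p)) (cos (pi / real p)) (tan (pi / real r)) g0 g1 g2 g3 A lam"
proof -
  define al ga where "al = pi / real p" and "ga = pi / real r"
  note ang = admissible_angles(1-4)[OF adm, folded al_def ga_def]
  have s: "0 < sin al" and c: "0 < cos al" using ang by (auto intro: sin_gt_zero cos_gt_zero)
  have sg: "0 < sin ga" and cg: "0 < cos ga" using ang by (auto intro: sin_gt_zero cos_gt_zero)
  have T: "0 < tan ga" using ang by (intro tan_gt_zero) auto
  have "tan al < tan ga" using ang by (intro tan_monotone) auto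
  then have scT: "sin al < cos al * tan ga" using c by (simp add: tan_def field_simps)
  note ind = sfo[unfolded simple_frustum_orthoscheme_def]
  have inj: "inj_on A {..<4}" "independent (A ` {..<4})" using ind by auto
  note uq = unit_normal_unique[OF inj]
  obtain u0 u1 where u01: "unit_normal A 0 u0" "unit_normal A 1 u1" "lorentz u0 u1 = - cos al"
    using ind has_dihedral_angleE[of A 0 1] unfolding al_def by metis
  obtain u2 u3 where u23: "unit_normal A 2 u2" "unit_normal A 3 u3" "lorentz u2 u3 = - cos ga"
    using ind has_dihedral_angleE[of A 2 3] unfolding ga_def by metis
  have pair: "lorentz u v = - cos t"
    if "has_dihedral_angle A i j t" "unit_normal A i u" "unit_normal A j v" "i < 4" "j < 4" for i j t u v
    using has_dihedral_angleE[OF that(1)] uq that by metis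
  have l12: "lorentz u1 u2 = - sin ga"
    using pair[of 1 2 "pi / real q" u1 u2] ind u01 u23 unfolding ang(4) by (simp add: cos_diff)
  have l0: "lorentz u0 u2 = 0" "lorentz u0 u3 = 0" "lorentz u1 u3 = 0"
    using pair[of 0 2 "pi / 2" u0 u2] pair[of 0 3 "pi / 2" u0 u3] pair[of 1 3 "pi / 2" u1 u3] ind u01 u23 by auto
  have self: "lorentz u0 u0 = 1" "lorentz u1 u1 = 1" "lorentz u2 u2 = 1" "lorentz u3 u3 = 1"
    using u01 u23 by (auto simp: unit_normal_def)
  note L = self l0 l12 u01(3) u23(3)
  have Lc: "lorentz u2 u0 = 0" "lorentz u3 u0 = 0" "lorentz u3 u1 = 0" "lorentz u2 u1 = - sin ga" "lorentz u1 u0 = - cos al" "lorentz u3 u2 = - cos ga"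
    using L by (simp_all add: lorentz_commute)
  define h1 where "h1 = (1 / sin ga) *\<^sub>R (u2 + cos ga *\<^sub>R u3)"
  \<comment> \<open>The factor normalizes \<open>lorentz h3 u0\<close> to 1 / 2, which makes
    \<open>h3 - u0\<close> null.\<close>
  define h3 where "h3 = (- 1 / (2 * cos al)) *\<^sub>R (u1 + h1)"
  define h0 where "h0 = h3 - u0"
  have sc: "cos ga * cos ga = 1 - sin ga * sin ga" using sin_cos_squared_add[of ga] by (simp add: power2_eq_square algebra_simps)
  have H1: "lorentz h1 h1 = 1" "lorentz h1 u3 = 0" "lorentz h1 u0 = 0" "lorentz h1 u1 = - 1"
    using sg by (simp_all add: h1_def L Lc sc field_simps)
  have H1': "lorentz u3 h1 = 0" "lorentz u0 h1 = 0" "lorentz u1 h1 = - 1"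
    using H1 by (simp_all add: lorentz_commute)
  have H3: "lorentz h3 h3 = 0" "lorentz h3 h1 = 0" "lorentz h3 u3 = 0" "lorentz h3 u0 = 1 / 2"
    using c by (simp_all add: h3_def H1 H1' L Lc)
  have H3': "lorentz h1 h3 = 0" "lorentz u3 h3 = 0" "lorentz u0 h3 = 1 / 2"
    using H3 by (simp_all add: lorentz_commute)
  have H0: "lorentz h0 h0 = 0" "lorentz h0 h3 = - 1 / 2" "lorentz h0 h1 = 0" "lorentz h0 u3 = 0"
    by (simp_all add: h0_def H3 H3' H1 H1' L Lc)
  have f3: "fst h3 \<noteq> 0"
  proof
    assume "fst h3 = 0"
    then have "h3 = 0" using H3(1) by (simp add: lorentz_def prod_eq_iff)
    then show False using H3(4) by simp
  qed
  \<comment> \<open>The sign moves \<open>h3\<close> into the future cone; multiplying the whole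
    frame by it preserves the Gram matrix.\<close>
  define e where "e = sgn (fst h3)"
  have e: "e * e = 1" "0 < e * fst h3" using f3 by (auto simp: e_def sgn_if)
  interpret null_frame "sin al" "cos al" "tan ga" "e *\<^sub>R h0" "e *\<^sub>R h1" "e *\<^sub>R u3" "e *\<^sub>R h3"
    by unfold_locales (use s c T scT e in \<open>simp_all add: H0 H1 H3 L mult.assoc[symmetric]\<close>)
  have Au: "lorentz (A j) w = 0" if "unit_normal A i w" "j < 4" "j \<noteq> i" for i j w
    using that by (simp add: unit_normal_def inward_normal_def lorentz_commute)
  have Ap: "0 < lorentz (A i) w" if "unit_normal A i w" for i w
    using that by (simp add: unit_normal_def inward_normal_def lorentz_commute)
  have cy: "cy v = e * lorentz v u3" and cx: "cx v = e * (lorentz v u2 + cos ga * lorentz v u3) / sin ga"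
    and ca: "ca v = (e * lorentz v u1 + cx v) / cos al" and cw: "cw v = ca v + 2 * e * lorentz v u0" for v
  proof -
    show "cy v = e * lorentz v u3" by (simp add: cy_def)
    have "cx v = e * lorentz v h1" by (simp add: cx_def)
    then show cx: "cx v = e * (lorentz v u2 + cos ga * lorentz v u3) / sin ga" by (simp add: h1_def)
    have cav: "ca v = - 2 * e * lorentz v h3" by (simp add: ca_def)
    show "ca v = (e * lorentz v u1 + cx v) / cos al"
      unfolding cav \<open>cx v = e * lorentz v h1\<close> using c by (simp add: h3_def field_simps)
    have "cw v = - 2 * e * lorentz v h0" by (simp add: cw_def)
    then show "cw v = ca v + 2 * e * lorentz v u0" unfolding cav by (simp add: h0_def algebra_simps)
  qed
  define lam where "lam i = (if i = 0 then cw (A 0) else ca (A i))" for i :: nat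
  note un = u01(1,2) u23(1,2)
  have c0: "cx (A 0) = 0" "cy (A 0) = 0" "ca (A 0) = 0" "cw (A 0) = 2 * e * lorentz (A 0) u0"
    by (simp_all add: cx cy ca cw Au[OF un(2)] Au[OF un(3)] Au[OF un(4)])
  have c1: "cx (A 1) = 0" "cy (A 1) = 0" "ca (A 1) = e * lorentz (A 1) u1 / cos al" "cw (A 1) = ca (A 1)"
    by (simp_all add: cx cy ca cw Au[OF un(1)] Au[OF un(3)] Au[OF un(4)])
  have c2: "cx (A 2) = e * lorentz (A 2) u2 / sin ga" "cy (A 2) = 0" "cx (A 2) = cos al * ca (A 2)" "cw (A 2) = ca (A 2)"
    using c by (simp_all add: cx cy ca cw Au[OF un(1)] Au[OF un(2)] Au[OF un(4)])
  have c3: "cy (A 3) = e * lorentz (A 3) u3" "cy (A 3) = tan ga * cx (A 3)" "cx (A 3) = cos al * ca (A 3)" "cw (A 3) = ca (A 3)"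
    using c sg cg by (simp_all add: cx cy ca cw Au[OF un(1)] Au[OF un(2)] Au[OF un(3)] tan_def)
  \<comment> \<open>Each vertex lies on the positive side of the inward normal of the opposite face,
    so all scalars have the sign \<open>e\<close>.\<close>
  have pos: "0 < e * lam 0" "0 < e * lam 1" "0 < e * lam 2" "0 < e * lam 3"
  proof -
    have ee: "e * (e * r) = r" for r using e(1) by (simp add: mult.assoc[symmetric])
    show "0 < e * lam 0" using Ap[OF un(1)] by (simp add: lam_def c0 ee mult.left_commute[of e 2])
    show "0 < e * lam 1" using Ap[OF un(2)] c c1(3) by (simp add: lam_def ee)
    have "e * (cos al * lam 2) = lorentz (A 2) u2 / sin ga" using c2(1,3) by (simp add: lam_def ee)
    then have "0 < cos al * (e * lam 2)" using Ap[OF un(3)] sg by (simp add: mult.left_commute)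
    then show "0 < e * lam 2" using c by (simp add: zero_less_mult_iff)
    have "e * (tan ga * (cos al * lam 3)) = lorentz (A 3) u3" using c3(1-3) by (simp add: lam_def ee)
    then have "0 < tan ga * cos al * (e * lam 3)" using Ap[OF un(4)] by (simp add: mult_ac)
    then show "0 < e * lam 3" by (rule zero_less_mult_pos) (use c T in simp)
  qed
  have "orthoscheme_frame (sin al) (cos al) (tan ga) (e *\<^sub>R h0) (e *\<^sub>R h1) (e *\<^sub>R u3) (e *\<^sub>R h3) A lam"
  proof unfold_locales
    show "A 0 = lam 0 *\<^sub>R (e *\<^sub>R h3)"
      using mk_coord[of "A 0"] unfolding c0(1-3) by (simp add: mk_def lam_def)
    show "A 1 = lam 1 *\<^sub>R b1"
      using mk_coord[of "A 1"] unfolding c1(1,2,4) by (simp add: mk_def b1_def lam_def scaleR_add_right)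
    show "A 2 = lam 2 *\<^sub>R b2"
      using mk_coord[of "A 2"] unfolding c2(2,3,4) by (simp add: mk_def b2_def lam_def scaleR_add_right mult_ac)
    show "A 3 = lam 3 *\<^sub>R b3"
      using mk_coord[of "A 3"] unfolding c3(2,3,4) by (simp add: mk_def b3_def lam_def scaleR_add_right mult_ac)
    fix i :: nat assume "i < 4"
    then consider "i = 0" | "i = 1" | "i = 2" | "i = 3" by linarith
    then have "0 < e * lam i" using pos by cases auto
    then have "0 < (e * lam i) * (e * lam 0)" using pos(1) by simp
    also have "\<dots> = lam i * lam 0" using e(1) by (metis mult.assoc mult.left_commute mult_1)
    finally show "0 < lam i * lam 0" .
  qed
  then show ?thesis using that unfolding al_def ga_def by blast
qed

context null_frame
begin

definition "standard_vertices i = (if i = 0 then g3 else if i = 1 then b1 else if i = 2 then b2 else b3)" for i :: nat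

lemma orthoscheme_frame_standard_vertices: "orthoscheme_frame s c T g0 g1 g2 g3 standard_vertices (\<lambda>_. 1)"
  by unfold_locales (simp_all add: standard_vertices_def)

text \<open>The converse of the normal form. It provides an orthoscheme for (7,3,6), on which the
  existence of a touching configuration rests.\<close>

lemma simple_frustum_orthoscheme_standard_vertices:
  assumes sc': "s = sin (pi / real p)" "c = cos (pi / real p)" "T = tan (pi / real r)" and adm: "admissible p q r"
  shows "simple_frustum_orthoscheme p q r standard_vertices"
proof -
  interpret orthoscheme_frame s c T g0 g1 g2 g3 standard_vertices "\<lambda>_. 1" by (rule orthoscheme_frame_standard_vertices)
  define ga where "ga = pi / real r"
  note ang = admissible_angles[OF adm, folded ga_def]
  have ga: "0 < ga" "ga < pi / 2" "ga < pi" using ang(1-3) pi_gt_zero by linarith+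
  have sg: "0 < sin ga" and cg: "0 < cos ga"
    using ga by (auto intro: sin_gt_zero cos_gt_zero)
  have Tg: "T = sin ga / cos ga" by (simp add: sc' ga_def tan_def)
  have gg: "sin ga * sin ga + cos ga * cos ga = 1" using sin_cos_squared_add[of ga] by (simp add: power2_eq_square)
  \<comment> \<open>Inward normals of the unit hemisphere and of the vertical planes
    \<open>x = c\<close>, \<open>y = T x\<close> and \<open>y = 0\<close>.\<close>
  define u0 u1 u2 u3 where "u0 = g3 - g0" and "u1 = - g1 - (2 * c) *\<^sub>R g3" and "u2 = sin ga *\<^sub>R g1 - cos ga *\<^sub>R g2" and "u3 = g2"
  note ud = u0_def u1_def u2_def u3_def
  have lo: "lorentz u0 v = (cw v - ca v) / 2" "lorentz u1 v = c * ca v - cx v" "lorentz u2 v = sin ga * cx v - cos ga * cy v" "lorentz u3 v = cy v" for v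
    by (simp_all add: ud ca_def cx_def cy_def cw_def lorentz_commute[of g0 v] lorentz_commute[of g1 v] lorentz_commute[of g2 v] lorentz_commute[of g3 v])
  have co: "ca g3 = 0" "cx g3 = 0" "cy g3 = 0" "cw g3 = 1"
  "ca b1 = 1" "cx b1 = 0" "cy b1 = 0" "cw b1 = 1"
  "ca b2 = 1" "cx b2 = c" "cy b2 = 0" "cw b2 = 1"
  "ca b3 = 1" "cx b3 = c" "cy b3 = c * T" "cw b3 = 1"
    by (simp_all add: b1_def b2_def b3_def ca_def[of g3] cx_def[of g3] cy_def[of g3] cw_def[of g3])
  have less4: "j < 4 \<longleftrightarrow> j = 0 \<or> j = 1 \<or> j = 2 \<or> j = 3" for j :: nat by auto
  have cT: "cos ga * (c * T) = sin ga * c" using cg by (simp add: Tg)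
  have un: "unit_normal standard_vertices 0 u0" "unit_normal standard_vertices 1 u1" "unit_normal standard_vertices 2 u2" "unit_normal standard_vertices 3 u3"
  proof -
    have "lorentz u0 u0 = 1" "lorentz u1 u1 = 1" "lorentz u2 u2 = 1" "lorentz u3 u3 = 1"
      using gg by (simp_all add: ud)
    then show "unit_normal standard_vertices 0 u0" "unit_normal standard_vertices 1 u1" "unit_normal standard_vertices 2 u2" "unit_normal standard_vertices 3 u3"
      unfolding unit_normal_def inward_normal_def less4
      using c T sg cg by (auto simp: standard_vertices_def lo co cT)
  qed
  define u where "u i = (if i = 0 then u0 else if i = 1 then u1 else if i = 2 then u2 else u3)" for i :: nat
  have "inward_normal standard_vertices i (u i)" if "i < 4" for i
    using that un unfolding less4 unit_normal_def by (auto simp: u_def)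
  note ind = independent_if_normals[OF this]
  have ang': "pi / real p \<le> pi" "0 \<le> pi / real q" "pi / real q \<le> pi" "0 \<le> ga" "ga \<le> pi"
    unfolding ang(4) using ang(1,2) ga by linarith+
  have cq: "cos (pi / real q) = sin ga" unfolding ang(4) by (simp add: cos_diff)
  have "has_dihedral_angle standard_vertices 0 1 (pi / real p)"
    by (rule has_dihedral_angleI[OF un(1,2)]) (use ang ang' sc' in \<open>simp_all add: ud\<close>)
  moreover have "has_dihedral_angle standard_vertices 1 2 (pi / real q)"
    by (rule has_dihedral_angleI[OF un(2,3)]) (use ang' in \<open>simp_all add: ud cq\<close>)
  moreover have "has_dihedral_angle standard_vertices 2 3 (pi / real r)"
    unfolding ga_def[symmetric] by (rule has_dihedral_angleI[OF un(3,4)]) (use ang' in \<open>simp_all add: ud\<close>)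
  moreover have "has_dihedral_angle standard_vertices 0 2 (pi / 2)" "has_dihedral_angle standard_vertices 0 3 (pi / 2)" "has_dihedral_angle standard_vertices 1 3 (pi / 2)"
    by (rule has_dihedral_angleI[OF un(1,3)] has_dihedral_angleI[OF un(1,4)] has_dihedral_angleI[OF un(2,4)];
        simp add: ud)+
  moreover have "ideal_point (standard_vertices 0)" using fut by (auto simp: standard_vertices_def ideal_point_def)
  moreover have "proper_point (standard_vertices 1)" "proper_point (standard_vertices 2)"
    using future_b1 future_b2 by (auto simp: standard_vertices_def proper_point_def future_def)
  moreover have "outer_point (standard_vertices 3)" using rho(1) by (simp add: standard_vertices_def outer_point_def lorentz_b3_b3)
  ultimately show ?thesis unfolding simple_frustum_orthoscheme_def using ind by blast
qed

end

lemma null_frame_exists: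
  assumes "0 < s" "0 < c" "s\<^sup>2 + c\<^sup>2 = 1" "0 < T" "s < c * T"
  obtains g0 g1 g2 g3 where "null_frame s c T g0 g1 g2 g3"
proof
  show "null_frame s c T (1 / 2, - axis 3 (1 / 2)) (0, axis 1 1) (0, axis 2 1) (1 / 2, axis 3 (1 / 2))"
    by unfold_locales (use assms in \<open>simp_all add: lorentz_def inner_axis_axis\<close>)
qed

section \<open>Series bounds\<close>

definition artanh_sum :: "nat \<Rightarrow> real \<Rightarrow> real" where
  "artanh_sum n x = (\<Sum>k<n. x ^ (2 * k + 1) / real (2 * k + 1))"

lemma DERIV_power_odd: "((\<lambda>x. x ^ (2 * k + 1) / real (2 * k + 1)) has_real_derivative x ^ (2 * k)) (at (x :: real))"
proof -
  have "((\<lambda>x. x ^ (2 * k + 1) / real (2 * k + 1)) has_real_derivative (real (2 * k + 1) * x ^ (2 * k + 1 - 1)) / real (2 * k + 1)) (at x)"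
    by (intro DERIV_cdivide) (use DERIV_pow[of "2 * k + 1" x] in simp)
  then show ?thesis by simp
qed

lemma DERIV_artanh_sum: "(artanh_sum n has_real_derivative (\<Sum>k<n. (x\<^sup>2) ^ k)) (at x)"
  unfolding artanh_sum_def by (intro DERIV_sum) (use DERIV_power_odd in \<open>simp add: power_mult\<close>)

lemma nonneg_of_deriv:
  fixes F f :: "real \<Rightarrow> real"
  assumes "0 \<le> x" and der: "\<And>t. 0 \<le> t \<Longrightarrow> t \<le> x \<Longrightarrow> (F has_real_derivative f t) (at t)"
    and "\<And>t. 0 \<le> t \<Longrightarrow> t \<le> x \<Longrightarrow> 0 \<le> f t" and "F 0 = 0"
  shows "0 \<le> F x"
proof -
  have "F 0 \<le> F x"
    by (rule DERIV_nonneg_imp_nondecreasing[OF assms(1)]) (use assms in blast)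
  then show ?thesis using assms(4) by simp
qed

text \<open>The remainder has the derivative t^(2 n) / (1 - t^2), which lies between 0 and t^(2 n) /
  (1 - b^2).\<close>

lemma artanh_bounds:
  fixes x b :: real
  assumes x: "0 \<le> x" "x \<le> b" and b: "b < 1"
  shows "artanh_sum n x \<le> artanh x" and "artanh x \<le> artanh_sum n x + x ^ (2 * n + 1) / (real (2 * n + 1) * (1 - b\<^sup>2))"
proof -
  have t1: "t\<^sup>2 < 1" "t\<^sup>2 \<le> b\<^sup>2" "\<bar>t\<bar> < 1" if "0 \<le> t" "t \<le> x" for t
    using that x b by (auto simp: abs_square_less_1 intro: power_mono)
  have b1: "b\<^sup>2 < 1" using x b by (simp add: abs_square_less_1)
  have geo: "(\<Sum>k<n. (t\<^sup>2) ^ k) = (1 - t ^ (2 * n)) / (1 - t\<^sup>2)" if "t\<^sup>2 < 1" for t :: real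
    using that by (simp add: sum_gp_strict power_mult)
  have "0 \<le> artanh x - artanh_sum n x"
  proof (rule nonneg_of_deriv[OF x(1)])
    fix t assume t: "0 \<le> t" "t \<le> x"
    show "((\<lambda>x. artanh x - artanh_sum n x) has_real_derivative 1 / (1 - t\<^sup>2) - (1 - t ^ (2 * n)) / (1 - t\<^sup>2)) (at t)"
      unfolding geo[OF t1(1)[OF t], symmetric] using t1[OF t]
      by (intro DERIV_diff DERIV_artanh_sum artanh_real_has_field_derivative) auto
    show "0 \<le> 1 / (1 - t\<^sup>2) - (1 - t ^ (2 * n)) / (1 - t\<^sup>2)"
      using t t1(1)[OF t] by (simp add: divide_right_mono)
  qed (simp add: artanh_sum_def)
  then show "artanh_sum n x \<le> artanh x" by simp
  have "0 \<le> artanh_sum n x + x ^ (2 * n + 1) / real (2 * n + 1) / (1 - b\<^sup>2) - artanh x"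
  proof (rule nonneg_of_deriv[OF x(1)])
    fix t assume t: "0 \<le> t" "t \<le> x"
    show "((\<lambda>x. artanh_sum n x + x ^ (2 * n + 1) / real (2 * n + 1) / (1 - b\<^sup>2) - artanh x) has_real_derivative
        (1 - t ^ (2 * n)) / (1 - t\<^sup>2) + t ^ (2 * n) / (1 - b\<^sup>2) - 1 / (1 - t\<^sup>2)) (at t)"
      unfolding geo[OF t1(1)[OF t], symmetric] using t1[OF t]
      by (intro DERIV_diff DERIV_add DERIV_cdivide DERIV_power_odd DERIV_artanh_sum artanh_real_has_field_derivative) auto
    have "t ^ (2 * n) / (1 - t\<^sup>2) \<le> t ^ (2 * n) / (1 - b\<^sup>2)"
      using t t1(2)[OF t] b1 by (intro divide_left_mono) auto
    then show "0 \<le> (1 - t ^ (2 * n)) / (1 - t\<^sup>2) + t ^ (2 * n) / (1 - b\<^sup>2) - 1 / (1 - t\<^sup>2)"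
      by (simp add: diff_divide_distrib)
  qed (simp add: artanh_sum_def)
  then show "artanh x \<le> artanh_sum n x + x ^ (2 * n + 1) / (real (2 * n + 1) * (1 - b\<^sup>2))" by simp
qed

lemma artanh_mono: "0 \<le> x \<Longrightarrow> x \<le> y \<Longrightarrow> y < 1 \<Longrightarrow> artanh x \<le> artanh (y :: real)"
  unfolding artanh_def by (intro divide_right_mono ln_mono) (auto intro!: divide_pos_pos frac_le)

definition arctan_sum :: "nat \<Rightarrow> real \<Rightarrow> real" where
  "arctan_sum n x = (\<Sum>k<n. (- 1) ^ k * (x ^ (2 * k + 1) / real (2 * k + 1)))"

lemma DERIV_arctan_sum: "(arctan_sum n has_real_derivative (1 - (- (x\<^sup>2)) ^ n) / (1 + x\<^sup>2)) (at x)"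
proof -
  have "(arctan_sum n has_real_derivative (\<Sum>k<n. (- 1) ^ k * x ^ (2 * k))) (at x)"
    unfolding arctan_sum_def by (intro DERIV_sum DERIV_cmult DERIV_power_odd)
  also have "(\<Sum>k<n. (- 1) ^ k * x ^ (2 * k)) = (\<Sum>k<n. (- (x\<^sup>2)) ^ k)"
    by (intro sum.cong) (simp_all add: power_mult power_mult_distrib[symmetric])
  also have "\<dots> = (1 - (- (x\<^sup>2)) ^ n) / (1 + x\<^sup>2)"
    using add_pos_nonneg[of 1 "x\<^sup>2"] by (subst sum_gp_strict) auto
  finally show ?thesis .
qed

text \<open>The remainder has the derivative (- t^2)^n / (1 + t^2), whose sign is given by the
  parity of \<open>n\<close>.\<close>

lemma arctan_bounds:
  assumes "0 \<le> x"
  shows "even n \<Longrightarrow> arctan_sum n x \<le> arctan x" "odd n \<Longrightarrow> arctan x \<le> arctan_sum n x"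
proof -
  have p: "0 < 1 + t\<^sup>2" for t :: real by (simp add: add_pos_nonneg)
  have d: "((\<lambda>x. arctan x - arctan_sum n x) has_real_derivative (- (t\<^sup>2)) ^ n / (1 + t\<^sup>2)) (at t)" for t
  proof (rule DERIV_cong)
    show "((\<lambda>x. arctan x - arctan_sum n x) has_real_derivative inverse (1 + t\<^sup>2) - (1 - (- (t\<^sup>2)) ^ n) / (1 + t\<^sup>2)) (at t)"
      by (intro DERIV_diff DERIV_arctan DERIV_arctan_sum)
    show "inverse (1 + t\<^sup>2) - (1 - (- (t\<^sup>2)) ^ n) / (1 + t\<^sup>2) = (- (t\<^sup>2)) ^ n / (1 + t\<^sup>2)"
      by (simp add: inverse_eq_divide diff_divide_distrib)
  qed
  have z: "arctan_sum n 0 = 0" by (simp add: arctan_sum_def)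
  show "arctan_sum n x \<le> arctan x" if "even n"
  proof -
    have "0 \<le> arctan x - arctan_sum n x"
    proof (rule nonneg_of_deriv[OF assms d])
      fix t :: real
      have "0 \<le> (- (t\<^sup>2)) ^ n" using that by simp
      then show "0 \<le> (- (t\<^sup>2)) ^ n / (1 + t\<^sup>2)" using p[of t] by simp
    qed (simp add: z)
    then show ?thesis by simp
  qed
  show "arctan x \<le> arctan_sum n x" if "odd n"
  proof -
    have "0 \<le> - (arctan x - arctan_sum n x)"
    proof (rule nonneg_of_deriv[OF assms DERIV_minus[OF d]])
      fix t :: real
      have "(- (t\<^sup>2)) ^ n \<le> 0" using that by simp
      then show "0 \<le> - ((- (t\<^sup>2)) ^ n / (1 + t\<^sup>2))" using p[of t] by (simp add: divide_nonpos_pos)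
    qed (simp add: z)
    then show ?thesis by simp
  qed
qed

text \<open>The bound is y / (1 + y^2 / 3), a convergent of the continued fraction of the
  arctangent. Being rational, it reduces the monotonicity claims to polynomial inequalities.\<close>

lemma arctan_ge: "0 \<le> y \<Longrightarrow> 3 * y / (3 + y\<^sup>2) \<le> arctan y"
proof -
  assume y: "0 \<le> y"
  have p: "0 < 1 + t\<^sup>2" "0 < 3 + t\<^sup>2" for t :: real by (simp_all add: add_pos_nonneg)
  have "0 \<le> arctan y - 3 * y / (3 + y\<^sup>2)"
  proof (rule nonneg_of_deriv[OF y])
    fix t :: real assume "0 \<le> t"
    show "((\<lambda>y. arctan y - 3 * y / (3 + y\<^sup>2)) has_real_derivative inverse (1 + t\<^sup>2) - (9 - 3 * t\<^sup>2) / (3 + t\<^sup>2)\<^sup>2) (at t)"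
      using p(2)[of t] by (auto intro!: derivative_eq_intros simp: power2_eq_square field_simps)
    have "inverse (1 + t\<^sup>2) - (9 - 3 * t\<^sup>2) / (3 + t\<^sup>2)\<^sup>2 = 4 * t ^ 4 / ((1 + t\<^sup>2) * (3 + t\<^sup>2)\<^sup>2)"
      using p[of t] by (simp add: divide_simps) (simp add: power2_eq_square power4_eq_xxxx algebra_simps)
    then show "0 \<le> inverse (1 + t\<^sup>2) - (9 - 3 * t\<^sup>2) / (3 + t\<^sup>2)\<^sup>2" using p[of t] by simp
  qed simp
  then show ?thesis by simp
qed

definition ti2_sum :: "nat \<Rightarrow> real \<Rightarrow> real" where
  "ti2_sum n x = (\<Sum>k<n. (- 1) ^ k * (x ^ (2 * k + 1) / (real (2 * k + 1))\<^sup>2))"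

lemma DERIV_ti2_sum:
  assumes "x \<noteq> 0"
  shows "(ti2_sum n has_real_derivative arctan_sum n x / x) (at x)"
proof -
  have d: "((\<lambda>x. x ^ (2 * k + 1) / (real (2 * k + 1))\<^sup>2) has_real_derivative x ^ (2 * k + 1) / real (2 * k + 1) / x) (at x)" for k
  proof -
    have "((\<lambda>x. x ^ (2 * k + 1) / real (2 * k + 1) / real (2 * k + 1)) has_real_derivative x ^ (2 * k) / real (2 * k + 1)) (at x)"
      by (intro DERIV_cdivide DERIV_power_odd)
    then show ?thesis using assms by (simp add: power2_eq_square)
  qed
  have "(ti2_sum n has_real_derivative (\<Sum>k<n. (- 1) ^ k * (x ^ (2 * k + 1) / real (2 * k + 1) / x))) (at x)"
    unfolding ti2_sum_def by (intro DERIV_sum DERIV_cmult d)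
  also have "(\<Sum>k<n. (- 1) ^ k * (x ^ (2 * k + 1) / real (2 * k + 1) / x)) = arctan_sum n x / x"
    by (simp only: arctan_sum_def sum_divide_distrib times_divide_eq_right)
  finally show ?thesis .
qed

lemma ti2_bounds:
  assumes x: "0 \<le> x"
  shows "even n \<Longrightarrow> ti2_sum n x \<le> ti2 x" "odd n \<Longrightarrow> ti2 x \<le> ti2_sum n x"
proof -
  have c: "continuous_on {0..x} ti2" "continuous_on {0..x} (ti2_sum n)"
    by (rule continuous_on_ti2) (auto simp: ti2_sum_def[abs_def] intro!: continuous_intros)
  have z: "ti2_sum n 0 = 0" by (simp add: ti2_sum_def)
  assume "even n"
  have "ti2 0 - ti2_sum n 0 \<le> ti2 x - ti2_sum n x"
  proof (rule DERIV_nonneg_imp_increasing_open[OF x])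
    fix t assume t: "0 < t" "t < x"
    have "((\<lambda>x. ti2 x - ti2_sum n x) has_real_derivative arctan t / t - arctan_sum n t / t) (at t)"
      using t by (intro DERIV_diff DERIV_ti2 DERIV_ti2_sum) auto
    moreover have "0 \<le> arctan t / t - arctan_sum n t / t"
      using t arctan_bounds(1)[of t n] \<open>even n\<close> by (simp add: divide_right_mono)
    ultimately show "\<exists>y. ((\<lambda>x. ti2 x - ti2_sum n x) has_real_derivative y) (at t) \<and> 0 \<le> y" by blast
  qed (intro continuous_intros c)
  then show "ti2_sum n x \<le> ti2 x" using z by simp
next
  have c: "continuous_on {0..x} ti2" "continuous_on {0..x} (ti2_sum n)"
    by (rule continuous_on_ti2) (auto simp: ti2_sum_def[abs_def] intro!: continuous_intros)
  have z: "ti2_sum n 0 = 0" by (simp add: ti2_sum_def)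
  assume "odd n"
  have "ti2_sum n 0 - ti2 0 \<le> ti2_sum n x - ti2 x"
  proof (rule DERIV_nonneg_imp_increasing_open[OF x])
    fix t assume t: "0 < t" "t < x"
    have "((\<lambda>x. ti2_sum n x - ti2 x) has_real_derivative arctan_sum n t / t - arctan t / t) (at t)"
      using t by (intro DERIV_diff DERIV_ti2 DERIV_ti2_sum) auto
    moreover have "0 \<le> arctan_sum n t / t - arctan t / t"
      using t arctan_bounds(2)[of t n] \<open>odd n\<close> by (simp add: divide_right_mono)
    ultimately show "\<exists>y. ((\<lambda>x. ti2_sum n x - ti2 x) has_real_derivative y) (at t) \<and> 0 \<le> y" by blast
  qed (intro continuous_intros c)
  then show "ti2 x \<le> ti2_sum n x" using z by simp
qed

lemma edge_integral_bounds:
  assumes al: "0 \<le> al" "al < ga" "ga < pi / 2"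
    and der: "\<And>t. 0 \<le> t \<Longrightarrow> t \<le> al \<Longrightarrow> (F has_real_derivative f t) (at t)"
  shows "(\<And>t. 0 \<le> t \<Longrightarrow> t \<le> al \<Longrightarrow> edge_length ga t \<le> f t) \<Longrightarrow> edge_integral ga al \<le> F al - F 0"
    and "(\<And>t. 0 \<le> t \<Longrightarrow> t \<le> al \<Longrightarrow> f t \<le> edge_length ga t) \<Longrightarrow> F al - F 0 \<le> edge_integral ga al"
proof -
  have I: "(f has_integral (F al - F 0)) {0..al}"
    using der al by (intro fundamental_theorem_of_calculus)
      (auto simp: has_real_derivative_iff_has_vector_derivative[symmetric] intro: has_field_derivative_at_within)
  note E = has_integral_edge_length[OF al]
  show "(\<And>t. 0 \<le> t \<Longrightarrow> t \<le> al \<Longrightarrow> edge_length ga t \<le> f t) \<Longrightarrow> edge_integral ga al \<le> F al - F 0"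
    by (rule has_integral_le[OF E I]) auto
  show "(\<And>t. 0 \<le> t \<Longrightarrow> t \<le> al \<Longrightarrow> f t \<le> edge_length ga t) \<Longrightarrow> F al - F 0 \<le> edge_integral ga al"
    by (rule has_integral_le[OF I E]) auto
qed

section \<open>Derivatives of the volumes with respect to \<alpha>\<close>

lemma DERIV_edge_integral:
  assumes al: "0 < al" "al < ga" and ga: "ga < pi / 2"
  shows "(edge_integral ga has_real_derivative edge_length ga al) (at al)"
proof -
  define m where "m = (al + ga) / 2"
  have m: "al < m" "m < ga" using al by (auto simp: m_def)
  have "((\<lambda>x. integral {0..x} (edge_length ga)) has_real_derivative edge_length ga al) (at al within {0..m})"
    using al m ga by (intro integral_has_real_derivative continuous_at_imp_continuous_on ballI isCont_edge_length) auto
  moreover have "at al within {0..m} = at al" using al m by (intro at_within_interior) auto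
  ultimately show ?thesis unfolding edge_integral_def[abs_def] by simp
qed

lemma DERIV_frustum_volume:
  assumes "0 < al" "al < ga" "ga < pi / 2"
  shows "(frustum_volume ga has_real_derivative - edge_length ga al / 2) (at al)"
proof -
  have "((\<lambda>al. (neg_ln_tan_integral (pi / 2 - ga) - edge_integral ga al) / 2) has_real_derivative (0 - edge_length ga al) / 2) (at al)"
    by (intro DERIV_cdivide DERIV_diff DERIV_const DERIV_edge_integral assms)
  then show ?thesis by (simp add: frustum_volume_def[abs_def])
qed

text \<open>The volume of the part of the frustum in the hyperball whose hypersphere passes through \<open>A 2\<close>,
  that is, of width \<open>artanh (tan \<alpha> / tan \<gamma>)\<close>.\<close>

definition hyperball_volume :: "real \<Rightarrow> real \<Rightarrow> real" where
  "hyperball_volume ga al = (ga - al) / 2 * (artanh (tan al / tan ga) + (tan al / tan ga) / (1 - (tan al / tan ga)\<^sup>2))"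

lemma DERIV_artanh_plus:
  fixes t :: real
  assumes g: "(g has_real_derivative m) (at x)" and l: "\<bar>g x\<bar> < 1"
  shows "((\<lambda>x. artanh (g x) + g x / (1 - (g x)\<^sup>2)) has_real_derivative 2 * m / (1 - (g x)\<^sup>2)\<^sup>2) (at x)"
proof -
  have ne: "1 - (g x)\<^sup>2 \<noteq> 0" using l abs_square_less_1[of "g x"] by auto
  have "((\<lambda>x. artanh (g x) + g x / (1 - (g x)\<^sup>2)) has_real_derivative
      1 / (1 - (g x)\<^sup>2) * m + (m * (1 - (g x)\<^sup>2) - g x * (0 - 2 * g x * m)) / ((1 - (g x)\<^sup>2) * (1 - (g x)\<^sup>2))) (at x)"
    using ne by (intro DERIV_add DERIV_fun_artanh[OF g l] DERIV_divide) (auto intro!: derivative_eq_intros g)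
  also have "1 / (1 - (g x)\<^sup>2) * m + (m * (1 - (g x)\<^sup>2) - g x * (0 - 2 * g x * m)) / ((1 - (g x)\<^sup>2) * (1 - (g x)\<^sup>2)) = 2 * m / (1 - (g x)\<^sup>2)\<^sup>2"
    using ne by (simp add: divide_simps power2_eq_square) (simp add: algebra_simps)
  finally show ?thesis .
qed

lemma DERIV_hyperball_volume:
  assumes "0 < al" "al < ga" "ga < pi / 2"
  defines "u \<equiv> tan al / tan ga"
  shows "(hyperball_volume ga has_real_derivative
      (ga - al) * ((1 + (tan al)\<^sup>2) / tan ga) / (1 - u\<^sup>2)\<^sup>2 - (artanh u + u / (1 - u\<^sup>2)) / 2) (at al)"
proof -
  have c: "cos al > 0" using assms by (intro cos_gt_zero) auto
  have u: "0 \<le> u" "u < 1" unfolding u_def using tan_ratio[of al ga] assms by auto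
  have d: "((\<lambda>x. tan x / tan ga) has_real_derivative inverse ((cos al)\<^sup>2) / tan ga) (at al)"
    using c by (intro DERIV_cdivide DERIV_tan) auto
  have sec: "inverse ((cos al)\<^sup>2) = 1 + (tan al)\<^sup>2" using c tan_sec[of al] by (simp add: power_inverse)
  have "(hyperball_volume ga has_real_derivative
     (0 - 1) / 2 * (artanh u + u / (1 - u\<^sup>2)) + 2 * ((1 + (tan al)\<^sup>2) / tan ga) / (1 - u\<^sup>2)\<^sup>2 * ((ga - al) / 2)) (at al)"
    unfolding hyperball_volume_def[abs_def] u_def
    by (intro DERIV_mult DERIV_cdivide DERIV_diff DERIV_const DERIV_ident DERIV_artanh_plus d[unfolded sec])
      (use u in \<open>simp add: u_def\<close>)
  moreover have "(0 - 1) / 2 * a + 2 * m / w * (d / 2) = d * m / w - a / 2" for a m w d :: real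
    by simp
  ultimately show ?thesis by (simp only:)
qed

section \<open>Monotonicity of the volume deficit\<close>

text \<open>It holds coefficientwise: the power series of the right side has the coefficients 1,
  1/2, 1/2, ..., that of the left side 1, 1/3, 1/5, ... The lemma removes \<open>artanh\<close> from
  the derivative of the deficit.\<close>

lemma artanh_le_mean:
  fixes u :: real
  assumes u: "0 \<le> u" "u < 1"
  shows "artanh u \<le> (u + u / (1 - u\<^sup>2)) / 2"
proof -
  have "0 \<le> (u + u / (1 - u\<^sup>2)) / 2 - artanh u"
  proof (rule nonneg_of_deriv[OF u(1)])
    fix t assume t: "0 \<le> t" "t \<le> u"
    then have t1: "t\<^sup>2 < 1" "\<bar>t\<bar> < 1" using u by (auto simp: abs_square_less_1)
    show "((\<lambda>u. (u + u / (1 - u\<^sup>2)) / 2 - artanh u) has_real_derivative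
        (1 + (1 * (1 - t\<^sup>2) - t * (0 - 2 * t)) / ((1 - t\<^sup>2) * (1 - t\<^sup>2))) / 2 - 1 / (1 - t\<^sup>2)) (at t)"
      using t1 by (auto intro!: derivative_eq_intros)
    have "(1 + (1 * (1 - t\<^sup>2) - t * (0 - 2 * t)) / ((1 - t\<^sup>2) * (1 - t\<^sup>2))) / 2 - 1 / (1 - t\<^sup>2) = t\<^sup>2 * (1 + t\<^sup>2) / (2 * (1 - t\<^sup>2)\<^sup>2)"
      using t1 by (simp add: divide_simps power2_eq_square) (simp add: algebra_simps)
    then show "0 \<le> (1 + (1 * (1 - t\<^sup>2) - t * (0 - 2 * t)) / ((1 - t\<^sup>2) * (1 - t\<^sup>2))) / 2 - 1 / (1 - t\<^sup>2)" by simp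
  qed simp
  then show ?thesis by simp
qed

text \<open>The gap is the arctangent of T (1 - u) / (1 + T^2 u), and the rational lower bound for
  the arctangent applies.\<close>

lemma angle_gap_ge:
  assumes al: "0 < al" "al < ga" "ga < pi / 2"
  defines "T \<equiv> tan ga" and "u \<equiv> tan al / tan ga"
  shows "3 * T * (1 - u) * (1 + T\<^sup>2 * u) / (3 * (1 + T\<^sup>2 * u)\<^sup>2 + T\<^sup>2 * (1 - u)\<^sup>2) \<le> ga - al"
proof -
  have T: "T > 0" unfolding T_def using al by (intro tan_gt_zero) auto
  have u: "0 \<le> u" "u < 1" unfolding u_def using tan_ratio[of al ga] al by auto
  define y where "y = tan (ga - al)"
  have x: "tan al = T * u" using T by (simp add: u_def T_def)
  have p: "0 < 1 + T\<^sup>2 * u" using u by (simp add: add_pos_nonneg)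
  have "y = (T - T * u) / (1 + T * (T * u))"
    unfolding y_def using al x T_def
    by (subst tan_diff) (auto simp: less_imp_neq[THEN not_sym] intro!: cos_gt_zero less_imp_neq[THEN not_sym])
  also have "\<dots> = T * (1 - u) / (1 + T\<^sup>2 * u)" by (simp add: power2_eq_square algebra_simps)
  finally have y: "y = T * (1 - u) / (1 + T\<^sup>2 * u)" .
  then have "0 \<le> y" using T u p by simp
  then have "3 * y / (3 + y\<^sup>2) \<le> arctan y" by (rule arctan_ge)
  also have "arctan y = ga - al" unfolding y_def using al by (intro arctan_tan) auto
  finally have "3 * y / (3 + y\<^sup>2) \<le> ga - al" .
  moreover have "3 * y / (3 + y\<^sup>2) = 3 * T * (1 - u) * (1 + T\<^sup>2 * u) / (3 * (1 + T\<^sup>2 * u)\<^sup>2 + T\<^sup>2 * (1 - u)\<^sup>2)"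
  proof -
    have "3 * (a / b) / (3 + (a / b)\<^sup>2) = 3 * a * b / (3 * b\<^sup>2 + a\<^sup>2)" if "0 < b" for a b :: real
      using that add_pos_nonneg[of "3 * b\<^sup>2" "a\<^sup>2"] by (simp add: power_divide divide_simps) (simp add: power2_eq_square algebra_simps)
    from this[OF p, of "T * (1 - u)"] show ?thesis unfolding y by (simp add: power_mult_distrib mult_ac)
  qed
  ultimately show ?thesis by simp
qed

text \<open>The constant \<open>837/20000\<close> is \<open>(1 - 0.8326) / 4\<close>.\<close>

lemma deficit_has_nonpos_deriv:
  assumes al: "0 < al" "al < ga" "ga < pi / 2" and D: "8326 / 10000 \<le> D"
    and H: "(H has_real_derivative H') (at al)"
  defines "T \<equiv> tan ga" and "u \<equiv> tan al / tan ga"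
  assumes E: "- H' * (1 - u\<^sup>2)\<^sup>2 = E * (1 - u)"
    and poly: "u * (1 + u) * (1 / 2 + 837 / 20000 * (2 - u\<^sup>2)) + E
      \<le> 3 * (1 + T\<^sup>2 * u) * (1 + T\<^sup>2 * u\<^sup>2) / (3 * (1 + T\<^sup>2 * u)\<^sup>2 + T\<^sup>2 * (1 - u)\<^sup>2)"
  shows "\<exists>y. ((\<lambda>al. D * frustum_volume ga al - H al - hyperball_volume ga al) has_real_derivative y) (at al) \<and> y \<le> 0"
proof -
  have T: "T > 0" unfolding T_def using al by (intro tan_gt_zero) auto
  have u: "0 \<le> u" "u < 1" unfolding u_def using tan_ratio[of al ga] al by auto
  have w: "0 < 1 - u\<^sup>2" using u by (simp add: abs_square_less_1)
  have x: "tan al = T * u" using T by (simp add: u_def T_def)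
  define M where "M = (1 + (tan al)\<^sup>2) / tan ga"
  have M: "M = (1 + T\<^sup>2 * u\<^sup>2) / T" unfolding M_def x T_def[symmetric] by (simp add: power_mult_distrib)
  define y where "y = D * (- artanh u / 2) - H' - ((ga - al) * M / (1 - u\<^sup>2)\<^sup>2 - (artanh u + u / (1 - u\<^sup>2)) / 2)"
  have der: "((\<lambda>al. D * frustum_volume ga al - H al - hyperball_volume ga al) has_real_derivative y) (at al)"
    unfolding y_def M_def u_def
    by (intro DERIV_diff DERIV_cmult H DERIV_hyperball_volume[OF al] DERIV_frustum_volume[OF al, unfolded edge_length_def])
  define Q where "Q = 3 * (1 + T\<^sup>2 * u)\<^sup>2 + T\<^sup>2 * (1 - u)\<^sup>2"
  have Q: "Q > 0"
  proof -
    have "0 < 1 + T\<^sup>2 * u" using u by (simp add: add_pos_nonneg)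
    then show ?thesis unfolding Q_def by (intro add_pos_nonneg) auto
  qed
  have gap: "(1 - u) * (3 * (1 + T\<^sup>2 * u) * (1 + T\<^sup>2 * u\<^sup>2) / Q) \<le> (ga - al) * M"
  proof -
    have "0 \<le> (1 + T\<^sup>2 * u\<^sup>2) / T" using T by simp
    from mult_right_mono[OF angle_gap_ge[OF al, folded T_def u_def] this]
    have "3 * T * (1 - u) * (1 + T\<^sup>2 * u) / Q * ((1 + T\<^sup>2 * u\<^sup>2) / T) \<le> (ga - al) * M"
      unfolding M Q_def .
    moreover have "3 * T * (1 - u) * (1 + T\<^sup>2 * u) / Q * ((1 + T\<^sup>2 * u\<^sup>2) / T) = (1 - u) * (3 * (1 + T\<^sup>2 * u) * (1 + T\<^sup>2 * u\<^sup>2) / Q)"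
      using T by simp
    ultimately show ?thesis by simp
  qed
  have h0: "0 \<le> artanh u" using u by (rule artanh_nonneg)
  \<comment> \<open>The \<open>artanh\<close> terms of the frustum volume and of the hyperball
    volume combine to this one. It decreases in \<open>D\<close>, so a lower bound for
    \<open>D\<close> is enough; 837 / 10000 is (1 - 0.8326) / 2.\<close>
  have "(1 - D) / 2 * artanh u \<le> 837 / 10000 * artanh u" using D h0 by (intro mult_right_mono) auto
  also have "\<dots> \<le> 837 / 10000 * ((u + u / (1 - u\<^sup>2)) / 2)" using artanh_le_mean[OF u] by (intro mult_left_mono) auto
  finally have "y \<le> 837 / 20000 * (u + u / (1 - u\<^sup>2)) + u / (1 - u\<^sup>2) / 2 - H' - (ga - al) * M / (1 - u\<^sup>2)\<^sup>2"
    unfolding y_def by (simp add: algebra_simps diff_divide_distrib add_divide_distrib)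
  \<comment> \<open>Over the common denominator every term carries a factor \<open>1 - u\<close>:
    the one with \<open>H'\<close> by the hypothesis on \<open>E\<close>, the gap by its lower
    bound. What remains is \<open>poly\<close>.\<close>
  also have "\<dots> = ((1 - u) * (u * (1 + u) * (1 / 2 + 837 / 20000 * (2 - u\<^sup>2))) + - H' * (1 - u\<^sup>2)\<^sup>2 - (ga - al) * M) / (1 - u\<^sup>2)\<^sup>2"
  proof -
    have e: "(1 - u) * (u * (1 + u) * (1 / 2 + 837 / 20000 * (2 - u\<^sup>2))) = (1 - u\<^sup>2) * u * (1 / 2 + 837 / 20000 * (1 + (1 - u\<^sup>2)))"
      by (simp add: power2_eq_square field_simps)
    define v where "v = 1 - u\<^sup>2"
    show ?thesis unfolding e v_def[symmetric] using w unfolding v_def[symmetric]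
      by (simp add: divide_simps power2_eq_square) (simp add: algebra_simps)
  qed
  also have "\<dots> \<le> 0"
  proof -
    have "(1 - u) * (u * (1 + u) * (1 / 2 + 837 / 20000 * (2 - u\<^sup>2)) + E) \<le> (1 - u) * (3 * (1 + T\<^sup>2 * u) * (1 + T\<^sup>2 * u\<^sup>2) / Q)"
      using poly u unfolding Q_def by (intro mult_left_mono) auto
    with gap have "(1 - u) * (u * (1 + u) * (1 / 2 + 837 / 20000 * (2 - u\<^sup>2))) + - H' * (1 - u\<^sup>2)\<^sup>2 - (ga - al) * M \<le> 0"
      unfolding E by (simp add: distrib_left mult.commute[of E])
    then show ?thesis by (simp add: divide_nonpos_nonneg)
  qed
  finally show ?thesis using der by blast
qed

lemma decreasing_from_deriv:
  fixes F :: "real \<Rightarrow> real"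
  assumes "0 < a" "a \<le> b" and "\<And>x. 0 < x \<Longrightarrow> x \<le> b \<Longrightarrow> \<exists>y. (F has_real_derivative y) (at x) \<and> y \<le> 0"
  shows "F b \<le> F a"
proof (rule DERIV_nonpos_imp_nonincreasing[OF assms(2)])
  fix x assume x: "a \<le> x" "x \<le> b"
  then have "0 < x" using assms(1) by simp
  from assms(3)[OF this x(2)] show "\<exists>y. (F has_real_derivative y) (at x) \<and> y \<le> 0" .
qed

lemma tan_pi6_sq: "(tan (pi / 6))\<^sup>2 = 1 / 3"
  by (simp add: tan_30 power_divide)

lemma tan_pi3_sq: "(tan (pi / 3))\<^sup>2 = 3"
  by (simp add: tan_60)

text \<open>The cap is slightly above tan (\<pi>/7) / tan (\<pi>/6), the largest ratio that occurs.
  A cap below 1 is necessary here and in the two analogues below: at \<open>u = 1\<close> the left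
  side is 1.0837 and the right side 1. After clearing denominators, negative monomials are estimated
  at the cap and positive ones of high degree by 0.\<close>

lemma poly_36:
  fixes u :: real
  assumes u: "0 \<le> u" "u \<le> 8342 / 10000"
  shows "u * (1 + u) * (1 / 2 + 837 / 20000 * (2 - u\<^sup>2)) + u * (1 - u) * (1 + u)\<^sup>2 / (2 * (3 + u\<^sup>2))
      \<le> (3 + u) * (3 + u\<^sup>2) / (10 + 4 * u + 2 * u\<^sup>2)"
proof -
  have pw: "u ^ k \<le> (8342 / 10000) ^ k" "0 \<le> u ^ k" for k using u by (auto intro: power_mono)
  have "0 \<le> 54 - 13511 / 500 * u - 67577 / 2500 * u ^ 2 - 70881 / 5000 * u ^ 3 - 9163 / 5000 * u ^ 4
      + 2087 / 625 * u ^ 5 + 837 / 625 * u ^ 6 + 2511 / 5000 * u ^ 7 + 837 / 5000 * u ^ 8"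
    using pw(1)[of 1] pw(1)[of 2] pw(1)[of 3] pw(1)[of 4] pw(2)[of 5] pw(2)[of 6] pw(2)[of 7] pw(2)[of 8]
    by (simp add: power_divide)
  also have "\<dots> = 2 * (3 + u) * (3 + u\<^sup>2)\<^sup>2 - 2 * (u * (1 + u) * (1 / 2 + 837 / 20000 * (2 - u\<^sup>2))) * (3 + u\<^sup>2) * (10 + 4 * u + 2 * u\<^sup>2)
      - u * (1 - u) * (1 + u)\<^sup>2 * (10 + 4 * u + 2 * u\<^sup>2)"
    by (simp add: field_simps eval_nat_numeral)
  finally have nn: "0 \<le> \<dots>" .
  define A B R N where "A = 3 + u\<^sup>2" and "B = 10 + 4 * u + 2 * u\<^sup>2"
    and "R = u * (1 + u) * (1 / 2 + 837 / 20000 * (2 - u\<^sup>2))" and "N = u * (1 - u) * (1 + u)\<^sup>2"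
  have p: "0 < A" "0 < B" using u by (auto simp: A_def B_def add_pos_nonneg)
  have nn': "0 \<le> 2 * (3 + u) * A\<^sup>2 - 2 * R * A * B - N * B"
    using nn by (simp only: A_def B_def R_def N_def)
  have "(3 + u) * A / B - (R + N / (2 * A)) = (2 * (3 + u) * A\<^sup>2 - 2 * R * A * B - N * B) / (2 * A * B)"
    using p by (simp add: divide_simps power2_eq_square) (simp add: algebra_simps)
  also have "0 \<le> \<dots>" using nn' p by simp
  finally show ?thesis unfolding A_def[symmetric] B_def[symmetric] R_def[symmetric] N_def[symmetric] by simp
qed

text \<open>The cap is slightly above tan (\<pi>/5).\<close>

lemma poly_44:
  fixes u :: real
  assumes u: "0 \<le> u" "u \<le> 7266 / 10000"
  shows "u * (1 + u) * (1 / 2 + 837 / 20000 * (2 - u\<^sup>2)) + (1 - u) * (1 + u\<^sup>2) / (2 * (1 + u))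
      \<le> 3 * (1 + u) * (1 + u\<^sup>2) / (4 * (1 + u + u\<^sup>2))"
proof -
  have pw: "u ^ k \<le> (7266 / 10000) ^ k" "0 \<le> u ^ k" for k using u by (auto intro: power_mono)
  \<comment> \<open>The bracket decreases in \<open>u\<close>, so its value at the cap is a lower
    bound; it may be negative, but multiplied by \<open>u\<close> it stays above - 9 / 10.\<close>
  have "- 10273 / 10000 \<le> 9163 / 2500 - 7511 / 2500 * u - 5859 / 5000 * u ^ 2 - 17511 / 5000 * u ^ 3"
    using pw(1)[of 1] pw(1)[of 2] pw(1)[of 3] by (simp add: power_divide)
  then have "u * (- 10273 / 10000) \<le> u * (9163 / 2500 - 7511 / 2500 * u - 5859 / 5000 * u ^ 2 - 17511 / 5000 * u ^ 3)"
    using u by (intro mult_left_mono) auto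
  moreover have "- 9 / 10 \<le> u * (- 10273 / 10000)" using u by simp
  ultimately have "0 \<le> 1 + u * (9163 / 2500 - 7511 / 2500 * u - 5859 / 5000 * u ^ 2 - 17511 / 5000 * u ^ 3)"
    by linarith
  then have "0 \<le> 1 + u * (9163 / 2500 - 7511 / 2500 * u - 5859 / 5000 * u ^ 2 - 17511 / 5000 * u ^ 3)
      + 837 / 2500 * u ^ 5 + 2511 / 5000 * u ^ 6 + 837 / 5000 * u ^ 7"
    using pw(2)[of 5] pw(2)[of 6] pw(2)[of 7] by linarith
  also have "\<dots> = 3 * (1 + u)\<^sup>2 * (1 + u\<^sup>2) - 4 * (u * (1 + u) * (1 / 2 + 837 / 20000 * (2 - u\<^sup>2))) * (1 + u + u\<^sup>2) * (1 + u)
      - 2 * ((1 - u) * (1 + u\<^sup>2)) * (1 + u + u\<^sup>2)"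
    by (simp add: field_simps eval_nat_numeral)
  finally have nn: "0 \<le> \<dots>" .
  define A B R N where "A = 1 + u" and "B = 1 + u + u\<^sup>2"
    and "R = u * (1 + u) * (1 / 2 + 837 / 20000 * (2 - u\<^sup>2))" and "N = (1 - u) * (1 + u\<^sup>2)"
  have p: "0 < A" "0 < B" using u by (auto simp: A_def B_def add_pos_nonneg)
  have nn': "0 \<le> 3 * A\<^sup>2 * (1 + u\<^sup>2) - 4 * R * B * A - 2 * N * B"
    using nn by (simp only: A_def B_def R_def N_def)
  have "3 * A * (1 + u\<^sup>2) / (4 * B) - (R + N / (2 * A)) = (3 * A\<^sup>2 * (1 + u\<^sup>2) - 4 * R * B * A - 2 * N * B) / (4 * A * B)"
    using p by (simp add: divide_simps power2_eq_square) (simp add: algebra_simps)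
  also have "0 \<le> \<dots>" using nn' p by simp
  finally show ?thesis unfolding A_def B_def R_def N_def by simp
qed

text \<open>The cap is slightly above tan (\<pi>/4) / tan (\<pi>/3) = 1 / sqrt 3.\<close>

lemma poly_63:
  fixes u :: real
  assumes u: "0 \<le> u" "u \<le> 5775 / 10000"
  shows "u * (1 + u) * (1 / 2 + 837 / 20000 * (2 - u\<^sup>2)) + (1 - u) * (1 + 3 * u\<^sup>2) / (6 * (1 + u))
      \<le> (1 + 3 * u) * (1 + 3 * u\<^sup>2) / (2 * (1 + 2 * u + 5 * u\<^sup>2))"
proof -
  have pw: "u ^ k \<le> (5775 / 10000) ^ k" "0 \<le> u ^ k" for k using u by (auto intro: power_mono)
  have "0 \<le> 37489 / 2500 - 2511 / 625 * u - 11511 / 250 * u ^ 3"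
    using pw(1)[of 1] pw(1)[of 3] by (simp add: power_divide)
  then have "0 \<le> u * (37489 / 2500 - 2511 / 625 * u - 11511 / 250 * u ^ 3)"
    using u by (intro mult_nonneg_nonneg) auto
  then have "0 \<le> 4 + u * (37489 / 2500 - 2511 / 625 * u - 11511 / 250 * u ^ 3)
      + 32291 / 5000 * u ^ 3 + 7533 / 1250 * u ^ 6 + 2511 / 1000 * u ^ 7"
    using pw(2)[of 3] pw(2)[of 6] pw(2)[of 7] by linarith
  also have "\<dots> = 6 * (1 + 3 * u) * (1 + 3 * u\<^sup>2) * (1 + u) - 12 * (u * (1 + u) * (1 / 2 + 837 / 20000 * (2 - u\<^sup>2))) * (1 + 2 * u + 5 * u\<^sup>2) * (1 + u)
      - 2 * ((1 - u) * (1 + 3 * u\<^sup>2)) * (1 + 2 * u + 5 * u\<^sup>2)"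
    by (simp add: field_simps eval_nat_numeral)
  finally have nn: "0 \<le> \<dots>" .
  define A B R N where "A = 1 + u" and "B = 1 + 2 * u + 5 * u\<^sup>2"
    and "R = u * (1 + u) * (1 / 2 + 837 / 20000 * (2 - u\<^sup>2))" and "N = (1 - u) * (1 + 3 * u\<^sup>2)"
  have p: "0 < A" "0 < B" using u by (auto simp: A_def B_def add_pos_nonneg)
  have nn': "0 \<le> 6 * (1 + 3 * u) * (1 + 3 * u\<^sup>2) * A - 12 * R * B * A - 2 * N * B"
    using nn by (simp only: A_def B_def R_def N_def)
  have "(1 + 3 * u) * (1 + 3 * u\<^sup>2) / (2 * B) - (R + N / (6 * A)) = (6 * (1 + 3 * u) * (1 + 3 * u\<^sup>2) * A - 12 * R * B * A - 2 * N * B) / (12 * A * B)"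
    using p by (simp add: divide_simps) (simp add: algebra_simps)
  also have "0 \<le> \<dots>" using nn' p by simp
  finally show ?thesis unfolding A_def B_def R_def N_def by simp
qed

lemma DERIV_tan_sq: "cos x \<noteq> 0 \<Longrightarrow> (tan has_real_derivative 1 + (tan x)\<^sup>2) (at x)"
  using DERIV_tan[of x] tan_sec[of x] by (simp add: power_inverse)

lemma cos_times_sin:
  fixes x :: real
  assumes "cos x \<noteq> 0"
  shows "cos x * sin x = tan x / (1 + (tan x)\<^sup>2)"
proof -
  have "tan x / (1 + (tan x)\<^sup>2) = tan x * (cos x)\<^sup>2" using tan_sec[OF assms] by (simp add: inverse_eq_divide power_divide)
  then show ?thesis using assms by (simp add: tan_def power2_eq_square)
qed

lemma tan_scaled:
  assumes al: "0 < al" "al \<le> b" "b < ga" "ga < pi / 2" and k: "tan b \<le> k * tan ga"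
  shows "0 \<le> tan al / tan ga" "tan al / tan ga \<le> k" "tan al / tan ga < 1" "0 < cos al"
proof -
  show "0 \<le> tan al / tan ga" "tan al / tan ga < 1" using tan_ratio[of al ga] al by auto
  have "tan al \<le> tan b" using al by (intro tan_mono_le) auto
  moreover have "tan ga > 0" using al by (intro tan_gt_zero) auto
  ultimately show "tan al / tan ga \<le> k" using k by (simp add: pos_divide_le_eq)
  show "0 < cos al" using al by (intro cos_gt_zero) auto
qed

text \<open>The subtracted volumes belong to the horosphere through \<open>A 1\<close> and the
  hypersphere through \<open>A 2\<close>.\<close>

lemma deficit_36:
  assumes D: "8326 / 10000 \<le> D" and b: "b < pi / 6" "tan b \<le> 8342 / 10000 * tan (pi / 6)" and al: "0 < al" "al \<le> b"
  defines "F \<equiv> \<lambda>al. D * frustum_volume (pi / 6) al - tan (pi / 6) * (cos al)\<^sup>2 / 4 - hyperball_volume (pi / 6) al"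
  shows "F b \<le> F al"
proof (rule decreasing_from_deriv[OF al])
  fix x assume x: "0 < x" "x \<le> b"
  define T where "T = tan (pi / 6)"
  have T2: "T\<^sup>2 = 1 / 3" "T \<noteq> 0" using tan_pi6_sq unfolding T_def by auto
  define u where "u = tan x / T"
  have u: "0 \<le> u" "u \<le> 8342 / 10000" "u < 1" and c: "0 < cos x"
    using tan_scaled[OF x b(1) _ b(2)] unfolding u_def T_def by auto
  have xu: "tan x = T * u" using T2 by (simp add: u_def)
  show "\<exists>y. (F has_real_derivative y) (at x) \<and> y \<le> 0"
    unfolding F_def
  proof (rule deficit_has_nonpos_deriv[where H' = "- T * (cos x * sin x) / 2" and E = "u * (1 - u) * (1 + u)\<^sup>2 / (2 * (3 + u\<^sup>2))"])
    show "((\<lambda>al. tan (pi / 6) * (cos al)\<^sup>2 / 4) has_real_derivative - T * (cos x * sin x) / 2) (at x)"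
      unfolding T_def by (auto intro!: derivative_eq_intros)
    have "cos x * sin x = tan x / (1 + (tan x)\<^sup>2)"
      using c by (intro cos_times_sin) simp
    also have "\<dots> = T * u / (1 + u\<^sup>2 / 3)" by (simp add: xu power_mult_distrib T2)
    finally have "- (- T * (cos x * sin x) / 2) = T\<^sup>2 * u / (2 * (1 + u\<^sup>2 / 3))"
      by (simp add: power2_eq_square mult_ac)
    also have "\<dots> = u / (2 * (3 + u\<^sup>2))" unfolding T2 by (simp add: divide_simps)
    finally have H': "- (- T * (cos x * sin x) / 2) = u / (2 * (3 + u\<^sup>2))" .
    show "- (- T * (cos x * sin x) / 2) * (1 - (tan x / tan (pi / 6))\<^sup>2)\<^sup>2
       = u * (1 - u) * (1 + u)\<^sup>2 / (2 * (3 + u\<^sup>2)) * (1 - tan x / tan (pi / 6))"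
      unfolding H' T_def[symmetric] u_def[symmetric] by (simp add: power2_eq_square divide_inverse) (simp add: algebra_simps)
    have "(3 + u) * (3 + u\<^sup>2) / (10 + 4 * u + 2 * u\<^sup>2) = 3 * (1 + 1 / 3 * u) * (1 + 1 / 3 * u\<^sup>2) / (3 * (1 + 1 / 3 * u)\<^sup>2 + 1 / 3 * (1 - u)\<^sup>2)"
    proof -
      have "3 * (1 + 1 / 3 * u)\<^sup>2 + 1 / 3 * (1 - u)\<^sup>2 = (10 + 4 * u + 2 * u\<^sup>2) / 3"
        by (simp add: power2_eq_square field_simps)
      moreover have "3 * (1 + 1 / 3 * u) * (1 + 1 / 3 * u\<^sup>2) = (3 + u) * (3 + u\<^sup>2) / 3" by (simp add: field_simps)
      ultimately show ?thesis by (simp only:) simp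
    qed
    with poly_36[OF u(1,2)]
    show "tan x / tan (pi / 6) * (1 + tan x / tan (pi / 6)) * (1 / 2 + 837 / 20000 * (2 - (tan x / tan (pi / 6))\<^sup>2)) + u * (1 - u) * (1 + u)\<^sup>2 / (2 * (3 + u\<^sup>2))
      \<le> 3 * (1 + (tan (pi / 6))\<^sup>2 * (tan x / tan (pi / 6))) * (1 + (tan (pi / 6))\<^sup>2 * (tan x / tan (pi / 6))\<^sup>2) /
         (3 * (1 + (tan (pi / 6))\<^sup>2 * (tan x / tan (pi / 6)))\<^sup>2 + (tan (pi / 6))\<^sup>2 * (1 - tan x / tan (pi / 6))\<^sup>2)"
      unfolding T_def[symmetric] u_def[symmetric] T2(1) by simp
  qed (use x b D in auto)
qed

text \<open>Here the hypersphere passes through \<open>A 2\<close> and the horosphere is tangent to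
  it, at the height \<open>rho * exp h = s + c * T\<close>. The cusp volume c^2 T / (4 (s + c T)^2)
  is then T / (4 (tan \<alpha> + T)^2).\<close>

lemma deficit_tangent:
  assumes D: "8326 / 10000 \<le> D" and ga: "0 < ga" "ga < pi / 2" and b: "b < ga" "tan b \<le> k * tan ga" and al: "0 < al" "al \<le> b"
    and poly: "\<And>u. 0 \<le> u \<Longrightarrow> u \<le> k \<Longrightarrow> u * (1 + u) * (1 / 2 + 837 / 20000 * (2 - u\<^sup>2)) + (1 - u) * (1 + (tan ga)\<^sup>2 * u\<^sup>2) / (2 * (tan ga)\<^sup>2 * (1 + u))
      \<le> 3 * (1 + (tan ga)\<^sup>2 * u) * (1 + (tan ga)\<^sup>2 * u\<^sup>2) / (3 * (1 + (tan ga)\<^sup>2 * u)\<^sup>2 + (tan ga)\<^sup>2 * (1 - u)\<^sup>2)"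
  defines "F \<equiv> \<lambda>al. D * frustum_volume ga al - tan ga / (4 * (tan al + tan ga)\<^sup>2) - hyperball_volume ga al"
  shows "F b \<le> F al"
proof (rule decreasing_from_deriv[OF al])
  fix x assume x: "0 < x" "x \<le> b"
  define T where "T = tan ga"
  have T: "0 < T" unfolding T_def using ga by (rule tan_gt_zero)
  define u where "u = tan x / T"
  have u: "0 \<le> u" "u \<le> k" "u < 1" and c: "0 < cos x"
    using tan_scaled[OF x b(1) ga(2) b(2)] unfolding u_def T_def by auto
  have xu: "tan x = T * u" using T by (simp add: u_def)
  have d: "(tan has_real_derivative 1 + (tan x)\<^sup>2) (at x)"
    using c by (intro DERIV_tan_sq) simp
  have xT: "0 < tan x + T" unfolding xu using T u by (simp add: add_nonneg_pos)
  show "\<exists>y. (F has_real_derivative y) (at x) \<and> y \<le> 0"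
    unfolding F_def
  proof (rule deficit_has_nonpos_deriv[where H' = "- T * (1 + (tan x)\<^sup>2) / (2 * (tan x + T)^3)" and E = "(1 - u) * (1 + T\<^sup>2 * u\<^sup>2) / (2 * T\<^sup>2 * (1 + u))"])
    have "((\<lambda>al. tan ga / (4 * (tan al + tan ga)\<^sup>2)) has_real_derivative
       (0 * (4 * (tan x + T)\<^sup>2) - T * (4 * (2 * (tan x + T) * (1 + (tan x)\<^sup>2)))) / ((4 * (tan x + T)\<^sup>2) * (4 * (tan x + T)\<^sup>2))) (at x)"
      unfolding T_def[symmetric]
    proof (rule DERIV_divide[OF DERIV_const])
      have "((\<lambda>t. (tan t + T)\<^sup>2) has_real_derivative of_nat 2 * ((1 + (tan x)\<^sup>2 + 0) * (tan x + T) ^ (2 - Suc 0))) (at x)"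
        by (intro DERIV_power DERIV_add d DERIV_const)
      from DERIV_cmult[OF this, of 4]
      show "((\<lambda>t. 4 * (tan t + T)\<^sup>2) has_real_derivative 4 * (2 * (tan x + T) * (1 + (tan x)\<^sup>2))) (at x)"
        by (simp add: algebra_simps)
      show "4 * (tan x + T)\<^sup>2 \<noteq> 0" using xT by simp
    qed
    also have "(0 * (4 * (tan x + T)\<^sup>2) - T * (4 * (2 * (tan x + T) * (1 + (tan x)\<^sup>2)))) / ((4 * (tan x + T)\<^sup>2) * (4 * (tan x + T)\<^sup>2))
       = - T * (1 + (tan x)\<^sup>2) / (2 * (tan x + T)^3)"
    proof -
      have "(0 * (4 * w\<^sup>2) - T * (4 * (2 * w * m))) / ((4 * w\<^sup>2) * (4 * w\<^sup>2)) = - T * m / (2 * w^3)" if "0 < w" for w m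
        using that by (simp add: divide_simps power2_eq_square power3_eq_cube)
      from this[OF xT] show ?thesis .
    qed
    finally show "((\<lambda>al. tan ga / (4 * (tan al + tan ga)\<^sup>2)) has_real_derivative - T * (1 + (tan x)\<^sup>2) / (2 * (tan x + T)^3)) (at x)" .
    have "tan x + T = T * (1 + u)" by (simp add: xu algebra_simps)
    then have H': "- (- T * (1 + (tan x)\<^sup>2) / (2 * (tan x + T)^3)) = (1 + T\<^sup>2 * u\<^sup>2) / (2 * T\<^sup>2 * (1 + u)^3)"
      using T by (simp add: xu power_mult_distrib power2_eq_square power3_eq_cube mult_ac)
    have "1 + u \<noteq> 0" using u by simp
    then have "(1 + T\<^sup>2 * u\<^sup>2) / (2 * T\<^sup>2 * (1 + u)^3) * ((1 - u) * (1 + u))\<^sup>2 = (1 - u) * (1 + T\<^sup>2 * u\<^sup>2) / (2 * T\<^sup>2 * (1 + u)) * (1 - u)"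
      using T by (simp add: divide_simps power2_eq_square power3_eq_cube)
    moreover have "(1 - u) * (1 + u) = 1 - u\<^sup>2" by (simp add: power2_eq_square algebra_simps)
    ultimately show "- (- T * (1 + (tan x)\<^sup>2) / (2 * (tan x + T)^3)) * (1 - (tan x / tan ga)\<^sup>2)\<^sup>2
       = (1 - u) * (1 + T\<^sup>2 * u\<^sup>2) / (2 * T\<^sup>2 * (1 + u)) * (1 - tan x / tan ga)"
      unfolding H' T_def[symmetric] u_def[symmetric] by simp
    show "tan x / tan ga * (1 + tan x / tan ga) * (1 / 2 + 837 / 20000 * (2 - (tan x / tan ga)\<^sup>2)) + (1 - u) * (1 + T\<^sup>2 * u\<^sup>2) / (2 * T\<^sup>2 * (1 + u))
      \<le> 3 * (1 + (tan ga)\<^sup>2 * (tan x / tan ga)) * (1 + (tan ga)\<^sup>2 * (tan x / tan ga)\<^sup>2) /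
         (3 * (1 + (tan ga)\<^sup>2 * (tan x / tan ga))\<^sup>2 + (tan ga)\<^sup>2 * (1 - tan x / tan ga)\<^sup>2)"
      using poly[OF u(1,2)] unfolding T_def[symmetric] u_def[symmetric] .
  qed (use x b ga D in auto)
qed

lemma deficit_44:
  assumes "8326 / 10000 \<le> D" and "b < pi / 4" "tan b \<le> 7266 / 10000" and "0 < al" "al \<le> b"
  defines "F \<equiv> \<lambda>al. D * frustum_volume (pi / 4) al - 1 / (4 * (tan al + 1)\<^sup>2) - hyperball_volume (pi / 4) al"
  shows "F b \<le> F al"
proof -
  have T: "tan (pi / 4) = 1" by (rule tan_45)
  have *: "u * (1 + u) * (1 / 2 + 837 / 20000 * (2 - u\<^sup>2)) + (1 - u) * (1 + 1\<^sup>2 * u\<^sup>2) / (2 * 1\<^sup>2 * (1 + u))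
      \<le> 3 * (1 + 1\<^sup>2 * u) * (1 + 1\<^sup>2 * u\<^sup>2) / (3 * (1 + 1\<^sup>2 * u)\<^sup>2 + 1\<^sup>2 * (1 - u)\<^sup>2)" if "0 \<le> u" "u \<le> 7266 / 10000" for u :: real
  proof -
    have "3 * (1 + u)\<^sup>2 + (1 - u)\<^sup>2 = 4 * (1 + u + u\<^sup>2)" by (simp add: power2_eq_square algebra_simps)
    with poly_44[OF that] show ?thesis by simp
  qed
  show ?thesis
    unfolding F_def
    by (rule deficit_tangent[of D "pi / 4" b "7266 / 10000" al, unfolded T, OF assms(1) _ _ assms(2) _ assms(4,5) *]) (use assms in auto)
qed

lemma deficit_63:
  assumes "8326 / 10000 \<le> D" and "0 < al" "al \<le> pi / 4"
  defines "F \<equiv> \<lambda>al. D * frustum_volume (pi / 3) al - tan (pi / 3) / (4 * (tan al + tan (pi / 3))\<^sup>2) - hyperball_volume (pi / 3) al"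
  shows "F (pi / 4) \<le> F al"
proof -
  have *: "u * (1 + u) * (1 / 2 + 837 / 20000 * (2 - u\<^sup>2)) + (1 - u) * (1 + 3 * u\<^sup>2) / (2 * 3 * (1 + u))
      \<le> 3 * (1 + 3 * u) * (1 + 3 * u\<^sup>2) / (3 * (1 + 3 * u)\<^sup>2 + 3 * (1 - u)\<^sup>2)" if "0 \<le> u" "u \<le> 5775 / 10000" for u :: real
  proof -
    have "3 * (1 + 3 * u)\<^sup>2 + 3 * (1 - u)\<^sup>2 = 3 * (2 * (1 + 2 * u + 5 * u\<^sup>2))" by (simp add: power2_eq_square algebra_simps)
    then have e: "3 * (1 + 3 * u) * (1 + 3 * u\<^sup>2) / (3 * (1 + 3 * u)\<^sup>2 + 3 * (1 - u)\<^sup>2) = (1 + 3 * u) * (1 + 3 * u\<^sup>2) / (2 * (1 + 2 * u + 5 * u\<^sup>2))"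
      by (simp only: mult.assoc[of 3] mult_divide_mult_cancel_left_if) simp
    show ?thesis unfolding e using poly_63[OF that] by simp
  qed
  have "1 \<le> 5775 / 10000 * tan (pi / 3)"
  proof -
    have "(10000 / 5775)\<^sup>2 \<le> (tan (pi / 3))\<^sup>2" unfolding tan_pi3_sq by (simp add: power_divide)
    then have "10000 / 5775 \<le> tan (pi / 3)" by (rule power2_le_imp_le) (simp add: tan_60)
    then show ?thesis by simp
  qed
  then show ?thesis
    unfolding F_def
    by (intro deficit_tangent[of D "pi / 3" "pi / 4" "5775 / 10000" al, unfolded tan_pi3_sq, OF assms(1) _ _ _ _ assms(2,3) *])
      (simp_all add: tan_45)
qed

text \<open>It holds termwise in the power series, since x^(4 k + 2) is at most x^(2 k + 2).\<close>

lemma artanh_sq_le: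
  fixes x :: real
  assumes x: "0 \<le> x" "x < 1"
  shows "artanh (x\<^sup>2) \<le> x * artanh x"
proof -
  have "0 \<le> x * artanh x - artanh (x\<^sup>2)"
  proof (rule nonneg_of_deriv[OF x(1)])
    fix t assume t: "0 \<le> t" "t \<le> x"
    then have t1: "t\<^sup>2 < 1" "\<bar>t\<bar> < 1" "\<bar>t\<^sup>2\<bar> < 1" using x by (auto simp: abs_square_less_1)
    have p: "0 < 1 - t\<^sup>2" "0 < 1 + t\<^sup>2" using t1 by (auto simp: add_pos_nonneg)
    have "((\<lambda>x. x * artanh x - artanh (x\<^sup>2)) has_real_derivative
        (1 * artanh t + 1 / (1 - t\<^sup>2) * t) - 1 / (1 - (t\<^sup>2)\<^sup>2) * (2 * t)) (at t)"
      by (intro DERIV_diff DERIV_mult DERIV_ident artanh_real_has_field_derivative t1 DERIV_fun_artanh)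
        (auto intro!: derivative_eq_intros)
    moreover have "(1 * artanh t + 1 / (1 - t\<^sup>2) * t) - 1 / (1 - (t\<^sup>2)\<^sup>2) * (2 * t) = artanh t - t / (1 + t\<^sup>2)"
    proof -
      have "1 - (t\<^sup>2)\<^sup>2 = (1 - t\<^sup>2) * (1 + t\<^sup>2)" by (simp add: power2_eq_square algebra_simps)
      moreover have "1 / a * t - 1 / (a * b) * (2 * t) = - t / b" if "0 < a" "0 < b" "a + b = 2" for a b
      proof -
        have b: "b = 2 - a" using that by simp
        show ?thesis using that(1,2) unfolding b by (simp add: field_simps)
      qed
      from this[OF p] have "1 / (1 - t\<^sup>2) * t - 1 / ((1 - t\<^sup>2) * (1 + t\<^sup>2)) * (2 * t) = - t / (1 + t\<^sup>2)" by simp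
      ultimately show ?thesis by simp
    qed
    ultimately show "((\<lambda>x. x * artanh x - artanh (x\<^sup>2)) has_real_derivative artanh t - t / (1 + t\<^sup>2)) (at t)" by (simp only:)
    have "t / (1 + t\<^sup>2) \<le> t" using t by (simp add: pos_divide_le_eq p mult_le_cancel_left1)
    also have "t \<le> artanh t" using artanh_bounds(1)[of t t 1] t x by (simp add: artanh_sum_def)
    finally show "0 \<le> artanh t - t / (1 + t\<^sup>2)" by simp
  qed simp
  then show ?thesis by simp
qed

text \<open>For \<open>\<gamma> = \<pi>/4\<close>, the hyperball of width \<open>artanh ((tan \<alpha>)\<^sup>2)\<close> is the one that touches the horoball
  when the horosphere passes through \<open>A 1\<close>.\<close>

definition small_hyperball_volume :: "real \<Rightarrow> real" where
  "small_hyperball_volume al = (pi / 4 - al) / 2 * (artanh ((tan al)\<^sup>2) + (tan al)\<^sup>2 / (1 - ((tan al)\<^sup>2)\<^sup>2))"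

text \<open>Once the \<open>artanh\<close> terms cancel, the gap is bounded through sin (\<pi>/2 - 2
  t) \<le> \<pi>/2 - 2 t, that is, cos (2 t) \<le> 2 (\<pi>/4 - t). What is left amounts to (1 -
  x)^2 (1 + x + x^2) \<ge> 0.\<close>

lemma deficit_44_small:
  assumes D: "8326 / 10000 \<le> D" and b: "b < pi / 4" "tan b \<le> 7266 / 10000" and al: "0 < al" "al \<le> b"
  defines "F \<equiv> \<lambda>al. D * frustum_volume (pi / 4) al - (cos al)\<^sup>2 / 4 - small_hyperball_volume al"
  shows "F b \<le> F al"
proof (rule decreasing_from_deriv[OF al])
  fix t assume t: "0 < t" "t \<le> b"
  define x where "x = tan t"
  have x: "0 \<le> x" "x \<le> 7266 / 10000" "x < 1" and c: "0 < cos t"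
    using tan_scaled[of t b "pi / 4" "7266 / 10000"] t b by (auto simp: x_def tan_45)
  have x2: "x\<^sup>2 < 1" "\<bar>x\<^sup>2\<bar> < 1" using x by (auto simp: abs_square_less_1)
  have p: "0 < 1 - x\<^sup>2" "0 < 1 + x\<^sup>2" using x2 by (auto simp: add_pos_nonneg)
  have e4: "1 - (x\<^sup>2)\<^sup>2 = (1 - x\<^sup>2) * (1 + x\<^sup>2)" by (simp add: power2_eq_square algebra_simps)
  have d: "(tan has_real_derivative 1 + x\<^sup>2) (at t)"
    unfolding x_def using c by (intro DERIV_tan_sq) simp
  have d2: "((\<lambda>t. (tan t)\<^sup>2) has_real_derivative 2 * x * (1 + x\<^sup>2)) (at t)"
    using DERIV_power[OF d, of 2] by (simp add: x_def mult_ac)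
  have cs: "cos t * sin t = x / (1 + x\<^sup>2)"
    unfolding x_def using c by (intro cos_times_sin) simp
  have dV: "(frustum_volume (pi / 4) has_real_derivative - artanh x / 2) (at t)"
    using DERIV_frustum_volume[of t "pi / 4"] t b by (simp add: edge_length_def tan_45 x_def)
  have dW: "(small_hyperball_volume has_real_derivative
     (0 - 1) / 2 * (artanh (x\<^sup>2) + x\<^sup>2 / (1 - (x\<^sup>2)\<^sup>2)) + 2 * (2 * x * (1 + x\<^sup>2)) / (1 - (x\<^sup>2)\<^sup>2)\<^sup>2 * ((pi / 4 - t) / 2)) (at t)"
    unfolding small_hyperball_volume_def[abs_def] x_def
    by (intro DERIV_mult DERIV_cdivide DERIV_diff DERIV_const DERIV_ident DERIV_artanh_plus d2[unfolded x_def])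
      (use x2 in \<open>simp add: x_def\<close>)
  define y where "y = D * (- artanh x / 2) - (- (cos t * sin t) / 2)
     - ((0 - 1) / 2 * (artanh (x\<^sup>2) + x\<^sup>2 / (1 - (x\<^sup>2)\<^sup>2)) + 2 * (2 * x * (1 + x\<^sup>2)) / (1 - (x\<^sup>2)\<^sup>2)\<^sup>2 * ((pi / 4 - t) / 2))"
  have dF: "(F has_real_derivative y) (at t)"
    unfolding F_def y_def
    by (intro DERIV_diff DERIV_cmult dV dW) (auto intro!: derivative_eq_intros)
  have h0: "0 \<le> artanh x" using x by (intro artanh_nonneg) auto
  have "artanh (x\<^sup>2) \<le> x * artanh x" using x by (intro artanh_sq_le) auto
  \<comment> \<open>Since 0.7266 is less than 0.8326, \<open>x\<close> is at most
    \<open>D\<close>.\<close>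
  also have "\<dots> \<le> D * artanh x" using x D h0 by (intro mult_right_mono) auto
  finally have A: "artanh (x\<^sup>2) \<le> D * artanh x" .
  have gap: "(1 - x\<^sup>2) / (1 + x\<^sup>2) \<le> 2 * (pi / 4 - t)"
  proof -
    have "cos (2 * t) = (1 - x\<^sup>2) / (1 + x\<^sup>2)" 
    proof -
      have "cos (2 * t) = (cos t)\<^sup>2 * (1 - x\<^sup>2)"
        using c by (simp add: cos_double x_def tan_def power_divide right_diff_distrib)
      moreover have "(cos t)\<^sup>2 = 1 / (1 + x\<^sup>2)"
        using tan_sec[of t] c by (simp add: x_def power_divide inverse_eq_divide)
      ultimately show ?thesis by simp
    qed
    moreover have "sin (pi / 2 - 2 * t) \<le> pi / 2 - 2 * t" using t b by (intro sin_x_le_x) auto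
    ultimately show ?thesis by (simp add: sin_diff)
  qed
  have "(1 - x\<^sup>2) / (1 + x\<^sup>2) * (x * (1 + x\<^sup>2) / (1 - (x\<^sup>2)\<^sup>2)\<^sup>2) \<le> 2 * (pi / 4 - t) * (x * (1 + x\<^sup>2) / (1 - (x\<^sup>2)\<^sup>2)\<^sup>2)"
    using gap x p by (intro mult_right_mono) auto
  moreover have "2 * (2 * x * (1 + x\<^sup>2)) / (1 - (x\<^sup>2)\<^sup>2)\<^sup>2 * ((pi / 4 - t) / 2) = 2 * (pi / 4 - t) * (x * (1 + x\<^sup>2) / (1 - (x\<^sup>2)\<^sup>2)\<^sup>2)"
    by simp
  ultimately have B: "(1 - x\<^sup>2) / (1 + x\<^sup>2) * (x * (1 + x\<^sup>2) / (1 - (x\<^sup>2)\<^sup>2)\<^sup>2) \<le> 2 * (2 * x * (1 + x\<^sup>2)) / (1 - (x\<^sup>2)\<^sup>2)\<^sup>2 * ((pi / 4 - t) / 2)"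
    by (simp only:)
  have C: "x / (1 + x\<^sup>2) / 2 + x\<^sup>2 / (1 - (x\<^sup>2)\<^sup>2) / 2 \<le> (1 - x\<^sup>2) / (1 + x\<^sup>2) * (x * (1 + x\<^sup>2) / (1 - (x\<^sup>2)\<^sup>2)\<^sup>2)"
  proof -
    define a b where "a = 1 - x\<^sup>2" and "b = 1 + x\<^sup>2"
    have ab: "0 < a" "0 < b" "a = 1 - x\<^sup>2" "b = 1 + x\<^sup>2" using p by (auto simp: a_def b_def)
    have "0 \<le> (1 - x) * (1 - x) * (1 + x + x\<^sup>2)" using x by (intro mult_nonneg_nonneg) auto
    also have "\<dots> = 2 - a * b - x * b" unfolding ab(3,4) by (simp add: algebra_simps power2_eq_square)
    finally have "0 \<le> x * (2 - a * b - x * b) / (2 * a * b * b)" using x ab(1,2) by simp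
    also have "\<dots> = a / b * (x * b / (a * b)\<^sup>2) - (x / b / 2 + x\<^sup>2 / (a * b) / 2)"
      using ab(1,2) by (simp add: divide_simps power2_eq_square) (simp add: algebra_simps)
    finally show ?thesis unfolding e4 ab(3,4) by simp
  qed
  have "y \<le> 0" unfolding y_def using A B C cs by (simp add: algebra_simps add_divide_distrib diff_divide_distrib)
  with dF show "\<exists>y. (F has_real_derivative y) (at t) \<and> y \<le> 0" by blast
qed

section \<open>Polynomial bounds for the edge integral\<close>

text \<open>The coefficients are chosen so that \<open>T * edge_poly (T\<^sup>2) N ((tan t / T)\<^sup>2)\<close> has the \<open>N\<close>-th partial sum
  of the series of \<open>artanh (tan t / T)\<close> as its derivative, up to one monomial.\<close>

fun edge_coeff :: "real \<Rightarrow> nat \<Rightarrow> real" where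
  "edge_coeff q 0 = 1"
| "edge_coeff q (Suc n) = 1 / (2 * real n + 3) - q * edge_coeff q n"

definition edge_poly :: "real \<Rightarrow> nat \<Rightarrow> real \<Rightarrow> real" where
  "edge_poly q N w = (\<Sum>n<N. edge_coeff q n * w ^ (n + 1) / (2 * real n + 2))"

text \<open>The chain rule contributes the factor \<open>1 + T\<^sup>2 * x\<^sup>2\<close>. By the
  recursion consecutive coefficients combine to 1 / (2 n + 3), so the product telescopes to the
  coefficients of \<open>artanh\<close> and leaves one monomial at the end.\<close>

lemma DERIV_edge_poly:
  assumes "cos t \<noteq> 0" "T \<noteq> 0"
  defines "x \<equiv> tan t / T"
  shows "((\<lambda>t. T * edge_poly (T\<^sup>2) N ((tan t / T)\<^sup>2)) has_real_derivative
     artanh_sum N x + (edge_coeff (T\<^sup>2) N - 1 / (2 * real N + 1)) * - (x ^ (2 * N + 1))) (at t)"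
proof -
  have dx: "((\<lambda>t. tan t / T) has_real_derivative (1 + T\<^sup>2 * x\<^sup>2) / T) (at t)"
  proof -
    have "(tan has_real_derivative 1 + (tan t)\<^sup>2) (at t)"
      using assms(1) by (rule DERIV_tan_sq)
    from DERIV_cdivide[OF this, of T] show ?thesis using assms(2) by (simp add: x_def power_divide)
  qed
  have "((\<lambda>t. edge_poly (T\<^sup>2) N ((tan t / T)\<^sup>2)) has_real_derivative
     (\<Sum>n<N. edge_coeff (T\<^sup>2) n * (x ^ (2 * n + 1) * ((1 + T\<^sup>2 * x\<^sup>2) / T)))) (at t)"
    unfolding edge_poly_def
  proof (intro DERIV_sum)
    fix n
    have "((\<lambda>t. (tan t / T) ^ (2 * n + 2)) has_real_derivative of_nat (2 * n + 2) * ((1 + T\<^sup>2 * x\<^sup>2) / T * (tan t / T) ^ (2 * n + 2 - Suc 0))) (at t)"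
      by (rule DERIV_power[OF dx])
    from DERIV_cdivide[OF DERIV_cmult[OF this, of "edge_coeff (T\<^sup>2) n"], of "2 * real n + 2"]
    have "((\<lambda>t. edge_coeff (T\<^sup>2) n * (tan t / T) ^ (2 * n + 2) / (2 * real n + 2)) has_real_derivative
       edge_coeff (T\<^sup>2) n * (x ^ (2 * n + 1) * ((1 + T\<^sup>2 * x\<^sup>2) / T))) (at t)"
    proof (rule DERIV_cong)
      have e: "e * (r * (m * y)) / r = e * (y * m)" if "r \<noteq> 0" for e r m y :: real using that by simp
      have r: "real (2 * n + 2) = 2 * real n + 2" "2 * real n + 2 \<noteq> 0" "2 * n + 2 - Suc 0 = 2 * n + 1" by simp_all
      show "edge_coeff (T\<^sup>2) n * (real (2 * n + 2) * ((1 + T\<^sup>2 * x\<^sup>2) / T * (tan t / T) ^ (2 * n + 2 - Suc 0))) / (2 * real n + 2)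
        = edge_coeff (T\<^sup>2) n * (x ^ (2 * n + 1) * ((1 + T\<^sup>2 * x\<^sup>2) / T))"
        unfolding r(1,3) x_def[symmetric] by (rule e[OF r(2)])
    qed
    moreover have "(tan t / T) ^ (2 * n + 2) = ((tan t / T)\<^sup>2) ^ (n + 1)" for t
      unfolding power_mult[symmetric] by simp
    ultimately show "((\<lambda>t. edge_coeff (T\<^sup>2) n * ((tan t / T)\<^sup>2) ^ (n + 1) / (2 * real n + 2)) has_real_derivative
       edge_coeff (T\<^sup>2) n * (x ^ (2 * n + 1) * ((1 + T\<^sup>2 * x\<^sup>2) / T))) (at t)" by (simp only:)
  qed
  from DERIV_cmult[OF this, of T]
  have "((\<lambda>t. T * edge_poly (T\<^sup>2) N ((tan t / T)\<^sup>2)) has_real_derivative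
     (\<Sum>n<N. edge_coeff (T\<^sup>2) n * x ^ (2 * n + 1) * (1 + T\<^sup>2 * x\<^sup>2))) (at t)"
    using assms(2) by (simp add: sum_distrib_left mult.assoc mult.left_commute[of T])
  also have "(\<Sum>n<N. edge_coeff (T\<^sup>2) n * x ^ (2 * n + 1) * (1 + T\<^sup>2 * x\<^sup>2))
     = artanh_sum N x + (edge_coeff (T\<^sup>2) N - 1 / (2 * real N + 1)) * - (x ^ (2 * N + 1))"
  proof (induction N)
    case (Suc N)
    then show ?case by (simp add: artanh_sum_def algebra_simps power2_eq_square)
  qed (simp add: artanh_sum_def)
  finally show ?thesis .
qed

text \<open>The induction needs q / (2 n + 1) \<le> 1 / (2 n + 3), which holds for q \<le> 1/3 with
  equality at n = 0, q = 1/3, the value for \<gamma> = \<pi>/6.\<close>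

lemma edge_coeff_bounds:
  assumes "0 \<le> q" "q \<le> 1 / 3"
  shows "0 \<le> edge_coeff q n \<and> edge_coeff q n \<le> 1 / (2 * real n + 1)"
proof (induction n)
  case (Suc n)
  have "q * edge_coeff q n \<le> 1 / 3 * (1 / (2 * real n + 1))" using Suc assms by (intro mult_mono) auto
  also have "\<dots> \<le> 1 / (2 * real n + 3)" by (simp add: field_simps)
  finally have "q * edge_coeff q n \<le> 1 / (2 * real n + 3)" .
  moreover have "0 \<le> q * edge_coeff q n" using Suc assms by simp
  ultimately show ?case by (simp add: add.commute)
qed simp

text \<open>The remainders of the integrand are multiples of x^(2 N + 1) with x = tan t / T.
  Enlarged by the factor 1 + (tan t)^2 they have a monomial in x as antiderivative.\<close>

lemma edge_integral_poly_bounds: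
  assumes al: "0 < al" "al < ga" "ga < pi / 2" and T: "(tan ga)\<^sup>2 \<le> 1 / 3"
  defines "w \<equiv> (tan al / tan ga)\<^sup>2" and "T \<equiv> tan ga"
  shows "T * (edge_poly (T\<^sup>2) N w - w ^ (N + 1) / ((2 * real N + 1) * (2 * real N + 2))) \<le> edge_integral ga al"
    and "edge_integral ga al \<le> T * (edge_poly (T\<^sup>2) N w + w ^ (N + 1) / ((2 * real N + 1) * (2 * real N + 2) * (1 - w)))"
proof -
  have T0: "0 < T" unfolding T_def using al by (intro tan_gt_zero) auto
  have u: "0 \<le> tan al / T" "tan al / T < 1" unfolding T_def using tan_ratio[of al ga] al by auto
  have w1: "w < 1" unfolding w_def T_def[symmetric] using u by (simp add: abs_square_less_1)
  define M where "M = 1 / (2 * real N + 1)"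
  have M: "0 < M" "edge_coeff (T\<^sup>2) N \<le> M" "0 \<le> edge_coeff (T\<^sup>2) N"
    using edge_coeff_bounds[of "T\<^sup>2" N] T unfolding M_def T_def by auto
  have dR: "((\<lambda>t. T * (K * ((tan t / T) ^ (2 * N + 2) / (2 * real N + 2)))) has_real_derivative
      K * (1 + (tan t)\<^sup>2) * (tan t / T) ^ (2 * N + 1)) (at t)" if "cos t \<noteq> 0" for K t
  proof -
    have "(tan has_real_derivative 1 + (tan t)\<^sup>2) (at t)"
      using that by (rule DERIV_tan_sq)
    from DERIV_cmult[OF DERIV_cmult[OF DERIV_cdivide[OF DERIV_power[OF DERIV_cdivide[OF this, of T], of "2 * N + 2"], of "2 * real N + 2"], of K], of T]
    show ?thesis
    proof (rule DERIV_cong)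
      have e: "T * (K * (r * (m / T * y) / r)) = K * m * y" if "r \<noteq> 0" for r m y using that T0 by simp
      have r: "real (2 * N + 2) = 2 * real N + 2" "2 * real N + 2 \<noteq> 0" "2 * N + 2 - Suc 0 = 2 * N + 1" by simp_all
      show "T * (K * (real (2 * N + 2) * ((1 + (tan t)\<^sup>2) / T * (tan t / T) ^ (2 * N + 2 - Suc 0)) / (2 * real N + 2)))
        = K * (1 + (tan t)\<^sup>2) * (tan t / T) ^ (2 * N + 1)"
        unfolding r(1,3) by (rule e[OF r(2)])
    qed
  qed
  \<comment> \<open>The choice \<open>K = - M\<close> pushes the derivative below the partial sum of
    \<open>artanh\<close>; \<open>K = M / (1 - w)\<close> pushes it above partial sum plus
    tail.\<close>
  define F where "F = (\<lambda>K t. T * edge_poly (T\<^sup>2) N ((tan t / T)\<^sup>2) + T * (K * ((tan t / T) ^ (2 * N + 2) / (2 * real N + 2))))"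
  have dF: "(F K has_real_derivative artanh_sum N (tan t / T) + (edge_coeff (T\<^sup>2) N - M) * - ((tan t / T) ^ (2 * N + 1))
      + K * (1 + (tan t)\<^sup>2) * (tan t / T) ^ (2 * N + 1)) (at t)" if "0 \<le> t" "t \<le> al" for K t
  proof -
    have "cos t > 0" using that al by (intro cos_gt_zero_pi) auto
    then have "cos t \<noteq> 0" by simp
    then show ?thesis unfolding F_def M_def using T0 by (intro DERIV_add DERIV_edge_poly dR) auto
  qed
  have F0: "F K 0 = 0" for K by (simp add: F_def edge_poly_def)
  have FE: "F K al = T * (edge_poly (T\<^sup>2) N w + K * (w ^ (N + 1) / (2 * real N + 2)))" for K
    unfolding F_def w_def T_def[symmetric] by (simp only: power_mult[symmetric] distrib_left) simp
  have x: "0 \<le> tan t / T" "tan t / T \<le> tan al / T" if "0 \<le> t" "t \<le> al" for t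
  proof -
    show "0 \<le> tan t / T" unfolding T_def using tan_ratio[of t ga] that al by auto
    have "tan t \<le> tan al" using that al by (intro tan_mono_le) auto
    then show "tan t / T \<le> tan al / T" using T0 by (simp add: divide_right_mono)
  qed
  have "F (- M) al - F (- M) 0 \<le> edge_integral ga al"
  proof (rule edge_integral_bounds(2)[OF less_imp_le[OF al(1)] al(2,3) dF])
    fix t assume t: "0 \<le> t" "t \<le> al"
    have "artanh_sum N (tan t / T) \<le> artanh (tan t / T)" using x[OF t] u by (intro artanh_bounds(1)) auto
    moreover have "(edge_coeff (T\<^sup>2) N - M) * - ((tan t / T) ^ (2 * N + 1)) + - M * (1 + (tan t)\<^sup>2) * (tan t / T) ^ (2 * N + 1)
       = - (edge_coeff (T\<^sup>2) N + M * (tan t)\<^sup>2) * (tan t / T) ^ (2 * N + 1)"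
    proof -
      have "(e - M) * - y + - M * (1 + z) * y = - (e + M * z) * y" for e y z :: real by (simp add: algebra_simps)
      then show ?thesis by (simp only:)
    qed
    moreover have "0 \<le> (edge_coeff (T\<^sup>2) N + M * (tan t)\<^sup>2) * (tan t / T) ^ (2 * N + 1)"
      by (intro mult_nonneg_nonneg add_nonneg_nonneg zero_le_power x(1)[OF t] M(3) less_imp_le[OF M(1)] zero_le_power2)
    ultimately show "artanh_sum N (tan t / T) + (edge_coeff (T\<^sup>2) N - M) * - ((tan t / T) ^ (2 * N + 1))
       + - M * (1 + (tan t)\<^sup>2) * (tan t / T) ^ (2 * N + 1) \<le> edge_length ga t"
      unfolding edge_length_def T_def[symmetric] by linarith
  qed
  then show "T * (edge_poly (T\<^sup>2) N w - w ^ (N + 1) / ((2 * real N + 1) * (2 * real N + 2))) \<le> edge_integral ga al"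
    unfolding F0 FE by (simp add: M_def)
  have "edge_integral ga al \<le> F (M / (1 - w)) al - F (M / (1 - w)) 0"
  proof (rule edge_integral_bounds(1)[OF less_imp_le[OF al(1)] al(2,3) dF])
    fix t assume t: "0 \<le> t" "t \<le> al"
    have "artanh (tan t / T) \<le> artanh_sum N (tan t / T) + (tan t / T) ^ (2 * N + 1) / (real (2 * N + 1) * (1 - (tan al / T)\<^sup>2))"
      using x[OF t] u by (intro artanh_bounds(2)) auto
    also have "(tan t / T) ^ (2 * N + 1) / (real (2 * N + 1) * (1 - (tan al / T)\<^sup>2)) = M / (1 - w) * 1 * (tan t / T) ^ (2 * N + 1)"
      unfolding w_def M_def T_def[symmetric] by (simp add: add.commute)
    also have "\<dots> \<le> M / (1 - w) * (1 + (tan t)\<^sup>2) * (tan t / T) ^ (2 * N + 1)"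
      using M w1 zero_le_power[OF x(1)[OF t], of "2 * N + 1"] by (intro mult_right_mono mult_left_mono) auto
    moreover have "0 \<le> (edge_coeff (T\<^sup>2) N - M) * - ((tan t / T) ^ (2 * N + 1))"
      using M zero_le_power[OF x(1)[OF t], of "2 * N + 1"] by (intro mult_nonpos_nonpos) auto
    ultimately show "edge_length ga t \<le> artanh_sum N (tan t / T) + (edge_coeff (T\<^sup>2) N - M) * - ((tan t / T) ^ (2 * N + 1))
       + M / (1 - w) * (1 + (tan t)\<^sup>2) * (tan t / T) ^ (2 * N + 1)"
      unfolding edge_length_def T_def[symmetric] by linarith
  qed
  then show "edge_integral ga al \<le> T * (edge_poly (T\<^sup>2) N w + w ^ (N + 1) / ((2 * real N + 1) * (2 * real N + 2) * (1 - w)))"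
    unfolding F0 FE by (simp add: M_def mult_ac)
qed

text \<open>Meant for \<gamma> = \<pi>/4 and \<pi>/3, where the square of tan \<gamma> exceeds 1/3.
  The constants are chosen so that the quintic bound x + x^3 / 3 + x^5 / (5 (1 - w)) of
  \<open>artanh\<close> equals x (1 + T^2 x^2) (a + b x^2) + (1 - a) x: the first part integrates to
  a polynomial in x^2, the second to the logarithm.\<close>

lemma edge_integral_le_ln:
  assumes al: "0 < al" "al < ga" "ga < pi / 2"
  defines "w \<equiv> (tan al / tan ga)\<^sup>2" and "T \<equiv> tan ga"
  assumes b: "b = 1 / (5 * (1 - w)) / T\<^sup>2" and a: "a = (1 / 3 - b) / T\<^sup>2"
  shows "edge_integral ga al \<le> T / 2 * (a * w + b * w\<^sup>2 / 2) + (1 - a) / (2 * T) * ln (1 + (tan al)\<^sup>2)"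
proof -
  have T0: "0 < T" unfolding T_def using al by (intro tan_gt_zero) auto
  have u: "0 \<le> tan al / T" "tan al / T < 1" unfolding T_def using tan_ratio[of al ga] al by auto
  define F where "F = (\<lambda>t. T / 2 * (a * (tan t / T)\<^sup>2 + b * ((tan t / T)\<^sup>2)\<^sup>2 / 2) + (1 - a) / (2 * T) * ln (1 + (tan t)\<^sup>2))"
  have "edge_integral ga al \<le> F al - F 0"
  proof (rule edge_integral_bounds(1)[OF less_imp_le[OF al(1)] al(2,3)])
    fix t assume t: "0 \<le> t" "t \<le> al"
    define x where "x = tan t / T"
    have xt: "tan t = T * x" using T0 by (simp add: x_def)
    have x: "0 \<le> x" "x \<le> tan al / T"
    proof -
      show "0 \<le> x" unfolding x_def T_def using tan_ratio[of t ga] t al by auto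
      have "tan t \<le> tan al" using t al by (intro tan_mono_le) auto
      then show "x \<le> tan al / T" unfolding x_def using T0 by (simp add: divide_right_mono)
    qed
    have c: "cos t > 0" using t al by (intro cos_gt_zero_pi) auto
    have d: "(tan has_real_derivative 1 + (tan t)\<^sup>2) (at t)"
      using c by (intro DERIV_tan_sq) simp
    have p: "0 < 1 + (tan t)\<^sup>2" by (simp add: add_pos_nonneg)
    have dx: "((\<lambda>t. tan t / T) has_real_derivative (1 + (tan t)\<^sup>2) / T) (at t)" by (intro DERIV_cdivide d)
    have dx2: "((\<lambda>t. (tan t / T)\<^sup>2) has_real_derivative 2 * x * ((1 + (tan t)\<^sup>2) / T)) (at t)"
      using DERIV_power[OF dx, of 2] unfolding x_def by (simp add: mult_ac)
    have dx4: "((\<lambda>t. ((tan t / T)\<^sup>2)\<^sup>2) has_real_derivative 2 * x\<^sup>2 * (2 * x * ((1 + (tan t)\<^sup>2) / T))) (at t)"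
      using DERIV_power[OF dx2, of 2] by (simp add: x_def mult_ac)
    have dt2: "((\<lambda>t. (tan t)\<^sup>2) has_real_derivative 2 * tan t * (1 + (tan t)\<^sup>2)) (at t)"
      using DERIV_power[OF d, of 2] by (simp add: mult_ac)
    have dl: "((\<lambda>t. ln (1 + (tan t)\<^sup>2)) has_real_derivative 2 * tan t) (at t)"
    proof (rule DERIV_cong[OF DERIV_chain2[OF DERIV_ln[OF p] DERIV_add[OF DERIV_const[of 1] dt2]]])
      have "inverse m * (0 + y * m) = y" if "0 < m" for m y :: real using that by simp
      from this[OF p] show "inverse (1 + (tan t)\<^sup>2) * (0 + 2 * tan t * (1 + (tan t)\<^sup>2)) = 2 * tan t" .
    qed
    have "(F has_real_derivative T / 2 * (a * (2 * x * ((1 + (tan t)\<^sup>2) / T)) + b * (2 * x\<^sup>2 * (2 * x * ((1 + (tan t)\<^sup>2) / T))) / 2)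
        + (1 - a) / (2 * T) * (2 * tan t)) (at t)"
      unfolding F_def by (intro DERIV_add DERIV_cmult DERIV_cdivide dx2 dx4 dl)
    moreover have "T / 2 * (a * (2 * x * ((1 + (tan t)\<^sup>2) / T)) + b * (2 * x\<^sup>2 * (2 * x * ((1 + (tan t)\<^sup>2) / T))) / 2)
        + (1 - a) / (2 * T) * (2 * tan t) = x * (1 + T\<^sup>2 * x\<^sup>2) * (a + b * x\<^sup>2) + (1 - a) * x"
      using T0 by (simp add: xt field_simps power2_eq_square)
    moreover have "\<dots> = x + (a * T\<^sup>2 + b) * x ^ 3 + b * T\<^sup>2 * x ^ 5"
      by (simp add: algebra_simps power2_eq_square eval_nat_numeral)
    moreover have "a * T\<^sup>2 + b = 1 / 3" "b * T\<^sup>2 = 1 / (5 * (1 - w))" using T0 by (simp_all add: a b)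
    ultimately show "(F has_real_derivative (tan t / T) + 1 / 3 * (tan t / T) ^ 3 + 1 / (5 * (1 - w)) * (tan t / T) ^ 5) (at t)"
      unfolding x_def by simp
    have "artanh x \<le> artanh_sum 2 x + x ^ (2 * 2 + 1) / (real (2 * 2 + 1) * (1 - (tan al / T)\<^sup>2))"
      using x u by (intro artanh_bounds(2)) auto
    then show "edge_length ga t \<le> (tan t / T) + 1 / 3 * (tan t / T) ^ 3 + 1 / (5 * (1 - w)) * (tan t / T) ^ 5"
      unfolding edge_length_def T_def[symmetric] x_def[symmetric] w_def by (simp add: artanh_sum_def eval_nat_numeral)
  qed
  then show ?thesis unfolding F_def w_def T_def[symmetric] by simp
qed

section \<open>Numerical evaluation at the extremal angles\<close>

lemma ln_3_bounds: "2 * 549306114 / 10^9 \<le> ln (3::real)" "ln (3::real) \<le> 2 * 549306146 / 10^9"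
proof -
  have e: "ln 3 = 2 * artanh (1 / 2 :: real)" by (simp add: artanh_def)
  show "2 * 549306114 / 10^9 \<le> ln (3::real)" "ln (3::real) \<le> 2 * 549306146 / 10^9"
    unfolding e using artanh_bounds[of "1 / 2 :: real" "1 / 2" 10]
    by (simp_all add: artanh_sum_def eval_nat_numeral)
qed

text \<open>The addition theorem of \<open>artanh\<close> with artanh (4/5) = ln 3. It moves
  arguments near 0.834 to about 0.1, where four terms of the series suffice.\<close>

lemma artanh_shift_ln3:
  fixes r :: real
  assumes "8 / 10 \<le> r" "r < 1"
  shows "artanh r = ln 3 + artanh ((10 * r - 8) / (10 - 8 * r))"
proof -
  define s where "s = (10 * r - 8) / (10 - 8 * r)"
  have p: "0 < 10 - 8 * r" using assms by simp
  have "1 + s = (2 + 2 * r) / (10 - 8 * r)" "1 - s = (18 - 18 * r) / (10 - 8 * r)"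
    using p by (simp_all add: s_def field_simps)
  then have "(1 + s) / (1 - s) = (2 + 2 * r) / (18 - 18 * r)" using p by simp
  also have "\<dots> = ((1 + r) / (1 - r)) / 9" using assms by (simp add: field_simps)
  finally have e: "(1 + s) / (1 - s) = ((1 + r) / (1 - r)) / 3\<^sup>2" by simp
  have "ln (((1 + r) / (1 - r)) / 3\<^sup>2) = ln ((1 + r) / (1 - r)) - ln (3\<^sup>2)" using assms by (intro ln_divide_pos) auto
  moreover have "ln (3\<^sup>2) = 2 * ln (3::real)" using ln_realpow[of 3 2] by simp
  ultimately have "ln (((1 + r) / (1 - r)) / 3\<^sup>2) = ln ((1 + r) / (1 - r)) - 2 * ln 3" by (simp only:)
  then show ?thesis unfolding s_def[symmetric] artanh_def e by linarith
qed

text \<open>For \<theta> = \<pi>/7 the angles 3 \<theta> and 4 \<theta> are supplementary;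
  expressing cos (4 \<theta>) = - cos (3 \<theta>) in c and dividing by c + 1 leaves a cubic
  equation.\<close>

lemma cos_pi7_bounds: "9009688678 / 10^10 \<le> cos (pi / 7)" "cos (pi / 7) \<le> 9009688680 / 10^10"
proof -
  define c where "c = cos (pi / 7)"
  have "cos (pi / 6) < c" unfolding c_def by (intro cos_monotone_0_pi) auto
  moreover have "86 / 100 \<le> sqrt 3 / 2"
    using real_le_rsqrt[of "86 / 50" 3] by (simp add: power_divide)
  ultimately have c: "86 / 100 \<le> c" by (simp add: cos_30)
  have "cos (2 * (2 * (pi / 7))) = - cos (3 * (pi / 7))"
    using cos_pi_minus[of "3 * (pi / 7)"] by (simp add: field_simps)
  then have "2 * (2 * c\<^sup>2 - 1)\<^sup>2 - 1 = - (4 * c ^ 3 - 3 * c)"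
    unfolding cos_treble_cos c_def by (simp only: cos_double_cos)
  then have "(c + 1) * (8 * c ^ 3 - 4 * c\<^sup>2 - 4 * c + 1) = 0"
    by (simp add: algebra_simps eval_nat_numeral)
  then have z: "8 * c ^ 3 - 4 * c\<^sup>2 - 4 * c + 1 = 0" using c by auto
  \<comment> \<open>The cubic is increasing from 0.86 on, so comparing its values locates the
    root.\<close>
  have mono: "x \<le> y" if "86 / 100 \<le> x" "86 / 100 \<le> y" "8 * x ^ 3 - 4 * x\<^sup>2 - 4 * x + 1 \<le> 8 * y ^ 3 - 4 * y\<^sup>2 - 4 * y + 1" for x y :: real
  proof (rule ccontr)
    assume "\<not> x \<le> y"
    have "86 / 100 * x \<le> x * x" "86 / 100 * y \<le> y * y" "86 / 100 * x \<le> y * x" using that by (auto intro: mult_right_mono)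
    moreover have "0 < 8 * (A + B + C) - 4 * (x + y) - 4" if "86 / 100 * x \<le> A" "86 / 100 * y \<le> C" "86 / 100 * x \<le> B" "86 / 100 \<le> x" "86 / 100 \<le> y" for A B C :: real
      using that by simp
    ultimately have "0 < 8 * (x * x + y * x + y * y) - 4 * (x + y) - 4" using that(1,2) by blast
    then have "0 < (x - y) * (8 * (x * x + y * x + y * y) - 4 * (x + y) - 4)" using \<open>\<not> x \<le> y\<close> by simp
    then show False using that(3) by (simp add: algebra_simps eval_nat_numeral)
  qed
  show "9009688678 / 10^10 \<le> cos (pi / 7)"
    using mono[of "9009688678 / 10^10" c] c unfolding z unfolding c_def by (simp add: eval_nat_numeral)
  show "cos (pi / 7) \<le> 9009688680 / 10^10"
    using mono[of c "9009688680 / 10^10"] c unfolding z unfolding c_def by (simp add: eval_nat_numeral)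
qed

lemma tan_sq_eq: "cos x \<noteq> 0 \<Longrightarrow> (tan x)\<^sup>2 = 1 / (cos x)\<^sup>2 - (1 :: real)"
  using tan_sec[of x] by (simp add: power_divide inverse_eq_divide)

lemma tan_ratio_36:
  defines "u \<equiv> tan (pi / 7) / tan (pi / 6)"
  shows "69574233 / 10^8 \<le> u\<^sup>2" "u\<^sup>2 \<le> 69574235 / 10^8" "8341117 / 10^7 \<le> u" "u \<le> 83411172 / 10^8"
proof -
  define c where "c = cos (pi / 7)"
  note c = cos_pi7_bounds[folded c_def]
  have c0: "0 < c" using c(1) by (rule less_le_trans[rotated]) simp
  have "(9009688678 / 10^10)\<^sup>2 \<le> c\<^sup>2" "c\<^sup>2 \<le> (9009688680 / 10^10)\<^sup>2"
    using c c0 by (intro power_mono; simp)+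
  then have c2: "8117449007 / 10^10 \<le> c\<^sup>2" "c\<^sup>2 \<le> 8117449012 / 10^10" by (simp_all add: power_divide)
  have u2: "u\<^sup>2 = 3 * (1 / c\<^sup>2 - 1)"
    using c0 tan_sq_eq[of "pi / 7"] by (simp add: u_def power_divide tan_pi6_sq c_def)
  show W: "69574233 / 10^8 \<le> u\<^sup>2" "u\<^sup>2 \<le> 69574235 / 10^8"
  proof -
    have "1 / (8117449012 / 10^10) \<le> 1 / c\<^sup>2" "1 / c\<^sup>2 \<le> 1 / (8117449007 / 10^10)"
      using c2 c0 by (intro divide_left_mono; simp)+
    then show "69574233 / 10^8 \<le> u\<^sup>2" "u\<^sup>2 \<le> 69574235 / 10^8" unfolding u2 by simp_all
  qed
  have u0: "0 \<le> u" unfolding u_def using tan_ratio[of "pi / 7" "pi / 6"] by simp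
  show "8341117 / 10^7 \<le> u"
    by (rule power2_le_imp_le[OF order.trans[OF _ W(1)] u0]) (simp add: power_divide)
  show "u \<le> 83411172 / 10^8"
    by (rule power2_le_imp_le[OF order.trans[OF W(2)]]) (simp_all add: power_divide)
qed

text \<open>The certificate \<open>xs\<close> lists the Horner tails of the polynomial, in units of \<open>10^-8\<close> and
  each correct up to 10 units; rounding every tail keeps the rational arithmetic small.\<close>

fun horner_certificate :: "real \<Rightarrow> real \<Rightarrow> real \<Rightarrow> real \<Rightarrow> real \<Rightarrow> real list \<Rightarrow> bool" where
  "horner_certificate q v w m b [] \<longleftrightarrow> False"
| "horner_certificate q v w m b [x] \<longleftrightarrow> x = 0"
| "horner_certificate q v w m b (x # y # xs) \<longleftrightarrow>
     (x - 10) / 10^8 \<le> b / (2 * m + 2) + v * ((y - 10) / 10^8) \<and> b / (2 * m + 2) + w * ((y + 10) / 10^8) \<le> (x + 10) / 10^8 \<and>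
     horner_certificate q v w (m + 1) (1 / (2 * m + 3) - q * b) (y # xs)"

text \<open>For q \<le> 1/3 the coefficients are nonnegative, so a tail times \<open>t\<close> lies
  between its multiples by \<open>v\<close> and by \<open>w\<close>; the rounding intervals then
  propagate from the last tail to the first.\<close>

lemma horner_certificate_sound:
  assumes "horner_certificate q v w (real n) (edge_coeff q n) (x # xs)"
    and t: "0 \<le> v" "v \<le> t" "t \<le> w" and q: "0 \<le> q" "q \<le> 1 / 3"
  shows "(x - 10) / 10^8 \<le> (\<Sum>k<length xs. edge_coeff q (n + k) * t ^ k / (2 * real (n + k) + 2)) \<and>
    (\<Sum>k<length xs. edge_coeff q (n + k) * t ^ k / (2 * real (n + k) + 2)) \<le> (x + 10) / 10^8"
  using assms(1)
proof (induction xs arbitrary: n x)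
  case (Cons y xs)
  define S where "S = (\<Sum>k<length xs. edge_coeff q (Suc n + k) * t ^ k / (2 * real (Suc n + k) + 2))"
  have S0: "0 \<le> S" unfolding S_def using edge_coeff_bounds[OF q] t
    by (intro sum_nonneg divide_nonneg_nonneg mult_nonneg_nonneg zero_le_power) (auto simp del: edge_coeff.simps)
  have c: "(x - 10) / 10^8 \<le> edge_coeff q n / (2 * real n + 2) + v * ((y - 10) / 10^8)"
    "edge_coeff q n / (2 * real n + 2) + w * ((y + 10) / 10^8) \<le> (x + 10) / 10^8"
    "horner_certificate q v w (real (Suc n)) (edge_coeff q (Suc n)) (y # xs)"
    using Cons.prems by (simp_all add: add.commute)
  from Cons.IH[OF c(3)] have S: "(y - 10) / 10^8 \<le> S" "S \<le> (y + 10) / 10^8" by (auto simp: S_def)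
  have "v * ((y - 10) / 10^8) \<le> v * S" using S(1) t by (intro mult_left_mono) auto
  also have "\<dots> \<le> t * S" using t S0 by (intro mult_right_mono)
  finally have l: "v * ((y - 10) / 10^8) \<le> t * S" .
  have "t * S \<le> w * S" using t S0 by (intro mult_right_mono)
  also have "\<dots> \<le> w * ((y + 10) / 10^8)" using S(2) t by (intro mult_left_mono) auto
  finally have u: "t * S \<le> w * ((y + 10) / 10^8)" .
  have "(\<Sum>k<length (y # xs). edge_coeff q (n + k) * t ^ k / (2 * real (n + k) + 2))
     = edge_coeff q n / (2 * real n + 2) + (\<Sum>k<length xs. t * (edge_coeff q (Suc n + k) * t ^ k / (2 * real (Suc n + k) + 2)))"
    by (simp add: mult_ac sum.lessThan_Suc_shift del: sum.lessThan_Suc edge_coeff.simps)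
  also have "\<dots> = edge_coeff q n / (2 * real n + 2) + t * S" by (simp only: S_def sum_distrib_left)
  finally have e: "(\<Sum>k<length (y # xs). edge_coeff q (n + k) * t ^ k / (2 * real (n + k) + 2)) = edge_coeff q n / (2 * real n + 2) + t * S" .
  show ?case unfolding e using l u c(1,2) by linarith
qed simp

lemma edge_poly_bounds:
  assumes t: "69574233 / 10^8 \<le> t" "t \<le> 69574235 / 10^8"
  shows "36400988 / 10^8 \<le> edge_poly (1 / 3) 22 t" "edge_poly (1 / 3) 22 t \<le> 36401004 / 10^8"
proof -
  have ep: "edge_poly (1 / 3) 22 t = t * (\<Sum>k<22. edge_coeff (1 / 3) k * t ^ k / (2 * real k + 2))"
    by (simp only: edge_poly_def sum_distrib_left) (simp add: mult_ac)
  \<comment> \<open>Together with the head 52319650 these are the tails starting at the coefficients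
    0 to 21; the final 0 is the empty tail.\<close>
  define xs :: "real list" where "xs = [3334064, 4792096, 2096700, 1644745, 1132031, 880427, 689048, 559615, 462265, 388802, 331244, 285259, 247603, 216030, 188804, 164512, 141876, 119623, 96329, 70262, 39169, 0]"
  have "horner_certificate (1 / 3) (69574233 / 10^8) (69574235 / 10^8) (real 0) (edge_coeff (1 / 3) 0) (52319650 # xs)"
    unfolding xs_def by simp
  from horner_certificate_sound[OF this _ t]
  have "(52319650 - 10) / 10^8 \<le> (\<Sum>k<length xs. edge_coeff (1 / 3) (0 + k) * t ^ k / (2 * real (0 + k) + 2)) \<and>
    (\<Sum>k<length xs. edge_coeff (1 / 3) (0 + k) * t ^ k / (2 * real (0 + k) + 2)) \<le> (52319650 + 10) / 10^8"
    by simp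
  moreover have "length xs = 22" by (simp add: xs_def)
  ultimately have "(52319650 - 10) / 10^8 \<le> (\<Sum>k<22. edge_coeff (1 / 3) k * t ^ k / (2 * real k + 2))"
    "(\<Sum>k<22. edge_coeff (1 / 3) k * t ^ k / (2 * real k + 2)) \<le> (52319650 + 10) / 10^8"
    by (simp_all only: add_0)
  moreover have "36400988 / 10^8 \<le> t * S \<and> t * S \<le> 36401004 / 10^8"
    if "(52319650 - 10) / 10^8 \<le> S" "S \<le> (52319650 + 10) / 10^8" for S
  proof -
    have "69574233 / 10^8 * ((52319650 - 10) / 10^8) \<le> t * S" "t * S \<le> 69574235 / 10^8 * ((52319650 + 10) / 10^8)"
      using that t by (intro mult_mono; simp)+
    then show ?thesis by simp
  qed
  ultimately show "36400988 / 10^8 \<le> edge_poly (1 / 3) 22 t" "edge_poly (1 / 3) 22 t \<le> 36401004 / 10^8"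
    unfolding ep by blast+
qed

text \<open>Since the square of tan (\<pi>/6) is 1/3, the series is tan (\<pi>/6) times an
  alternating rational series; an even and an odd partial sum enclose it.\<close>

lemma ti2_tan_pi6_bounds:
  "96677642 / 10^8 * tan (pi / 6) \<le> ti2 (tan (pi / 6))" "ti2 (tan (pi / 6)) \<le> 96677647 / 10^8 * tan (pi / 6)"
proof -
  define T where "T = tan (pi / 6)"
  have T: "0 < T" "T\<^sup>2 = 1 / 3" unfolding T_def using tan_pi6_sq by (auto intro: tan_gt_zero)
  have "ti2_sum n T = (\<Sum>k<n. (- (1 / 3)) ^ k / (real (2 * k + 1))\<^sup>2) * T" for n
  proof -
    have "(- 1) ^ k * (T ^ (2 * k + 1) / (real (2 * k + 1))\<^sup>2) = (- (1 / 3)) ^ k / (real (2 * k + 1))\<^sup>2 * T" for k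
    proof -
      have "T ^ (2 * k + 1) = (1 / 3) ^ k * T" by (simp add: power_mult T)
      moreover have "(- 1) ^ k * (1 / 3) ^ k = (- (1 / 3 :: real)) ^ k" by (simp add: power_mult_distrib[symmetric])
      moreover have "(- 1) ^ k * (a * T / m) = (- 1) ^ k * a / m * T" for a m by simp
      ultimately show ?thesis by (simp only:)
    qed
    then show ?thesis by (simp only: ti2_sum_def sum_distrib_right)
  qed
  moreover have "96677642 / 10^8 \<le> (\<Sum>k<10. (- (1 / 3 :: real)) ^ k / (real (2 * k + 1))\<^sup>2)"
    "(\<Sum>k<11. (- (1 / 3 :: real)) ^ k / (real (2 * k + 1))\<^sup>2) \<le> 96677647 / 10^8"
    by (simp_all add: eval_nat_numeral)
  ultimately have "96677642 / 10^8 * T \<le> ti2_sum 10 T" "ti2_sum 11 T \<le> 96677647 / 10^8 * T"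
    using T(1) by (simp_all only: mult_le_cancel_right_pos)
  then show "96677642 / 10^8 * tan (pi / 6) \<le> ti2 (tan (pi / 6))" "ti2 (tan (pi / 6)) \<le> 96677647 / 10^8 * tan (pi / 6)"
    using ti2_bounds[of T 10] ti2_bounds[of T 11] T(1) unfolding T_def by auto
qed

lemma tan_pi6_bounds: "577350269 / 10^9 \<le> tan (pi / 6)" "tan (pi / 6) \<le> 57735027 / 10^8"
proof -
  have T: "0 < tan (pi / 6)" by (intro tan_gt_zero) auto
  show "577350269 / 10^9 \<le> tan (pi / 6)"
    by (rule power2_le_imp_le) (use T in \<open>simp_all add: tan_pi6_sq power_divide\<close>)
  show "tan (pi / 6) \<le> 57735027 / 10^8"
    by (rule power2_le_imp_le) (simp_all add: tan_pi6_sq power_divide)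
qed

lemma pi_bounds: "314159265 / 10^8 \<le> pi" "pi \<le> 314159266 / 10^8"
  using pi_approx by simp_all

lemma neg_ln_tan_integral_pi6: "neg_ln_tan_integral (pi / 6) = ti2 (tan (pi / 6)) + pi / 12 * ln 3"
proof -
  have "ln (tan (pi / 6)) = - (ln 3 / 2)" by (simp add: tan_30 ln_div ln_sqrt)
  then show ?thesis by (simp add: neg_ln_tan_integral_def)
qed

lemma neg_ln_tan_integral_pi3: "neg_ln_tan_integral (pi / 3) = ti2 (tan (pi / 6)) + pi / 12 * ln 3"
  using neg_ln_tan_integral_reflect[of "pi / 6"] by (simp add: neg_ln_tan_integral_pi6)

lemma frustum_volume_36_bounds:
  "3178113 / 10^7 \<le> frustum_volume (pi / 6) (pi / 7)" "frustum_volume (pi / 6) (pi / 7) \<le> 3178119 / 10^7"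
proof -
  define T E w where "T = tan (pi / 6)" and "E = edge_integral (pi / 6) (pi / 7)" and "w = (tan (pi / 7) / tan (pi / 6))\<^sup>2"
  have T: "577350269 / 10^9 \<le> T" "T \<le> 57735027 / 10^8" using tan_pi6_bounds by (auto simp: T_def)
  have w: "69574233 / 10^8 \<le> w" "w \<le> 69574235 / 10^8" using tan_ratio_36 by (auto simp: w_def)
  have pw: "w ^ 23 \<le> (6958 / 10000) ^ 23" "0 \<le> w ^ 23" using w by (auto intro!: power_mono)
  have "(6958 / 10000) ^ 23 \<le> (2407 / 10^7 :: real)" by (simp add: power_divide)
  with pw have w23: "w ^ 23 \<le> 2407 / 10^7" by linarith
  \<comment> \<open>2070 = 45 * 46 is the denominator (2 N + 1) (2 N + 2) of the error term for N =
    22.\<close>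
  have r1: "w ^ 23 / 2070 \<le> 2 / 10^7" using w23 by simp
  have "w ^ 23 / (2070 * (1 - w)) \<le> (2407 / 10^7) / (2070 * (3042 / 10000))"
    using w w23 pw by (intro frac_le) auto
  then have r2: "w ^ 23 / (2070 * (1 - w)) \<le> 4 / 10^7" by (rule order.trans) simp
  have "T * (edge_poly (1 / 3) 22 w - w ^ 23 / 2070) \<le> E" "E \<le> T * (edge_poly (1 / 3) 22 w + w ^ 23 / (2070 * (1 - w)))"
    using edge_integral_poly_bounds[of "pi / 7" "pi / 6" 22] unfolding T_def[symmetric] E_def[symmetric]
    by (simp_all add: tan_pi6_sq[folded T_def] w_def[folded T_def])
  moreover have "T * (36400968 / 10^8) \<le> T * (edge_poly (1 / 3) 22 w - w ^ 23 / 2070)"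
    "T * (edge_poly (1 / 3) 22 w + w ^ 23 / (2070 * (1 - w))) \<le> T * (36401044 / 10^8)"
  proof -
    have "36400968 / 10^8 \<le> e - a \<and> e + b \<le> 36401044 / 10^8"
      if "36400988 / 10^8 \<le> e" "e \<le> 36401004 / 10^8" "a \<le> 2 / 10^7" "b \<le> 4 / 10^7" for a b e :: real
      using that by simp
    from this[OF edge_poly_bounds[OF w] r1 r2]
    have "36400968 / 10^8 \<le> edge_poly (1 / 3) 22 w - w ^ 23 / 2070"
      "edge_poly (1 / 3) 22 w + w ^ 23 / (2070 * (1 - w)) \<le> 36401044 / 10^8" by blast+
    moreover have "0 \<le> T" using T(1) by simp
    ultimately show "T * (36400968 / 10^8) \<le> T * (edge_poly (1 / 3) 22 w - w ^ 23 / 2070)"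
      "T * (edge_poly (1 / 3) 22 w + w ^ 23 / (2070 * (1 - w))) \<le> T * (36401044 / 10^8)"
      by (simp_all only: mult_left_mono)
  qed
  ultimately have E: "T * (36400968 / 10^8) \<le> E" "E \<le> T * (36401044 / 10^8)" by linarith+
  have "314159265 / 10^8 * (2 * 549306114 / 10^9) \<le> pi * ln 3" "pi * ln 3 \<le> 314159266 / 10^8 * (2 * 549306146 / 10^9)"
    using pi_bounds ln_3_bounds by (intro mult_mono; simp)+
  moreover have "2 * frustum_volume (pi / 6) (pi / 7) = ti2 T + pi * ln 3 / 12 - E"
  proof -
    have "pi / 2 - pi / 6 = pi / 3" by simp
    then show ?thesis by (simp add: frustum_volume_def neg_ln_tan_integral_pi3 T_def E_def)
  qed
  ultimately show "3178113 / 10^7 \<le> frustum_volume (pi / 6) (pi / 7)" "frustum_volume (pi / 6) (pi / 7) \<le> 3178119 / 10^7"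
    using E T ti2_tan_pi6_bounds[folded T_def] by simp_all
qed

lemma hyperball_volume_36_bounds:
  "14746652 / 10^8 \<le> hyperball_volume (pi / 6) (pi / 7)" "hyperball_volume (pi / 6) (pi / 7) \<le> 14746660 / 10^8"
proof -
  define u where "u = tan (pi / 7) / tan (pi / 6)"
  note u = tan_ratio_36[folded u_def]
  have "artanh (8341117 / 10^7) \<le> artanh u" "artanh u \<le> artanh (83411172 / 10^8)"
    using u by (intro artanh_mono; simp)+
  moreover have "artanh (8341117 / 10^7) = ln (3::real) + artanh (3411170 / 33271064)" "artanh (83411172 / 10^8) = ln (3::real) + artanh (34111720 / 332710624 :: real)"
    using artanh_shift_ln3[of "8341117 / 10^7"] artanh_shift_ln3[of "83411172 / 10^8"] by simp_all
  moreover have "artanh_sum 4 (3411170 / 33271064) \<le> artanh (3411170 / 33271064)"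
    by (rule artanh_bounds(1)[of _ "1 / 2"]) auto
  moreover have "artanh (34111720 / 332710624 :: real) \<le> artanh_sum 4 (34111720 / 332710624) + (34111720 / 332710624) ^ (2 * 4 + 1) / (real (2 * 4 + 1) * (1 - (1 / 2)\<^sup>2))"
    by (rule artanh_bounds(2)) auto
  moreover have "1028881 / 10^7 \<le> artanh_sum 4 (3411170 / 33271064)"
    "artanh_sum 4 (34111720 / 332710624) + (34111720 / 332710624) ^ (2 * 4 + 1) / (real (2 * 4 + 1) * (1 - (1 / 2)\<^sup>2)) \<le> 1028883 / 10^7"
    by (simp_all add: artanh_sum_def eval_nat_numeral)
  ultimately have a: "12015003 / 10^7 \<le> artanh u" "artanh u \<le> 12015006 / 10^7"
    using ln_3_bounds by simp_all
  have *: "(8341117 / 10^7) / (1 - 69574233 / 10^8) \<le> u / (1 - u\<^sup>2)" "u / (1 - u\<^sup>2) \<le> (83411172 / 10^8) / (1 - 69574235 / 10^8)"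
    using u by (intro frac_le; simp)+
  define x where "x = artanh u + u / (1 - u\<^sup>2)"
  with a * have x: "39429645 / 10^7 \<le> x" "x \<le> 39429662 / 10^7" by simp_all
  have "hyperball_volume (pi / 6) (pi / 7) = pi * x / 84"
    by (simp add: hyperball_volume_def u_def x_def)
  moreover have "314159265 / 10^8 * (39429645 / 10^7) \<le> pi * x" "pi * x \<le> 314159266 / 10^8 * (39429662 / 10^7)"
    using pi_bounds x by (intro mult_mono; simp)+
  ultimately show "14746652 / 10^8 \<le> hyperball_volume (pi / 6) (pi / 7)" "hyperball_volume (pi / 6) (pi / 7) \<le> 14746660 / 10^8"
    by simp_all
qed

definition optimal_density :: real where
  "optimal_density = (tan (pi / 6) * (cos (pi / 7))\<^sup>2 / 4 + hyperball_volume (pi / 6) (pi / 7)) / frustum_volume (pi / 6) (pi / 7)"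

text \<open>The interval has to lie within 0.000005 of 0.83267. Its lower end also supplies 0.8326
  \<le> D and the comparison with the other two families.\<close>

lemma optimal_density_bounds: "8326680 / 10^7 \<le> optimal_density" "optimal_density \<le> 8326700 / 10^7"
proof -
  define V where "V = frustum_volume (pi / 6) (pi / 7)"
  note V = frustum_volume_36_bounds[folded V_def]
  have "(9009688678 / 10^10)\<^sup>2 \<le> (cos (pi / 7))\<^sup>2" "(cos (pi / 7))\<^sup>2 \<le> (9009688680 / 10^10)\<^sup>2"
    using cos_pi7_bounds by (intro power_mono; simp)+
  then have "577350269 / 10^9 * (9009688678 / 10^10)\<^sup>2 \<le> tan (pi / 6) * (cos (pi / 7))\<^sup>2"
    "tan (pi / 6) * (cos (pi / 7))\<^sup>2 \<le> 57735027 / 10^8 * (9009688680 / 10^10)\<^sup>2"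
    using tan_pi6_bounds by (intro mult_mono; simp)+
  then have N: "11716528 / 10^8 \<le> tan (pi / 6) * (cos (pi / 7))\<^sup>2 / 4" "tan (pi / 6) * (cos (pi / 7))\<^sup>2 / 4 \<le> 11716529 / 10^8"
    by (simp_all add: power_divide)
  have "8326680 / 10^7 * V \<le> tan (pi / 6) * (cos (pi / 7))\<^sup>2 / 4 + hyperball_volume (pi / 6) (pi / 7)"
    "tan (pi / 6) * (cos (pi / 7))\<^sup>2 / 4 + hyperball_volume (pi / 6) (pi / 7) \<le> 8326700 / 10^7 * V"
    using V N hyperball_volume_36_bounds by simp_all
  moreover have "0 < V" using V by simp
  ultimately show "8326680 / 10^7 \<le> optimal_density" "optimal_density \<le> 8326700 / 10^7"
    unfolding optimal_density_def V_def[symmetric] by (simp_all add: pos_le_divide_eq pos_divide_le_eq)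
qed

section \<open>The least p of the families (4,4) and (6,3)\<close>

lemma cos_pi5_bounds: "809016 / 10^6 \<le> cos (pi / 5)" "cos (pi / 5) \<le> 809018 / 10^6"
  and cos_pi5_sq: "(cos (pi / 5))\<^sup>2 = (2 * cos (pi / 5) + 1) / 4"
proof -
  define c where "c = cos (pi / 5)"
  have c: "0 < c" unfolding c_def by (intro cos_gt_zero) auto
  \<comment> \<open>For \<pi>/5 the double and the triple angle are supplementary, which gives a
    quadratic equation after division by c + 1.\<close>
  have "cos (2 * (pi / 5)) = - cos (3 * (pi / 5))"
    using cos_pi_minus[of "3 * (pi / 5)"] by (simp add: field_simps)
  then have "2 * c\<^sup>2 - 1 = - (4 * c ^ 3 - 3 * c)"
    unfolding cos_treble_cos c_def by (simp only: cos_double_cos)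
  then have "(c + 1) * (4 * c\<^sup>2 - 2 * c - 1) = 0" by (simp add: algebra_simps eval_nat_numeral)
  then have z: "4 * c\<^sup>2 - 2 * c - 1 = 0" using c by auto
  then show "(cos (pi / 5))\<^sup>2 = (2 * cos (pi / 5) + 1) / 4" unfolding c_def by simp
  have mono: "x \<le> y" if "1 / 2 \<le> x" "0 < y" "4 * x\<^sup>2 - 2 * x - 1 \<le> 4 * y\<^sup>2 - 2 * y - 1" for x y :: real
  proof (rule ccontr)
    assume "\<not> x \<le> y"
    then have "0 < (x - y) * (4 * (x + y) - 2)" using that by (intro mult_pos_pos) auto
    then show False using that(3) by (simp add: algebra_simps power2_eq_square)
  qed
  show "809016 / 10^6 \<le> cos (pi / 5)"
    using mono[of "809016 / 10^6" c] c unfolding z unfolding c_def by (simp add: power_divide)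
  then have "1 / 2 \<le> c" unfolding c_def by (rule order.trans[rotated]) simp
  then show "cos (pi / 5) \<le> 809018 / 10^6"
    using mono[of c "809018 / 10^6"] unfolding z unfolding c_def by (simp add: power_divide)
qed

lemma tan_pi5_bounds:
  "52786 / 10^5 \<le> (tan (pi / 5))\<^sup>2" "(tan (pi / 5))\<^sup>2 \<le> 527866 / 10^6" "72653 / 10^5 \<le> tan (pi / 5)" "tan (pi / 5) \<le> 72655 / 10^5"
proof -
  have c2: "654508 / 10^6 \<le> (cos (pi / 5))\<^sup>2" "(cos (pi / 5))\<^sup>2 \<le> 654509 / 10^6"
    using cos_pi5_bounds unfolding cos_pi5_sq by simp_all
  have c0: "cos (pi / 5) \<noteq> 0" using cos_pi5_bounds(1) by auto
  have "1 / (654509 / 10^6) \<le> 1 / (cos (pi / 5))\<^sup>2" "1 / (cos (pi / 5))\<^sup>2 \<le> 1 / (654508 / 10^6)"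
    using c0 by (intro divide_left_mono mult_pos_pos c2; simp)+
  moreover note c0
  ultimately show W: "52786 / 10^5 \<le> (tan (pi / 5))\<^sup>2" "(tan (pi / 5))\<^sup>2 \<le> 527866 / 10^6"
    by (simp_all add: tan_sq_eq)
  have t: "0 < tan (pi / 5)" by (intro tan_gt_zero) auto
  show "72653 / 10^5 \<le> tan (pi / 5)"
    by (rule power2_le_imp_le[OF order.trans[OF _ W(1)]]) (use t in \<open>simp_all add: power_divide\<close>)
  show "tan (pi / 5) \<le> 72655 / 10^5"
    by (rule power2_le_imp_le[OF order.trans[OF W(2)]]) (simp_all add: power_divide)
qed

text \<open>The constant term of the volume is \<open>ti2 1\<close>, Catalan's constant. Its series
  converges slowly, but the margin of this family is wide enough for ten terms.\<close>

lemma frustum_volume_44_ge: "3389 / 10000 \<le> frustum_volume (pi / 4) (pi / 5)"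
proof -
  define w where "w = (tan (pi / 5))\<^sup>2"
  note w = tan_pi5_bounds(1,2)[folded w_def]
  define b where "b = 1 / (5 * (1 - w))"
  have "1 / (5 * (1 - 52786 / 10^5)) \<le> b" "b \<le> 1 / (5 * (1 - 527866 / 10^6))"
    unfolding b_def using w by (intro divide_left_mono; simp)+
  then have b: "4236 / 10^4 \<le> b" "b \<le> 42361 / 10^5" by simp_all
  \<comment> \<open>The coefficient 1/3 - b is negative, so lower bounds of \<open>b\<close> and
    \<open>w\<close> are what is needed.\<close>
  have aw: "(1 / 3 - b) * w \<le> - (9026 / 10^5) * (52786 / 10^5)"
  proof -
    have "(9026 / 10^5) * (52786 / 10^5) \<le> (b - 1 / 3) * w" using b w by (intro mult_mono) auto
    then show ?thesis by (simp add: algebra_simps)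
  qed
  have "w\<^sup>2 \<le> (527866 / 10^6)\<^sup>2" using w by (intro power_mono) auto
  then have bw: "b * w\<^sup>2 \<le> 42361 / 10^5 * (527866 / 10^6)\<^sup>2" using b by (intro mult_mono) auto
  have "ln (1 + w) \<le> 4240 / 10^4"
  proof -
    have "ln (1 + w) \<le> ln (1 + 527866 / 10^6)" using w by (intro ln_mono) auto
    also have "\<dots> = 2 * artanh (527866 / 2527866)" by (simp add: artanh_def)
    also have "artanh (527866 / 2527866) \<le> artanh_sum 2 (527866 / 2527866) + (527866 / 2527866) ^ (2 * 2 + 1) / (real (2 * 2 + 1) * (1 - (1 / 2 :: real)\<^sup>2))"
      by (rule artanh_bounds(2)) auto
    also have "\<dots> \<le> 21197 / 10^5" by (simp add: artanh_sum_def eval_nat_numeral)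
    finally show ?thesis by simp
  qed
  moreover have "0 \<le> ln (1 + w)" using w by simp
  ultimately have l: "(1 - (1 / 3 - b)) * ln (1 + w) \<le> (2 / 3 + 42361 / 10^5) * (4240 / 10^4)"
    using b by (intro mult_mono) auto
  have "edge_integral (pi / 4) (pi / 5) \<le> 1 / 2 * ((1 / 3 - b) * w + b * w\<^sup>2 / 2) + (1 - (1 / 3 - b)) / (2 * 1) * ln (1 + w)"
    using edge_integral_le_ln[of "pi / 5" "pi / 4" b "1 / 3 - b"] by (simp add: tan_45 w_def b_def)
  moreover have "9147 / 10000 \<le> ti2 1"
  proof -
    have "9147 / 10000 \<le> ti2_sum 10 1" by (simp add: ti2_sum_def eval_nat_numeral)
    also have "\<dots> \<le> ti2 1" by (rule ti2_bounds) auto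
    finally show ?thesis .
  qed
  moreover have "2 * frustum_volume (pi / 4) (pi / 5) = ti2 1 - edge_integral (pi / 4) (pi / 5)"
    by (simp add: frustum_volume_def neg_ln_tan_integral_def tan_45)
  moreover have "(1 / 3 - b) * w \<le> - (476 / 10000)" by (rule order.trans[OF aw]) simp
  moreover have "b * w\<^sup>2 \<le> 1181 / 10000" by (rule order.trans[OF bw]) (simp add: power_divide)
  moreover have "(1 - (1 / 3 - b)) * ln (1 + w) \<le> 4623 / 10000" by (rule order.trans[OF l]) simp
  moreover have "3389 / 10000 \<le> V" if "I \<le> 1 / 2 * (x + y / 2) + v / (2 * 1) * l" "9147 / 10000 \<le> g" "2 * V = g - I"
    "x \<le> - (476 / 10000)" "y \<le> 1181 / 10000" "v * l \<le> 4623 / 10000" for I x y v l g V :: real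
  proof -
    have "v / (2 * 1) * l = v * l / 2" "1 / 2 * (x + y / 2) = x / 2 + y / 4" by simp_all
    then show ?thesis using that by linarith
  qed
  ultimately show ?thesis by blast
qed

text \<open>The first candidate has the hypersphere through \<open>A 2\<close> and a horosphere
  tangent to it, the second the horosphere through \<open>A 1\<close> and the small hyperball that
  touches it.\<close>

lemma optimal_density_44:
  "1 / (4 * (tan (pi / 5) + 1)\<^sup>2) + hyperball_volume (pi / 4) (pi / 5) \<le> optimal_density * frustum_volume (pi / 4) (pi / 5)"
  "(cos (pi / 5))\<^sup>2 / 4 + small_hyperball_volume (pi / 5) \<le> optimal_density * frustum_volume (pi / 4) (pi / 5)"
proof -
  define t where "t = tan (pi / 5)"
  note t = tan_pi5_bounds[folded t_def]
  have DV: "8326680 / 10^7 * (3389 / 10000) \<le> optimal_density * frustum_volume (pi / 4) (pi / 5)"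
    using optimal_density_bounds(1) frustum_volume_44_ge by (intro mult_mono; simp)
  have "artanh t \<le> artanh (72655 / 10^5)" using t by (intro artanh_mono; simp)
  also have "artanh (72655 / 10^5) \<le> artanh_sum 4 (72655 / 10^5) + (72655 / 10^5) ^ (2 * 4 + 1) / (real (2 * 4 + 1) * (1 - (72655 / 10^5 :: real)\<^sup>2))"
    by (rule artanh_bounds(2)) auto
  also have "\<dots> \<le> 924 / 10^3" by (simp add: artanh_sum_def eval_nat_numeral)
  finally have "artanh t \<le> 924 / 10^3" .
  moreover have "t / (1 - t\<^sup>2) \<le> (72655 / 10^5) / (1 - 527866 / 10^6)" using t by (intro frac_le; simp)
  ultimately have x: "artanh t + t / (1 - t\<^sup>2) \<le> 2463 / 10^3" by simp
  have "0 \<le> artanh t" "0 \<le> t / (1 - t\<^sup>2)" using t by (intro artanh_nonneg divide_nonneg_nonneg; simp)+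
  then have "pi * (artanh t + t / (1 - t\<^sup>2)) \<le> 314159266 / 10^8 * (2463 / 10^3)"
    using x pi_bounds by (intro mult_mono) auto
  moreover have "hyperball_volume (pi / 4) (pi / 5) = pi * (artanh t + t / (1 - t\<^sup>2)) / 40"
    by (simp add: hyperball_volume_def t_def tan_45)
  moreover have "y / 40 \<le> 1935 / 10^4" if "y \<le> 314159266 / 10^8 * (2463 / 10^3)" for y :: real using that by simp
  ultimately have h: "hyperball_volume (pi / 4) (pi / 5) \<le> 1935 / 10^4" by (simp only:)
  have "(1 + 72653 / 10^5)\<^sup>2 \<le> (t + 1)\<^sup>2" using t by (intro power_mono) auto
  then have "1 / (4 * (t + 1)\<^sup>2) \<le> 1 / (4 * (1 + 72653 / 10^5)\<^sup>2)"
    using t by (intro divide_left_mono) auto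
  then show "1 / (4 * (tan (pi / 5) + 1)\<^sup>2) + hyperball_volume (pi / 4) (pi / 5) \<le> optimal_density * frustum_volume (pi / 4) (pi / 5)"
    using h DV unfolding t_def[symmetric] by (simp add: power_divide)
  define w where "w = t\<^sup>2"
  have w: "52786 / 10^5 \<le> w" "w \<le> 527866 / 10^6" using t by (auto simp: w_def)
  have "w\<^sup>2 \<le> (527866 / 10^6)\<^sup>2" using w by (intro power_mono) auto
  then have "w / (1 - w\<^sup>2) \<le> (527866 / 10^6) / (1 - (527866 / 10^6)\<^sup>2)" using w by (intro frac_le) (auto simp: power_divide)
  moreover have "artanh w \<le> (w + w / (1 - w\<^sup>2)) / 2" using w by (intro artanh_le_mean) auto
  ultimately have x: "artanh w + w / (1 - w\<^sup>2) \<le> 137 / 10^2" using w by (simp add: power_divide)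
  have "0 \<le> artanh w" "0 \<le> w / (1 - w\<^sup>2)" using w by (intro artanh_nonneg divide_nonneg_nonneg; simp add: power_le_one)+
  then have "pi * (artanh w + w / (1 - w\<^sup>2)) \<le> 314159266 / 10^8 * (137 / 10^2)"
    using x pi_bounds by (intro mult_mono) auto
  moreover have "small_hyperball_volume (pi / 5) = pi * (artanh w + w / (1 - w\<^sup>2)) / 40"
    by (simp add: small_hyperball_volume_def t_def w_def)
  moreover have "y / 40 \<le> 108 / 10^3" if "y \<le> 314159266 / 10^8 * (137 / 10^2)" for y :: real using that by simp
  ultimately have "small_hyperball_volume (pi / 5) \<le> 108 / 10^3" by (simp only:)
  moreover have "(cos (pi / 5))\<^sup>2 \<le> 655 / 10^3" unfolding cos_pi5_sq using cos_pi5_bounds(2) by simp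
  ultimately show "(cos (pi / 5))\<^sup>2 / 4 + small_hyperball_volume (pi / 5) \<le> optimal_density * frustum_volume (pi / 4) (pi / 5)"
    using DV by simp
qed

lemma tan_pi3: "tan (pi / 3) = 3 * tan (pi / 6)"
  by (simp add: tan_60 tan_30 real_div_sqrt)

lemma frustum_volume_63_ge: "3167 / 10^4 \<le> frustum_volume (pi / 3) (pi / 4)"
proof -
  define t where "t = tan (pi / 6)"
  note t = tan_pi6_bounds[folded t_def]
  have t2: "t\<^sup>2 = 1 / 3" unfolding t_def by (rule tan_pi6_sq)
  have "edge_integral (pi / 3) (pi / 4) \<le> 3 * t / 2 * (7 / 90 * (1 / 3) + 1 / 10 * (1 / 3)\<^sup>2 / 2) + (1 - 7 / 90) / (2 * (3 * t)) * ln 2"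
    \<comment> \<open>Here w = 1/3 and T^2 = 3, hence b = 1/10 and a = 7/90.\<close>
    using edge_integral_le_ln[of "pi / 4" "pi / 3" "1 / 10" "7 / 90"]
    by (simp add: tan_45 tan_pi3 t_def[symmetric] power_mult_distrib power_divide t2)
  moreover have "(1 - 7 / 90) / (2 * (3 * t)) * ln 2 = 83 / 180 * (t * ln 2)"
  proof -
    have u: "1 / (3 * t) = t" using t t2 by (simp add: field_simps power2_eq_square)
    have "(1 - 7 / 90) / (2 * (3 * t)) * ln 2 = 83 / 180 * (1 / (3 * t) * ln 2)" by simp
    then show ?thesis unfolding u .
  qed
  moreover have "t * ln 2 \<le> 57735027 / 10^8 * (25 / 36)" using t ln2_le_25_over_36 by (intro mult_mono) auto
  ultimately have "edge_integral (pi / 3) (pi / 4) \<le> 2122 / 10^4" using t by (simp add: power_divide)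
  moreover have "314159265 / 10^8 * (2 * 549306114 / 10^9) \<le> pi * ln 3"
    using pi_bounds ln_3_bounds by (intro mult_mono; simp)
  moreover have "2 * frustum_volume (pi / 3) (pi / 4) = ti2 t + pi * ln 3 / 12 - edge_integral (pi / 3) (pi / 4)"
  proof -
    have "pi / 2 - pi / 3 = pi / 6" by simp
    then show ?thesis by (simp add: frustum_volume_def neg_ln_tan_integral_pi6 t_def)
  qed
  ultimately show ?thesis using t ti2_tan_pi6_bounds[folded t_def] by simp
qed

text \<open>The first candidate has the hypersphere through \<open>A 2\<close> and a horosphere
  tangent to it. The second is the horoball alone: for \<alpha> = \<pi>/4 the hemisphere has radius
  1, and the horosphere at height 1 cuts off tan (\<pi>/3) / 8.\<close>

lemma optimal_density_63:
  "tan (pi / 3) / (4 * (tan (pi / 4) + tan (pi / 3))\<^sup>2) + hyperball_volume (pi / 3) (pi / 4) \<le> optimal_density * frustum_volume (pi / 3) (pi / 4)"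
  "tan (pi / 3) / 8 \<le> optimal_density * frustum_volume (pi / 3) (pi / 4)"
proof -
  define t where "t = tan (pi / 6)"
  note t = tan_pi6_bounds[folded t_def]
  have t2: "t\<^sup>2 = 1 / 3" unfolding t_def by (rule tan_pi6_sq)
  have DV: "8326680 / 10^7 * (3167 / 10^4) \<le> optimal_density * frustum_volume (pi / 3) (pi / 4)"
    using optimal_density_bounds(1) frustum_volume_63_ge by (intro mult_mono; simp)
  then show "tan (pi / 3) / 8 \<le> optimal_density * frustum_volume (pi / 3) (pi / 4)"
    using t unfolding tan_pi3 t_def[symmetric] by simp
  have u: "1 / (3 * t) = t" using t t2 by (simp add: field_simps power2_eq_square)
  have "artanh t \<le> artanh_sum 2 t + t ^ (2 * 2 + 1) / (real (2 * 2 + 1) * (1 - t\<^sup>2))"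
    using t by (intro artanh_bounds(2)) auto
  also have "\<dots> = t + t * t\<^sup>2 / 3 + t * t\<^sup>2 * t\<^sup>2 / (5 * (1 - t\<^sup>2))"
    by (simp add: artanh_sum_def eval_nat_numeral)
  finally have "artanh t + t / (1 - t\<^sup>2) \<le> 265 / 100 * t" using t unfolding t2 by simp
  also have "\<dots> \<le> 153 / 100" using t by simp
  finally have x: "artanh t + t / (1 - t\<^sup>2) \<le> 153 / 100" .
  have "0 \<le> artanh t" "0 \<le> t / (1 - t\<^sup>2)" using t t2 by (intro artanh_nonneg divide_nonneg_nonneg; simp)+
  then have "pi * (artanh t + t / (1 - t\<^sup>2)) \<le> 314159266 / 10^8 * (153 / 100)"
    using x pi_bounds by (intro mult_mono) auto
  moreover have "hyperball_volume (pi / 3) (pi / 4) = pi * (artanh t + t / (1 - t\<^sup>2)) / 24"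
    by (simp add: hyperball_volume_def tan_45 tan_pi3 u[unfolded t_def] t_def)
  moreover have "y / 24 \<le> 2003 / 10^4" if "y \<le> 314159266 / 10^8 * (153 / 100)" for y :: real using that by simp
  ultimately have "hyperball_volume (pi / 3) (pi / 4) \<le> 2003 / 10^4" by (simp only:)
  moreover have "3 * t / (4 * (1 + 3 * t)\<^sup>2) \<le> (3 * (57735027 / 10^8)) / (4 * (1 + 3 * (577350269 / 10^9))\<^sup>2)"
    using t by (intro frac_le mult_left_mono power_mono) auto
  ultimately show "tan (pi / 3) / (4 * (tan (pi / 4) + tan (pi / 3))\<^sup>2) + hyperball_volume (pi / 3) (pi / 4) \<le> optimal_density * frustum_volume (pi / 3) (pi / 4)"
    using DV unfolding tan_45 tan_pi3 t_def[symmetric] by (simp add: power_divide)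
qed

section \<open>Optimality\<close>

text \<open>A convex function is bounded by its values at the ends: by the sign of the derivative at
  \<open>h\<close> it either decreases from \<open>a\<close> to \<open>h\<close> or increases from
  \<open>h\<close> to \<open>b\<close>.\<close>

lemma le_bound_at_ends_if_deriv_mono:
  fixes f f' :: "real \<Rightarrow> real"
  assumes ab: "a \<le> h" "h \<le> b"
    and der: "\<And>x. a \<le> x \<Longrightarrow> x \<le> b \<Longrightarrow> (f has_real_derivative f' x) (at x)"
    and mono: "\<And>x y. a \<le> x \<Longrightarrow> x \<le> y \<Longrightarrow> y \<le> b \<Longrightarrow> f' x \<le> f' y"
    and le: "f a \<le> m" "f b \<le> m"
  shows "f h \<le> m"
proof (cases "f' h \<le> 0")
  case True
  have "f h \<le> f a"
  proof (rule DERIV_nonpos_imp_nonincreasing[OF ab(1)])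
    fix x assume x: "a \<le> x" "x \<le> h"
    then show "\<exists>y. (f has_real_derivative y) (at x) \<and> y \<le> 0"
      using der[of x] mono[of x h] True ab by (intro exI[of _ "f' x"]) auto
  qed
  then show ?thesis using le by simp
next
  case False
  have "f h \<le> f b"
  proof (rule DERIV_nonneg_imp_nondecreasing[OF ab(2)])
    fix x assume x: "h \<le> x" "x \<le> b"
    then show "\<exists>y. (f has_real_derivative y) (at x) \<and> 0 \<le> y"
      using der[of x] mono[of h x] False ab by (intro exI[of _ "f' x"]) auto
  qed
  then show ?thesis using le by simp
qed

text \<open>The integral of cosh^2 from 0 to \<open>h\<close>: the volume of the hyperball per unit
  area of its base plane.\<close>

definition hyperball_profile :: "real \<Rightarrow> real" where
  "hyperball_profile h = h / 2 + sinh (2 * h) / 4"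

lemma hyperball_profile_mono: "a \<le> b \<Longrightarrow> hyperball_profile a \<le> hyperball_profile b"
  unfolding hyperball_profile_def by (intro add_mono divide_right_mono) auto

lemma hyperball_profile_artanh:
  fixes u :: real
  assumes u: "0 \<le> u" "u < 1"
  shows "hyperball_profile (artanh u) = (artanh u + u / (1 - u\<^sup>2)) / 2"
    and "(exp (artanh u))\<^sup>2 = (1 + u) / (1 - u)"
proof -
  have p: "0 < (1 + u) / (1 - u)" using u by simp
  have e: "2 * artanh u = ln ((1 + u) / (1 - u))" by (simp add: artanh_def)
  have q: "1 - u\<^sup>2 = (1 - u) * (1 + u)" by (simp add: power2_eq_square algebra_simps)
  show "(exp (artanh u))\<^sup>2 = (1 + u) / (1 - u)"
    using p e by (simp add: exp_double[symmetric])
  have "sinh (2 * artanh u) = ((1 + u) / (1 - u) - inverse ((1 + u) / (1 - u))) / 2"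
    unfolding e using p by (simp add: sinh_ln_real)
  also have "\<dots> = 2 * u / (1 - u\<^sup>2)" unfolding q using u by (simp add: divide_simps) (simp add: algebra_simps)
  finally have "sinh (2 * artanh u) = 2 * u / (1 - u\<^sup>2)" .
  moreover have "2 * u / w / 4 = u / w / 2" for w by simp
  ultimately show "hyperball_profile (artanh u) = (artanh u + u / (1 - u\<^sup>2)) / 2"
    by (simp only: hyperball_profile_def add_divide_distrib)
qed

text \<open>K exp (- 2 h) is convex because K is nonnegative, and the profile is convex for h \<ge>
  0.\<close>

lemma convex_profile_le:
  assumes ab: "0 \<le> a" "a \<le> h" "h \<le> b" and K: "0 \<le> K" "0 \<le> d"
    and le: "K / (exp a)\<^sup>2 + d * hyperball_profile a \<le> m" "K / (exp b)\<^sup>2 + d * hyperball_profile b \<le> m"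
  shows "K / (exp h)\<^sup>2 + d * hyperball_profile h \<le> m"
proof -
  have e: "K / (exp x)\<^sup>2 = K * exp (- 2 * x)" for x :: real
    by (simp add: exp_double[symmetric] exp_minus divide_inverse)
  show ?thesis
  proof (rule le_bound_at_ends_if_deriv_mono[OF ab(2,3) _ _ le, where f' = "\<lambda>x. K * (exp (- 2 * x) * (- 2)) + d * (1 / 2 + cosh (2 * x) * 2 / 4)"])
    fix x
    show "((\<lambda>x. K / (exp x)\<^sup>2 + d * hyperball_profile x) has_real_derivative K * (exp (- 2 * x) * (- 2)) + d * (1 / 2 + cosh (2 * x) * 2 / 4)) (at x)"
      unfolding e hyperball_profile_def by (auto intro!: derivative_eq_intros)
  next
    fix x y assume "a \<le> x" "x \<le> y"
    then show "K * (exp (- 2 * x) * (- 2)) + d * (1 / 2 + cosh (2 * x) * 2 / 4) \<le> K * (exp (- 2 * y) * (- 2)) + d * (1 / 2 + cosh (2 * y) * 2 / 4)"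
    proof -
      have "K * exp (- 2 * y) \<le> K * exp (- 2 * x)" using \<open>x \<le> y\<close> K by (intro mult_left_mono) auto
      moreover have "d * cosh (2 * x) \<le> d * cosh (2 * y)"
        using \<open>a \<le> x\<close> \<open>x \<le> y\<close> ab(1) K by (intro mult_left_mono) (auto simp: cosh_real_nonneg_le_iff)
      ultimately show ?thesis by (simp add: distrib_left)
    qed
  qed
qed

lemma frustum_volume_antimono:
  assumes "0 < a" "a \<le> b" "b < ga" "ga < pi / 2"
  shows "frustum_volume ga b \<le> frustum_volume ga a"
proof (rule decreasing_from_deriv[OF assms(1,2)])
  fix x assume "0 < x" "x \<le> b"
  then show "\<exists>y. (frustum_volume ga has_real_derivative y) (at x) \<and> y \<le> 0"
    using assms by (intro exI[of _ "- edge_length ga x / 2"] conjI DERIV_frustum_volume) (auto simp: edge_length_nonneg)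
qed

text \<open>The numerical consequences of the packing conditions; the estimates of this locale
  involve no further geometry.\<close>

locale packing_data =
  fixes al ga rho z h :: real
  assumes al: "0 < al" "al < ga" "ga < pi / 2"
    and rho: "0 < rho" "rho\<^sup>2 = (cos al * tan ga)\<^sup>2 - (sin al)\<^sup>2"
    and z: "1 \<le> z" "rho * exp h \<le> z"
    and h: "0 \<le> h" "tanh h \<le> tan al / tan ga"
begin

abbreviation total :: real where
  "total \<equiv> (cos al)\<^sup>2 * tan ga / (4 * z\<^sup>2) + (ga - al) * hyperball_profile h"

lemma pos: "0 < tan ga" "0 < cos al" "0 < tan al" "0 \<le> tan al / tan ga" "tan al / tan ga < 1"
  using al tan_ratio[of al ga] by (auto intro!: tan_gt_zero cos_gt_zero)

lemma le_artanh: "h \<le> artanh (tan al / tan ga)"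
proof -
  have "artanh (tanh h) \<le> artanh (tan al / tan ga)" using h pos by (intro artanh_mono) auto
  then show ?thesis by (simp add: artanh_tanh_real)
qed

lemma cusp_le: "(cos al)\<^sup>2 * tan ga / (4 * z\<^sup>2) \<le> (cos al)\<^sup>2 * tan ga / 4"
proof -
  have "(cos al)\<^sup>2 * tan ga * 1 \<le> (cos al)\<^sup>2 * tan ga * z\<^sup>2" using z pos by (intro mult_left_mono) auto
  then show ?thesis using z by (simp add: divide_simps)
qed

lemma cusp_le_exp: "(cos al)\<^sup>2 * tan ga / (4 * z\<^sup>2) \<le> (cos al)\<^sup>2 * tan ga / (4 * rho\<^sup>2) / (exp h)\<^sup>2"
proof -
  have "(rho * exp h)\<^sup>2 \<le> z\<^sup>2" using z rho by (intro power_mono) auto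
  then have "(cos al)\<^sup>2 * tan ga / (4 * z\<^sup>2) \<le> (cos al)\<^sup>2 * tan ga / (4 * (rho * exp h)\<^sup>2)"
    using z rho pos by (intro divide_left_mono) auto
  then show ?thesis by (simp add: power_mult_distrib mult_ac)
qed

lemma profile_end: "(ga - al) * hyperball_profile (artanh (tan al / tan ga)) = hyperball_volume ga al"
  by (simp add: hyperball_profile_artanh pos hyperball_volume_def)

text \<open>At the largest width \<open>rho\<close> times the exponential is cos \<alpha> (tan
  \<alpha> + tan \<gamma>), the height of a horosphere tangent to the hypersphere through
  \<open>A 2\<close>.\<close>

lemma cusp_end: "(cos al)\<^sup>2 * tan ga / (4 * rho\<^sup>2) / (exp (artanh (tan al / tan ga)))\<^sup>2 = tan ga / (4 * (tan al + tan ga)\<^sup>2)"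
proof -
  define c T x where "c = cos al" and "T = tan ga" and "x = tan al"
  have p: "0 < c" "0 < T" "0 < x" "x < T" using pos by (auto simp: c_def T_def x_def)
  have "sin al = c * x" using p by (simp add: c_def x_def tan_def)
  then have r: "rho\<^sup>2 = c\<^sup>2 * ((T - x) * (T + x))"
    unfolding rho(2) c_def[symmetric] T_def[symmetric] by (simp add: power2_eq_square algebra_simps)
  have "(1 + x / T) / (1 - x / T) = (T + x) / (T - x)" using p by (simp add: field_simps)
  then have "(cos al)\<^sup>2 * tan ga / (4 * rho\<^sup>2) / (exp (artanh (tan al / tan ga)))\<^sup>2
     = c\<^sup>2 * T / (4 * (c\<^sup>2 * ((T - x) * (T + x)))) / ((T + x) / (T - x))"
    by (simp add: hyperball_profile_artanh pos r c_def T_def x_def)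
  also have "\<dots> = T / (4 * (x + T)\<^sup>2)" using p by (simp add: power2_eq_square add.commute)
  finally show ?thesis unfolding T_def x_def .
qed

text \<open>Both summands are replaced by their separate maxima, at height 1 and at the largest
  width. Nothing is lost for \<alpha> = \<pi>/7, since these extremes are compatible for \<gamma> =
  \<pi>/6.\<close>

lemma total_le_36:
  assumes "ga = pi / 6" "al \<le> pi / 7"
  shows "total \<le> optimal_density * frustum_volume ga al"
proof -
  have "(ga - al) * hyperball_profile h \<le> hyperball_volume ga al"
    unfolding profile_end[symmetric] using al le_artanh by (intro mult_left_mono hyperball_profile_mono) auto
  moreover have "0 < frustum_volume (pi / 6) (pi / 7)"
    using frustum_volume_36_bounds(1) by (rule less_le_trans[rotated]) simp
  then have "optimal_density * frustum_volume (pi / 6) (pi / 7) = tan (pi / 6) * (cos (pi / 7))\<^sup>2 / 4 + hyperball_volume (pi / 6) (pi / 7)"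
    by (simp add: optimal_density_def)
  moreover have "8326 / 10000 \<le> optimal_density" using optimal_density_bounds(1) by simp
  from deficit_36[OF this _ _ al(1) assms(2)] tan_ratio_36(4) pos(1)
  have "optimal_density * frustum_volume (pi / 6) (pi / 7) - tan (pi / 6) * (cos (pi / 7))\<^sup>2 / 4 - hyperball_volume (pi / 6) (pi / 7)
     \<le> optimal_density * frustum_volume (pi / 6) al - tan (pi / 6) * (cos al)\<^sup>2 / 4 - hyperball_volume (pi / 6) al"
    using assms(1) by (simp add: pos_divide_le_eq)
  ultimately show ?thesis using cusp_le unfolding assms(1) by (simp add: mult_ac)
qed

lemma total_le_44:
  assumes "ga = pi / 4" "al \<le> pi / 5"
  shows "total \<le> optimal_density * frustum_volume ga al"
proof -
  define x where "x = tan al"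
  have T: "tan ga = 1" by (simp add: assms(1) tan_45)
  have x: "0 < x" "x < 1" using pos by (auto simp: x_def T)
  have D: "8326 / 10000 \<le> optimal_density" using optimal_density_bounds(1) by simp
  have t5: "pi / 5 < pi / 4" "tan (pi / 5) \<le> 7266 / 10000" using tan_pi5_bounds(4) by simp_all
  have x2: "0 \<le> x\<^sup>2" "x\<^sup>2 < 1" "x\<^sup>2 \<le> x" using x mult_left_le[of x x] by (auto simp: abs_square_less_1) (simp add: power2_eq_square)
  \<comment> \<open>At this width \<open>rho * exp h\<close> equals 1: the square of
    \<open>rho\<close> is (cos \<alpha>)^2 (1 - x^2), that of the exponential (1 + x^2) / (1 - x^2).
    For smaller widths the cusp is bounded at height 1, for larger ones at height
    \<open>rho * exp h\<close>.\<close>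
  define hB where "hB = artanh (x\<^sup>2)"
  have hB: "0 \<le> hB" "hB \<le> artanh x" unfolding hB_def using x2 x by (auto intro!: artanh_nonneg artanh_mono)
  have small: "(cos al)\<^sup>2 / 4 + (ga - al) * hyperball_profile hB \<le> optimal_density * frustum_volume ga al"
  proof -
    have "(ga - al) * hyperball_profile hB = small_hyperball_volume al"
      using x2 by (simp add: hB_def hyperball_profile_artanh small_hyperball_volume_def x_def assms(1))
    then show ?thesis using deficit_44_small[OF D t5 al(1) assms(2)] optimal_density_44(2) unfolding assms(1) by linarith
  qed
  show ?thesis
  proof (cases "h \<le> hB")
    case True
    have "(ga - al) * hyperball_profile h \<le> (ga - al) * hyperball_profile hB"
      using al True by (intro mult_left_mono hyperball_profile_mono) auto
    then show ?thesis using cusp_le small T by simp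
  next
    case False
    define K where "K = (cos al)\<^sup>2 * tan ga / (4 * rho\<^sup>2)"
    have "sin al = cos al * x" using pos by (simp add: x_def tan_def)
    then have r: "rho\<^sup>2 = (cos al)\<^sup>2 * (1 - x\<^sup>2)" unfolding rho(2) T by (simp add: power_mult_distrib algebra_simps)
    have c: "(cos al)\<^sup>2 * (1 + x\<^sup>2) = 1" using tan_sec[of al] pos by (simp add: x_def power_inverse field_simps)
    have "K / (exp hB)\<^sup>2 + (ga - al) * hyperball_profile hB \<le> optimal_density * frustum_volume ga al"
    proof -
      have "K / (exp hB)\<^sup>2 = (cos al)\<^sup>2 / (4 * ((cos al)\<^sup>2 * (1 - x\<^sup>2))) / ((1 + x\<^sup>2) / (1 - x\<^sup>2))"
        using x2 by (simp add: hB_def hyperball_profile_artanh K_def r T)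
      also have "\<dots> = (cos al)\<^sup>2 / (4 * ((cos al)\<^sup>2 * (1 + x\<^sup>2)))"
      proof -
        have "d / (4 * (d * m)) / (k / m) = d / (4 * (d * k))" if "m \<noteq> 0" for d m k :: real using that by simp
        moreover have "1 - x\<^sup>2 \<noteq> 0" using x2 by simp
        ultimately show ?thesis by blast
      qed
      finally have "K / (exp hB)\<^sup>2 = (cos al)\<^sup>2 / 4" unfolding c by simp
      then show ?thesis using small by linarith
    qed
    moreover have "K / (exp (artanh x))\<^sup>2 + (ga - al) * hyperball_profile (artanh x) \<le> optimal_density * frustum_volume ga al"
    proof -
      have "K / (exp (artanh x))\<^sup>2 = 1 / (4 * (tan al + 1)\<^sup>2)" using cusp_end by (simp add: K_def T x_def)
      moreover have "(ga - al) * hyperball_profile (artanh x) = hyperball_volume ga al" using profile_end by (simp add: T x_def)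
      ultimately show ?thesis using deficit_44[OF D t5 al(1) assms(2)] optimal_density_44(1) unfolding assms(1) by linarith
    qed
    moreover have "h \<le> artanh x" using le_artanh by (simp add: T x_def)
    moreover have "0 \<le> K" unfolding K_def T by simp
    ultimately have "K / (exp h)\<^sup>2 + (ga - al) * hyperball_profile h \<le> optimal_density * frustum_volume ga al"
      using False hB al by (intro convex_profile_le[of hB h "artanh x"]) auto
    then show ?thesis using cusp_le_exp unfolding K_def by linarith
  qed
qed

text \<open>For \<alpha> \<le> \<pi>/4 the radius is at least 1, so the convex bound is taken on the
  whole range of widths. At width 0 the cusp term is largest for \<alpha> = \<pi>/4, while the
  frustum volume is least there; at the largest width the deficit is monotone.\<close>

lemma total_le_63:
  assumes "ga = pi / 3" "al \<le> pi / 4"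
  shows "total \<le> optimal_density * frustum_volume ga al"
proof -
  have D: "8326 / 10000 \<le> optimal_density" using optimal_density_bounds(1) by simp
  define K where "K = (cos al)\<^sup>2 * tan ga / (4 * rho\<^sup>2)"
  have "cos (pi / 4) \<le> cos al" using assms(2) al by (intro cos_monotone_0_pi_le) auto
  then have "(cos (pi / 4))\<^sup>2 \<le> (cos al)\<^sup>2" by (intro power_mono) (auto simp: cos_45)
  then have c: "1 / 2 \<le> (cos al)\<^sup>2" by (simp add: cos_45 power_divide)
  have r: "rho\<^sup>2 = 4 * (cos al)\<^sup>2 - 1"
    unfolding rho(2) assms(1) power_mult_distrib tan_pi3_sq sin_squared_eq by simp
  have "(cos al)\<^sup>2 / (4 * (4 * (cos al)\<^sup>2 - 1)) \<le> 1 / 8" using c by (simp add: divide_le_eq)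
  then have "tan ga * ((cos al)\<^sup>2 / (4 * (4 * (cos al)\<^sup>2 - 1))) \<le> tan ga * (1 / 8)" using pos by (intro mult_left_mono) auto
  then have "K \<le> tan (pi / 3) / 8" by (simp add: K_def r assms(1) mult_ac)
  also have "\<dots> \<le> optimal_density * frustum_volume (pi / 3) (pi / 4)" by (rule optimal_density_63)
  also have "\<dots> \<le> optimal_density * frustum_volume ga al"
    unfolding assms(1) using D assms(2) al(1) by (intro mult_left_mono frustum_volume_antimono) auto
  finally have "K / (exp 0)\<^sup>2 + (ga - al) * hyperball_profile 0 \<le> optimal_density * frustum_volume ga al"
    by (simp add: hyperball_profile_def)
  moreover have "K / (exp (artanh (tan al / tan ga)))\<^sup>2 + (ga - al) * hyperball_profile (artanh (tan al / tan ga)) \<le> optimal_density * frustum_volume ga al"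
    using deficit_63[OF D al(1) assms(2)] optimal_density_63(1)
    unfolding profile_end cusp_end[folded K_def] unfolding assms(1) by linarith
  moreover have "0 \<le> K" unfolding K_def using pos by simp
  ultimately have "K / (exp h)\<^sup>2 + (ga - al) * hyperball_profile h \<le> optimal_density * frustum_volume ga al"
    using al le_artanh h by (intro convex_profile_le[of 0 h "artanh (tan al / tan ga)"]) auto
  then show ?thesis using cusp_le_exp unfolding K_def by linarith
qed

lemma total_le:
  assumes "admissible p q r" "al = pi / real p" "ga = pi / real r"
  shows "total \<le> optimal_density * frustum_volume ga al"
proof -
  have le: "al \<le> pi / real n" if "0 < n" "n \<le> p" for n
    unfolding assms(2) using that by (intro divide_left_mono) auto
  from assms(1) consider "r = 6" "7 \<le> p" | "r = 4" "5 \<le> p" | "r = 3" "4 \<le> p"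
    unfolding admissible_def by blast
  then show ?thesis
  proof cases
    case 1
    then show ?thesis using le[of 7] assms(3) by (intro total_le_36) auto
  next
    case 2
    then show ?thesis using le[of 5] assms(3) by (intro total_le_44) auto
  next
    case 3
    then show ?thesis using le[of 4] assms(3) by (intro total_le_63) auto
  qed
qed

end

section \<open>Transfer of the estimates to packings\<close>

lemma (in null_frame) tan_ratio_eq:
  assumes "s = sin al" "c = cos al" "T = tan ga"
  shows "s / (c * T) = tan al / tan ga"
  using assms by (simp add: tan_def)

lemma arctan_inverse_tan:
  assumes "0 < t" "t < pi / 2"
  shows "arctan (1 / tan t) = pi / 2 - t"
proof -
  have "1 / tan t = tan (pi / 2 - t)" by (simp add: tan_cot inverse_eq_divide)
  then show ?thesis using assms by (simp add: arctan_tan)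
qed

text \<open>Since \<open>(rho / T)\<^sup>2\<close> is 1 - (sin \<alpha>)^2 / (sin \<gamma>)^2, the
  integrand of the prism becomes the volume integrand of the edge integral section.\<close>

lemma (in orthoscheme_frame) hyp_vol_frustum:
  assumes sc': "s = sin al" "c = cos al" "T = tan ga" and al: "0 < al" "al < ga" "ga < pi / 2"
  shows "hyp_vol (frustum A) = frustum_volume ga al"
proof -
  have sg: "0 < sin ga" and cg: "0 < cos ga" using al by (auto intro!: sin_gt_zero cos_gt_zero)
  have gg: "(sin ga)\<^sup>2 + (cos ga)\<^sup>2 = 1" by simp
  have "(rho / T)\<^sup>2 = c\<^sup>2 - s\<^sup>2 / T\<^sup>2"
    using T by (simp add: power_divide rho(2) diff_divide_distrib power_mult_distrib)
  also have "1 / T\<^sup>2 = 1 / (sin ga)\<^sup>2 - 1"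
  proof -
    have "1 / T\<^sup>2 = (1 - (sin ga)\<^sup>2) / (sin ga)\<^sup>2" unfolding cos_squared_eq[symmetric] by (simp add: sc' tan_def power_divide)
    then show ?thesis using sg by (simp add: diff_divide_distrib)
  qed
  then have "s\<^sup>2 / T\<^sup>2 = s\<^sup>2 * (1 / (sin ga)\<^sup>2 - 1)" by (metis times_divide_eq_right mult.right_neutral)
  finally have "(rho / T)\<^sup>2 = (c\<^sup>2 + s\<^sup>2) - s\<^sup>2 / (sin ga)\<^sup>2" by (simp add: algebra_simps)
  then have rT: "(rho / T)\<^sup>2 = 1 - s\<^sup>2 / (sin ga)\<^sup>2" using sc by simp
  have height: "s / c * sqrt (((rho / T)\<^sup>2 + (tan u)\<^sup>2) / (1 - (rho / T)\<^sup>2)) = sqrt ((sin ga / cos u)\<^sup>2 - (sin al)\<^sup>2) / cos al"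
    if "u \<in> {0..pi / 2 - ga}" for u
  proof -
    have cu: "0 < cos u" using that al by (intro cos_gt_zero_pi) auto
    have "(rho / T)\<^sup>2 + (tan u)\<^sup>2 = 1 / (cos u)\<^sup>2 - s\<^sup>2 / (sin ga)\<^sup>2"
      unfolding rT using tan_sec[of u] cu by (simp add: power_divide inverse_eq_divide)
    then have "((rho / T)\<^sup>2 + (tan u)\<^sup>2) / (1 - (rho / T)\<^sup>2) = (1 / (cos u)\<^sup>2 - s\<^sup>2 / (sin ga)\<^sup>2) / (s\<^sup>2 / (sin ga)\<^sup>2)"
      by (simp add: rT)
    also have "\<dots> = ((sin ga / cos u)\<^sup>2 - s\<^sup>2) / s\<^sup>2"
    proof -
      have "(1 / k - m / g) / (m / g) = (g / k - m) / m" if "0 < m" "0 < g" for k m g :: real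
        using that by (cases "k = 0") (simp_all add: field_simps)
      then show ?thesis using s sg by (simp add: power_divide)
    qed
    finally have e: "((rho / T)\<^sup>2 + (tan u)\<^sup>2) / (1 - (rho / T)\<^sup>2) = ((sin ga / cos u)\<^sup>2 - s\<^sup>2) / s\<^sup>2" .
    show ?thesis unfolding e sc'(1,2)[symmetric] using s by (simp add: real_sqrt_divide)
  qed
  have "s / (c * T) / (s / c) = 1 / tan ga" using s c T by (simp add: sc'(3))
  then have lim: "arctan (s / (c * T) / (s / c)) = pi / 2 - ga" using al by (simp add: arctan_inverse_tan)
  have "emeasure hyp_measure (frustum A) =
      (\<integral>\<^sup>+u. ennreal (1 / 2) * (ennreal (artanh (sqrt ((sin ga / cos u)\<^sup>2 - (sin al)\<^sup>2) / cos al)) * indicator {0..pi / 2 - ga} u) \<partial>lborel)"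
    unfolding emeasure_frustum lim
  proof (intro nn_integral_cong)
    fix u
    show "ennreal (artanh (s / c * sqrt (((rho / T)\<^sup>2 + (tan u)\<^sup>2) / (1 - (rho / T)\<^sup>2))) / 2) * indicator {0..pi / 2 - ga} u
      = ennreal (1 / 2) * (ennreal (artanh (sqrt ((sin ga / cos u)\<^sup>2 - (sin al)\<^sup>2) / cos al)) * indicator {0..pi / 2 - ga} u)"
    proof (cases "u \<in> {0..pi / 2 - ga}")
      case True
      have "ennreal (1 / 2 * x) = ennreal (1 / 2) * ennreal x" for x by (intro ennreal_mult') simp
      then show ?thesis unfolding height[OF True] using True by simp
    qed simp
  qed
  also have "\<dots> = ennreal (1 / 2) * (\<integral>\<^sup>+u. ennreal (artanh (sqrt ((sin ga / cos u)\<^sup>2 - (sin al)\<^sup>2) / cos al)) * indicator {0..pi / 2 - ga} u \<partial>lborel)"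
    unfolding artanh_def by (intro nn_integral_cmult) measurable
  also have "\<dots> = ennreal (1 / 2) * ennreal (2 * frustum_volume ga al)"
    using nn_integral_frustum_volume(1)[of al ga] al by simp
  also have "\<dots> = ennreal (1 / 2 * (2 * frustum_volume ga al))" by (intro ennreal_mult'[symmetric]) simp
  finally show ?thesis
    using nn_integral_frustum_volume(2)[of al ga] al by (simp add: hyp_vol_def measure_def)
qed

lemma (in orthoscheme_frame) arctan_difference:
  assumes sc': "s = sin al" "c = cos al" "T = tan ga" and al: "0 < al" "al < ga" "ga < pi / 2"
  shows "arctan (c / s) - arctan (1 / T) = ga - al"
proof -
  have "c / s = 1 / tan al" by (simp add: sc' tan_def)
  then show ?thesis using al by (simp add: arctan_inverse_tan sc'(3))
qed

lemma packing_density_le: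
  assumes adm: "admissible p q r" and pack: "hyp_hor_packing p q r A b h"
  shows "packing_density A b h \<le> optimal_density"
proof -
  define al ga where "al = pi / real p" and "ga = pi / real r"
  have ang: "0 < al" "al < ga" "ga < pi / 2" using admissible_angles(1-3)[OF adm] by (auto simp: al_def ga_def)
  have sfo: "simple_frustum_orthoscheme p q r A" and h0: "0 \<le> h"
    and disj: "horoball (A 0) b \<inter> rel_interior (face_PPP A) = {}" "horoball (A 0) b \<inter> rel_interior (face_AAPP A) = {}"
      "hyperball (A 3) (A 0) h \<inter> rel_interior (face_AAA A) = {}"
      "interior (horoball (A 0) b) \<inter> interior (hyperball (A 3) (A 0) h) = {}"
    using pack by (auto simp: hyp_hor_packing_def)
  obtain g0 g1 g2 g3 lam where "orthoscheme_frame (sin al) (cos al) (tan ga) g0 g1 g2 g3 A lam"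
    using simple_frustum_orthoscheme_frame[OF sfo adm] unfolding al_def ga_def by blast
  then interpret orthoscheme_frame "sin al" "cos al" "tan ga" g0 g1 g2 g3 A lam .
  have z0_ge: "1 \<le> z0 b" "rho \<le> z0 b" using disj by (auto intro: packing_z0_ge_1 packing_z0_ge_rho)
  have sh: "sinh h \<le> sin al / rho" using disj h0 by (auto intro: packing_sinh_le)
  interpret packing_data al ga rho "z0 b" h
    by unfold_locales
      (use ang rho z0_ge h0 sh tanh_le_iff[OF h0] tan_ratio_eq[of al ga] packing_exp_le[OF disj(4) h0 z0_ge(2)] in auto)
  have "hyp_vol (frustum A \<inter> (horoball (A 0) b \<union> hyperball (A 3) (A 0) h)) \<le> total"
    using hyp_vol_frustum_union_le(1)[OF z0_ge h0 sh] arctan_difference[OF _ _ _ ang] by (simp add: hyperball_profile_def mult.commute)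
  also have le: "total \<le> optimal_density * frustum_volume ga al"
    by (rule total_le[OF adm al_def ga_def])
  finally have "hyp_vol (frustum A \<inter> (horoball (A 0) b \<union> hyperball (A 3) (A 0) h)) \<le> optimal_density * frustum_volume ga al" .
  \<comment> \<open>Positivity of the volume follows from the estimate itself, because the cusp part
    of the covered volume is positive.\<close>
  moreover have "0 < frustum_volume ga al"
  proof -
    have "0 < (cos al)\<^sup>2 * tan ga / (4 * (z0 b)\<^sup>2)" using z0_pos[of b] c T by simp
    moreover have "0 \<le> (ga - al) * hyperball_profile h"
      using ang h0 by (simp add: hyperball_profile_def)
    ultimately have "0 < optimal_density * frustum_volume ga al" using le by linarith
    moreover have "0 < optimal_density" using optimal_density_bounds(1) by (rule less_le_trans[rotated]) simp
    ultimately show ?thesis by (simp add: zero_less_mult_iff)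
  qed
  moreover have "hyp_vol (frustum A) = frustum_volume ga al" using hyp_vol_frustum[OF _ _ _ ang] by simp
  ultimately show ?thesis by (simp add: packing_density_def pos_divide_le_eq)
qed

text \<open>The distance from \<open>A 2\<close> to the base plane has
  \<open>rho * sinh h = s\<close>, and by the definition of \<open>rho\<close> then
  \<open>rho * cosh h = c * T\<close>; the exponential is the sum of the two.\<close>

lemma (in null_frame) rho_times_exp:
  assumes "sinh h = s / rho"
  shows "rho * exp h = s + c * T"
proof -
  have "(rho * cosh h)\<^sup>2 = rho\<^sup>2 + (rho * sinh h)\<^sup>2"
    by (simp add: power_mult_distrib cosh_square_eq algebra_simps)
  also have "\<dots> = (c * T)\<^sup>2" using rho assms by simp
  finally have "rho * cosh h = c * T" using rho(1) c T cosh_real_pos[of h] by (simp add: power2_eq_iff_nonneg)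
  moreover have "rho * sinh h = s" using rho assms by simp
  moreover have "exp h = sinh h + cosh h" by (simp add: sinh_plus_cosh)
  ultimately show ?thesis by (simp add: distrib_left)
qed

lemma touching_configuration_7_3_6:
  assumes "touching_configuration 7 3 6 A b h"
  shows "hyp_hor_packing 7 3 6 A b h" "packing_density A b h = optimal_density"
proof -
  define al ga where "al = pi / 7" and "ga = pi / 6"
  have adm: "admissible 7 3 6" by (simp add: admissible_def)
  have ang: "0 < al" "al < ga" "ga < pi / 2" by (simp_all add: al_def ga_def)
  have sfo: "simple_frustum_orthoscheme 7 3 6 A" and h: "0 \<le> h"
    and t: "chart (A 1) \<in> horosphere (A 0) b" "chart (A 2) \<in> hypersphere (A 3) (A 0) h"
    using assms by (auto simp: touching_configuration_def)
  obtain g0 g1 g2 g3 lam where "orthoscheme_frame (sin al) (cos al) (tan ga) g0 g1 g2 g3 A lam"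
    using simple_frustum_orthoscheme_frame[OF sfo adm] unfolding al_def ga_def of_nat_numeral by blast
  then interpret orthoscheme_frame "sin al" "cos al" "tan ga" g0 g1 g2 g3 A lam .
  have z: "z0 b = 1" using t(1) unfolding horosphere_A chart_A by (simp add: height_b1)
  have sh: "sinh h = sin al / rho" using t(2) unfolding hypersphere_A chart_A by (simp add: sd_b2)
  note re = rho_times_exp[OF sh]
  have cg: "0 < cos ga" using ang by (intro cos_gt_zero) auto
  \<comment> \<open>The hypersphere through \<open>A 2\<close> reaches the height sin (\<alpha> +
    \<gamma>) / cos \<gamma>; it stays below the horosphere at height 1 because \<alpha> + \<gamma>
    is less than \<pi>/3 = \<pi>/2 - \<gamma>.\<close>
  have "sin (al + ga) < sin (pi / 3)" unfolding al_def ga_def by (intro sin_monotone_2pi) auto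
  also have "sin (pi / 3) = cos ga" by (simp add: ga_def sin_60 cos_30)
  finally have "(sin al * cos ga + cos al * sin ga) / cos ga < 1" using cg by (simp add: sin_add)
  then have lt1: "sin al + cos al * tan ga < 1" using cg by (simp add: tan_def add_divide_distrib)
  have "rho * 1 \<le> rho * exp h" using rho(1) h by (intro mult_left_mono) auto
  then have r1: "rho < 1" using re lt1 by simp
  show "hyp_hor_packing 7 3 6 A b h"
    by (rule hyp_hor_packingI[OF sfo h]) (use z sh re lt1 r1 in auto)
  have vol: "hyp_vol (frustum A \<inter> (horoball (A 0) b \<union> hyperball (A 3) (A 0) h)) = (cos al)\<^sup>2 * tan ga / 4 + (ga - al) * hyperball_profile h"
    using hyp_vol_frustum_union_le(2)[of b h] z sh re lt1 r1 h arctan_difference[OF _ _ _ ang]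
    by (simp add: hyperball_profile_def mult.commute)
  have "tanh h = tan al / tan ga"
  proof -
    have "tanh h = (rho * sinh h) / (rho * cosh h)" using rho(1) by (simp add: tanh_def)
    moreover have "rho * sinh h = sin al" using rho sh by simp
    moreover have "rho * sinh h + rho * cosh h = sin al + cos al * tan ga"
      using re by (simp add: distrib_left[symmetric] sinh_plus_cosh)
    ultimately have "tanh h = sin al / (cos al * tan ga)" by simp
    then show ?thesis using tan_ratio_eq[of al ga] by simp
  qed
  then have "h = artanh (tan al / tan ga)" using artanh_tanh_real[of h] by simp
  then have "(ga - al) * hyperball_profile h = hyperball_volume ga al"
    using tan_ratio[of al ga] ang by (simp add: hyperball_profile_artanh hyperball_volume_def)
  then show "packing_density A b h = optimal_density"
    unfolding packing_density_def vol optimal_density_def using hyp_vol_frustum[OF _ _ _ ang]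
    by (simp add: al_def ga_def mult.commute)
qed

lemma (in orthoscheme_frame) touching_configuration_exists:
  assumes sfo: "simple_frustum_orthoscheme p q r A"
  shows "\<exists>b h. touching_configuration p q r A b h"
proof (intro exI)
  \<comment> \<open>This value of the Busemann function puts the horosphere at height 1, the height
    of \<open>A 1\<close>.\<close>
  have "z0 (- ln (2 * fst g3)) = 1" using fut by (simp add: z0_def)
  moreover have "0 < s / rho" using s rho(1) by simp
  ultimately show "touching_configuration p q r A (- ln (2 * fst g3)) (arsinh (s / rho))"
    unfolding touching_configuration_def horosphere_A hypersphere_A chart_A
    using sfo by (simp add: height_b1 sd_b2 chart_future_H3 future_b1 future_b2 less_imp_le)
qed

lemma touching_configuration_7_3_6_exists: "\<exists>A b h. touching_configuration 7 3 6 A b h"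
proof -
  define al ga where "al = pi / 7" and "ga = pi / 6"
  have adm: "admissible 7 3 6" by (simp add: admissible_def)
  have ang: "0 < al" "al < ga" "ga < pi / 2" by (simp_all add: al_def ga_def)
  have pos: "0 < sin al" "0 < cos al" "0 < tan ga" using ang by (auto intro!: sin_gt_zero cos_gt_zero tan_gt_zero)
  have "tan al < tan ga" using ang by (intro tan_monotone) auto
  moreover have "tan al = sin al / cos al" by (simp add: tan_def)
  ultimately have lt: "sin al < cos al * tan ga" using pos by (simp add: pos_divide_less_eq mult.commute)
  obtain g0 g1 g2 g3 where "null_frame (sin al) (cos al) (tan ga) g0 g1 g2 g3"
    by (rule null_frame_exists[OF pos(1,2) sin_cos_squared_add pos(3) lt])
  then interpret N: null_frame "sin al" "cos al" "tan ga" g0 g1 g2 g3 .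
  have "simple_frustum_orthoscheme 7 3 6 N.standard_vertices"
    by (rule N.simple_frustum_orthoscheme_standard_vertices) (simp_all add: al_def ga_def adm)
  from orthoscheme_frame.touching_configuration_exists[OF N.orthoscheme_frame_standard_vertices this] show ?thesis by blast
qed

theorem theorem5p3:
  shows "(\<exists>A \<beta> h. touching_configuration 7 3 6 A \<beta> h) \<and>
    (\<forall>A \<beta> h. touching_configuration 7 3 6 A \<beta> h \<longrightarrow>
       hyp_hor_packing 7 3 6 A \<beta> h \<and>
       (\<forall>p q r A' \<beta>' h'. admissible p q r \<and> hyp_hor_packing p q r A' \<beta>' h' \<longrightarrow>
          packing_density A' \<beta>' h' \<le> packing_density A \<beta> h) \<and>
       \<bar>packing_density A \<beta> h - 0.83267\<bar> < 0.000005)"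
proof (intro conjI allI impI touching_configuration_7_3_6_exists)
  fix A \<beta> h assume t: "touching_configuration 7 3 6 A \<beta> h"
  show "hyp_hor_packing 7 3 6 A \<beta> h" by (rule touching_configuration_7_3_6[OF t])
  show "\<bar>packing_density A \<beta> h - 0.83267\<bar> < 0.000005"
    unfolding touching_configuration_7_3_6(2)[OF t] using optimal_density_bounds by (simp add: abs_if)
  fix p q r A' \<beta>' h' assume "admissible p q r \<and> hyp_hor_packing p q r A' \<beta>' h'"
  then show "packing_density A' \<beta>' h' \<le> packing_density A \<beta> h"
    unfolding touching_configuration_7_3_6(2)[OF t] by (blast intro: packing_density_le)
qed

end
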